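(* Let $s:\mathbb{N}\to\mathbb{N}$ be a nice function with $s(n)\geq\log^2 n$. Then $$\mathrm{NAuxSA}[\mathrm{poly}\text{ time},\ \log\text{ space},\ s(\mathrm{poly})\text{ height}] = \mathrm{ATiSz}[s(\mathrm{poly})\text{ time},\ \mathrm{poly}\text{ treesize}].$$
   Context: A function $s$ is nice if it is constructible (a Turing machine, given $n$ in unary, outputs $s(n)$ in unary using logarithmic space) and $s(n)/\lg n$ is non-decreasing. $\mathrm{NAuxSA}[t,w,h]$ is the class of languages decided by a nondeterministic Turing machine with a read-only input tape, a read-write working tape of length $O(w(n))$, and an auxiliary stack tape of length $O(h(n))$ ($n$ = input length); the stack tape can be read with a freely moving head, but is written only via "push $\sigma$" (replace the first blank cell by the non-blank symbol $\sigma$) and "pop" (replace the last non-blank cell by a blank); moreover every accepted input has an accepting run with $O(t(n))$ steps. An alternating Turing machine (ATM) has its states partitioned into existential and universal states. An accepting tree for an input is a finite tree labeled by configurations whose root is the initial configuration, each node in an existential state has one child labeled with a successor configuration, each node in a universal state has all successor configurations as children, and all leaves are accepting configurations. An ATM accepts in time $t$ and treesize $z$ if there is an accepting tree with all root-to-leaf distances at most $t$ and at most $z$ nodes. $\mathrm{ATiSz}[t,z]$ is the class of languages decided by ATMs such that every accepted input has an accepting tree within time $O(t(n))$ and treesize $O(z(n))$. A bound given by a family of functions denotes the union over the family: poly $=\{n^c\}_c$, $\log=\{\log n\}$, $s(\mathrm{poly})=\{s(n^c)\}_c$. *)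

theory Defs
  imports Complex_Main "HOL-Library.Landau_Symbols"
begin

(* Conventions for all machines below: states and tape symbols are natural numbers
   below a machine-specific bound, symbol 0 is the blank, tapes are infinite to the
   right only, and a left move in cell 0 leaves the head where it is. *)

datatype dir = Lft | Stay | Rgt

fun shift :: "dir \<Rightarrow> nat \<Rightarrow> nat" where
  "shift Lft p = p - 1"
| "shift Stay p = p"
| "shift Rgt p = Suc p"

type_synonym tape = "(nat \<Rightarrow> nat) \<times> nat"   (* contents, head position *)

definition blank_tape :: tape where
  "blank_tape = (\<lambda>_. 0, 0)"

definition scan :: "tape \<Rightarrow> nat" where
  "scan tp = fst tp (snd tp)"

definition write_move :: "nat \<Rightarrow> dir \<Rightarrow> tape \<Rightarrow> tape" where
  "write_move a d tp = ((fst tp)(snd tp := a), shift d (snd tp))"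

(* A read-only input tape carries x in cells 1, ..., |x| between two end markers;
   its head cannot leave cells 0, ..., |x| + 1. *)

datatype 'a insym = LeftEnd | Letter 'a | RightEnd

definition input_cell :: "'a list \<Rightarrow> nat \<Rightarrow> 'a insym" where
  "input_cell x i =
    (if i = 0 then LeftEnd else if i \<le> length x then Letter (x ! (i - 1)) else RightEnd)"

definition input_shift :: "'a list \<Rightarrow> dir \<Rightarrow> nat \<Rightarrow> nat" where
  "input_shift x d p = min (Suc (length x)) (shift d p)"


section \<open>Nice functions\<close>

text \<open>
  A deterministic transducer with a read-only input tape, one working tape and a
  write-only output tape. Numbers are given and produced in unary: \<open>n\<close> is the word
  \<open>replicate n ()\<close>. The transition function yields the new state, the symbol written to
  the working tape, the moves of the input head and of the working head, and whether a
  symbol is appended to the output; the machine halts where it yields \<open>None\<close>.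
\<close>

record transducer =
  d_states :: nat
  d_syms :: nat
  d_start :: nat
  d_trans :: "nat \<Rightarrow> unit insym \<Rightarrow> nat \<Rightarrow> (nat \<times> nat \<times> dir \<times> dir \<times> bool) option"

record transducer_conf =
  d_state :: nat
  d_ipos :: nat
  d_work :: tape
  d_out :: "unit list"

definition wf_transducer :: "transducer \<Rightarrow> bool" where
  "wf_transducer M \<longleftrightarrow> d_start M < d_states M \<and> 0 < d_syms M \<and>
    (\<forall>q i a q' a' di dw b. q < d_states M \<longrightarrow> a < d_syms M \<longrightarrow>
      d_trans M q i a = Some (q', a', di, dw, b) \<longrightarrow> q' < d_states M \<and> a' < d_syms M)"

definition transducer_init :: "transducer \<Rightarrow> transducer_conf" where
  "transducer_init M = \<lparr>d_state = d_start M, d_ipos = 0, d_work = blank_tape, d_out = []\<rparr>"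

definition transducer_action ::
    "transducer \<Rightarrow> unit list \<Rightarrow> transducer_conf \<Rightarrow> (nat \<times> nat \<times> dir \<times> dir \<times> bool) option" where
  "transducer_action M x c =
    d_trans M (d_state c) (input_cell x (d_ipos c)) (scan (d_work c))"

definition transducer_step ::
    "transducer \<Rightarrow> unit list \<Rightarrow> transducer_conf \<Rightarrow> transducer_conf \<Rightarrow> bool" where
  "transducer_step M x c c' \<longleftrightarrow>
    (\<exists>q a di dw b. transducer_action M x c = Some (q, a, di, dw, b) \<and>
      c' = \<lparr>d_state = q, d_ipos = input_shift x di (d_ipos c),
            d_work = write_move a dw (d_work c),
            d_out = d_out c @ (if b then [()] else [])\<rparr>)"

definition constructible :: "(nat \<Rightarrow> nat) \<Rightarrow> bool" where
  "constructible s \<longleftrightarrow>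
    (\<exists>M W. wf_transducer M \<and>
      (\<lambda>n. real (W n)) \<in> O(\<lambda>n. log 2 (real n)) \<and>
      (\<forall>n c. (transducer_step M (replicate n ()))\<^sup>*\<^sup>* (transducer_init M) c \<longrightarrow>
        snd (d_work c) < W n) \<and>
      (\<forall>n. \<exists>c. (transducer_step M (replicate n ()))\<^sup>*\<^sup>* (transducer_init M) c \<and>
        transducer_action M (replicate n ()) c = None \<and>
        d_out c = replicate (s n) ()))"

(* The quotient s(n) / lg n only makes sense for n \<ge> 2. *)
definition nice :: "(nat \<Rightarrow> nat) \<Rightarrow> bool" where
  "nice s \<longleftrightarrow> constructible s \<and> mono_on {2..} (\<lambda>n. real (s n) / log 2 (real n))"


section \<open>Nondeterministic machines with an auxiliary stack tape\<close>

datatype stack_op = Keep | Push nat | Pop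

text \<open>
  The stack tape is represented by the list of its non-blank cells, which always form a
  prefix of the tape, together with the position of its reading head. Pushing and popping
  take place at the end of that prefix, independently of the reading head. Popping an
  empty stack has no effect.
\<close>

fun stack_apply :: "stack_op \<Rightarrow> nat list \<Rightarrow> nat list" where
  "stack_apply Keep st = st"
| "stack_apply (Push a) st = st @ [a]"
| "stack_apply Pop st = butlast st"

definition stack_scan :: "nat list \<Rightarrow> nat \<Rightarrow> nat" where
  "stack_scan st p = (if p < length st then st ! p else 0)"

(* A transition relates (state, input symbol, working tape symbol, stack tape symbol) to
   (state, symbol written to the working tape, moves of the input head, working head and
   stack head, stack operation). *)
record 'a nauxsa =
  n_states :: nat
  n_syms :: nat
  n_start :: nat
  n_accept :: "nat set"
  n_trans :: "((nat \<times> 'a insym \<times> nat \<times> nat) \<times>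
               (nat \<times> nat \<times> dir \<times> dir \<times> dir \<times> stack_op)) set"

record nauxsa_conf =
  n_state :: nat
  n_ipos :: nat
  n_work :: tape
  n_stack :: "nat list"
  n_spos :: nat

definition wf_nauxsa :: "'a nauxsa \<Rightarrow> bool" where
  "wf_nauxsa M \<longleftrightarrow> n_start M < n_states M \<and> 0 < n_syms M \<and>
    (\<forall>q i a b q' a' di dw ds p. ((q, i, a, b), (q', a', di, dw, ds, p)) \<in> n_trans M \<longrightarrow>
      q < n_states M \<and> a < n_syms M \<and> b < n_syms M \<and> q' < n_states M \<and> a' < n_syms M \<and>
      (\<forall>e. p = Push e \<longrightarrow> 0 < e \<and> e < n_syms M))"

definition nauxsa_init :: "'a nauxsa \<Rightarrow> nauxsa_conf" where
  "nauxsa_init M =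
    \<lparr>n_state = n_start M, n_ipos = 0, n_work = blank_tape, n_stack = [], n_spos = 0\<rparr>"

definition nauxsa_step ::
    "'a nauxsa \<Rightarrow> 'a list \<Rightarrow> nauxsa_conf \<Rightarrow> nauxsa_conf \<Rightarrow> bool" where
  "nauxsa_step M x c c' \<longleftrightarrow>
    (\<exists>q a di dw ds p.
      ((n_state c, input_cell x (n_ipos c), scan (n_work c), stack_scan (n_stack c) (n_spos c)),
       (q, a, di, dw, ds, p)) \<in> n_trans M \<and>
      c' = \<lparr>n_state = q, n_ipos = input_shift x di (n_ipos c),
            n_work = write_move a dw (n_work c),
            n_stack = stack_apply p (n_stack c), n_spos = shift ds (n_spos c)\<rparr>)"

definition nauxsa_accepts :: "'a nauxsa \<Rightarrow> 'a list \<Rightarrow> bool" where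
  "nauxsa_accepts M x \<longleftrightarrow>
    (\<exists>c. (nauxsa_step M x)\<^sup>*\<^sup>* (nauxsa_init M) c \<and> n_state c \<in> n_accept M)"

text \<open>
  The lengths of the working tape and of the stack tape bound every configuration that the
  machine can reach on any input, whereas the time bound only concerns one accepting run
  for each accepted input.
\<close>

definition NAuxSA ::
    "(nat \<Rightarrow> real) \<Rightarrow> (nat \<Rightarrow> real) \<Rightarrow> (nat \<Rightarrow> real) \<Rightarrow> 'a list set set" where
  "NAuxSA t w h = {A. \<exists>(M :: 'a nauxsa) T W H. wf_nauxsa M \<and> A = {x. nauxsa_accepts M x} \<and>
    (\<lambda>n. real (T n)) \<in> O(t) \<and> (\<lambda>n. real (W n)) \<in> O(w) \<and> (\<lambda>n. real (H n)) \<in> O(h) \<and>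
    (\<forall>x c. (nauxsa_step M x)\<^sup>*\<^sup>* (nauxsa_init M) c \<longrightarrow>
      snd (n_work c) < W (length x) \<and>
      length (n_stack c) \<le> H (length x) \<and> n_spos c < H (length x)) \<and>
    (\<forall>x \<in> A. \<exists>k c. k \<le> T (length x) \<and>
      (nauxsa_step M x ^^ k) (nauxsa_init M) c \<and> n_state c \<in> n_accept M)}"


section \<open>Alternating machines\<close>

text \<open>
  Time bounds may be sublinear, so the input is accessed randomly: tape 0 is an index tape,
  and a machine sees the input letter whose address (counting from 0) is currently written
  on it, or \<open>None\<close> if there is no such letter. Addresses are in binary, least significant
  digit in cell 0; symbol 1 is the digit one, every other symbol, the blank included, the
  digit zero. There are any number of further tapes.
\<close>

definition addressed :: "'a list \<Rightarrow> tape \<Rightarrow> 'a option" where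
  "addressed x tp =
    (let i = (\<Sum>j | fst tp j = 1. 2 ^ j) in if i < length x then Some (x ! i) else None)"

(* States outside a_univ are existential. A transition relates (state, symbols scanned on
   the tapes, input letter seen) to (state, symbol written and head move for each tape). *)
record 'a atm =
  a_tapes :: nat
  a_states :: nat
  a_syms :: nat
  a_start :: nat
  a_accept :: "nat set"
  a_univ :: "nat set"
  a_trans :: "((nat \<times> nat list \<times> 'a option) \<times> (nat \<times> (nat \<times> dir) list)) set"

record atm_conf =
  a_state :: nat
  a_conts :: "tape list"

(* Accepting states are halting. *)
definition wf_atm :: "'a atm \<Rightarrow> bool" where
  "wf_atm M \<longleftrightarrow> 0 < a_tapes M \<and> a_start M < a_states M \<and> 0 < a_syms M \<and>
    (\<forall>q as i q' acts. ((q, as, i), (q', acts)) \<in> a_trans M \<longrightarrow>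
      q < a_states M \<and> q \<notin> a_accept M \<and> q' < a_states M \<and>
      length as = a_tapes M \<and> (\<forall>a \<in> set as. a < a_syms M) \<and>
      length acts = a_tapes M \<and> (\<forall>(a, d) \<in> set acts. a < a_syms M))"

definition atm_init :: "'a atm \<Rightarrow> atm_conf" where
  "atm_init M = \<lparr>a_state = a_start M, a_conts = replicate (a_tapes M) blank_tape\<rparr>"

definition atm_step :: "'a atm \<Rightarrow> 'a list \<Rightarrow> atm_conf \<Rightarrow> atm_conf \<Rightarrow> bool" where
  "atm_step M x c c' \<longleftrightarrow>
    (\<exists>q acts.
      ((a_state c, map scan (a_conts c), addressed x (hd (a_conts c))), (q, acts)) \<in> a_trans M \<and>
      c' = \<lparr>a_state = q, a_conts = map2 (\<lambda>(a, d). write_move a d) acts (a_conts c)\<rparr>)"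

datatype ctree = Node (label: atm_conf) (children: "ctree list")

primrec treesize :: "ctree \<Rightarrow> nat" where
  "treesize (Node c ts) = Suc (sum_list (map treesize ts))"

(* the largest distance from the root to a leaf *)
primrec treedepth :: "ctree \<Rightarrow> nat" where
  "treedepth (Node c ts) = (if ts = [] then 0 else Suc (Max (set (map treedepth ts))))"

inductive accepting_from :: "'a atm \<Rightarrow> 'a list \<Rightarrow> ctree \<Rightarrow> bool" for M x where
  leaf: "a_state c \<in> a_accept M \<Longrightarrow> accepting_from M x (Node c [])"
| exist: "a_state c \<notin> a_univ M \<Longrightarrow> atm_step M x c (label u) \<Longrightarrow> accepting_from M x u \<Longrightarrow>
    accepting_from M x (Node c [u])"
| univ: "a_state c \<in> a_univ M \<Longrightarrow> us \<noteq> [] \<Longrightarrow> distinct (map label us) \<Longrightarrow>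
    label ` set us = {c'. atm_step M x c c'} \<Longrightarrow> \<forall>u \<in> set us. accepting_from M x u \<Longrightarrow>
    accepting_from M x (Node c us)"

definition accepting_tree :: "'a atm \<Rightarrow> 'a list \<Rightarrow> ctree \<Rightarrow> bool" where
  "accepting_tree M x u \<longleftrightarrow> label u = atm_init M \<and> accepting_from M x u"

definition ATiSz :: "(nat \<Rightarrow> real) \<Rightarrow> (nat \<Rightarrow> real) \<Rightarrow> 'a list set set" where
  "ATiSz t z = {A. \<exists>(M :: 'a atm) T Z. wf_atm M \<and> A = {x. \<exists>u. accepting_tree M x u} \<and>
    (\<lambda>n. real (T n)) \<in> O(t) \<and> (\<lambda>n. real (Z n)) \<in> O(z) \<and>
    (\<forall>x \<in> A. \<exists>u. accepting_tree M x u \<and>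
      treedepth u \<le> T (length x) \<and> treesize u \<le> Z (length x))}"


section \<open>Families of bounds\<close>

definition NAuxSA_family ::
    "(nat \<Rightarrow> real) set \<Rightarrow> (nat \<Rightarrow> real) set \<Rightarrow> (nat \<Rightarrow> real) set \<Rightarrow> 'a list set set" where
  "NAuxSA_family TT WW HH = (\<Union>t \<in> TT. \<Union>w \<in> WW. \<Union>h \<in> HH. NAuxSA t w h)"

definition ATiSz_family ::
    "(nat \<Rightarrow> real) set \<Rightarrow> (nat \<Rightarrow> real) set \<Rightarrow> 'a list set set" where
  "ATiSz_family TT ZZ = (\<Union>t \<in> TT. \<Union>z \<in> ZZ. ATiSz t z)"

definition poly_bounds :: "(nat \<Rightarrow> real) set" where
  "poly_bounds = range (\<lambda>c n. real (n ^ c))"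

definition log_bounds :: "(nat \<Rightarrow> real) set" where
  "log_bounds = {\<lambda>n. log 2 (real n)}"

definition of_poly_bounds :: "(nat \<Rightarrow> nat) \<Rightarrow> (nat \<Rightarrow> real) set" where
  "of_poly_bounds s = range (\<lambda>c n. real (s (n ^ c)))"

end

theory Submission
  imports Defs "HOL-Library.Countable"
begin

text \<open>Machines of both kinds are treated as programs over polynomially bounded registers, which are kept
 in binary on a working tape.

 Apart from its stack, a stack machine is in one of polynomially many surface configurations. A segment
 is a run that returns to the stack it started from; a context is a pair of runs around a segment, the
 first building up a word on the stack and the second removing it. An alternating machine verifies a
 segment by guessing either its middle or a context around a shorter segment, and a context by guessing
 a way to split it, each part being verified in a universal branch; the stack is kept on a tape. By
 choosing the cuts so that the parts get shorter by a constant factor, the recursion has logarithmic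
 depth besides the time spent on writing the stack. A level costs logarithmic time, which is absorbed
 since `s` is at least the square of the logarithm, and the leaves are distinct steps of the run, so
 that the tree has polynomial size.

 Conversely, a stack machine searches an accepting tree depth first, with the transitions still to be
 followed on its stack. The tape contents of the alternating machine do not fit into its working
 space; they are recovered by replaying the transitions on the stack. To bound the depth of the search,
 the machine guesses a number of polynomial size and runs the transducer for `s` on it.\<close>

section \<open>Polynomial and logarithmic bounds\<close>

text \<open>The time bound is met by amortization. A level of the recursion costs time of the order
  of the register length L = O(log n), so writing one stack letter per level would lose a factor log
  n. A level therefore writes up to L letters at once; the depth is then O(log n) plus height / L,
  and multiplication by L gives O(log^2 n + height). A context around such a word can contain many
  steps and must itself be halved, which is why segments and contexts are treated simultaneously. As
  the height may exceed every polynomial, the tree size is bounded through the number of steps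
  instead. Conversely, space and height bounds concern all computations, whereas accepting trees are
  bounded only on accepted inputs. The stack machine must hence limit itself: it marks off its space
  by counting the input, and it gets stuck beyond the depth allowed by the output of the transducer,
  which never exceeds s(m) for the guessed m even when interrupted. Its time is charged to the nodes
  of the tree, so that no child may be searched twice although different transitions can lead to the
  same child.\<close>

definition pb :: "(nat => nat) => bool" where
 "pb f = (EX c. ALL n. f n <= (n + 2) ^ c)"

text \<open>The base \<open>n + 2\<close> is at least 2, so its \<open>k\<close>-th power dominates
  the constant \<open>k\<close> for every n. Powers of n itself would fail at n = 0 and n = 1, and
  the bounds are needed for every input length.\<close>

lemma pb_const: "pb (%_. k)"
proof -
 have "k <= (n + 2) ^ k" for n :: nat
 proof -
  have "k <= 2 ^ k" by (simp add: less_imp_le)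
  also have "... <= (n + 2) ^ k" by (rule power_mono) auto
  finally show ?thesis .
 qed
 thus ?thesis unfolding pb_def by blast
qed

lemma pb_id: "pb (%n. n)" unfolding pb_def by (rule exI[of _ 1]) simp

lemma pb_mono: "pb g ==> (!!n. f n <= g n) ==> pb f" unfolding pb_def by (meson le_trans)

lemma pb_mult: assumes "pb f" "pb g" shows "pb (%n. f n * g n)"
proof -
 obtain c d where "!!n. f n <= (n + 2) ^ c" "!!n. g n <= (n + 2) ^ d" using assms unfolding pb_def by blast
 hence "f n * g n <= (n + 2) ^ (c + d)" for n by (simp add: power_add mult_le_mono)
 thus ?thesis unfolding pb_def by blast
qed

lemma pb_add: assumes "pb f" "pb g" shows "pb (%n. f n + g n)"
proof -
 have "pb (%n. (f n + 1) * (g n + 1))"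
 proof (rule pb_mult)
  have *: "pb (%n. h n + 1)" if h: "pb h" for h
  proof -
   obtain c where c: "!!n. h n <= (n + 2) ^ c" using h unfolding pb_def by blast
   have "h n + 1 <= (n + 2) ^ Suc c" for n
   proof -
    have "h n + 1 <= (n + 2) ^ c + (n + 2) ^ c" using c[of n] by (intro add_mono) simp_all
    also have "... <= (n + 2) ^ Suc c" by simp
    finally show ?thesis .
   qed
   thus ?thesis unfolding pb_def by blast
  qed
  show "pb (%n. f n + 1)" "pb (%n. g n + 1)" using * assms by auto
 qed
 thus ?thesis by (rule pb_mono) simp
qed

lemma pb_Suc: "pb f ==> pb (%n. Suc (f n))" using pb_add[OF _ pb_const[of 1]] by simp

lemma pb_power: "pb f ==> pb (%n. f n ^ k)" by (induction k) (auto intro: pb_const pb_mult)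

lemma pb_comp: assumes "pb f" "pb g" shows "pb (%n. f (g n))"
proof -
 obtain c where c: "!!n. f n <= (n + 2) ^ c" using assms(1) unfolding pb_def by blast
 have "pb (%n. (g n + 2) ^ c)" by (intro pb_power pb_add assms pb_const)
 thus ?thesis by (rule pb_mono) (use c in blast)
qed

lemmas pb_intros = pb_const pb_id pb_mult pb_add pb_Suc pb_power

text \<open>An O-bound says nothing about finitely many n. Their values are added to the constant,
  which suffices because \<open>g\<close> is at least 1 everywhere.\<close>

lemma bound_extend:
 fixes f g :: "nat => nat"
 assumes "(%n. real (f n)) : O(h)" and "!!n. \<bar>h n\<bar> <= real (g n)" and "!!n. 1 <= g n"
 shows "EX k. ALL n. f n <= k * g n"
proof -
 obtain c where c: "c > 0" "eventually (%n. norm (real (f n)) <= c * norm (h n)) at_top"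
  using assms(1) by (auto elim: landau_o.bigE)
 then obtain N where N: "!!n. n >= N ==> real (f n) <= c * \<bar>h n\<bar>" by (auto simp: eventually_at_top_linorder)
 define k where "k = nat \<lceil>c\<rceil> + (\<Sum>i<N. f i)"
 have "f n <= k * g n" for n
 proof (cases "n < N")
  case True
  hence "f n <= (\<Sum>i<N. f i)" by (intro member_le_sum) auto
  also have "... <= k" by (simp add: k_def)
  also have "... <= k * g n" using assms(3)[of n] by simp
  finally show ?thesis .
 next
  case False
  hence "real (f n) <= c * \<bar>h n\<bar>" using N by simp
  also have "... <= c * real (g n)" using c(1) assms(2)[of n] by (simp add: mult_left_mono)
  also have "... <= real k * real (g n)"
  proof (rule mult_right_mono)
   have "c <= real (nat \<lceil>c\<rceil>)" by (rule real_nat_ceiling_ge)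
   also have "... <= real k" unfolding k_def of_nat_le_iff by simp
   finally show "c <= real k" .
  qed simp
  finally show ?thesis by (metis of_nat_le_iff of_nat_mult)
 qed
 thus ?thesis by blast
qed

lemma pb_of_bigo:
 assumes "(%n. real (f n)) : O(%n. real (n ^ c))"
 shows "pb f"
proof -
 have "EX k. ALL n. f n <= k * (n ^ c + 1)" by (rule bound_extend[OF assms]) auto
 then obtain k where "!!n. f n <= k * (n ^ c + 1)" by blast
 moreover have "pb (%n. k * (n ^ c + 1))" by (intro pb_intros)
 ultimately show ?thesis using pb_mono by blast
qed

lemma bigo_of_pb: assumes "pb f" shows "EX c. (%n. real (f n)) : O(%n. real (n ^ c))"
proof -
 obtain c where c: "!!n. f n <= (n + 2) ^ c" using assms unfolding pb_def by blast
 have "(%n. real (f n)) : O(%n. real (n ^ c))"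
 proof (rule bigoI[of _ "3 ^ c"], unfold eventually_at_top_linorder, intro exI[of _ 1] allI impI)
  fix n :: nat assume n: "1 <= n"
  have "f n <= (n + 2) ^ c" by (rule c)
  also have "... <= (3 * n) ^ c" by (rule power_mono) (use n in auto)
  finally have "f n <= 3 ^ c * n ^ c" by (simp add: power_mult_distrib)
  hence "real (f n) <= real (3 ^ c * n ^ c)" by (subst of_nat_le_iff)
  thus "norm (real (f n)) <= 3 ^ c * norm (real (n ^ c))" by simp
 qed
 thus ?thesis by blast
qed

section \<open>The binary length as an integer logarithm\<close>

fun bl :: "nat => nat" where
 "bl n = (if n = 0 then 0 else Suc (bl (n div 2)))"

declare bl.simps [simp del]

lemma bl_0 [simp]: "bl 0 = 0" by (simp add: bl.simps)

lemma bl_pos: "0 < n ==> bl n = Suc (bl (n div 2))" by (simp add: bl.simps)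

lemma less_two_power_bl: "n < 2 ^ bl n"
proof (induction n rule: bl.induct)
 case (1 n)
 show ?case
 proof (cases "n = 0")
  case False
  hence "n div 2 < 2 ^ bl (n div 2)" using 1 by blast
  hence "n < 2 * 2 ^ bl (n div 2)" by linarith
  moreover have "bl n = Suc (bl (n div 2))" using False by (intro bl_pos) simp
  ultimately show ?thesis by simp
 qed simp
qed

lemma two_power_bl_le: "2 ^ bl n <= 2 * n + 1"
proof -
 have "n = 0 \<or> 2 ^ bl n <= 2 * n"
 proof (induction n rule: bl.induct)
  case (1 n)
  show ?case
  proof (cases "n = 0")
   case False
   hence b: "bl n = Suc (bl (n div 2))" by (intro bl_pos) simp
   consider "n div 2 = 0" | "2 ^ bl (n div 2) <= 2 * (n div 2)" using 1[OF False] by argo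
   thus ?thesis
   proof cases
    case 1
    thus ?thesis using False b by auto
   next
    case 2
    thus ?thesis unfolding b by simp linarith
   qed
  qed simp
 qed
 thus ?thesis by auto
qed

lemma bl_mono: "m <= n ==> bl m <= bl n"
proof (induction m arbitrary: n rule: bl.induct)
 case (1 m)
 show ?case
 proof (cases "m = 0")
  case False
  hence "bl (m div 2) <= bl (n div 2)" using 1 by (simp add: div_le_mono)
  moreover have "bl m = Suc (bl (m div 2))" "bl n = Suc (bl (n div 2))"
   using False 1(2) bl_pos[of m] bl_pos[of n] by simp_all
  ultimately show ?thesis by simp
 qed simp
qed

lemma pb_two_power_bl: "pb f ==> pb (%n. 2 ^ bl (f n))"
 by (rule pb_mono[of "%n. 2 * f n + 1"]) (intro pb_intros two_power_bl_le | assumption)+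

lemma log_zero [simp]: "log b 0 = 0" by (simp add: log_def)

lemma log_le_bl: "log 2 (real n) <= real (bl n)"
proof (cases "n = 0")
 case False
 have "real n <= 2 ^ bl n" using less_two_power_bl[of n]
  by (metis less_imp_le of_nat_le_iff of_nat_numeral of_nat_power)
 thus ?thesis using False by (simp add: log_le_iff powr_realpow)
qed simp

text \<open>For n >= 2, \<open>2 ^ bl (Suc n) <= 2 * n + 3 <= 4 * n\<close>, so
  \<open>bl (Suc n)\<close> is at most 2 + log n, and log n >= 1 absorbs the 2. The successor makes
  the length positive for every n, which is why later bounds are stated with it.\<close>

lemma bl_Suc_bigo: "(%n. real (bl (Suc n))) : O(%n. log 2 (real n))"
proof (rule bigoI[of _ 4], unfold eventually_at_top_linorder, intro exI[of _ 2] allI impI)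
 fix n :: nat assume n: "2 <= n"
 have l1: "1 <= log 2 (real n)" using n by simp
 have "2 ^ bl (Suc n) <= 2 * Suc n + 1" by (rule two_power_bl_le)
 also have "... <= 4 * n" using n by simp
 finally have "real (2 ^ bl (Suc n)) <= real (4 * n)" by (subst of_nat_le_iff)
 hence "2 ^ bl (Suc n) <= 4 * real n" by simp
 hence "log 2 (2 ^ bl (Suc n)) <= log 2 (4 * real n)" by (rule log_mono[rotated 2]) simp_all
 moreover have "log 2 (2 ^ bl (Suc n)) = real (bl (Suc n))" by (rule log_pow_cancel) simp_all
 moreover have "log 2 (4 * real n) = 2 + log 2 (real n)"
 proof -
  have "log 2 (4 * real n) = log 2 4 + log 2 (real n)" using n by (simp add: log_mult)
  moreover have "log 2 4 = (2 :: real)" using log_pow_cancel[of 2 2] by simp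
  ultimately show ?thesis by simp
 qed
 ultimately show "norm (real (bl (Suc n))) <= 4 * norm (log 2 (real n))" using l1 by auto
qed

lemma log_space_bl:
 assumes "(%n. real (W n)) : O(%n. log 2 (real n))"
 shows "EX k. ALL n. W n <= k * bl (Suc n)"
proof (rule bound_extend[OF assms])
 fix n :: nat
 show "1 <= bl (Suc n)" using bl_pos[of "Suc n"] by simp
 have "log 2 (real n) <= real (bl n)" by (rule log_le_bl)
 also have "... <= real (bl (Suc n))" by (simp add: bl_mono)
 finally show "\<bar>log 2 (real n)\<bar> <= real (bl (Suc n))" by (cases "n = 0") (auto simp: abs_if not_less)
qed

text \<open>Exchanging exponents turns \<open>(2 ^ b) ^ (k * bl (Suc n))\<close> into a fixed power
  of \<open>2 ^ bl (Suc n)\<close>, which is linear in n. This is why logarithmic space allows only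
  polynomially many tape contents.\<close>

lemma pb_exp_log:
 assumes "(%n. real (W n)) : O(%n. log 2 (real n))"
 shows "pb (%n. b ^ W n)"
proof -
 obtain k where k: "!!n. W n <= k * bl (Suc n)" using log_space_bl[OF assms] by blast
 have "pb (%n. (2 ^ bl (Suc n)) ^ (b * k))" by (intro pb_power pb_two_power_bl pb_intros)
 thus ?thesis
 proof (rule pb_mono)
  fix n
  have "b ^ W n <= (2 ^ b) ^ W n" by (rule power_mono) (auto simp: less_imp_le)
  also have "... <= (2 ^ b) ^ (k * bl (Suc n))" by (rule power_increasing) (auto simp: k)
  also have "... = (2 ^ bl (Suc n)) ^ (b * k)" by (simp add: power_mult[symmetric] mult.assoc mult.left_commute)
  finally show "b ^ W n <= (2 ^ bl (Suc n)) ^ (b * k)" .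
 qed
qed

instance insym :: (countable) countable by countable_datatype

instance dir :: finite
proof
 have "UNIV <= {Lft, Stay, Rgt}" using dir.exhaust by blast
 thus "finite (UNIV :: dir set)" by (rule finite_subset) simp
qed

instance insym :: (finite) finite
proof
 have "UNIV <= insert LeftEnd (insert RightEnd (range (Letter :: 'a => _)))"
 proof
  fix x :: "'a insym"
  show "x : insert LeftEnd (insert RightEnd (range Letter))" by (cases x) auto
 qed
 thus "finite (UNIV :: 'a insym set)" by (rule finite_subset) simp
qed

section \<open>Programs over bounded registers\<close>

text \<open>A selector names nothing (worth 0), the old value (`False`) or the new value (`True`)
 of a register.\<close>

type_synonym sel = "(bool * nat) option"

text \<open>A command `(ch, X, Y, Z, m, a)` nondeterministically changes the registers in "ch" such
 that `X = m * Y + Z + a` holds afterwards.\<close>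

type_synonym rcmd = "nat list * sel * sel * sel * nat * nat"

fun sv :: "sel => (nat => nat) => (nat => nat) => nat" where
 "sv None v v' = 0"
| "sv (Some (b, i)) v v' = (if b then v' i else v i)"

text \<open>A command is a guess followed by one linear equation, because such an equation can be
  verified in a single pass from the least significant digit with a bounded carry. Assignment,
  comparison and division by a constant differ only in which side the guessed value stands
  on.\<close>

fun rsem :: "nat => rcmd => (nat => nat) => (nat => nat) => bool" where
 "rsem cap (ch, X, Y, Z, m, a) v v' = ((ALL i. i ~: set ch --> v' i = v i) & (ALL i : set ch. v' i < cap) &
  sv X v v' = m * sv Y v v' + sv Z v v' + a)"

fun rseq :: "nat => rcmd list => (nat => nat) => (nat => nat) => bool" where
 "rseq cap [] v v' = (v' = v)"
| "rseq cap (c # cs) v v' = (EX u. rsem cap c v u & rseq cap cs u v')"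

lemma rseq_append: "rseq cap (xs @ ys) v v' = (EX u. rseq cap xs v u & rseq cap ys u v')"
 by (induction xs arbitrary: v) auto

definition sel_ok :: "nat => sel => bool" where
 "sel_ok K s = (ALL b i. s = Some (b, i) --> i < K)"

fun cmd_ok :: "nat => rcmd => bool" where
 "cmd_ok K (ch, X, Y, Z, m, a) = (set ch <= {..<K} & sel_ok K X & sel_ok K Y & sel_ok K Z)"

lemma sel_ok_simps [simp]: "sel_ok K None" "sel_ok K (Some (b, i)) = (i < K)" by (auto simp: sel_ok_def)

subsection \<open>Sweeping over digits\<close>

text \<open>Registers are stored in base `B`, least significant digits first; a symbol holds one
 digit of each of the `K` registers. The additional argument of `mealy` is a carry.\<close>

fun mealy :: "nat => nat => rcmd => nat => nat list => nat list => nat => bool" where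
 "mealy B K (ch, X, Y, Z, m, a) u x y u' = (length y = K & (ALL d : set y. d < B) & (ALL i < K. i ~: set ch --> y ! i = x ! i) &
  sv X (nth x) (nth y) + B * u' = m * sv Y (nth x) (nth y) + sv Z (nth x) (nth y) + u)"

fun mp :: "nat => nat => rcmd => nat => nat list list => nat list list => nat => bool" where
 "mp B K c u [] [] u' = (u' = u)"
| "mp B K c u (x # xs) (y # ys) u' = (EX u1. mealy B K c u x y u1 & mp B K c u1 xs ys u')"
| "mp B K c u _ _ u' = False"

fun val :: "nat => nat list list => nat => nat" where
 "val B [] i = 0"
| "val B (x # w) i = x ! i + B * val B w i"

definition vs :: "nat => nat => nat list => bool" where
 "vs K B x = (length x = K & (ALL d : set x. d < B))"

abbreviation vw :: "nat => nat => nat list list => bool" where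
 "vw K B w \<equiv> ALL x : set w. vs K B x"

lemma vs_nth: "vs K B x ==> i < K ==> x ! i < B" by (auto simp: vs_def)

lemma mp_length: "mp B K c u w w' u' ==> length w' = length w" by (induction B K c u w w' u' rule: mp.induct) auto

lemma mealy_vs: "mealy B K c u x y u' ==> vs K B y" by (cases c) (auto simp: vs_def)

lemma mp_vw: "mp B K c u w w' u' ==> vw K B w'" by (induction B K c u w w' u' rule: mp.induct) (auto dest: mealy_vs)

lemma mp_snoc:
 "mp B K c u xs ys u1 ==> mealy B K c u1 x y u' ==> mp B K c u (xs @ [x]) (ys @ [y]) u'"
 by (induction B K c u xs ys u1 rule: mp.induct) auto

lemma sv_val: "sv X (val B (x # w)) (val B (y # w')) = sv X (nth x) (nth y) + B * sv X (val B w) (val B w')"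
 by (cases X) auto

lemma sv_zero: "sv S (%_. 0) (%_. 0) = 0" by (cases S) auto

text \<open>Weighted by the powers of \<open>B\<close>, the digit equations add up and the carries
  telescope. The final carry \<open>u'\<close> is the overflow beyond the word.\<close>

lemma mp_sound:
 assumes "mp B K c u w w' u'" "c = (ch, X, Y, Z, m, a)"
 shows "(ALL i < K. i ~: set ch --> val B w' i = val B w i) &
  sv X (val B w) (val B w') + B ^ length w * u' =
   m * sv Y (val B w) (val B w') + sv Z (val B w) (val B w') + u" using assms
proof (induction B K c u w w' u' rule: mp.induct)
 case (1 B K c u u')
 thus ?case by (simp add: sv_zero)
next
 case (2 B K c u x xs y ys u')
 then obtain u1 where m: "mealy B K c u x y u1" and p: "mp B K c u1 xs ys u'" by auto
 note IH = 2(1)[OF p 2(3)]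
 have "B * (sv X (val B xs) (val B ys) + B ^ length xs * u') =
   B * (m * sv Y (val B xs) (val B ys) + sv Z (val B xs) (val B ys) + u1)" using IH by simp
 hence "sv X (nth x) (nth y) + B * sv X (val B xs) (val B ys) + B * B ^ length xs * u' =
  m * (sv Y (nth x) (nth y) + B * sv Y (val B xs) (val B ys)) +
  (sv Z (nth x) (nth y) + B * sv Z (val B xs) (val B ys)) + u" using m 2(3) by (simp add: algebra_simps)
 thus ?case unfolding sv_val using IH m 2(3) by (auto simp: mult.assoc)
qed auto

lemma val_less: "vw K B w ==> i < K ==> val B w i < B ^ length w"
proof (induction w)
 case (Cons x w)
 hence "x ! i < B" "val B w i < B ^ length w" by (auto simp: vs_nth)
 hence "x ! i + B * val B w i < B * (val B w i + 1)" by simp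
 also have "... <= B * B ^ length w" using `val B w i < _` by (intro mult_le_mono2) simp
 finally show ?case by simp
qed simp

text \<open>The new word is forced: its digits are those of \<open>v'\<close>, and the carries are
  the quotients of the digit equations. The last carry is 0 because the word is long enough for all
  values of \<open>v'\<close>.\<close>

lemma mp_complete:
 assumes "vw K B w" "cmd_ok K (ch, X, Y, Z, m, a)" "1 < B"
  and "ALL i < K. v' i < B ^ length w" "ALL i < K. i ~: set ch --> v' i = val B w i"
  and "sv X (val B w) v' = m * sv Y (val B w) v' + sv Z (val B w) v' + u"
 shows "EX w'. mp B K (ch, X, Y, Z, m, a) u w w' 0 & (ALL i < K. val B w' i = v' i)" using assms
proof (induction w arbitrary: v' u)
 case Nil
 have "sv S (%_. 0) v' = 0" if "sel_ok K S" for S using that Nil(4) by (cases S) auto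
 hence "u = 0" using Nil(2,6) by simp
 thus ?case using Nil by (intro exI[of _ "[]"]) auto
next
 case (Cons x w)
 define y where "y = map (%i. v' i mod B) [0..<K]"
 define v1 where "v1 = (%i. v' i div B)"
 have y: "y ! i = v' i mod B" if "i < K" for i using that by (simp add: y_def)
 have split: "sv S (val B (x # w)) v' = sv S (nth x) (nth y) + B * sv S (val B w) v1" if "sel_ok K S" for S
  using that y by (cases S) (auto simp: v1_def)
 have dB: "sv S (nth x) (nth y) < B" if "sel_ok K S" for S using that y Cons(2,4) by (cases S) (auto simp: vs_nth)
 \<comment> \<open>\<open>T\<close> is the right-hand side of the first digit equation and
   \<open>Q\<close> that of the equation for the remaining digits. The remainder of \<open>T\<close>
   has to be the digit of \<open>X\<close>, and its quotient is the carry.\<close>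
 define T where "T = m * sv Y (nth x) (nth y) + sv Z (nth x) (nth y) + u"
 define Q where "Q = m * sv Y (val B w) v1 + sv Z (val B w) v1"
 have ok: "sel_ok K X" "sel_ok K Y" "sel_ok K Z" using Cons(3) by auto
 have eq: "sv X (nth x) (nth y) + B * sv X (val B w) v1 = T + B * Q"
  using Cons(7) unfolding split[OF ok(1)] split[OF ok(2)] split[OF ok(3)] T_def Q_def by (simp add: algebra_simps)
 have "(T + B * Q) mod B = sv X (nth x) (nth y)" "(T + B * Q) div B = sv X (val B w) v1"
  unfolding eq[symmetric] using dB[OF ok(1)] Cons(4) by auto
 hence T: "T mod B = sv X (nth x) (nth y)" "T div B + Q = sv X (val B w) v1" using Cons(4) by auto
 have m: "mealy B K (ch, X, Y, Z, m, a) u x y (T div B)"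
 proof -
  have "y ! i = x ! i" if "i < K" "i ~: set ch" for i
  proof -
   have "v' i = x ! i + B * val B w i" using Cons(6) that by simp
   moreover have "x ! i < B" using Cons(2) that by (auto simp: vs_nth)
   ultimately show ?thesis using y[OF that(1)] by simp
  qed
  moreover have "sv X (nth x) (nth y) + B * (T div B) = T" using T(1) by (metis mod_mult_div_eq)
  ultimately show ?thesis using Cons(4) by (auto simp: y_def T_def)
 qed
 have "EX w'. mp B K (ch, X, Y, Z, m, a) (T div B) w w' 0 & (ALL i < K. val B w' i = v1 i)"
 proof (rule Cons.IH[OF _ Cons(3,4)])
  show "vw K B w" using Cons(2) by simp
  show "ALL i < K. v1 i < B ^ length w" using Cons(4,5) by (auto simp: v1_def less_mult_imp_div_less mult.commute)
  show "ALL i < K. i ~: set ch --> v1 i = val B w i"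
  proof (intro allI impI, goal_cases)
   case i: (1 i)
   have "v' i = x ! i + B * val B w i" using Cons(6) i by simp
   moreover have "x ! i < B" using Cons(2) i by (auto simp: vs_nth)
   ultimately show ?case by (simp add: v1_def)
  qed
  show "sv X (val B w) v1 = m * sv Y (val B w) v1 + sv Z (val B w) v1 + T div B" using T(2) by (simp add: Q_def)
 qed
 then obtain w' where w': "mp B K (ch, X, Y, Z, m, a) (T div B) w w' 0" "ALL i < K. val B w' i = v1 i" by blast
 show ?case
 proof (intro exI conjI)
  show "mp B K (ch, X, Y, Z, m, a) u (x # w) (y # w') 0" unfolding mp.simps using m w'(1) by blast
  show "ALL i < K. val B (y # w') i = v' i" using w'(2) y by (simp add: v1_def)
 qed
qed

fun carry_init :: "rcmd => nat" where
 "carry_init (ch, X, Y, Z, m, a) = a"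

fun carry_bound :: "rcmd => nat" where
 "carry_bound (ch, X, Y, Z, m, a) = m + a + 1"

lemma carry_init_bound: "carry_init c <= carry_bound c" by (cases c) auto

text \<open>Digits are at most \<open>B - 1\<close>, so
  \<open>B * u' <= (m + 1) * (B - 1) + u\<close>. A bound that is at least \<open>m + 1\<close>
  reproduces itself, hence only finitely many carries occur and they can be kept in the
  state.\<close>

lemma mealy_carry_bound:
 assumes "mealy B K c u x y u'" "cmd_ok K c" "vs K B x" "u <= carry_bound c" "0 < B"
 shows "u' <= carry_bound c"
proof -
 obtain ch X Y Z m a where c: "c = (ch, X, Y, Z, m, a)" by (cases c)
 have vy: "vs K B y" using assms(1) by (rule mealy_vs)
 have d: "sv S (nth x) (nth y) <= B - 1" if "sel_ok K S" for S
 proof (cases S)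
  case (Some p)
  obtain b i where p: "p = (b, i)" by (cases p)
  hence "i < K" using that Some by simp
  hence "x ! i < B" "y ! i < B" using vs_nth[OF assms(3)] vs_nth[OF vy] by auto
  thus ?thesis using Some p by auto
 qed simp
 have "B * u' <= m * sv Y (nth x) (nth y) + sv Z (nth x) (nth y) + u" using assms(1) c by simp
 also have "... <= m * (B - 1) + (B - 1) + u" using d[of Y] d[of Z] assms(2) c by (intro add_mono mult_le_mono) auto
 also have "... = (m + 1) * (B - 1) + u" by simp
 also have "... <= carry_bound c * (B - 1) + carry_bound c" using assms(4) c by (intro add_mono mult_le_mono) auto
 also have "... = B * carry_bound c" using assms(5) by (cases B) auto
 finally show ?thesis using assms(5) by simp
qed

fun wseq :: "nat => nat => rcmd list => nat list list => nat list list => bool" where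
 "wseq B K [] w w' = (w' = w)"
| "wseq B K (c # cs) w w' = (EX w1. mp B K c (carry_init c) w w1 0 & wseq B K cs w1 w')"

lemma wseq_append: "wseq B K (xs @ ys) w w' = (EX w1. wseq B K xs w w1 & wseq B K ys w1 w')"
 by (induction xs arbitrary: w) auto

lemma wseq_length: "wseq B K cs w w' ==> length w' = length w" by (induction cs arbitrary: w) (auto dest: mp_length)

lemma wseq_vw: "wseq B K cs w w' ==> vw K B w ==> vw K B w'"
proof (induction cs arbitrary: w)
 case (Cons c cs)
 then obtain w1 where w1: "mp B K c (carry_init c) w w1 0" "wseq B K cs w1 w'" by auto
 have "vw K B w1" using mp_vw[OF w1(1)] .
 thus ?case using Cons.IH[OF w1(2)] by blast
qed simp

definition rep :: "nat => nat => nat list list => (nat => nat) => bool" where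
 "rep K B w v = (vw K B w & (ALL i < K. val B w i = v i))"

lemma rep_less: "rep K B w v ==> i < K ==> v i < B ^ length w" unfolding rep_def using val_less by metis

lemma sv_cong: "sel_ok K S ==> ALL i < K. v i = u i ==> ALL i < K. v' i = u' i ==> sv S v v' = sv S u u'"
 by (cases S) auto

lemma mp_rsem:
 assumes "mp B K c (carry_init c) w w' 0" "rep K B w v" "cmd_ok K c"
 shows "EX v'. rsem (B ^ length w) c v v' & rep K B w' v'"
proof -
 obtain ch X Y Z m a where c: "c = (ch, X, Y, Z, m, a)" by (cases c)
 \<comment> \<open>Registers from \<open>K\<close> on are not stored; they keep their old values, as
   \<open>rsem\<close> demands of unchanged registers.\<close>
 define v' where "v' = (%i. if i < K then val B w' i else v i)"
 have w': "vw K B w'" using mp_vw[OF assms(1)] .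
 have len: "length w' = length w" using mp_length[OF assms(1)] .
 have s: "sv S v v' = sv S (val B w) (val B w')" if "sel_ok K S" for S
  by (rule sv_cong[OF that]) (use assms(2) in "auto simp: v'_def rep_def")
 note snd = mp_sound[OF assms(1) c]
 have "rsem (B ^ length w) c v v'" using snd assms(2,3) val_less[OF w'] s[of X] s[of Y] s[of Z]
  by (auto simp: c v'_def rep_def len)
 moreover have "rep K B w' v'" using w' by (auto simp: rep_def v'_def)
 ultimately show ?thesis by blast
qed

lemma rsem_mp:
 assumes "rsem (B ^ length w) c v v'" "rep K B w v" "cmd_ok K c" "1 < B"
 shows "EX w'. mp B K c (carry_init c) w w' 0 & rep K B w' v'"
proof -
 obtain ch X Y Z m a where c: "c = (ch, X, Y, Z, m, a)" by (cases c)
 have s: "sv S (val B w) v' = sv S v v'" if "sel_ok K S" for S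
  by (rule sv_cong[OF that]) (use assms(2) in "auto simp: rep_def")
 have "EX w'. mp B K (ch, X, Y, Z, m, a) a w w' 0 & (ALL i < K. val B w' i = v' i)"
 proof (rule mp_complete)
  show "vw K B w" using assms(2) by (auto simp: rep_def)
  show "ALL i < K. v' i < B ^ length w" using assms(1) rep_less[OF assms(2)] c by (metis rsem.simps)
  show "ALL i < K. i ~: set ch --> v' i = val B w i" using assms(1,2) c by (auto simp: rep_def)
  show "sv X (val B w) v' = m * sv Y (val B w) v' + sv Z (val B w) v' + a" using assms(1,3) s c by auto
 qed (use assms(3,4) c in auto)
 then obtain w' where w': "mp B K c (carry_init c) w w' 0" "ALL i < K. val B w' i = v' i" using c by auto
 hence "rep K B w' v'" using mp_vw[OF w'(1)] by (simp add: rep_def)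
 thus ?thesis using w' by blast
qed

lemma wseq_rseq:
 assumes "wseq B K cs w w'" "rep K B w v" "ALL c : set cs. cmd_ok K c"
 shows "EX v'. rseq (B ^ length w) cs v v' & rep K B w' v'" using assms
proof (induction cs arbitrary: w v)
 case (Cons c cs)
 then obtain w1 where w1: "mp B K c (carry_init c) w w1 0" "wseq B K cs w1 w'" by auto
 obtain v1 where v1: "rsem (B ^ length w) c v v1" "rep K B w1 v1"
  using mp_rsem[OF w1(1) Cons.prems(2)] Cons.prems(3) by auto
 thus ?case using Cons.IH[OF w1(2) v1(2)] Cons(4) mp_length[OF w1(1)] by auto
qed auto

lemma rseq_wseq:
 assumes "rseq (B ^ length w) cs v v'" "rep K B w v" "ALL c : set cs. cmd_ok K c" "1 < B"
 shows "EX w'. wseq B K cs w w' & rep K B w' v'" using assms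
proof (induction cs arbitrary: w v)
 case (Cons c cs)
 then obtain v1 where v1: "rsem (B ^ length w) c v v1" "rseq (B ^ length w) cs v1 v'" by auto
 obtain w1 where w1: "mp B K c (carry_init c) w w1 0" "rep K B w1 v1"
  using rsem_mp[OF v1(1) Cons.prems(2)] Cons.prems(3,4) by auto
 thus ?case using Cons.IH[of w1 v1] v1(2) Cons(4,5) mp_length[OF w1(1)] by auto
qed auto

subsection \<open>Sweeping over a tape\<close>

text \<open>The blank 0 is reserved for the empty list. A digit vector has length
  \<open>K > 0\<close> and is never written as a blank, so blanks delimit the register word.\<close>

definition cod :: "nat list => nat" where
 "cod x = (if x = [] then 0 else Suc (to_nat x))"

lemma cod_eq [simp]: "(cod x = cod y) = (x = y)" by (auto simp: cod_def)

lemma cod_0 [simp]: "(cod x = 0) = (x = [])" "(0 = cod x) = (x = [])" "cod [] = 0" by (auto simp: cod_def)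

text \<open>The word starts in cell 1; the blank in cell 0 tells the head on its way back that it
  has arrived.\<close>

definition wtape :: "nat list list => nat => tape" where
 "wtape w p = (%i. if 0 < i & i <= length w then cod (w ! (i - 1)) else 0, p)"

lemma scan_wtape [simp]:
 "scan (wtape w 0) = 0"
 "scan (wtape w (Suc p)) = (if p < length w then cod (w ! p) else 0)" by (auto simp: scan_def wtape_def)

lemma snd_wtape [simp]: "snd (wtape w p) = p" by (simp add: wtape_def)

lemma write_move_scan: "a = scan tp ==> write_move a d tp = (fst tp, shift d (snd tp))"
 by (simp add: write_move_def scan_def)

lemma wtape_move: "a = scan (wtape w p) ==> write_move a d (wtape w p) = wtape w (shift d p)"
 by (simp add: write_move_scan) (simp add: wtape_def)

lemma wtape_write:
 "p = Suc (length xs) ==> write_move (cod y) d (wtape (xs @ x # ys) p) = wtape (xs @ y # ys) (shift d p)"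
 by (auto simp: write_move_def wtape_def nth_append fun_eq_iff nth_Cons')

lemma wtape_extend:
 "p = Suc (length xs) ==> write_move (cod y) d (wtape xs p) = wtape (xs @ [y]) (shift d p)"
 by (auto simp: write_move_def wtape_def nth_append fun_eq_iff)

lemma wtape_eq_0: "wtape [] 0 = blank_tape" by (auto simp: wtape_def blank_tape_def)

text \<open>In \<open>Run\<close> the head is at home with commands left to do, in
  \<open>Fwd\<close> it sweeps right with a carry, in \<open>Bwd\<close> it returns. The last
  component is the program state to be in once no command is left.\<close>

datatype 'k ctrl =
  Run "rcmd list" 'k
 | Fwd rcmd nat "rcmd list" 'k
 | Bwd "rcmd list" 'k

instance ctrl :: (countable) countable by countable_datatype

text \<open>\<open>turn\<close> exists only for carry 0: a command whose result does not fit into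
  the word gets stuck, which is how the capacity is enforced.\<close>

inductive ts :: "nat => nat => 'k ctrl => nat => 'k ctrl => nat => dir => bool" for B K where
 start: "ts B K (Run (c # cs) k) 0 (Fwd c (carry_init c) cs k) 0 Rgt"
| fwd: "mealy B K c u x y u' ==> vs K B x ==> ts B K (Fwd c u cs k) (cod x) (Fwd c u' cs k) (cod y) Rgt"
| turn: "ts B K (Fwd c 0 cs k) 0 (Bwd cs k) 0 Lft"
| bwd: "vs K B x ==> ts B K (Bwd cs k) (cod x) (Bwd cs k) (cod x) Lft"
| home: "ts B K (Bwd cs k) 0 (Run cs k) 0 Stay"

text \<open>The state of a sweep is described relative to the word \<open>w0\<close> at the last
  program step: \<open>pre\<close> has been executed on it, and in \<open>Fwd\<close> the part
  \<open>x\<close> of the word has already been replaced by \<open>x'\<close>. Nothing is claimed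
  about whether the remaining commands succeed.\<close>

fun tinv :: "nat => nat => nat list list => rcmd list => 'k => 'k ctrl => tape => bool" where
 "tinv B K w0 cs0 k0 (Run cs k) tp = (k = k0 &
  (EX pre w. cs0 = pre @ cs & wseq B K pre w0 w & tp = wtape w 0))"
| "tinv B K w0 cs0 k0 (Fwd c u cs k) tp = (k = k0 &
  (EX pre x x' y. cs0 = pre @ c # cs & wseq B K pre w0 (x @ y) &
   mp B K c (carry_init c) x x' u & tp = wtape (x' @ y) (Suc (length x'))))"
| "tinv B K w0 cs0 k0 (Bwd cs k) tp = (k = k0 &
  (EX pre w p. cs0 = pre @ cs & wseq B K pre w0 w & p <= length w & tp = wtape w p))"

lemma vs_nonempty: "vs K B x ==> 0 < K ==> x ~= []" by (auto simp: vs_def)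

lemma tinv_step:
 assumes "ts B K s (scan tp) s' a d" "tinv B K w0 cs0 k0 s tp" "vw K B w0" "0 < K"
 shows "tinv B K w0 cs0 k0 s' (write_move a d tp)" using assms(1)
proof cases
 case (start c cs k)
 then obtain pre w where *: "k = k0" "cs0 = pre @ c # cs" "wseq B K pre w0 w" "tp = wtape w 0" using assms(2) by auto
 have "write_move a d tp = wtape w (Suc 0)" unfolding *(4) using start by (simp add: wtape_move)
 thus ?thesis using * start by (simp, intro exI[of _ pre] conjI exI[of _ "[]"] exI[of _ w]) auto
next
 case (fwd c u x y u' cs k)
 then obtain pre z z' r where *: "k = k0" "cs0 = pre @ c # cs" "wseq B K pre w0 (z @ r)"
  "mp B K c (carry_init c) z z' u" "tp = wtape (z' @ r) (Suc (length z'))" using assms(2) by auto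
 have me: "mealy B K c u x y u'" and "x ~= []" using fwd vs_nonempty assms(4) by blast+
 then obtain r' where r: "r = x # r'" using fwd *(5) by (cases r) (auto split: if_splits)
 have "write_move a d tp = wtape (z' @ y # r') (Suc (Suc (length z')))"
  unfolding *(5) r using fwd by (simp add: wtape_write)
 moreover have "mp B K c (carry_init c) (z @ [x]) (z' @ [y]) u'" by (rule mp_snoc[OF *(4) me])
 ultimately show ?thesis using * fwd r
  by (simp, intro exI[of _ pre] conjI exI[of _ "z @ [x]"] exI[of _ "z' @ [y]"] exI[of _ r']) auto
next
 case (turn c cs k)
 then obtain pre z z' r where *: "k = k0" "cs0 = pre @ c # cs" "wseq B K pre w0 (z @ r)"
  "mp B K c (carry_init c) z z' 0" "tp = wtape (z' @ r) (Suc (length z'))" using assms(2) by auto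
 \<comment> \<open>The scanned blank cannot be a digit vector, so the sweep has reached the end of
   the word and the command is complete.\<close>
 have "r = []"
 proof (rule ccontr)
  assume "r ~= []"
  hence "vs K B (hd r)" using wseq_vw[OF *(3) assms(3)] by simp
  thus False using turn *(5) vs_nonempty[OF _ assms(4)] `r ~= []`
   by (auto simp: nth_append hd_conv_nth split: if_splits)
 qed
 have "write_move a d tp = wtape z' (length z')" unfolding *(5) using turn `r = []` by (subst wtape_move) auto
 moreover have "wseq B K (pre @ [c]) w0 z'" using * `r = []` by (auto simp: wseq_append)
 ultimately show ?thesis using * turn by (auto intro!: exI[of _ "pre @ [c]"] exI[of _ z'])
next
 case (bwd x cs k)
 then obtain pre w p where *: "k = k0" "cs0 = pre @ cs" "wseq B K pre w0 w" "p <= length w"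
  "tp = wtape w p" using assms(2) by auto
 have "write_move a d tp = wtape w (p - 1)" unfolding *(5) using bwd *(5) by (subst wtape_move) auto
 thus ?thesis using * bwd by (auto intro!: exI[of _ pre] exI[of _ w] exI[of _ "p - 1"])
next
 case (home cs k)
 then obtain pre w p where *: "k = k0" "cs0 = pre @ cs" "wseq B K pre w0 w" "p <= length w"
  "tp = wtape w p" using assms(2) by auto
 have "p = 0"
 proof (cases p)
  case (Suc p')
  hence "vs K B (w ! p')" using wseq_vw[OF *(3) assms(3)] *(4) by simp
  thus ?thesis using home *(4,5) Suc vs_nonempty[OF _ assms(4)] by auto
 qed
 hence "write_move a d tp = wtape w 0" unfolding *(5) using home by (subst wtape_move) auto
 thus ?thesis using * home by auto
qed

lemma tinv_space: "tinv B K w0 cs0 k0 s tp ==> snd tp <= Suc (length w0)"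
 by (cases s) (auto dest!: wseq_length mp_length)

definition tstep :: "nat => nat => 'k ctrl * tape => 'k ctrl * tape => bool" where
 "tstep B K c c' = (EX a d. ts B K (fst c) (scan (snd c)) (fst c') a d & snd c' = write_move a d (snd c))"

lemma relpowp_trans: "(R ^^ m) a b ==> (R ^^ n) b c ==> (R ^^ (m + n)) a c" by (auto simp: relpowp_add)

lemma relpowp_step: "R a b ==> (R ^^ n) b c ==> (R ^^ Suc n) a c" by (rule relpowp_Suc_I2)

lemma tstep_fwd:
 assumes "mp B K c u xs ys u'" "vw K B xs"
 shows "(tstep B K ^^ length xs) (Fwd c u cs k, wtape (zs @ xs) (Suc (length zs)))
   (Fwd c u' cs k, wtape (zs @ ys) (Suc (length zs + length xs)))" using assms
proof (induction B K c u xs ys u' arbitrary: zs rule: mp.induct)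
 case (2 B K c u x xs y ys u')
 then obtain u1 where u1: "mealy B K c u x y u1" "mp B K c u1 xs ys u'" by auto
 have "tstep B K (Fwd c u cs k, wtape (zs @ x # xs) (Suc (length zs)))
   (Fwd c u1 cs k, wtape (zs @ y # xs) (Suc (Suc (length zs))))"
  unfolding tstep_def using ts.fwd[OF u1(1), of cs k] 2(3)
  by (intro exI[of _ "cod y"] exI[of _ Rgt]) (auto simp: wtape_write)
 moreover have "(tstep B K ^^ length xs) (Fwd c u1 cs k, wtape (zs @ y # xs) (Suc (Suc (length zs))))
   (Fwd c u' cs k, wtape (zs @ y # ys) (Suc (length zs + length (x # xs))))"
  using 2(1)[OF u1(2), of "zs @ [y]"] 2(3) by simp
 ultimately show ?case by (simp only: list.size(4) add_0_right add_Suc_right One_nat_def) (rule relpowp_step[where R = "tstep B K"])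
qed auto

lemma tstep_bwd:
 assumes "vw K B w" "p <= length w"
 shows "(tstep B K ^^ Suc p) (Bwd cs k, wtape w p) (Run cs k, wtape w 0)" using assms(2)
proof (induction p)
 case 0
 have "tstep B K (Bwd cs k, wtape w 0) (Run cs k, wtape w 0)"
  unfolding tstep_def using ts.home[of B K cs k] by (intro exI[of _ 0] exI[of _ Stay]) (auto simp: wtape_move)
 thus ?case by (auto simp: relcompp_apply)
next
 case (Suc p)
 have "tstep B K (Bwd cs k, wtape w (Suc p)) (Bwd cs k, wtape w p)"
  unfolding tstep_def using ts.bwd[of K B "w ! p" cs k] assms(1) Suc(2)
  by (intro exI[of _ "cod (w ! p)"] exI[of _ Lft]) (auto simp: wtape_move)
 thus ?case using Suc by (intro relpowp_step[where R = "tstep B K" and n = "Suc p"]) auto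
qed

text \<open>With l the length of the word, each command costs one step to leave cell 0, l steps to
  the right, one to turn and l + 1 back home.\<close>

lemma wseq_run:
 assumes "wseq B K cs w w'" "vw K B w"
 shows "(tstep B K ^^ (length cs * (2 * length w + 3))) (Run cs k, wtape w 0) (Run [] k, wtape w' 0)" using assms
proof (induction cs arbitrary: w)
 case (Cons c cs)
 then obtain w1 where w1: "mp B K c (carry_init c) w w1 0" "wseq B K cs w1 w'" by auto
 have vw1: "vw K B w1" using mp_vw[OF w1(1)] .
 have len: "length w1 = length w" using mp_length[OF w1(1)] .
 have 1: "tstep B K (Run (c # cs) k, wtape w 0) (Fwd c (carry_init c) cs k, wtape w 1)"
  unfolding tstep_def using ts.start[of B K c cs k] by (intro exI[of _ 0] exI[of _ Rgt]) (auto simp: wtape_move)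
 have 2: "(tstep B K ^^ length w) (Fwd c (carry_init c) cs k, wtape w 1)
   (Fwd c 0 cs k, wtape w1 (Suc (length w)))" using tstep_fwd[OF w1(1), of cs k "[]"] Cons(3) by simp
 have 3: "tstep B K (Fwd c 0 cs k, wtape w1 (Suc (length w))) (Bwd cs k, wtape w1 (length w))"
  unfolding tstep_def using ts.turn[of B K c cs k] len by (intro exI[of _ 0] exI[of _ Lft]) (auto simp: wtape_move)
 have 4: "(tstep B K ^^ Suc (length w)) (Bwd cs k, wtape w1 (length w)) (Run cs k, wtape w1 0)"
  using tstep_bwd[OF vw1, of "length w"] len by simp
 have 5: "(tstep B K ^^ (length cs * (2 * length w + 3))) (Run cs k, wtape w1 0) (Run [] k, wtape w' 0)"
  using Cons.IH[OF w1(2) vw1] len by simp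
 have "(tstep B K ^^ (Suc (length w + Suc (Suc (length w) + length cs * (2 * length w + 3)))))
  (Run (c # cs) k, wtape w 0) (Run [] k, wtape w' 0)"
  by (rule relpowp_step[where R = "tstep B K", OF 1], rule relpowp_trans[OF 2],
    rule relpowp_step[where R = "tstep B K", OF 3], rule relpowp_trans[OF 4], rule 5)
 thus ?case by (simp add: algebra_simps eval_nat_numeral del: relpowp.simps)
qed simp

definition syms :: "nat => nat => nat set" where
 "syms K B = insert 0 (cod ` {x. vs K B x})"

text \<open>A finite superset of the controls that occur: suffixes of the command lists in
  \<open>C\<close>, together with carries up to \<open>carry_bound\<close>. The machine models
  demand a bound on the states.\<close>

definition ctrls :: "rcmd list set => 'k set => 'k ctrl set" where
 "ctrls C KS = {s. EX k : KS. EX cs : C. EX pre.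
   (EX r. cs = pre @ r & (s = Run r k \<or> s = Bwd r k)) \<or>
   (EX c r u. cs = pre @ c # r & u <= carry_bound c & s = Fwd c u r k)}"

lemma finite_syms: "finite (syms K B)"
proof -
 have "{x. vs K B x} <= {x. set x <= {..<B} & length x = K}" by (auto simp: vs_def)
 hence "finite {x. vs K B x}" by (rule finite_subset) (simp add: finite_lists_length_eq)
 thus ?thesis by (simp add: syms_def)
qed

lemma finite_ctrls: assumes "finite C" "finite KS" shows "finite (ctrls C KS)"
proof -
 define SF where "SF = (UN cs:C. (%n. drop n cs) ` {..length cs})"
 have fSF: "finite SF" using assms by (auto simp: SF_def)
 define CM where "CM = (UN cs:C. set cs)"
 have fCM: "finite CM" using assms by (auto simp: CM_def)
 define U where "U = (\<Sum>c\<in>CM. carry_bound c)"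
 have sf: "r : SF" if "pre @ r : C" for pre r
  unfolding SF_def using that by (intro UN_I[OF that] image_eqI[of _ _ "length pre"]) auto
 have U: "carry_bound c <= U" if "c : CM" for c unfolding U_def using that fCM by (intro member_le_sum) auto
 have "ctrls C KS <= (%(r, k). Run r k) ` (SF \<times> KS) \<union> (%(r, k). Bwd r k) ` (SF \<times> KS) \<union>
  (%(c, u, r, k). Fwd c u r k) ` (CM \<times> {..U} \<times> SF \<times> KS)"
 proof
  fix s assume "s : ctrls C KS"
  then obtain k cs pre where k: "k : KS" "cs : C" and
   "(EX r. cs = pre @ r & (s = Run r k \<or> s = Bwd r k)) \<or>
    (EX c r u. cs = pre @ c # r & u <= carry_bound c & s = Fwd c u r k)" by (auto simp: ctrls_def)
  then consider r where "cs = pre @ r" "s = Run r k \<or> s = Bwd r k" |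
   c r u where "cs = pre @ c # r" "u <= carry_bound c" "s = Fwd c u r k" by blast
  thus "s : (%(r, k). Run r k) ` (SF \<times> KS) \<union> (%(r, k). Bwd r k) ` (SF \<times> KS) \<union>
   (%(c, u, r, k). Fwd c u r k) ` (CM \<times> {..U} \<times> SF \<times> KS)"
  proof cases
   case 1
   hence "r : SF" using sf k by blast
   thus ?thesis using 1 k by force
  next
   case 2
   hence "r : SF" using sf[of "pre @ [c]" r] k by simp
   moreover have "c : CM" unfolding CM_def using 2 k by fastforce
   ultimately show ?thesis using 2 k U[of c] by (intro UnI2 image_eqI[of _ _ "(c, u, r, k)"]) auto
  qed
 qed
 thus ?thesis by (rule finite_subset) (use fSF fCM assms in auto)
qed

lemma ts_ctrls:
 assumes "ts B K s a s' b d" "s : ctrls C KS" "ALL cs : C. ALL c : set cs. cmd_ok K c" "0 < B"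
 shows "s' : ctrls C KS & a : syms K B & b : syms K B" using assms(1)
proof cases
 case (start c cs k)
 then obtain cs0 pre where "k : KS" "cs0 : C" "cs0 = pre @ c # cs" using assms(2) by (auto simp: ctrls_def)
 hence "s' : ctrls C KS" unfolding ctrls_def using start carry_init_bound by blast
 thus ?thesis using start by (simp add: syms_def)
next
 case (fwd c u x y u' cs k)
 then obtain cs0 pre where *: "k : KS" "cs0 : C" "cs0 = pre @ c # cs" "u <= carry_bound c"
  using assms(2) by (auto simp: ctrls_def)
 have "cmd_ok K c" using assms(3) * by auto
 hence "u' <= carry_bound c" using mealy_carry_bound fwd *(4) assms(4) by blast
 hence "s' : ctrls C KS" unfolding ctrls_def using fwd * by blast
 moreover have "vs K B y" using fwd mealy_vs by blast
 ultimately show ?thesis using fwd by (auto simp: syms_def)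
next
 case (turn c cs k)
 then obtain cs0 pre where "k : KS" "cs0 : C" "cs0 = (pre @ [c]) @ cs" using assms(2) by (auto simp: ctrls_def)
 hence "s' : ctrls C KS" unfolding ctrls_def using turn by blast
 thus ?thesis using turn by (simp add: syms_def)
next
 case (bwd x cs k)
 thus ?thesis using assms(2) by (simp add: syms_def)
next
 case (home cs k)
 then obtain cs0 pre where "k : KS" "cs0 : C" "cs0 = pre @ cs" using assms(2) by (auto simp: ctrls_def)
 hence "s' : ctrls C KS" unfolding ctrls_def using home by blast
 thus ?thesis using home by (simp add: syms_def)
qed

section \<open>Register programs on stack machines\<close>

type_synonym ('q, 'a) prog =
 "(('q * 'a insym * nat) * ('q * rcmd list * dir * dir * stack_op)) set"

type_synonym 'q mconf = "'q * nat * (nat => nat) * nat list * nat"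

inductive mstep :: "('q, 'a) prog => nat => 'a list => 'q mconf => 'q mconf => bool" for P cap x where
 "((q, input_cell x ip, stack_scan st sp), (q', cs, di, ds, p)) : P ==> rseq cap cs v v' ==>
  mstep P cap x (q, ip, v, st, sp) (q', input_shift x di ip, v', stack_apply p st, shift ds sp)"

text \<open>The input head starts on the right end marker, where the initial counting of the input
  leaves it.\<close>

definition minit :: "'q => 'a list => 'q mconf" where
 "minit q x = (q, Suc (length x), %_. 0, [], 0)"

section \<open>Binary numerals and their increment\<close>

fun bin :: "nat => nat list" where
 "bin n = (if n = 0 then [] else n mod 2 # bin (n div 2))"

declare bin.simps [simp del]

lemma bin_0 [simp]: "bin 0 = []" by (simp add: bin.simps)

lemma bin_pos: "0 < n ==> bin n = n mod 2 # bin (n div 2)" by (simp add: bin.simps)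

lemma length_bin: "length (bin n) = bl n"
proof (induction n rule: bin.induct)
 case (1 n)
 thus ?case by (cases "n = 0") (simp_all add: bin_pos[of n] bl_pos[of n])
qed

lemma bin_bits: "set (bin n) <= {0, 1}"
proof (induction n rule: bin.induct)
 case (1 n)
 thus ?case by (cases "n = 0") (auto simp add: bin_pos[of n])
qed

text \<open>The \<open>p\<close> ones at the low end become zeros, and the digit after them, a zero
  or the blank beyond the numeral, becomes a one. \<open>r\<close> is the numeral from that digit
  on.\<close>

definition incr_split :: "nat => nat => nat list => bool" where
 "incr_split m p r = (bin m = replicate p 1 @ r & (r = [] \<or> hd r = 0) &
   bin (Suc m) = replicate p 0 @ 1 # tl r)"

lemma incr_split_ex: "EX p r. incr_split m p r"
proof (induction m rule: bin.induct)
 case (1 m)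
 consider "m = 0" | "0 < m" "even m" | "0 < m" "odd m" by fastforce
 thus ?case
 proof cases
  case 1
  thus ?thesis by (auto simp: incr_split_def bin_pos intro!: exI[of _ 0])
 next
  case 2
  hence "bin m = 0 # bin (m div 2)" "bin (Suc m) = 1 # bin (m div 2)"
   using bin_pos[of m] bin_pos[of "Suc m"] by (auto simp: odd_iff_mod_2_eq_one)
  thus ?thesis by (auto simp: incr_split_def intro!: exI[of _ 0])
 next
  case 3
  then obtain p r where pr: "incr_split (m div 2) p r" using 1 by auto
  have "bin m = 1 # bin (m div 2)" "bin (Suc m) = 0 # bin (Suc (m div 2))"
   using 3 bin_pos[of m] bin_pos[of "Suc m"] by (auto simp: odd_iff_mod_2_eq_one)
  thus ?thesis using pr by (auto simp: incr_split_def intro!: exI[of _ "Suc p"] exI[of _ r])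
 qed
qed

abbreviation bw :: "nat list => nat list list" where
 "bw bs \<equiv> map (%b. [b]) bs"

datatype 'q nst = IH | IR | IL | FR | Ctl "'q ctrl"

instance nst :: (countable) countable by countable_datatype

text \<open>Before the program starts, the states `IH`, `IR`, `IL` count the cells of the input in binary
 on the working tape, which thereby gets its logarithmic length; `FR` then resets it.\<close>

inductive nt :: "('q, 'a) prog => nat => nat => 'q => 'q nst => 'a insym => nat => nat =>
  'q nst => nat => dir => dir => dir => stack_op => bool" for P B K q0 where
 ih1: "i ~= RightEnd ==> nt P B K q0 IH i 0 0 IR 0 Stay Rgt Stay Keep"
| ih2: "nt P B K q0 IH RightEnd 0 0 FR 0 Stay Rgt Stay Keep"
| ir1: "nt P B K q0 IR i (cod [1]) 0 IR (cod [0]) Stay Rgt Stay Keep"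
| ir2: "a : {0, cod [0]} ==> nt P B K q0 IR i a 0 IL (cod [1]) Stay Lft Stay Keep"
| il1: "a : {cod [0], cod [1]} ==> nt P B K q0 IL i a 0 IL a Stay Lft Stay Keep"
| il2: "nt P B K q0 IL i 0 0 IH 0 Rgt Stay Stay Keep"
| fr1: "a : {cod [0], cod [1]} ==> nt P B K q0 FR i a 0 FR (cod (replicate K 0)) Stay Rgt Stay Keep"
| fr2: "nt P B K q0 FR i 0 0 (Ctl (Bwd [] q0)) 0 Stay Lft Stay Keep"
| ctl: "ts B K s a s' b d ==> nt P B K q0 (Ctl s) i a e (Ctl s') b Stay d Stay Keep"
| edge: "((q, i, e), (q', cs, di, ds, p)) : P ==>
  nt P B K q0 (Ctl (Run [] q)) i 0 e (Ctl (Run cs q')) 0 di Stay ds p"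

definition nconf :: "'q::countable nst => nat => tape => nat list => nat => nauxsa_conf" where
 "nconf s ip tp st sp = \<lparr>n_state = to_nat s, n_ipos = ip, n_work = tp, n_stack = st, n_spos = sp\<rparr>"

lemma nconf_sel [simp]: "n_state (nconf s ip tp st sp) = to_nat s" "n_ipos (nconf s ip tp st sp) = ip"
 "n_work (nconf s ip tp st sp) = tp" "n_stack (nconf s ip tp st sp) = st"
 "n_spos (nconf s ip tp st sp) = sp" by (auto simp: nconf_def)

locale nprog =
 fixes P :: "('q::countable, 'a::finite) prog" and B K :: nat and q0 :: 'q and F :: "'q set"
 assumes fin: "finite P"
  and cmds: "((q, i, e), (q', cs, di, ds, p)) : P ==> c : set cs ==> cmd_ok K c"
  and pushes: "((q, i, e), (q', cs, di, ds, Push a)) : P ==> 0 < a"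
  and B: "1 < B" and K: "0 < K"
begin

definition "C = insert [] ((%(_, (_, cs, _)). cs) ` P)"
definition "KS = insert q0 ((%((q, _), _). q) ` P \<union> (%(_, (q', _)). q') ` P)"
definition "ES = insert 0 ((%((_, _, e), _). e) ` P \<union> {a. EX t : P. snd (snd (snd (snd (snd t)))) = Push a})"
definition "SS = {IH, IR, IL, FR} \<union> Ctl ` ctrls C KS"
definition "SY = syms K B \<union> {cod [0], cod [1]}"

definition "mtrans = {((to_nat s, i, a, e), (to_nat s', b, di, dw, ds, p)) | s i a e s' b di dw ds p.
 nt P B K q0 s i a e s' b di dw ds p & s : SS & e : ES}"

definition "bnd = Suc (Max (to_nat ` SS \<union> SY \<union> ES))"

definition "mach = \<lparr>n_states = bnd, n_syms = bnd, n_start = to_nat (IH :: 'q nst),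
 n_accept = {to_nat (Ctl (Run [] q)) | q. q : F}, n_trans = mtrans\<rparr>"

lemma finC: "finite C" and finKS: "finite KS" and finES: "finite ES"
proof -
 show "finite C" "finite KS" using fin by (auto simp: C_def KS_def)
 have "{a. EX t : P. snd (snd (snd (snd (snd t)))) = Push a} <=
  (%t. case snd (snd (snd (snd (snd t)))) of Push a => a | _ => 0) ` P"
 proof
  fix a assume "a : {a. EX t : P. snd (snd (snd (snd (snd t)))) = Push a}"
  then obtain t where "t : P" "snd (snd (snd (snd (snd t)))) = Push a" by blast
  thus "a : (%t. case snd (snd (snd (snd (snd t)))) of Push a => a | _ => 0) ` P"
   by (intro image_eqI[of _ _ t]) simp_all
 qed
 hence "finite {a. EX t : P. snd (snd (snd (snd (snd t)))) = Push a}" by (rule finite_subset) (use fin in auto)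
 thus "finite ES" using fin by (auto simp: ES_def)
qed

lemma C_ok: "cs : C ==> c : set cs ==> cmd_ok K c" by (auto simp: C_def dest: cmds)

lemma finSS: "finite SS" and finSY: "finite SY"
 using finite_ctrls[OF finC finKS] finite_syms by (auto simp: SS_def SY_def)

lemma bnd: "s : SS ==> to_nat s < bnd" "a : SY ==> a < bnd" "e : ES ==> e < bnd"
 using finSS finSY finES by (auto simp: bnd_def less_Suc_eq_le)

lemma P_sets:
 assumes "((q, i, e), (q', cs, di, ds, p)) : P"
 shows "cs : C" "q : KS" "q' : KS" "e : ES" "p = Push a ==> a : ES"
proof -
 show "cs : C" unfolding C_def by (rule insertI2, rule image_eqI[OF _ assms]) simp
 show "q : KS" unfolding KS_def by (rule insertI2, rule UnI1, rule image_eqI[OF _ assms]) simp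
 show "q' : KS" unfolding KS_def by (rule insertI2, rule UnI2, rule image_eqI[OF _ assms]) simp
 show "e : ES" unfolding ES_def by (rule insertI2, rule UnI1, rule image_eqI[OF _ assms]) simp
 show "a : ES" if "p = Push a" unfolding ES_def using assms that
  by (intro insertI2 UnI2 CollectI bexI[OF _ assms]) simp
qed

lemma Run_ctrls: "cs : C ==> k : KS ==> Run cs k : ctrls C KS" "cs : C ==> k : KS ==> Bwd cs k : ctrls C KS"
 unfolding ctrls_def by (force intro: exI[of _ "[]"])+

lemma nt_sets:
 assumes "nt P B K q0 s i a e s' b di dw ds p" "s : SS" "e : ES"
 shows "s' : SS & a : SY & b : SY & (ALL e. p = Push e --> 0 < e & e : ES)" using assms(1)
proof cases
 case fr1
 have "vs K B (replicate K 0)" using B by (auto simp: vs_def)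
 thus ?thesis using fr1 by (auto simp: SS_def SY_def syms_def)
next
 case fr2
 have "Bwd [] q0 : ctrls C KS" by (rule Run_ctrls) (auto simp: C_def KS_def)
 thus ?thesis using fr2 by (auto simp: SS_def SY_def syms_def)
next
 case (ctl u u')
 hence u: "u : ctrls C KS" using assms(2) by (auto simp: SS_def)
 have "ts B K u a u' b dw" using ctl by simp
 hence "u' : ctrls C KS & a : syms K B & b : syms K B" using ts_ctrls u C_ok B by fastforce
 thus ?thesis using ctl by (simp add: SS_def SY_def)
next
 case (edge q q' cs)
 hence ed: "((q, i, e), (q', cs, di, ds, p)) : P" by simp
 have "ALL f. p = Push f --> 0 < f & f : ES" using ed P_sets(5)[OF ed] pushes by blast
 moreover have "Run cs q' : ctrls C KS" using P_sets[OF ed] Run_ctrls by blast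
 ultimately show ?thesis using edge by (simp add: SS_def SY_def syms_def)
qed (auto simp: SS_def SY_def syms_def)

lemma wf_mach: "wf_nauxsa mach"
proof -
 have "IH : SS" "0 : SY" by (auto simp: SS_def SY_def syms_def)
 hence 1: "to_nat (IH :: 'q nst) < bnd" "0 < bnd" using bnd by auto
 have 2: "q < bnd & a < bnd & e < bnd & q' < bnd & b < bnd & (ALL f. p = Push f --> 0 < f & f < bnd)"
  if m: "((q, i, a, e), (q', b, di, dw, ds, p)) : mtrans" for q i a e q' b di dw ds p
 proof -
  obtain s s' where s: "q = to_nat s" "q' = to_nat s'" "nt P B K q0 s i a e s' b di dw ds p"
   "s : SS" "e : ES" using m unfolding mtrans_def by auto
  show ?thesis using nt_sets[OF s(3-5)] bnd s by auto
 qed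
 show ?thesis unfolding wf_nauxsa_def mach_def using 1 2 by simp
qed

abbreviation nc :: "'q nst => nat => tape => nat list => nat => nauxsa_conf" where
 "nc \<equiv> nconf"

lemma mach_step:
 "nauxsa_step mach x (nc s ip tp st sp) c' = (s : SS & stack_scan st sp : ES &
  (EX s' b di dw ds p. nt P B K q0 s (input_cell x ip) (scan tp) (stack_scan st sp) s' b di dw ds p &
   c' = nc s' (input_shift x di ip) (write_move b dw tp) (stack_apply p st) (shift ds sp)))"
  (is "?l = ?r")
proof
 assume ?l
 thus ?r unfolding nauxsa_step_def mach_def mtrans_def nconf_def by fastforce
next
 assume ?r
 then obtain s' b di dw ds p where *: "s : SS" "stack_scan st sp : ES"
  "nt P B K q0 s (input_cell x ip) (scan tp) (stack_scan st sp) s' b di dw ds p"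
  "c' = nc s' (input_shift x di ip) (write_move b dw tp) (stack_apply p st) (shift ds sp)" by blast
 hence "((to_nat s, input_cell x ip, scan tp, stack_scan st sp), (to_nat s', b, di, dw, ds, p)) : mtrans"
  unfolding mtrans_def by blast
 thus ?l unfolding nauxsa_step_def *(4)
  by (rule_tac exI[of _ "to_nat s'"], rule_tac exI[of _ b], rule_tac exI[of _ di], rule_tac exI[of _ dw],
   rule_tac exI[of _ ds], rule_tac exI[of _ p], simp add: mach_def nconf_def)
qed

lemma mach_init: "nauxsa_init mach = nc IH 0 (wtape [] 0) [] 0"
 by (simp add: nauxsa_init_def mach_def nconf_def wtape_eq_0)

section \<open>Correctness of the compiled stack machine on a fixed input\<close>

context
 fixes x :: "'a list"
begin

abbreviation "L \<equiv> bl (Suc (length x))"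
abbreviation "cap \<equiv> B ^ L"
abbreviation "frt j \<equiv> wtape (replicate j (replicate K 0) @ bw (drop j (bin (Suc (length x))))) (Suc j)"
abbreviation "irt j p r \<equiv> wtape (bw (replicate j 0 @ replicate (p - j) 1 @ r)) (Suc j)"
abbreviation "stp \<equiv> nauxsa_step mach x"
abbreviation "mreach \<equiv> (mstep P cap x)^** (minit q0 x)"

text \<open>During a sweep it is open whether the pending commands succeed, so the invariant says
  that every outcome \<open>v'\<close> they can have yields a reachable program configuration. If
  there is none, the stack has changed without any program step; the second conjunct then bounds it
  by one more than the stack of some reachable program configuration.\<close>

fun minv :: "'q nst => nat => tape => nat list => nat => bool" where
 "minv IH ip tp st sp = (ip <= Suc (length x) & tp = wtape (bw (bin ip)) 0 & st = [] & sp = 0)"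
| "minv IR ip tp st sp = (ip <= length x & st = [] & sp = 0 & (EX p r j. incr_split ip p r & j <= p &
   tp = irt j p r))"
| "minv IL ip tp st sp = (ip <= length x & st = [] & sp = 0 &
   (EX p <= bl (Suc ip). tp = wtape (bw (bin (Suc ip))) p))"
| "minv FR ip tp st sp = (ip = Suc (length x) & st = [] & sp = 0 &
   (EX j <= L. tp = frt j))"
| "minv (Ctl s) ip tp st sp = ((EX v0 w0 cs0 q. rep K B w0 v0 & length w0 = L & tinv B K w0 cs0 q s tp &
    (ALL c : set cs0. cmd_ok K c) & (ALL v'. rseq cap cs0 v0 v' --> mreach (q, ip, v', st, sp))) &
   (EX q1 ip1 v1 st1 sp1. mreach (q1, ip1, v1, st1, sp1) & length st <= Suc (length st1) & sp <= Suc sp1))"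

lemma rep_zero: "rep K B (replicate l (replicate K 0)) (%_. 0)"
proof -
 have "val B (replicate l (replicate K 0)) i = 0" if "i < K" for i using that by (induction l) auto
 thus ?thesis using B by (auto simp: rep_def vs_def)
qed

lemma input_cell_RightEnd: "ip <= Suc (length x) ==> (input_cell x ip = RightEnd) = (ip = Suc (length x))"
 by (auto simp: input_cell_def)

lemma bw_sym: "j < bl m ==> cod (bw (bin m) ! j) : {cod [0], cod [1]}"
proof -
 assume j: "j < bl m"
 hence "bin m ! j : set (bin m)" using length_bin[of m] by simp
 hence "bin m ! j : {0, 1}" using bin_bits[of m] by blast
 thus ?thesis using j length_bin[of m] by auto
qed

lemma minv_step:
 assumes "nt P B K q0 s (input_cell x ip) (scan tp) (stack_scan st sp) s' b di dw ds p"
  "minv s ip tp st sp"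
 shows "minv s' (input_shift x di ip) (write_move b dw tp) (stack_apply p st) (shift ds sp)" using assms(1)
proof cases
 case ih1
 hence tp: "tp = wtape (bw (bin ip)) 0" and ip: "ip <= Suc (length x)" "st = []" "sp = 0" using assms(2) by auto
 have "ip <= length x" using ih1 ip(1) input_cell_RightEnd[OF ip(1)] by simp
 obtain p0 r where pr: "incr_split ip p0 r" using incr_split_ex by blast
 have "write_move 0 Rgt tp = wtape (bw (bin ip)) (Suc 0)" unfolding tp by (subst wtape_move) auto
 hence "EX p r j. incr_split ip p r & j <= p &
   write_move 0 Rgt tp = irt j p r"
  by (rule_tac exI[of _ p0], rule_tac exI[of _ r], rule_tac exI[of _ 0]) (use pr in "simp add: incr_split_def")
 thus ?thesis using ih1 ip `ip <= length x` by (simp add: input_shift_def)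
next
 case ih2
 hence tp: "tp = wtape (bw (bin ip)) 0" and ip: "ip = Suc (length x)" "st = []" "sp = 0"
  using assms(2) input_cell_RightEnd by auto
 have "write_move 0 Rgt tp = wtape (bw (bin ip)) (Suc 0)" unfolding tp by (subst wtape_move) auto
 thus ?thesis using ih2 ip by (auto simp: input_shift_def intro!: exI[of _ "0::nat"])
next
 case ir1
 then obtain p' r j where *: "ip <= length x" "st = []" "sp = 0" "incr_split ip p' r" "j <= p'"
  "tp = wtape (bw (replicate j 0 @ replicate (p' - j) 1 @ r)) (Suc j)" using assms(2) by auto
 have "j < p'"
 proof (rule ccontr)
  assume "~ j < p'"
  hence "j = p'" using *(5) by simp
  hence "scan tp = (if r = [] then 0 else cod [hd r])" using *(6) by (auto simp: nth_append hd_conv_nth)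
  thus False using *(4) ir1 by (auto simp: incr_split_def split: if_splits)
 qed
 hence tp: "tp = wtape (bw (replicate j 0) @ [1] # bw (replicate (p' - Suc j) 1 @ r)) (Suc j)"
  unfolding *(6) by (metis (no_types, lifting) Cons_eq_appendI Suc_diff_Suc list.simps(9) map_append replicate_Suc)
 have "write_move (cod [0]) Rgt tp = wtape (bw (replicate j 0) @ [0] # bw (replicate (p' - Suc j) 1 @ r)) (Suc (Suc j))"
  unfolding tp by (subst wtape_write) auto
 also have "bw (replicate j 0) @ [0] # bw (replicate (p' - Suc j) 1 @ r) =
   bw (replicate (Suc j) 0 @ replicate (p' - Suc j) 1 @ r)" by (simp add: replicate_append_same[symmetric])
 finally have "EX p r j. incr_split ip p r & j <= p &
   write_move (cod [0]) Rgt tp = irt j p r"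
  by (rule_tac exI[of _ p'], rule_tac exI[of _ r], rule_tac exI[of _ "Suc j"]) (use * `j < p'` in simp)
 thus ?thesis using ir1 * by (simp add: input_shift_def)
next
 case ir2
 then obtain p' r j where *: "ip <= length x" "st = []" "sp = 0" "incr_split ip p' r" "j <= p'"
  "tp = wtape (bw (replicate j 0 @ replicate (p' - j) 1 @ r)) (Suc j)" using assms(2) by auto
 have "j = p'"
 proof (rule ccontr)
  assume "j ~= p'"
  hence "scan tp = cod [1]" using *(5,6) by (auto simp: nth_append)
  thus False using ir2 by auto
 qed
 have "write_move (cod [1]) Lft tp = wtape (bw (bin (Suc ip))) p'"
 proof (cases r)
  case Nil
  hence "tp = wtape (bw (replicate p' 0)) (Suc p')" using *(6) `j = p'` by simp
  hence "write_move (cod [1]) Lft tp = wtape (bw (replicate p' 0) @ [[1]]) p'" by (simp add: wtape_extend)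
  thus ?thesis using *(4) Nil by (simp add: incr_split_def)
 next
  case (Cons y r')
  hence "tp = wtape (bw (replicate p' 0) @ [y] # bw r') (Suc p')" using *(6) `j = p'` by simp
  hence "write_move (cod [1]) Lft tp = wtape (bw (replicate p' 0) @ [1] # bw r') p'" by (simp add: wtape_write)
  thus ?thesis using *(4) Cons by (simp add: incr_split_def)
 qed
 moreover have "p' <= bl (Suc ip)" using *(4) unfolding incr_split_def length_bin[symmetric] by simp
 ultimately show ?thesis using ir2 * by (auto simp: input_shift_def)
next
 case il1
 then obtain p' where *: "ip <= length x" "st = []" "sp = 0" "p' <= bl (Suc ip)"
   "tp = wtape (bw (bin (Suc ip))) p'" using assms(2) by auto
 have "write_move b Lft tp = wtape (bw (bin (Suc ip))) (p' - 1)"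
  unfolding *(5) using il1 *(5) by (subst wtape_move) auto
 hence "EX p <= bl (Suc ip). write_move b Lft tp = wtape (bw (bin (Suc ip))) p"
  using *(4) by (intro exI[of _ "p' - 1"]) simp
 thus ?thesis using il1 * by (simp add: input_shift_def)
next
 case il2
 then obtain p' where *: "ip <= length x" "st = []" "sp = 0" "p' <= bl (Suc ip)"
   "tp = wtape (bw (bin (Suc ip))) p'" using assms(2) by auto
 have "p' = 0"
 proof (cases p')
  case (Suc j)
  hence "cod (bw (bin (Suc ip)) ! j) : {cod [0], cod [1]}" using *(4) by (intro bw_sym) simp
  thus ?thesis using *(4,5) il2 Suc length_bin[of "Suc ip"] by auto
 qed
 hence "write_move 0 Stay tp = wtape (bw (bin (Suc ip))) 0" unfolding *(5) by (subst wtape_move) auto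
 thus ?thesis using il2 * by (auto simp: input_shift_def)
next
 case fr1
 then obtain j where *: "ip = Suc (length x)" "st = []" "sp = 0" "j <= L"
  "tp = frt j" using assms(2) by auto
 have "j < L"
 proof (rule ccontr)
  assume "~ j < L"
  hence "scan tp = 0" using *(4,5) length_bin[of "Suc (length x)"] by simp
  thus False using fr1 by auto
 qed
 then obtain y where y: "drop j (bin (Suc (length x))) = y # drop (Suc j) (bin (Suc (length x)))"
  using length_bin[of "Suc (length x)"] by (metis Cons_nth_drop_Suc)
 have "write_move b Rgt tp = wtape (replicate j (replicate K 0) @ replicate K 0 #
   bw (drop (Suc j) (bin (Suc (length x))))) (Suc (Suc j))" unfolding *(5) y using fr1 by (simp add: wtape_write)
 hence "write_move b Rgt tp = wtape (replicate (Suc j) (replicate K 0) @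
   bw (drop (Suc j) (bin (Suc (length x))))) (Suc (Suc j))"
  by (simp only: replicate_append_same[symmetric] replicate_Suc append_assoc append_Cons append_Nil)
 hence "EX j <= L. write_move b Rgt tp = wtape (replicate j (replicate K 0) @
   bw (drop j (bin (Suc (length x))))) (Suc j)" using `j < L` by (intro exI[of _ "Suc j"]) simp
 thus ?thesis using fr1 * by (simp add: input_shift_def)
next
 case fr2
 then obtain j where *: "ip = Suc (length x)" "st = []" "sp = 0" "j <= L"
  "tp = frt j" using assms(2) by auto
 have "j = L"
 proof (rule ccontr)
  assume "j ~= L"
  hence "j < L" using *(4) by simp
  hence "scan tp ~= 0" using *(5) length_bin[of "Suc (length x)"] by (auto simp: nth_append)
  thus False using fr2 by auto
 qed
 hence "tp = wtape (replicate L (replicate K 0)) (Suc L)" using *(5) length_bin[of "Suc (length x)"] by simp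
 hence "write_move 0 Lft tp = wtape (replicate L (replicate K 0)) L" by (simp add: wtape_move)
 hence ti: "tinv B K (replicate L (replicate K 0)) [] q0 (Bwd [] q0) (write_move 0 Lft tp)" by auto
 have r: "mreach (q0, Suc (length x), %_. 0, [], 0)" by (simp add: minit_def)
 have "EX v0 w0 cs0 q. rep K B w0 v0 & length w0 = L & tinv B K w0 cs0 q (Bwd [] q0) (write_move 0 Lft tp) &
    (ALL c : set cs0. cmd_ok K c) & (ALL v'. rseq cap cs0 v0 v' --> mreach (q, ip, v', st, sp))"
  by (rule exI[of _ "%_. 0"], rule exI[of _ "replicate L (replicate K 0)"], rule exI[of _ "[]"], rule exI[of _ q0])
   (use ti r rep_zero[of L] * in simp)
 moreover have "EX q1 ip1 v1 st1 sp1. mreach (q1, ip1, v1, st1, sp1) & length st <= Suc (length st1) & sp <= Suc sp1"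
  using r * by (metis le_SucI le_refl)
 ultimately show ?thesis using fr2 * by (simp add: input_shift_def)
next
 case (ctl u u')
 then obtain v0 w0 cs0 q where *: "rep K B w0 v0" "length w0 = L" "tinv B K w0 cs0 q u tp"
  "ALL c : set cs0. cmd_ok K c" "ALL v'. rseq cap cs0 v0 v' --> mreach (q, ip, v', st, sp)" using assms(2) by auto
 have ts: "ts B K u (scan tp) u' b dw" using ctl by simp
 have "mreach (q, input_shift x Stay ip, v', st, sp)" if "rseq cap cs0 v0 v'" for v'
 proof -
  have "mreach (q, ip, v', st, sp)" using that * by blast
  moreover have "ip <= Suc (length x)"
  proof -
   have "fst (snd c) <= Suc (length x)" if "mreach c" for c
    using that by (induction rule: rtranclp_induct) (auto simp: minit_def input_shift_def elim!: mstep.cases)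
   thus ?thesis using `mreach (q, ip, v', st, sp)` by fastforce
  qed
  ultimately show ?thesis by (simp add: input_shift_def)
 qed
 moreover have "tinv B K w0 cs0 q u' (write_move b dw tp)" using tinv_step[OF ts *(3) _ K] *(1) by (simp add: rep_def)
 ultimately have "EX v0 w0 cs0 q. rep K B w0 v0 & length w0 = L & tinv B K w0 cs0 q u' (write_move b dw tp) &
    (ALL c : set cs0. cmd_ok K c) & (ALL v'. rseq cap cs0 v0 v' --> mreach (q, input_shift x Stay ip, v', st, sp))"
  using *(1,2,4) by blast
 thus ?thesis using ctl assms(2) by simp
next
 case (edge q q' cs)
 then obtain v0 w0 cs0 k where *: "rep K B w0 v0" "length w0 = L" "tinv B K w0 cs0 k (Run [] q) tp"
  "ALL c : set cs0. cmd_ok K c" "ALL v'. rseq cap cs0 v0 v' --> mreach (k, ip, v', st, sp)" using assms(2) by auto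
 then obtain w where w: "wseq B K cs0 w0 w" "tp = wtape w 0" "k = q" by auto
 \<comment> \<open>The old commands have succeeded. The registers \<open>v\<close> they produced are
   fixed here and become the new point of reference of the invariant.\<close>
 obtain v where v: "rseq cap cs0 v0 v" "rep K B w v" using wseq_rseq[OF w(1) *(1,4)] *(2) by auto
 hence r: "mreach (q, ip, v, st, sp)" using * w by blast
 have "mreach (q', input_shift x di ip, v', stack_apply p st, shift ds sp)" if "rseq cap cs v v'" for v'
  using r mstep.intros[of q x ip st sp q' cs di ds p P cap v v'] that edge by auto
 moreover have "length w = L" using wseq_length[OF w(1)] *(2) by simp
 moreover have "ALL c : set cs. cmd_ok K c" using cmds edge by blast
 moreover have "write_move b dw tp = wtape w 0" unfolding w(2) using edge by (subst wtape_move) auto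
 moreover have "length (stack_apply p st) <= Suc (length st)" by (cases p) auto
 moreover have "shift ds sp <= Suc sp" by (cases ds) auto
 moreover have "tinv B K w cs q' (Run cs q') (wtape w 0)" by auto
 ultimately have "EX v0 w0 cs0 k. rep K B w0 v0 & length w0 = L & tinv B K w0 cs0 k (Run cs q') (write_move b dw tp) &
    (ALL c : set cs0. cmd_ok K c) &
    (ALL v'. rseq cap cs0 v0 v' --> mreach (k, input_shift x di ip, v', stack_apply p st, shift ds sp))"
  using v(2) by (rule_tac exI[of _ v], rule_tac exI[of _ w], rule_tac exI[of _ cs], rule_tac exI[of _ q']) simp
 moreover have "EX q1 ip1 v1 st1 sp1. mreach (q1, ip1, v1, st1, sp1) &
   length (stack_apply p st) <= Suc (length st1) & shift ds sp <= Suc sp1"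
  using r `length (stack_apply p st) <= Suc (length st)` `shift ds sp <= Suc sp` by blast
 ultimately show ?thesis using edge by simp
qed

lemma minv_reach:
 assumes "stp^** (nauxsa_init mach) c"
 shows "EX s ip tp st sp. c = nc s ip tp st sp & minv s ip tp st sp" using assms
proof (induction rule: rtranclp_induct)
 case base
 show ?case unfolding mach_init by (intro exI conjI, rule refl) simp
next
 case (step c c')
 then obtain s ip tp st sp where c: "c = nc s ip tp st sp" "minv s ip tp st sp" by blast
 obtain s' b di dw ds p where n: "nt P B K q0 s (input_cell x ip) (scan tp) (stack_scan st sp) s' b di dw ds p"
  "c' = nc s' (input_shift x di ip) (write_move b dw tp) (stack_apply p st) (shift ds sp)"
  using step(2) unfolding c(1) mach_step by blast
 show ?case using minv_step[OF n(1) c(2)] n(2) by blast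
qed

lemma minv_bounds:
 assumes "minv s ip tp st sp"
 shows "snd tp < bl (Suc (length x)) + 2"
  "EX c. mreach c & length st <= Suc (length (fst (snd (snd (snd c))))) & sp <= Suc (snd (snd (snd (snd c))))"
proof -
 have b: "bl m <= L" if "m <= Suc (length x)" for m using that by (rule bl_mono)
 show "snd tp < bl (Suc (length x)) + 2"
 proof (cases s)
  case IR
  then obtain p r j where *: "ip <= length x" "incr_split ip p r" "j <= p"
   "tp = irt j p r" using assms by auto
  have "p <= bl ip" using *(2) unfolding length_bin[symmetric] by (simp add: incr_split_def)
  thus ?thesis using b[of ip] * by simp
 next
  case IL
  thus ?thesis using assms b[of "Suc ip"] by auto
 next
  case (Ctl u)
  then obtain v0 w0 cs0 q where "length w0 = L" "tinv B K w0 cs0 q u tp" using assms by auto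
  thus ?thesis using tinv_space[of B K w0 cs0 q u tp] by simp
 qed (use assms in auto)
 show "EX c. mreach c & length st <= Suc (length (fst (snd (snd (snd c))))) & sp <= Suc (snd (snd (snd (snd c))))"
 proof (cases s)
  case (Ctl u)
  then obtain q1 ip1 v1 st1 sp1 where "mreach (q1, ip1, v1, st1, sp1)" "length st <= Suc (length st1)" "sp <= Suc sp1"
   using assms by auto
  thus ?thesis by (intro exI[of _ "(q1, ip1, v1, st1, sp1)"]) simp
 qed (use assms in \<open>auto simp del: split_paired_Ex intro!: exI[of _ "minit q0 x"]\<close>)
qed

lemma mach_accepts_sound:
 assumes "nauxsa_accepts mach x"
 shows "EX c. mreach c & fst c : F"
proof -
 obtain c where c: "stp^** (nauxsa_init mach) c" "n_state c : n_accept mach"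
  using assms by (auto simp: nauxsa_accepts_def)
 then obtain s ip tp st sp where s: "c = nc s ip tp st sp" "minv s ip tp st sp" using minv_reach by blast
 then obtain q where q: "s = Ctl (Run [] q)" "q : F" using c(2) by (auto simp: mach_def)
 then obtain v0 w0 cs0 k where *: "rep K B w0 v0" "length w0 = L" "tinv B K w0 cs0 k (Run [] q) tp"
  "ALL c : set cs0. cmd_ok K c" "ALL v'. rseq cap cs0 v0 v' --> mreach (k, ip, v', st, sp)" using s(2) by auto
 then obtain w where w: "wseq B K cs0 w0 w" "k = q" by auto
 obtain v where v: "rseq cap cs0 v0 v" using wseq_rseq[OF w(1) *(1,4)] *(2) by auto
 hence "mreach (q, ip, v, st, sp)" using * w by blast
 thus ?thesis using q(2) by (intro exI[of _ "(q, ip, v, st, sp)"]) auto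
qed

lemma mreach_ES: "mreach c ==> set (fst (snd (snd (snd c)))) <= ES"
proof (induction rule: rtranclp_induct)
 case (step c c')
 show ?case using step(2)
 proof cases
  case (1 q ip st sp q' cs di ds p v v')
  thus ?thesis using step(3) P_sets(5)[OF 1(3)] by (cases p) (auto dest: in_set_butlastD)
 qed
qed (simp add: minit_def)

lemma zero_in_ES: "0 : ES" by (simp add: ES_def)

lemma stack_scan_ES: "set st <= ES ==> stack_scan st sp : ES"
 using zero_in_ES nth_mem[of sp st] by (auto simp: stack_scan_def simp del: nth_mem)

lemma ctl_run:
 assumes "(tstep B K ^^ k) c c'" "fst c : ctrls C KS" "set st <= ES" "ip <= Suc (length x)"
 shows "(stp ^^ k) (nc (Ctl (fst c)) ip (snd c) st sp)
  (nc (Ctl (fst c')) ip (snd c') st sp) & fst c' : ctrls C KS" using assms(1)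
proof (induction k arbitrary: c')
 case 0
 thus ?case using assms by simp
next
 case (Suc k)
 then obtain d where d: "(tstep B K ^^ k) c d" "tstep B K d c'" by auto
 then obtain a dd where a: "ts B K (fst d) (scan (snd d)) (fst c') a dd" "snd c' = write_move a dd (snd d)"
  by (auto simp: tstep_def)
 have IH: "(stp ^^ k) (nc (Ctl (fst c)) ip (snd c) st sp)
  (nc (Ctl (fst d)) ip (snd d) st sp)" "fst d : ctrls C KS" using Suc.IH[OF d(1)] by auto
 have "nt P B K q0 (Ctl (fst d)) (input_cell x ip) (scan (snd d)) (stack_scan st sp) (Ctl (fst c')) a Stay dd Stay Keep"
  using a(1) by (rule nt.ctl)
 hence "stp (nc (Ctl (fst d)) ip (snd d) st sp) (nc (Ctl (fst c')) ip (snd c') st sp)"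
  unfolding mach_step using IH(2) stack_scan_ES[OF assms(3)] assms(4) a(2)
  by (intro conjI, simp add: SS_def, simp, rule_tac exI[of _ "Ctl (fst c')"], rule_tac exI[of _ a],
   rule_tac exI[of _ Stay], rule_tac exI[of _ dd], rule_tac exI[of _ Stay], rule_tac exI[of _ Keep])
   (simp add: input_shift_def)
 moreover have "fst c' : ctrls C KS" using ts_ctrls[OF a(1) IH(2)] C_ok B by auto
 ultimately show ?case using IH(1) by auto
qed

definition "cmax = (\<Sum>cs\<in>C. length cs)"

lemma cmax: "cs : C ==> length cs <= cmax" unfolding cmax_def using finC by (intro member_le_sum) auto

lemma macro_run:
 assumes "mstep P cap x (q, ip, v, st, sp) (q', ip', v', st', sp')" "rep K B w v" "length w = L"
  "set st <= ES" "ip <= Suc (length x)"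
 shows "EX w' k. rep K B w' v' & length w' = L & k <= Suc (cmax * (2 * L + 3)) &
  (stp ^^ k) (nc (Ctl (Run [] q)) ip (wtape w 0) st sp)
   (nc (Ctl (Run [] q')) ip' (wtape w' 0) st' sp')" using assms(1)
proof cases
 case (1 cs di ds p)
 have ed: "((q, input_cell x ip, stack_scan st sp), (q', cs, di, ds, p)) : P" using 1 by simp
 note ps = P_sets[OF ed]
 have st': "set st' <= ES" using assms(4) ps(5) 1 by (cases p) (auto dest: in_set_butlastD)
 have okc: "ALL c : set cs. cmd_ok K c" using C_ok ps(1) by blast
 obtain w' where w': "wseq B K cs w w'" "rep K B w' v'" using rseq_wseq[OF _ assms(2) okc B] 1 assms(3) by auto
 have "nt P B K q0 (Ctl (Run [] q)) (input_cell x ip) 0 (stack_scan st sp) (Ctl (Run cs q')) 0 di Stay ds p"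
  using 1 by (intro nt.edge) simp
 moreover have "Ctl (Run [] q) : SS" using Run_ctrls(1)[of "[]" q] ps by (auto simp: SS_def C_def)
 ultimately have s1: "stp (nc (Ctl (Run [] q)) ip (wtape w 0) st sp)
   (nc (Ctl (Run cs q')) ip' (wtape w 0) st' sp')" unfolding mach_step using stack_scan_ES[OF assms(4)] 1
  by (intro conjI, simp, simp, rule_tac exI[of _ "Ctl (Run cs q')"], rule_tac exI[of _ 0], rule_tac exI[of _ di],
   rule_tac exI[of _ Stay], rule_tac exI[of _ ds], rule_tac exI[of _ p]) (simp add: wtape_move)
 have "(tstep B K ^^ (length cs * (2 * L + 3))) (Run cs q', wtape w 0) (Run [] q', wtape w' 0)"
  using wseq_run[OF w'(1), of q'] assms(2,3) by (auto simp: rep_def)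
 moreover have "ip' <= Suc (length x)" using 1 by (auto simp: input_shift_def)
 ultimately have "(stp ^^ (length cs * (2 * L + 3)))
   (nc (Ctl (Run cs q')) ip' (wtape w 0) st' sp') (nc (Ctl (Run [] q')) ip' (wtape w' 0) st' sp')"
  using ctl_run[of _ "(Run cs q', wtape w 0)" "(Run [] q', wtape w' 0)"] Run_ctrls(1)[OF ps(1,3)] st' by auto
 hence "(stp ^^ Suc (length cs * (2 * L + 3)))
   (nc (Ctl (Run [] q)) ip (wtape w 0) st sp) (nc (Ctl (Run [] q')) ip' (wtape w' 0) st' sp')"
  by (rule relpowp_step[where R = "stp", OF s1])
 moreover have "length cs * (2 * L + 3) <= cmax * (2 * L + 3)" using cmax[OF ps(1)] by (rule mult_le_mono1)
 ultimately show ?thesis using w' wseq_length[OF w'(1)] assms(3) by fastforce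
qed

lemma macro_runs:
 assumes "(mstep P cap x ^^ k) (minit q0 x) (q, ip, v, st, sp)" "length w0 = L" "rep K B w0 (%_. 0)"
 shows "EX w j. rep K B w v & length w = L & j <= k * Suc (cmax * (2 * L + 3)) &
  (stp ^^ j) (nc (Ctl (Run [] q0)) (Suc (length x)) (wtape w0 0) [] 0)
   (nc (Ctl (Run [] q)) ip (wtape w 0) st sp)" using assms(1)
proof (induction k arbitrary: q ip v st sp)
 case 0
 thus ?case using assms by (auto simp: minit_def intro!: exI[of _ w0] exI[of _ 0])
next
 case (Suc k)
 then obtain q1 ip1 v1 st1 sp1 where 1: "(mstep P cap x ^^ k) (minit q0 x) (q1, ip1, v1, st1, sp1)"
  "mstep P cap x (q1, ip1, v1, st1, sp1) (q, ip, v, st, sp)" by (auto simp: relcompp_apply)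
 obtain w1 j1 where w1: "rep K B w1 v1" "length w1 = L" "j1 <= k * Suc (cmax * (2 * L + 3))"
  "(stp ^^ j1) (nc (Ctl (Run [] q0)) (Suc (length x)) (wtape w0 0) [] 0)
   (nc (Ctl (Run [] q1)) ip1 (wtape w1 0) st1 sp1)" using Suc.IH[OF 1(1)] by blast
 have r: "mreach (q1, ip1, v1, st1, sp1)" using 1(1) by (rule relpowp_imp_rtranclp)
 have "ip1 <= Suc (length x)"
 proof -
  have "fst (snd c) <= Suc (length x)" if "mreach c" for c
   using that by (induction rule: rtranclp_induct) (auto simp: minit_def input_shift_def elim!: mstep.cases)
  thus ?thesis using r by fastforce
 qed
 then obtain w j where w: "rep K B w v" "length w = L" "j <= Suc (cmax * (2 * L + 3))"
  "(stp ^^ j) (nc (Ctl (Run [] q1)) ip1 (wtape w1 0) st1 sp1)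
   (nc (Ctl (Run [] q)) ip (wtape w 0) st sp)" using macro_run[OF 1(2) w1(1,2)] mreach_ES[OF r] by auto
 have "(stp ^^ (j1 + j)) (nc (Ctl (Run [] q0)) (Suc (length x)) (wtape w0 0) [] 0)
   (nc (Ctl (Run [] q)) ip (wtape w 0) st sp)" using w1(4) w(4) by (rule relpowp_trans)
 thus ?case using w w1(3) by (intro exI[of _ w] exI[of _ "j1 + j"]) auto
qed

lemma init_step:
 assumes "nt P B K q0 s i a 0 s' b di dw Stay Keep" "s : SS" "i = input_cell x ip" "a = scan tp"
  "ip' = input_shift x di ip" "tp' = write_move b dw tp"
 shows "stp (nc s ip tp [] 0) (nc s' ip' tp' [] 0)" unfolding mach_step
 by (intro conjI, rule assms, simp add: stack_scan_def zero_in_ES, rule exI[of _ s'], rule exI[of _ b],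
  rule exI[of _ di], rule exI[of _ dw], rule exI[of _ Stay], rule exI[of _ Keep])
  (use assms in "simp add: stack_scan_def")

lemma init_SS: "IH : SS" "IR : SS" "IL : SS" "FR : SS" by (auto simp: SS_def)

lemma IR_run:
 assumes "incr_split ip p r" "j <= p" "ip <= length x"
 shows "(stp ^^ Suc (p - j))
  (nc IR ip (irt j p r) [] 0)
  (nc IL ip (wtape (bw (bin (Suc ip))) p) [] 0)" using assms(2)
proof (induction "p - j" arbitrary: j)
 case 0
 hence "j = p" by simp
 let ?tp = "irt j p r"
 have sc: "scan ?tp : {0, cod [0]}" using assms(1) `j = p` by (cases r) (auto simp: incr_split_def nth_append)
 have w: "write_move (cod [1]) Lft ?tp = wtape (bw (bin (Suc ip))) p"
 proof (cases r)
  case Nil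
  hence "?tp = wtape (bw (replicate p 0)) (Suc p)" using `j = p` by simp
  hence "write_move (cod [1]) Lft ?tp = wtape (bw (replicate p 0) @ [[1]]) p" by (simp add: wtape_extend)
  thus ?thesis using assms(1) Nil by (simp add: incr_split_def)
 next
  case (Cons y r')
  hence "?tp = wtape (bw (replicate p 0) @ [y] # bw r') (Suc p)" using `j = p` by simp
  hence "write_move (cod [1]) Lft ?tp = wtape (bw (replicate p 0) @ [1] # bw r') p" by (simp add: wtape_write)
  thus ?thesis using assms(1) Cons by (simp add: incr_split_def)
 qed
 have "stp (nc IR ip ?tp [] 0) (nc IL ip (wtape (bw (bin (Suc ip))) p) [] 0)"
  by (rule init_step[OF nt.ir2[OF sc] init_SS(2)]) (use w assms(3) in "simp_all add: input_shift_def")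
 thus ?case using 0 by (simp add: relcompp_apply)
next
 case (Suc d)
 let ?tp = "%j. irt j p r"
 have "replicate (p - j) (1::nat) = 1 # replicate (p - Suc j) 1"
  using Suc(2) by (metis Suc_diff_Suc replicate_Suc zero_less_Suc zero_less_diff)
 hence tp: "?tp j = wtape (bw (replicate j 0) @ [1] # bw (replicate (p - Suc j) 1 @ r)) (Suc j)" by simp
 have "write_move (cod [0]) Rgt (?tp j) = wtape (bw (replicate j 0) @ [0] # bw (replicate (p - Suc j) 1 @ r)) (Suc (Suc j))"
  unfolding tp by (subst wtape_write) auto
 also have "bw (replicate j 0) @ [0] # bw (replicate (p - Suc j) 1 @ r) =
   bw (replicate (Suc j) 0 @ replicate (p - Suc j) 1 @ r)" by (simp add: replicate_append_same[symmetric])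
 finally have w: "write_move (cod [0]) Rgt (?tp j) = ?tp (Suc j)" .
 have sc: "scan (?tp j) = cod [1]" unfolding tp by (simp add: nth_append)
 have "stp (nc IR ip (?tp j) [] 0) (nc IR ip (?tp (Suc j)) [] 0)"
  by (rule init_step[OF nt.ir1 init_SS(2)]) (use w sc assms(3) in "simp_all add: input_shift_def del: scan_wtape")
 moreover have "(stp ^^ Suc (p - Suc j)) (nc IR ip (?tp (Suc j)) [] 0)
   (nc IL ip (wtape (bw (bin (Suc ip))) p) [] 0)" by (rule Suc(1)) (use Suc(2) in auto)
 ultimately have "(stp ^^ Suc (Suc (p - Suc j))) (nc IR ip (?tp j) [] 0)
   (nc IL ip (wtape (bw (bin (Suc ip))) p) [] 0)" by (rule relpowp_step[where R = "stp"])
 thus ?case using Suc(2) by (metis Suc_diff_Suc zero_less_Suc zero_less_diff)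
qed

lemma IL_run:
 assumes "p <= bl (Suc ip)" "ip <= length x"
 shows "(stp ^^ Suc p) (nc IL ip (wtape (bw (bin (Suc ip))) p) [] 0)
  (nc IH (Suc ip) (wtape (bw (bin (Suc ip))) 0) [] 0)" using assms(1)
proof (induction p)
 case 0
 have "stp (nc IL ip (wtape (bw (bin (Suc ip))) 0) [] 0)
  (nc IH (Suc ip) (wtape (bw (bin (Suc ip))) 0) [] 0)"
  by (rule init_step[OF nt.il2 init_SS(3)]) (use assms(2) in "simp_all add: input_shift_def wtape_move")
 thus ?case by (simp add: relcompp_apply)
next
 case (Suc p)
 let ?w = "bw (bin (Suc ip))"
 have sc: "scan (wtape ?w (Suc p)) : {cod [0], cod [1]}"
  using bw_sym[of p "Suc ip"] Suc(2) length_bin[of "Suc ip"] by simp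
 have "stp (nc IL ip (wtape ?w (Suc p)) [] 0) (nc IL ip (wtape ?w p) [] 0)"
  by (rule init_step[OF nt.il1[OF sc] init_SS(3)])
   (use assms(2) in "simp_all add: input_shift_def wtape_move del: scan_wtape")
 thus ?case using Suc by (intro relpowp_step[where R = "stp" and n = "Suc p"]) auto
qed

text \<open>An increment that meets \<open>p\<close> ones takes \<open>2 * p + 3\<close> steps,
  namely one to leave cell 0 and \<open>p + 1\<close> in each direction, and \<open>p\<close> is at
  most \<open>L\<close>.\<close>

lemma IH_run:
 assumes "m <= Suc (length x)"
 shows "EX k <= m * (2 * L + 5). (stp ^^ k) (nc IH 0 (wtape [] 0) [] 0)
  (nc IH m (wtape (bw (bin m)) 0) [] 0)" using assms
proof (induction m)
 case (Suc m)
 then obtain k where k: "k <= m * (2 * L + 5)" "(stp ^^ k) (nc IH 0 (wtape [] 0) [] 0)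
  (nc IH m (wtape (bw (bin m)) 0) [] 0)" by auto
 obtain p r where pr: "incr_split m p r" using incr_split_ex by blast
 have p: "p <= L" using pr bl_mono[of m "Suc (length x)"] Suc(2)
  unfolding incr_split_def length_bin[symmetric] by auto
 have p': "p <= bl (Suc m)" using pr unfolding incr_split_def length_bin[symmetric] by auto
 have "stp (nc IH m (wtape (bw (bin m)) 0) [] 0) (nc IR m (wtape (bw (bin m)) (Suc 0)) [] 0)"
  by (rule init_step[OF nt.ih1[of "input_cell x m"] init_SS(1)])
   (use Suc(2) input_cell_RightEnd[of m] in "simp_all add: input_shift_def wtape_move")
 moreover have "(stp ^^ Suc p) (nc IR m (wtape (bw (bin m)) (Suc 0)) [] 0)
  (nc IL m (wtape (bw (bin (Suc m))) p) [] 0)" using IR_run[OF pr, of 0] pr Suc(2) by (simp add: incr_split_def)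
 moreover have "(stp ^^ Suc p) (nc IL m (wtape (bw (bin (Suc m))) p) [] 0)
  (nc IH (Suc m) (wtape (bw (bin (Suc m))) 0) [] 0)" using IL_run[OF p'] Suc(2) by simp
 ultimately have "(stp ^^ Suc (Suc p + Suc p)) (nc IH m (wtape (bw (bin m)) 0) [] 0)
  (nc IH (Suc m) (wtape (bw (bin (Suc m))) 0) [] 0)" by (meson relpowp_step relpowp_trans)
 with k(2) have "(stp ^^ (k + Suc (Suc p + Suc p))) (nc IH 0 (wtape [] 0) [] 0)
  (nc IH (Suc m) (wtape (bw (bin (Suc m))) 0) [] 0)" by (rule relpowp_trans)
 thus ?case using k(1) p by (intro exI[of _ "k + Suc (Suc p + Suc p)"]) auto
qed (auto intro: exI[of _ 0])

lemma FR_run: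
 assumes "j <= L"
 shows "(stp ^^ Suc (L - j))
  (nc FR (Suc (length x)) (frt j) [] 0)
  (nc (Ctl (Bwd [] q0)) (Suc (length x)) (wtape (replicate L (replicate K 0)) L) [] 0)" using assms
proof (induction "L - j" arbitrary: j)
 case 0
 hence "j = L" by simp
 let ?tp = "frt j"
 have tp: "?tp = wtape (replicate L (replicate K 0)) (Suc L)" using `j = L` length_bin[of "Suc (length x)"] by simp
 have "stp (nc FR (Suc (length x)) ?tp [] 0)
  (nc (Ctl (Bwd [] q0)) (Suc (length x)) (wtape (replicate L (replicate K 0)) L) [] 0)"
  unfolding tp by (rule init_step[OF nt.fr2 init_SS(4)]) (simp_all add: input_shift_def wtape_move)
 thus ?case using 0 by (simp add: relcompp_apply)
next
 case (Suc d)
 let ?tp = "%j. frt j"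
 have "j < L" using Suc(2) by simp
 hence y: "drop j (bin (Suc (length x))) = bin (Suc (length x)) ! j # drop (Suc j) (bin (Suc (length x)))"
  using length_bin[of "Suc (length x)"] by (metis Cons_nth_drop_Suc)
 have "write_move (cod (replicate K 0)) Rgt (?tp j) = wtape (replicate j (replicate K 0) @ replicate K 0 #
   bw (drop (Suc j) (bin (Suc (length x))))) (Suc (Suc j))" unfolding y by (simp add: wtape_write)
 hence w: "write_move (cod (replicate K 0)) Rgt (?tp j) = ?tp (Suc j)"
  by (simp only: replicate_append_same[symmetric] replicate_Suc append_assoc append_Cons append_Nil)
 have sc: "scan (?tp j) : {cod [0], cod [1]}"
  using bw_sym[OF `j < L`] `j < L` length_bin[of "Suc (length x)"] by (auto simp: nth_append)
 have "stp (nc FR (Suc (length x)) (?tp j) [] 0) (nc FR (Suc (length x)) (?tp (Suc j)) [] 0)"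
  by (rule init_step[OF nt.fr1[OF sc] init_SS(4)]) (use w in "simp_all add: input_shift_def del: scan_wtape")
 moreover have "(stp ^^ Suc (L - Suc j)) (nc FR (Suc (length x)) (?tp (Suc j)) [] 0)
   (nc (Ctl (Bwd [] q0)) (Suc (length x)) (wtape (replicate L (replicate K 0)) L) [] 0)"
  by (rule Suc(1)) (use Suc(2) in auto)
 ultimately have "(stp ^^ Suc (Suc (L - Suc j))) (nc FR (Suc (length x)) (?tp j) [] 0)
   (nc (Ctl (Bwd [] q0)) (Suc (length x)) (wtape (replicate L (replicate K 0)) L) [] 0)"
  by (rule relpowp_step[where R = "stp"])
 thus ?case using `j < L` by (metis Suc_diff_Suc)
qed

lemma init_run:
 "EX k <= (length x + 3) * (2 * L + 5). (stp ^^ k) (nauxsa_init mach)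
  (nc (Ctl (Run [] q0)) (Suc (length x)) (wtape (replicate L (replicate K 0)) 0) [] 0)"
proof -
 let ?n = "Suc (length x)" and ?z = "replicate L (replicate K 0)"
 obtain k where k: "k <= ?n * (2 * L + 5)" "(stp ^^ k) (nc IH 0 (wtape [] 0) [] 0)
  (nc IH ?n (wtape (bw (bin ?n)) 0) [] 0)" using IH_run[of ?n] by auto
 have ic: "input_cell x ?n = RightEnd" by (simp add: input_cell_def)
 have "stp (nc IH ?n (wtape (bw (bin ?n)) 0) [] 0) (nc FR ?n (wtape (bw (bin ?n)) (Suc 0)) [] 0)"
  by (rule init_step[OF nt.ih2 init_SS(1)]) (use ic in "simp_all add: input_shift_def wtape_move")
 moreover have "(stp ^^ Suc L) (nc FR ?n (wtape (bw (bin ?n)) (Suc 0)) [] 0)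
  (nc (Ctl (Bwd [] q0)) ?n (wtape ?z L) [] 0)" using FR_run[of 0] by simp
 moreover have "(stp ^^ Suc L) (nc (Ctl (Bwd [] q0)) ?n (wtape ?z L) [] 0)
  (nc (Ctl (Run [] q0)) ?n (wtape ?z 0) [] 0)"
 proof -
  have "(tstep B K ^^ Suc L) (Bwd [] q0, wtape ?z L) (Run [] q0, wtape ?z 0)"
   by (rule tstep_bwd) (use rep_zero in "auto simp: rep_def")
  moreover have "Bwd [] q0 : ctrls C KS" by (rule Run_ctrls) (auto simp: C_def KS_def)
  ultimately show ?thesis
   using ctl_run[of "Suc L" "(Bwd [] q0, wtape ?z L)" "(Run [] q0, wtape ?z 0)" "[]" ?n 0] by auto
 qed
 ultimately have "(stp ^^ Suc (Suc L + Suc L)) (nc IH ?n (wtape (bw (bin ?n)) 0) [] 0)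
  (nc (Ctl (Run [] q0)) ?n (wtape ?z 0) [] 0)" by (meson relpowp_step relpowp_trans)
 with k(2) have "(stp ^^ (k + Suc (Suc L + Suc L))) (nauxsa_init mach)
  (nc (Ctl (Run [] q0)) ?n (wtape ?z 0) [] 0)" unfolding mach_init by (rule relpowp_trans)
 moreover have "k + Suc (Suc L + Suc L) <= (length x + 3) * (2 * L + 5)" using k(1) by (simp add: add_mult_distrib)
 ultimately show ?thesis by blast
qed

lemma mach_complete:
 assumes "(mstep P cap x ^^ k) (minit q0 x) c" "fst c : F"
 shows "EX j d. j <= (length x + 3) * (2 * L + 5) + k * Suc (cmax * (2 * L + 3)) &
  (stp ^^ j) (nauxsa_init mach) d & n_state d : n_accept mach"
proof -
 obtain q ip v st sp where c: "c = (q, ip, v, st, sp)" by (cases c)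
 obtain w j where w: "j <= k * Suc (cmax * (2 * L + 3))"
  "(stp ^^ j) (nc (Ctl (Run [] q0)) (Suc (length x)) (wtape (replicate L (replicate K 0)) 0) [] 0)
   (nc (Ctl (Run [] q)) ip (wtape w 0) st sp)"
  using macro_runs[of k q ip v st sp, OF _ _ rep_zero] assms(1) c by fastforce
 obtain i where i: "i <= (length x + 3) * (2 * L + 5)" "(stp ^^ i) (nauxsa_init mach)
  (nc (Ctl (Run [] q0)) (Suc (length x)) (wtape (replicate L (replicate K 0)) 0) [] 0)" using init_run by blast
 have "(stp ^^ (i + j)) (nauxsa_init mach) (nc (Ctl (Run [] q)) ip (wtape w 0) st sp)"
  using i(2) w(2) by (rule relpowp_trans)
 moreover have "to_nat (Ctl (Run [] q)) : n_accept mach" using assms(2) c by (auto simp: mach_def)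
 ultimately show ?thesis using i(1) w(1)
  by (intro exI[of _ "i + j"] exI[of _ "nc (Ctl (Run [] q)) ip (wtape w 0) st sp"]) auto
qed

end

text \<open>The height grows by 2. A stack operation takes effect before the commands of its edge
  are known to succeed, so stack and stack head may be one ahead of the reachable program
  configurations; a further unit is due to the strict bound on the head position.\<close>

theorem program_in_NAuxSA:
 assumes sound: "!!x c. (mstep P (B ^ bl (Suc (length x))) x)^** (minit q0 x) c ==> fst c : F ==> x : A"
  and complete: "!!x. x : A ==> EX k c. k <= T (length x) &
   (mstep P (B ^ bl (Suc (length x))) x ^^ k) (minit q0 x) c & fst c : F"
  and height: "!!x q ip v st sp. (mstep P (B ^ bl (Suc (length x))) x)^** (minit q0 x) (q, ip, v, st, sp) ==>
   length st <= H (length x) & sp <= H (length x)"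
  and T: "pb T" and H: "(%n. real (H n + 2)) : O(h)"
 shows "EX c. A : NAuxSA (%n. real (n ^ c)) (%n. log 2 (real n)) h"
proof -
 define T' where "T' = (%n. (n + 3) * (2 * bl (Suc n) + 5) + T n * Suc (cmax * (2 * bl (Suc n) + 3)))"
 have "pb (%n. bl (Suc n))"
  by (rule pb_mono[of "%n. 2 ^ bl (Suc n)"]) (auto intro!: pb_two_power_bl pb_intros simp: less_imp_le)
 hence "pb T'" unfolding T'_def using T by (intro pb_intros)
 then obtain c where c: "(%n. real (T' n)) : O(%n. real (n ^ c))" using bigo_of_pb by blast
 have W: "(%n. real (bl (Suc n) + 2)) : O(%n. log 2 (real n))"
 proof -
  have "(%n. real (bl (Suc n))) : O(%n. log 2 (real n))" by (rule bl_Suc_bigo)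
  moreover have "(%n::nat. 2 :: real) : O(%n. log 2 (real n))"
  proof (rule bigoI[of _ 2], unfold eventually_at_top_linorder, intro exI[of _ 2] allI impI)
   fix n :: nat assume "2 <= n"
   hence "1 <= log 2 (real n)" by simp
   thus "norm (2 :: real) <= 2 * norm (log 2 (real n))" by simp
  qed
  ultimately have "(%n. real (bl (Suc n)) + 2) : O(%n. log 2 (real n))" by (rule sum_in_bigo)
  thus ?thesis by (simp add: add.commute)
 qed
 have acc: "A = {x. nauxsa_accepts mach x}"
 proof (intro set_eqI iffI; simp)
  fix x assume "x : A"
  thus "nauxsa_accepts mach x" using complete[of x] mach_complete[of _ x] unfolding nauxsa_accepts_def
   by (meson relpowp_imp_rtranclp)
 next
  fix x assume "nauxsa_accepts mach x"
  thus "x : A" using mach_accepts_sound sound by blast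
 qed
 have bounds: "snd (n_work c) < bl (Suc (length x)) + 2 & length (n_stack c) <= H (length x) + 2 &
   n_spos c < H (length x) + 2"
  if r: "(stp x)^** (nauxsa_init mach) c" for x c
 proof -
  obtain s ip tp st sp where s: "c = nc s ip tp st sp" "minv x s ip tp st sp" using minv_reach[OF r] by blast
  obtain d where d: "(mstep P (B ^ bl (Suc (length x))) x)^** (minit q0 x) d"
   "length st <= Suc (length (fst (snd (snd (snd d)))))" "sp <= Suc (snd (snd (snd (snd d))))"
   using minv_bounds(2)[OF s(2)] by blast
  obtain q' ip' v' st' sp' where d': "d = (q', ip', v', st', sp')" by (cases d)
  show ?thesis using minv_bounds(1)[OF s(2)] height[OF d(1)[unfolded d']] d(2,3) d' s(1) by auto
 qed
 have time: "EX k c. k <= T' (length x) & (stp x ^^ k) (nauxsa_init mach) c & n_state c : n_accept mach"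
  if "x : A" for x
 proof -
  obtain k c where k: "k <= T (length x)" "(mstep P (B ^ bl (Suc (length x))) x ^^ k) (minit q0 x) c" "fst c : F"
   using complete[OF `x : A`] by blast
  obtain j d where j: "j <= (length x + 3) * (2 * bl (Suc (length x)) + 5) + k * Suc (cmax * (2 * bl (Suc (length x)) + 3))"
   "(stp x ^^ j) (nauxsa_init mach) d" "n_state d : n_accept mach" using mach_complete[OF k(2,3)] by blast
  have "j <= T' (length x)" unfolding T'_def
   by (rule order_trans[OF j(1)]) (use k(1) in "intro add_left_mono mult_le_mono1")
  thus ?thesis using j by blast
 qed
 have "A : NAuxSA (%n. real (n ^ c)) (%n. log 2 (real n)) h" unfolding NAuxSA_def mem_Collect_eq
  by (rule exI[of _ mach], rule exI[of _ T'], rule exI[of _ "%n. bl (Suc n) + 2"], rule exI[of _ "%n. H n + 2"])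
   (use wf_mach acc c W H bounds time in blast)
 thus ?thesis ..
qed

end

section \<open>Register programs on alternating machines\<close>

text \<open>The states of an alternating register program either choose an edge of the program, or
 branch universally, or test an input letter, or test the symbol at a given distance from the
 last blank to the left on the stack tape, or accept.\<close>

datatype ('q, 'a) kind = KE | KU "'q list" | KI nat "'a option" | KS nat nat | KA

type_synonym 'q aprog = "(('q * nat) * ('q * rcmd list * nat * dir)) set"

definition letter_at :: "'a list => nat => 'a option" where
 "letter_at x i = (if i < length x then Some (x ! i) else None)"

text \<open>Acceptance with bounds on depth and size that are those of the compiled machine; sweeps
  and tests do not branch and add the same number to both. In \<open>stk\<close>, \<open>p0\<close>
  is the last blank at or left of the head, and division by 2 discards a mark that a cell may carry
  besides its symbol. \<open>weaken\<close> is needed because the branches of \<open>univ\<close>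
  share a single depth bound.\<close>

inductive macc :: "'q aprog => ('q => ('q, 'a) kind) => 'a list => nat =>
  'q => (nat => nat) => tape => nat => nat => bool" for E kd x L where
 acc: "kd q = KA ==> macc E kd x L q v tp 0 1"
| edge: "kd q = KE ==> ((q, scan tp), (q', cs, a, d)) : E ==> rseq (2 ^ L) cs v v' ==>
  macc E kd x L q' v' (write_move a d tp) t z ==>
  macc E kd x L q v tp (Suc (length cs * (2 * L + 3)) + t) (Suc (length cs * (2 * L + 3)) + z)"
| univ: "kd q = KU qs ==> length zs = length qs ==>
  ALL i < length qs. macc E kd x L (qs ! i) v tp t (zs ! i) ==>
  macc E kd x L q v tp (Suc t) (Suc (sum_list zs))"
| inp: "kd q = KI j l ==> letter_at x (v j) = l ==> macc E kd x L q v tp (L + 2) (L + 3)"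
| stk: "kd q = KS j b ==> p0 <= snd tp ==> fst tp p0 = 0 ==>
  ALL i. p0 < i --> i <= snd tp --> fst tp i ~= 0 ==> fst tp (p0 + 1 + v j) div 2 = b ==>
  macc E kd x L q v tp (snd tp + 5 * v j + 3 * L + 5) (snd tp + 5 * v j + 3 * L + 6)"
| weaken: "macc E kd x L q v tp t z ==> t <= t' ==> z <= z' ==> macc E kd x L q v tp t' z'"

datatype ('q, 'a) ast =
  G0 | G1 | AC "'q ctrl" | AI nat "'a option" | S1 nat nat | S2 nat nat | S3 nat nat | S4 nat nat | OK

instance ast :: (countable, countable) countable by countable_datatype

text \<open>`AI` copies a register to the index tape. `S1` moves the stack head to the last blank, and
 `S2`, `S3`, `S4` move it to the right while counting down a register.\<close>

inductive astp :: "'q aprog => ('q => ('q, 'a) kind) => nat => 'q =>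
  ('q, 'a) ast => nat => nat => 'a option =>
  ('q, 'a) ast => nat * dir => nat * dir => nat * dir => bool" for E kd K q0 where
 g0: "astp E kd K q0 G0 0 0 l G1 (0, Stay) (0, Rgt) (0, Stay)"
| g1: "astp E kd K q0 G1 0 0 l G1 (0, Stay) (cod (replicate K 0), Rgt) (0, Stay)"
| g2: "astp E kd K q0 G1 0 0 l (AC (Bwd [] q0)) (0, Stay) (0, Lft) (0, Stay)"
| ctl: "ts 2 K s a s' b d ==> astp E kd K q0 (AC s) a e l (AC s') (0, Stay) (b, d) (e, Stay)"
| edge: "kd q = KE ==> ((q, e), (q', cs, e', d)) : E ==>
  astp E kd K q0 (AC (Run [] q)) 0 e l (AC (Run cs q')) (0, Stay) (0, Stay) (e', d)"
| univ: "kd q = KU qs ==> q' : set qs ==>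
  astp E kd K q0 (AC (Run [] q)) 0 e l (AC (Run [] q')) (0, Stay) (0, Stay) (e, Stay)"
| inp: "kd q = KI j k ==> astp E kd K q0 (AC (Run [] q)) 0 e l (AI j k) (0, Stay) (0, Rgt) (e, Stay)"
| ai1: "vs K 2 y ==> astp E kd K q0 (AI j k) (cod y) e l (AI j k)
  (if y ! j = 1 then 1 else 0, Rgt) (cod y, Rgt) (e, Stay)"
| ai2: "astp E kd K q0 (AI j k) 0 e k OK (0, Stay) (0, Stay) (e, Stay)"
| ks: "kd q = KS j b ==> astp E kd K q0 (AC (Run [] q)) 0 e l (S1 j b) (0, Stay) (0, Stay) (e, Stay)"
| s1a: "e ~= 0 ==> astp E kd K q0 (S1 j b) 0 e l (S1 j b) (0, Stay) (0, Stay) (e, Lft)"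
| s1b: "astp E kd K q0 (S1 j b) 0 0 l (S2 j b) (0, Stay) (0, Stay) (0, Rgt)"
| s2: "astp E kd K q0 (S2 j b) 0 e l (S3 j b) (0, Stay) (0, Rgt) (e, Stay)"
| s3a: "vs K 2 y ==> y ! j = 0 ==>
  astp E kd K q0 (S3 j b) (cod y) e l (S3 j b) (0, Stay) (cod (y[j := 1]), Rgt) (e, Stay)"
| s3b: "vs K 2 y ==> y ! j = 1 ==>
  astp E kd K q0 (S3 j b) (cod y) e l (S4 j b) (0, Stay) (cod (y[j := 0]), Lft) (e, Stay)"
| s3c: "e div 2 = b ==> astp E kd K q0 (S3 j b) 0 e l OK (0, Stay) (0, Stay) (e, Stay)"
| s4a: "vs K 2 y ==> astp E kd K q0 (S4 j b) (cod y) e l (S4 j b) (0, Stay) (cod y, Lft) (e, Stay)"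
| s4b: "astp E kd K q0 (S4 j b) 0 e l (S2 j b) (0, Stay) (0, Stay) (e, Rgt)"

definition aconf :: "('q::countable, 'a::countable) ast => tape => tape => tape => atm_conf" where
 "aconf s t0 t1 t2 = \<lparr>a_state = to_nat s, a_conts = [t0, t1, t2]\<rparr>"

lemma a_state_aconf [simp]: "a_state (aconf s t0 t1 t2) = to_nat s" by (simp add: aconf_def)

lemma aconf_eq [simp]: "(aconf s t0 t1 t2 = aconf s' t0' t1' t2') = (s = s' & t0 = t0' & t1 = t1' & t2 = t2')"
 by (simp add: aconf_def)

definition awm :: "nat * dir => tape => tape" where
 "awm ad tp = write_move (fst ad) (snd ad) tp"

lemma val_append: "val B (xs @ ys) i = val B xs i + B ^ length xs * val B ys i"
 by (induction xs) (auto simp: algebra_simps)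

lemma val_bits:
 assumes "vw K 2 w" "j < K"
 shows "val 2 w j = (\<Sum>i | i < length w & w ! i ! j = 1. 2 ^ i)" using assms(1)
proof (induction w rule: rev_induct)
 case (snoc y w)
 have y: "y ! j < 2" using snoc(2) assms(2) by (auto simp: vs_def)
 let ?S = "{i. i < length w & w ! i ! j = 1}"
 have eq: "{i. i < length (w @ [y]) & (w @ [y]) ! i ! j = 1} = (if y ! j = 1 then insert (length w) ?S else ?S)"
  by (auto simp: nth_append less_Suc_eq)
 have "val 2 (w @ [y]) j = val 2 w j + 2 ^ length w * (y ! j)" by (simp add: val_append)
 also have "... = (\<Sum>i | i < length (w @ [y]) & (w @ [y]) ! i ! j = 1. 2 ^ i)"
  unfolding eq using snoc y by (cases "y ! j = 1") (auto simp: less_2_cases_iff)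
 finally show ?case .
qed simp

locale aprog =
 fixes E :: "'q::countable aprog" and kd :: "'q => ('q, 'a::finite) kind" and K :: nat
  and q0 :: 'q and Q :: "'q set"
 assumes fin: "finite E" "finite Q" "q0 : Q"
  and cmds: "((q, e), (q', cs, a, d)) : E ==> (ALL c : set cs. cmd_ok K c) & q : Q & q' : Q"
  and KU: "q : Q ==> kd q = KU qs ==> distinct qs & qs ~= [] & set qs <= Q"
  and KI: "q : Q ==> kd q = KI j l ==> j < K"
  and KS: "q : Q ==> kd q = KS j b ==> j < K"
  and K: "0 < K"
begin

definition "C = insert [] ((%(_, (_, cs, _)). cs) ` E)"
definition "ES = insert 0 ((%((_, e), _). e) ` E \<union> (%(_, (_, _, e, _)). e) ` E)"
definition "KIP = {(j, l). EX q : Q. kd q = KI j l}"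
definition "KSP = {(j, b). EX q : Q. kd q = KS j b}"
definition "SS = {G0, G1, OK} \<union> AC ` ctrls C Q \<union> (%(j, l). AI j l) ` KIP \<union>
 (%(j, b). S1 j b) ` KSP \<union> (%(j, b). S2 j b) ` KSP \<union> (%(j, b). S3 j b) ` KSP \<union> (%(j, b). S4 j b) ` KSP"
definition "SY = {0, 1} \<union> syms K 2 \<union> ES"

text \<open>The index tape is written from left to right only once, so the cell under its head is
  always still blank.\<close>

definition "atrans = {((to_nat s, [0, a, e], l), (to_nat s', [w0, w1, w2])) | s a e l s' w0 w1 w2.
 astp E kd K q0 s a e l s' w0 w1 w2 & s : SS & e : ES}"

definition "bnd = Suc (Max (to_nat ` SS \<union> SY))"

definition "mach = \<lparr>a_tapes = 3, a_states = bnd, a_syms = bnd, a_start = to_nat (G0 :: ('q, 'a) ast),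
 a_accept = insert (to_nat (OK :: ('q, 'a) ast)) {to_nat (AC (Run [] q) :: ('q, 'a) ast) | q. kd q = KA},
 a_univ = {to_nat (AC (Run [] q) :: ('q, 'a) ast) | q qs. kd q = KU qs},
 a_trans = atrans\<rparr>"

abbreviation ac :: "('q, 'a) ast => tape => tape => tape => atm_conf" where
 "ac \<equiv> aconf"

lemma finC: "finite C" and finES: "finite ES" using fin by (auto simp: C_def ES_def)

lemma C_ok: "cs : C ==> c : set cs ==> cmd_ok K c" by (auto simp: C_def dest: cmds)

lemma finSS: "finite SS"
proof -
 have "KIP <= (%q. case kd q of KI j l => (j, l) | _ => (0, None)) ` Q"
 proof
  fix s assume "s : KIP"
  then obtain j l q where "s = (j, l)" "q : Q" "kd q = KI j l" by (auto simp: KIP_def)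
  thus "s : (%q. case kd q of KI j l => (j, l) | _ => (0, None)) ` Q" by (intro image_eqI[of _ _ q]) simp_all
 qed
 hence 1: "finite KIP" by (rule finite_subset) (use fin in simp)
 have "KSP <= (%q. case kd q of KS j l => (j, l) | _ => (0, 0)) ` Q"
 proof
  fix s assume "s : KSP"
  then obtain j l q where "s = (j, l)" "q : Q" "kd q = KS j l" by (auto simp: KSP_def)
  thus "s : (%q. case kd q of KS j l => (j, l) | _ => (0, 0)) ` Q" by (intro image_eqI[of _ _ q]) simp_all
 qed
 hence 2: "finite KSP" by (rule finite_subset) (use fin in simp)
 show ?thesis using 1 2 finite_ctrls[OF finC fin(2)] unfolding SS_def by blast
qed

lemma bnd: "s : SS ==> to_nat s < bnd" "a : SY ==> a < bnd"
proof -
 have "finite SY" using finite_syms[of K 2] finES by (simp add: SY_def)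
 hence f: "finite (to_nat ` SS \<union> SY)" using finSS by simp
 show "s : SS ==> to_nat s < bnd" "a : SY ==> a < bnd"
  unfolding bnd_def less_Suc_eq_le using f by (auto intro: Max_ge)
qed

lemma E_sets:
 assumes "((q, e), (q', cs, a, d)) : E"
 shows "cs : C" "q : Q" "q' : Q" "e : ES" "a : ES"
proof -
 show "cs : C" unfolding C_def by (rule insertI2, rule image_eqI[OF _ assms]) simp
 show "e : ES" unfolding ES_def by (rule insertI2, rule UnI1, rule image_eqI[OF _ assms]) simp
 show "a : ES" unfolding ES_def by (rule insertI2, rule UnI2, rule image_eqI[OF _ assms]) simp
qed (use cmds[OF assms] in auto)

lemma Run_ctrls: "cs : C ==> k : Q ==> Run cs k : ctrls C Q" "cs : C ==> k : Q ==> Bwd cs k : ctrls C Q"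
 unfolding ctrls_def by (force intro: exI[of _ "[]"])+

lemma nil_C: "[] : C" by (simp add: C_def)

lemma ctrls_Q: "Run cs q : ctrls C Q ==> q : Q" by (auto simp: ctrls_def)

lemma SS_KS:
 "(S1 j b : SS) = (EX q : Q. kd q = KS j b)" "(S2 j b : SS) = (EX q : Q. kd q = KS j b)"
 "(S3 j b : SS) = (EX q : Q. kd q = KS j b)" "(S4 j b : SS) = (EX q : Q. kd q = KS j b)"
 "(AI j l : SS) = (EX q : Q. kd q = KI j l)" "(AC s : SS) = (s : ctrls C Q)" "G0 : SS" "G1 : SS" "OK : SS"
 by (auto simp: SS_def KIP_def KSP_def)

lemma astp_sets:
 assumes "astp E kd K q0 s a e l s' w0 w1 w2" "s : SS" "e : ES"
 shows "s' : SS & a : SY & e : SY & fst w0 : SY & fst w1 : SY & fst w2 : SY &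
  s ~= OK & (ALL q. kd q = KA --> s ~= AC (Run [] q))"
proof -
 have 0: "0 : SY" "1 : SY" and e: "e : SY" using assms(3) by (auto simp: SY_def)
 have sy: "cod y : SY" if "vs K 2 y" for y using that by (auto simp: SY_def syms_def)
 show ?thesis using assms(1)
 proof cases
  case g1
  have "vs K 2 (replicate K 0)" by (auto simp: vs_def)
  thus ?thesis using g1 0 e sy SS_KS by simp
 next
  case g2
  thus ?thesis using Run_ctrls(2)[OF nil_C fin(3)] 0 e SS_KS by simp
 next
  case (ctl u u' b d)
  hence u: "u : ctrls C Q" using assms(2) SS_KS by simp
  have "u' : ctrls C Q & a : syms K 2 & b : syms K 2" using ts_ctrls[OF ctl(6) u] C_ok by auto
  moreover have "u ~= Run [] q" for q using ctl(6) by (auto elim: ts.cases)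
  ultimately show ?thesis using ctl 0 e by (simp add: SS_KS SY_def)
 next
  case (edge q q' cs e' d)
  hence "((q, e), (q', cs, e', d)) : E" by simp
  note es = E_sets[OF this]
  have "Run cs q' : ctrls C Q" using es Run_ctrls by blast
  thus ?thesis using edge 0 e es by (auto simp add: SS_KS SY_def)
 next
  case (univ q qs q')
  hence "q : Q" using assms(2) ctrls_Q SS_KS by blast
  hence "q' : Q" using KU univ by blast
  hence "Run [] q' : ctrls C Q" using Run_ctrls nil_C by blast
  thus ?thesis using univ 0 e by (auto simp add: SS_KS)
 next
  case (inp q j k)
  hence "q : Q" using assms(2) ctrls_Q SS_KS by blast
  thus ?thesis using inp 0 e by (auto simp add: SS_KS)
 next
  case (ks q j b)
  hence "q : Q" using assms(2) ctrls_Q SS_KS by blast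
  thus ?thesis using ks 0 e by (auto simp add: SS_KS)
 next
  case (s3a y j b)
  then obtain q where "q : Q" "kd q = KS j b" using assms(2) SS_KS by blast
  hence "vs K 2 (y[j := 1])" using s3a by (auto simp: vs_def dest!: set_update_subset_insert[THEN subsetD])
  thus ?thesis using s3a 0 e sy assms(2) by (simp add: SS_KS)
 next
  case (s3b y j b)
  then obtain q where "q : Q" "kd q = KS j b" using assms(2) SS_KS by blast
  hence "vs K 2 (y[j := 0])" using s3b by (auto simp: vs_def dest!: set_update_subset_insert[THEN subsetD])
  thus ?thesis using s3b 0 e sy assms(2) by (simp add: SS_KS)
 qed (use 0 e sy assms(2) SS_KS in simp_all)
qed

lemma wf_mach: "wf_atm mach"
proof -
 have s: "to_nat (G0 :: ('q, 'a) ast) < bnd" "0 < bnd" using bnd(1)[OF SS_KS(7)] bnd(2)[of 0] by (auto simp: SY_def)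
 have 2: "q < bnd & q ~: a_accept mach & q' < bnd & length as = 3 & (ALL a : set as. a < bnd) &
   length acts = 3 & (ALL (a, d) : set acts. a < bnd)"
  if m: "((q, as, i), (q', acts)) : atrans" for q as i q' acts
 proof -
  obtain s a e s' w0 w1 w2 where *: "q = to_nat s" "as = [0, a, e]" "q' = to_nat s'" "acts = [w0, w1, w2]"
   "astp E kd K q0 s a e i s' w0 w1 w2" "s : SS" "e : ES" using m unfolding atrans_def by auto
  note b = astp_sets[OF *(5-7)]
  have "q ~: a_accept mach" using b *(1) by (auto simp: mach_def)
  thus ?thesis using b * bnd s by (cases w0; cases w1; cases w2) auto
 qed
 show ?thesis unfolding wf_atm_def using s 2 by (simp add: mach_def)
qed

lemma mach_step:
 "atm_step mach x (ac s t0 t1 t2) c' = (s : SS & scan t2 : ES & scan t0 = 0 &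
  (EX s' w0 w1 w2. astp E kd K q0 s (scan t1) (scan t2) (addressed x t0) s' w0 w1 w2 &
   c' = ac s' (awm w0 t0) (awm w1 t1) (awm w2 t2)))" (is "?l = ?r")
proof
 assume ?l
 then obtain q acts where m: "((to_nat s, [scan t0, scan t1, scan t2], addressed x t0), (q, acts)) : atrans"
  "c' = \<lparr>a_state = q, a_conts = map2 (%(a, d). write_move a d) acts [t0, t1, t2]\<rparr>"
  unfolding atm_step_def by (auto simp: mach_def aconf_def)
 hence "EX s' w0 w1 w2. q = to_nat s' & acts = [w0, w1, w2] & scan t0 = 0 &
  astp E kd K q0 s (scan t1) (scan t2) (addressed x t0) s' w0 w1 w2 & s : SS & scan t2 : ES"
  unfolding atrans_def by (auto simp del: split_paired_Ex)
 then obtain s' w0 w1 w2 where *: "q = to_nat s'" "acts = [w0, w1, w2]" "scan t0 = 0"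
  "astp E kd K q0 s (scan t1) (scan t2) (addressed x t0) s' w0 w1 w2" "s : SS" "scan t2 : ES" by blast
 hence "c' = ac s' (awm w0 t0) (awm w1 t1) (awm w2 t2)" using m(2) by (simp add: aconf_def awm_def split_def)
 thus ?r using * by blast
next
 assume ?r
 then obtain s' w0 w1 w2 where *: "s : SS" "scan t2 : ES" "scan t0 = 0"
  "astp E kd K q0 s (scan t1) (scan t2) (addressed x t0) s' w0 w1 w2"
  "c' = ac s' (awm w0 t0) (awm w1 t1) (awm w2 t2)" by blast
 hence "((to_nat s, [scan t0, scan t1, scan t2], addressed x t0), (to_nat s', [w0, w1, w2])) : atrans"
  unfolding atrans_def by (auto simp del: split_paired_Ex)
 thus ?l unfolding atm_step_def *(5) by (rule_tac exI[of _ "to_nat s'"], rule_tac exI[of _ "[w0, w1, w2]"])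
   (simp add: mach_def aconf_def awm_def split_def)
qed

section \<open>From program derivations to accepting trees\<close>

context
 fixes x :: "'a list"
begin

definition aacc :: "atm_conf => nat => nat => bool" where
 "aacc c t z = (EX u. label u = c & accepting_from mach x u & treedepth u <= t & treesize u <= z)"

lemma aacc_leaf: "a_state c : a_accept mach ==> aacc c 0 1"
 unfolding aacc_def by (intro exI[of _ "Node c []"]) (auto intro: accepting_from.leaf)

lemma aacc_exist: "atm_step mach x c c' ==> a_state c ~: a_univ mach ==> aacc c' t z ==> aacc c (Suc t) (Suc z)"
proof -
 assume s: "atm_step mach x c c'" "a_state c ~: a_univ mach" and "aacc c' t z"
 then obtain u where u: "label u = c'" "accepting_from mach x u" "treedepth u <= t" "treesize u <= z"
  by (auto simp: aacc_def)
 have "accepting_from mach x (Node c [u])" using s u by (intro accepting_from.exist) auto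
 thus ?thesis unfolding aacc_def using u by (intro exI[of _ "Node c [u]"]) auto
qed

lemma aacc_mono: "aacc c t z ==> t <= t' ==> z <= z' ==> aacc c t' z'" unfolding aacc_def by (metis le_trans)

lemma aacc_univ:
 assumes "a_state c : a_univ mach" "cs ~= []" "distinct cs" "set cs = {c'. atm_step mach x c c'}"
  "length zs = length cs" "ALL i < length cs. aacc (cs ! i) t (zs ! i)"
 shows "aacc c (Suc t) (Suc (sum_list zs))"
proof -
 have "ALL i. EX u. i < length cs --> label u = cs ! i & accepting_from mach x u & treedepth u <= t & treesize u <= zs ! i"
  using assms(6) unfolding aacc_def by auto
 then obtain f where f: "!!i. i < length cs ==> label (f i) = cs ! i & accepting_from mach x (f i) &
   treedepth (f i) <= t & treesize (f i) <= zs ! i" by metis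
 define us where "us = map f [0..<length cs]"
 have lab: "map label us = cs" unfolding us_def using f by (intro nth_equalityI) auto
 have "accepting_from mach x (Node c us)"
 proof (rule accepting_from.univ)
  show "us ~= []" using assms(2) by (auto simp: us_def)
  show "distinct (map label us)" using lab assms(3) by simp
  show "label ` set us = {c'. atm_step mach x c c'}" using lab assms(4) by (metis list.set_map)
  show "ALL u : set us. accepting_from mach x u" using f by (auto simp: us_def)
 qed (rule assms(1))
 moreover have "treedepth (Node c us) <= Suc t" using f assms(2) by (auto simp: us_def)
 moreover have "treesize (Node c us) <= Suc (sum_list zs)"
 proof -
  have "sum_list (map treesize us) = (\<Sum>i<length cs. treesize (f i))"
   by (simp add: us_def sum_list_sum_nth atLeast0LessThan)
  also have "... <= (\<Sum>i<length cs. zs ! i)" using f by (intro sum_mono) auto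
  also have "... = sum_list zs" using assms(5) by (simp add: sum_list_sum_nth atLeast0LessThan)
  finally show ?thesis by simp
 qed
 ultimately show ?thesis unfolding aacc_def by (intro exI[of _ "Node c us"]) simp
qed

lemma not_univ:
 "(to_nat (s :: ('q, 'a) ast) ~: a_univ mach) = (ALL q qs. kd q = KU qs --> s ~= AC (Run [] q))"
 by (auto simp: mach_def)

text \<open>\<open>k\<close> counts the steps of a nonbranching prefix, which add equally to depth
  and size. Keeping them apart from the \<open>t\<close> and \<open>z\<close> of the tree below lets
  runs be chained by arithmetic on \<open>k\<close> alone.\<close>

definition aa :: "nat => nat => nat => atm_conf => bool" where
 "aa t z k c = aacc c (k + t) (k + z)"

abbreviation "ab s \<equiv> ac s blank_tape"

lemma aa_step:
 assumes "astp E kd K q0 s a e l s' w0 w1 w2" "s : SS" "e : ES" "scan t0 = 0"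
  "a = scan t1" "e = scan t2" "l = addressed x t0" "to_nat s ~: a_univ mach"
  "aa t z k (ac s' t0' t1' t2')" "t0' = awm w0 t0" "t1' = awm w1 t1" "t2' = awm w2 t2"
 shows "aa t z (Suc k) (ac s t0 t1 t2)" unfolding aa_def add_Suc
proof (rule aacc_exist)
 show "atm_step mach x (ac s t0 t1 t2) (ac s' t0' t1' t2')" unfolding mach_step using assms by blast
qed (use assms in "auto simp: aa_def")

lemma awm_stay: "a = scan t ==> awm (a, Stay) t = t" by (simp add: awm_def write_move_scan)

lemma awm_wtape: "a = scan (wtape w p) ==> awm (a, d) (wtape w p) = wtape w (shift d p)"
 by (simp add: awm_def wtape_move)

lemma awm_write: "p = Suc (length xs) ==> awm (cod y, d) (wtape (xs @ y0 # ys) p) = wtape (xs @ y # ys) (shift d p)"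
 by (simp add: awm_def wtape_write)

lemma awm_Rgt: "a = scan t ==> awm (a, Rgt) t = (fst t, Suc (snd t))" by (simp add: awm_def write_move_scan)

lemma awm_Lft: "a = scan t ==> awm (a, Lft) t = (fst t, snd t - 1)" by (simp add: awm_def write_move_scan)

lemma scan_pair [simp]: "scan (f, p) = f p" by (simp add: scan_def)

lemma zero_ES: "0 : ES" by (simp add: ES_def)

lemma scan_blank [simp]: "scan blank_tape = 0" by (simp add: scan_def blank_tape_def)

lemma ctl_chain:
 assumes "(tstep 2 K ^^ n) (r, t1) (r', t1')" "r : ctrls C Q" "scan t2 : ES" "aa t z k (ab (AC r') t1' t2)"
 shows "aa t z (n + k) (ab (AC r) t1 t2)" using assms(1,2)
proof (induction n arbitrary: r t1)
 case (Suc n)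
 obtain u tu where d: "tstep 2 K (r, t1) (u, tu)" "(tstep 2 K ^^ n) (u, tu) (r', t1')"
  using relpowp_Suc_D2[OF Suc(2)] by (metis surj_pair)
 then obtain a dd where a: "ts 2 K r (scan t1) u a dd" "tu = write_move a dd t1" by (auto simp: tstep_def)
 have u: "u : ctrls C Q" using ts_ctrls[OF a(1) Suc(3)] C_ok by auto
 have "to_nat (AC r :: ('q, 'a) ast) ~: a_univ mach" unfolding not_univ using a(1) by (auto elim: ts.cases)
 thus ?case unfolding add_Suc by (intro aa_step[OF astp.ctl[OF a(1)] _ _ _ _ _ _ _ Suc.IH[OF d(2) u]])
   (use assms a Suc(3) in "auto simp: SS_KS awm_stay", simp add: awm_def)
qed (use assms in simp)

text \<open>A potential function for counting down in binary: a decrement turns the zeros at the low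
  end into ones, so the time spent on passing over them is paid by the drop of this number.\<close>

definition "zeros j w = length (filter (%y. y ! j = 0) w)"

lemma zeros_append: "zeros j (xs @ ys) = zeros j xs + zeros j ys" by (simp add: zeros_def)

lemma S4_run:
 assumes "vw K 2 w" "p <= length w" "S4 j b : SS" "scan t2 : ES" "aa t z k (ab (S2 j b) (wtape w 0) (awm (scan t2, Rgt) t2))"
 shows "aa t z (Suc p + k) (ab (S4 j b) (wtape w p) t2)" using assms(2)
proof (induction p)
 case 0
 show ?case unfolding add_Suc add_0
  by (rule aa_step[OF astp.s4b _ _ _ _ _ _ _ assms(5)]) (use assms in "auto simp: awm_stay not_univ")
next
 case (Suc p)
 hence y: "vs K 2 (w ! p)" using assms(1) by simp
 show ?case unfolding add_Suc by (rule aa_step[OF astp.s4a[OF y] _ _ _ _ _ _ _ Suc.IH[unfolded add_Suc]])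
   (use assms Suc(2) in "auto simp: awm_stay not_univ awm_wtape awm_write SS_KS")
qed

lemma vs_update: "vs K 2 y ==> d < 2 ==> vs K 2 (y[j := d])"
 by (auto simp: vs_def dest!: set_update_subset_insert[THEN subsetD])

lemma S3_run:
 assumes "vw K 2 xs" "ALL y : set xs. y ! j = 0" "j < K" "S3 j b : SS" "scan t2 : ES"
  "aa t z k (ab (S3 j b) (wtape (zs @ map (%y. y[j := 1]) xs @ ys) (Suc (length zs + length xs))) t2)"
 shows "aa t z (length xs + k) (ab (S3 j b) (wtape (zs @ xs @ ys) (Suc (length zs))) t2)" using assms(1,2,6)
proof (induction xs arbitrary: zs)
 case (Cons y xs)
 have y: "vs K 2 y" "y ! j = 0" using Cons(2,3) by auto
 have IH: "aa t z (length xs + k) (ab (S3 j b) (wtape ((zs @ [y[j := 1]]) @ xs @ ys) (Suc (length (zs @ [y[j := 1]])))) t2)"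
  by (rule Cons.IH) (use Cons(2-4) in auto)
 show ?case unfolding list.size append_Cons add_Suc add_Suc_right add_0_right
  by (rule aa_step[OF astp.s3a[OF y] _ _ _ _ _ _ _ IH])
   (use assms in "auto simp: awm_stay not_univ awm_wtape awm_write SS_KS")
qed simp

text \<open>Amortized analysis, giving time linear in \<open>v j + L\<close> and not their product.
  A decrement that passes over l zeros takes 2 l + 3 steps and lowers the number of zeros by at
  least l - 1, so with potential \<open>2 * zeros j w\<close> it costs at most 5. The value 0 is
  recognized by a sweep that meets no one and reaches the end, in \<open>L + 2\<close>
  steps.\<close>

lemma S2_run:
 assumes "rep K 2 w v" "length w = L" "j < K" "S2 j b : SS" "ALL i. fst t2 i : ES" "fst t2 (snd t2 + v j) div 2 = b"
 shows "aa 0 1 (5 * v j + 2 * zeros j w + L + 2) (ab (S2 j b) (wtape w 0) t2)" using assms(1,2,5,6)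
proof (induction "v j" arbitrary: v w t2)
 case 0
 have sc: "scan t2 : ES" using 0 by (simp add: scan_def)
 have vw: "vw K 2 w" using 0 by (auto simp: rep_def)
 have "val 2 w j = 0" using 0 assms(3) by (simp add: rep_def)
 hence z: "ALL y : set w. y ! j = 0" by (induction w) auto
 have "scan t2 div 2 = b" using 0 by (simp add: scan_def)
 have "aa 0 1 0 (ab OK (wtape (map (%y. y[j := 1]) w) (Suc L)) t2)"
  unfolding aa_def add_0 by (rule aacc_leaf) (simp add: mach_def)
 hence "aa 0 1 (Suc 0) (ab (S3 j b) (wtape (map (%y. y[j := 1]) w) (Suc L)) t2)"
  by (rule aa_step[OF astp.s3c, rotated 8])
   (use assms(4) sc 0 `scan t2 div 2 = b` in "auto simp: awm_stay not_univ SS_KS awm_wtape awm_write")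
 hence "aa 0 1 (L + Suc 0) (ab (S3 j b) (wtape ([] @ w @ []) (Suc (length ([] :: nat list list)))) t2)"
  using S3_run[OF vw z assms(3) _ sc, of b 0 1 "Suc 0" "[]" "[]"] 0 assms(4) by (simp add: SS_KS)
 hence "aa 0 1 (Suc (L + Suc 0)) (ab (S2 j b) (wtape w 0) t2)" by (rule aa_step[OF astp.s2 assms(4) sc, rotated 5])
   (auto simp: awm_stay not_univ awm_wtape awm_write SS_KS)
 thus ?case unfolding aa_def by (rule aacc_mono) (use 0 in auto)
next
 case (Suc n)
 have sc: "scan t2 : ES" using Suc by (simp add: scan_def)
 have vw: "vw K 2 w" using Suc by (auto simp: rep_def)
 have "val 2 w j ~= 0" using Suc(2,3) assms(3) by (simp add: rep_def)
 hence "EX y : set w. y ! j ~= 0" by (induction w) auto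
 then obtain xs y ys where w: "w = xs @ y # ys" "y ! j ~= 0" "ALL u : set xs. u ! j = 0"
  using split_list_first_prop[of w "%y. y ! j ~= 0"] by auto
 have y1: "vs K 2 y" using vw w by simp
 hence "y ! j < 2" using vs_nth assms(3) by blast
 hence y: "vs K 2 y" "y ! j = 1" using y1 w(2) by simp_all
 have jl: "j < length y" using y assms(3) by (simp add: vs_def)
 define w' where "w' = map (%y. y[j := 1]) xs @ y[j := 0] # ys"
 define v' where "v' = v(j := n)"
 have vw': "vw K 2 w'" using vw by (auto simp: w'_def w intro!: vs_update)
 have other: "val 2 w' i = val 2 w i" if "i ~= j" for i
  unfolding w'_def w val_append using that by (induction xs) auto
 have "val 2 xs j = 0" using w(3) by (induction xs) auto
 moreover have "val 2 (map (%y. y[j := 1]) xs) j = 2 ^ length xs - 1"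
 proof -
  have "vw K 2 xs" using vw w by auto
  hence "Suc (val 2 (map (%y. y[j := 1]) xs) j) = 2 ^ length xs" using assms(3) by (induction xs) (auto simp: vs_def)
  thus ?thesis by simp
 qed
 ultimately have "Suc (val 2 w' j) = val 2 w j" unfolding w'_def w val_append using y(2) jl by simp
 hence n: "val 2 w' j = n" using Suc(2,3) assms(3) by (simp add: rep_def)
 have rep': "rep K 2 w' v'" using vw' other n Suc(3) by (auto simp: rep_def v'_def)
 define t2' where "t2' = awm (scan t2, Rgt) t2"
 have t2': "t2' = (fst t2, Suc (snd t2))" by (simp add: t2'_def awm_def write_move_scan)
 let ?k = "5 * v' j + 2 * zeros j w' + L + 2"
 have "aa 0 1 ?k (ab (S2 j b) (wtape w' 0) t2')"
 proof (rule Suc(1)[OF _ rep'])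
  show "length w' = L" using Suc(4) by (simp add: w'_def w)
  show "fst t2' (snd t2' + v' j) div 2 = b" using Suc(2,6) by (simp add: t2' v'_def flip: Suc(2))
 qed (use Suc in "auto simp: v'_def t2'")
 hence "aa 0 1 (Suc (length xs) + ?k) (ab (S4 j b) (wtape w' (length xs)) t2)"
  by (intro S4_run[OF vw' _ _ sc]) (use assms(4) in "auto simp: t2'_def w'_def SS_KS")
 hence "aa 0 1 (Suc (Suc (length xs) + ?k)) (ab (S3 j b) (wtape (map (%y. y[j := 1]) xs @ y # ys) (Suc (length xs))) t2)"
  by (rule aa_step[OF astp.s3b[OF y] _ sc, rotated 6])
   (use assms(4) in "auto simp: awm_stay not_univ SS_KS awm_wtape awm_write w'_def nth_append")
 hence "aa 0 1 (length xs + Suc (Suc (length xs) + ?k))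
   (ab (S3 j b) (wtape ([] @ xs @ y # ys) (Suc (length ([] :: nat list list)))) t2)"
  by (intro S3_run[OF _ w(3) assms(3) _ sc]) (use assms(4) vw w(1) in "auto simp: SS_KS")
 hence "aa 0 1 (Suc (length xs + Suc (Suc (length xs) + ?k))) (ab (S2 j b) (wtape w 0) t2)"
  by (rule aa_step[OF astp.s2 assms(4) sc, rotated 5])
   (auto simp: awm_stay not_univ awm_wtape awm_write SS_KS w(1))
 moreover have "zeros j w' + length xs <= Suc (zeros j w)"
 proof -
  have "zeros j xs = length xs" using w(3) by (induction xs) (auto simp: zeros_def)
  moreover have "zeros j (map (%y. y[j := 1]) xs) = 0"
  proof -
   have "vw K 2 xs" using vw w by auto
   thus ?thesis using assms(3) by (induction xs) (auto simp: zeros_def vs_def)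
  qed
  ultimately show ?thesis using y(2) jl by (auto simp: w'_def w(1) zeros_append) (auto simp: zeros_def)
 qed
 moreover have "v j = Suc (v' j)" using Suc(2) by (simp add: v'_def)
 ultimately show ?case unfolding aa_def by (elim aacc_mono) auto
qed

lemma S1_run:
 assumes "p0 <= p" "f p0 = 0" "ALL i. p0 < i --> i <= p --> f i ~= 0" "ALL i. f i : ES" "S1 j b : SS"
  "aa t z k (ab (S2 j b) (wtape w 0) (f, Suc p0))"
 shows "aa t z (Suc (p - p0) + k) (ab (S1 j b) (wtape w 0) (f, p))" using assms(1,3)
proof (induction "p - p0" arbitrary: p)
 case 0
 hence "p = p0" by simp
 moreover have "aa t z (Suc k) (ab (S1 j b) (wtape w 0) (f, p0))"
  by (rule aa_step[OF astp.s1b _ _ _ _ _ _ _ assms(6)])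
   (use assms(2,4,5) in "auto simp: awm_stay not_univ awm_wtape awm_Rgt awm_Lft SS_KS zero_ES")
 ultimately show ?case by simp
next
 case (Suc d)
 have "f p ~= 0" using Suc by auto
 have IH: "aa t z (Suc (p - 1 - p0) + k) (ab (S1 j b) (wtape w 0) (f, p - 1))" by (rule Suc(1)) (use Suc in auto)
 have "aa t z (Suc (Suc (p - 1 - p0) + k)) (ab (S1 j b) (wtape w 0) (f, p))"
  by (rule aa_step[OF astp.s1a[OF `f p ~= 0`] _ _ _ _ _ _ _ IH])
   (use assms(4,5) in "auto simp: awm_stay not_univ awm_wtape awm_Rgt awm_Lft SS_KS zero_ES")
 moreover have "Suc (p - 1 - p0) = p - p0" using Suc(2) by simp
 ultimately show ?case by (simp only: add_Suc)
qed

definition itape :: "nat => nat list list => nat => tape" where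
 "itape j w p = (%i. if i < p & w ! i ! j = 1 then 1 else 0, p)"

lemma scan_itape [simp]: "scan (itape j w p) = 0" by (simp add: scan_def itape_def)

lemma itape_write: "awm (if w ! p ! j = 1 then 1 else 0, Rgt) (itape j w p) = itape j w (Suc p)"
 by (auto simp: itape_def awm_def write_move_def fun_eq_iff less_Suc_eq)

lemma itape_0: "itape j w 0 = blank_tape" by (auto simp: itape_def blank_tape_def)

lemma addressed_itape:
 assumes "rep K 2 w v" "j < K"
 shows "addressed x (itape j w (length w)) = letter_at x (v j)"
proof -
 have "{i. fst (itape j w (length w)) i = 1} = {i. i < length w & w ! i ! j = 1}" by (auto simp: itape_def)
 moreover have "val 2 w j = v j" using assms by (simp add: rep_def)
 ultimately show ?thesis using val_bits[of w K j] assms by (simp add: addressed_def letter_at_def rep_def Let_def)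
qed

lemma AI_run:
 assumes "rep K 2 w v" "j < K" "letter_at x (v j) = l" "AI j l : SS" "scan t2 : ES" "p <= length w"
 shows "aa 0 1 (Suc (length w - p)) (ac (AI j l) (itape j w p) (wtape w (Suc p)) t2)" using assms(6)
proof (induction "length w - p" arbitrary: p)
 case 0
 hence p: "p = length w" by simp
 have "aa 0 1 0 (ac OK (itape j w p) (wtape w (Suc p)) t2)" unfolding aa_def add_0 by (rule aacc_leaf) (simp add: mach_def)
 hence "aa 0 1 (Suc 0) (ac (AI j l) (itape j w p) (wtape w (Suc p)) t2)" by (rule aa_step[OF astp.ai2, rotated 7])
   (use assms addressed_itape[OF assms(1,2)] p in "auto simp: awm_stay not_univ")
 thus ?case using p by simp
next
 case (Suc d)
 have "p < length w" using Suc(2) by simp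
 have y: "vs K 2 (w ! p)" using assms(1) Suc by (auto simp: rep_def)
 have IH: "aa 0 1 (Suc (length w - Suc p)) (ac (AI j l) (itape j w (Suc p)) (wtape w (Suc (Suc p))) t2)"
  by (rule Suc(1)) (use Suc in auto)
 have "aa 0 1 (Suc (Suc (length w - Suc p))) (ac (AI j l) (itape j w p) (wtape w (Suc p)) t2)"
  by (rule aa_step[OF astp.ai1[OF y] _ _ _ _ _ _ _ IH])
   (use assms Suc(2) itape_write[of w p j] `p < length w` in "auto simp: awm_stay not_univ awm_wtape")
 moreover have "length w - p = Suc (length w - Suc p)" using Suc(2) by simp
 ultimately show ?case by simp
qed

lemma macc_complete:
 assumes "macc E kd x L q v tp t z" "q : Q" "rep K 2 w v" "length w = L" "ALL i. fst tp i : ES"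
 shows "aa t z 0 (ab (AC (Run [] q)) (wtape w 0) tp)" using assms
proof (induction arbitrary: w rule: macc.induct)
 case (acc q v tp)
 thus ?case unfolding aa_def add_0 by (intro aacc_leaf) (auto simp: mach_def)
next
 case (edge q tp q' cs a d v v' t z)
 note es = E_sets[OF edge(2)]
 have ok: "ALL c : set cs. cmd_ok K c" using C_ok es(1) by blast
 obtain w' where w': "wseq 2 K cs w w'" "rep K 2 w' v'" using rseq_wseq[of 2 w cs v v' K] edge ok by auto
 have ES': "ALL i. fst (write_move a d tp) i : ES" using edge(9) es by (auto simp: write_move_def)
 have r: "(tstep 2 K ^^ (length cs * (2 * L + 3))) (Run cs q', wtape w 0) (Run [] q', wtape w' 0)"
  using wseq_run[OF w'(1), of q'] edge(7,8) by (auto simp: rep_def)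
 have "aa t z 0 (ab (AC (Run [] q')) (wtape w' 0) (write_move a d tp))"
  by (rule edge.IH) (use es w' wseq_length[OF w'(1)] edge ES' in auto)
 hence "aa t z (length cs * (2 * L + 3)) (ab (AC (Run cs q')) (wtape w 0) (write_move a d tp))"
  using ctl_chain[OF r _ _ `aa t z 0 _`] ES' Run_ctrls(1)[OF es(1,3)] by (simp add: scan_def)
 hence "aa t z (Suc (length cs * (2 * L + 3))) (ab (AC (Run [] q)) (wtape w 0) tp)"
  by (rule aa_step[OF astp.edge[where E = E and kd = kd, OF edge(1,2)], rotated 7])
   (use edge es Run_ctrls(1)[OF nil_C] in "auto simp: SS_KS not_univ awm_stay", simp add: awm_def)
 thus ?case by (simp add: aa_def)
next
 case (univ q qs zs v tp t)
 note qs = KU[OF univ(4,1)]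
 define cs where "cs = map (%q'. ab (AC (Run [] q')) (wtape w 0) tp) qs"
 \<comment> \<open>The children must be exactly the successors: in \<open>Run [] q\<close> with
   \<open>kd q = KU qs\<close> only the rule \<open>univ\<close> applies, as every other rule
   demands a different kind of \<open>q\<close> or a pending command.\<close>
 have "set cs = {c'. atm_step mach x (ab (AC (Run [] q)) (wtape w 0) tp) c'}" (is "_ = ?S")
 proof (intro equalityI subsetI)
  fix c assume "c : set cs"
  then obtain q' where q': "q' : set qs" "c = ab (AC (Run [] q')) (wtape w 0) tp" by (auto simp: cs_def)
  have "astp E kd K q0 (AC (Run [] q)) 0 (scan tp) (addressed x blank_tape) (AC (Run [] q')) (0, Stay) (0, Stay) (scan tp, Stay)"
   using univ(1) q'(1) by (rule astp.univ)
  moreover have "scan tp : ES" using univ(7) by (simp add: scan_def)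
  ultimately have "atm_step mach x (ab (AC (Run [] q)) (wtape w 0) tp) c"
   unfolding mach_step q'(2) using Run_ctrls(1)[OF nil_C univ(4)]
   by (intro conjI, simp add: SS_KS, simp, simp, rule_tac exI[of _ "AC (Run [] q')"], rule_tac exI[of _ "(0, Stay)"],
    rule_tac exI[of _ "(0, Stay)"], rule_tac exI[of _ "(scan tp, Stay)"]) (simp add: awm_stay)
  thus "c : ?S" by simp
 next
  fix c assume "c : ?S"
  then obtain s' w0 w1 w2 where s: "astp E kd K q0 (AC (Run [] q)) 0 (scan tp) (addressed x blank_tape) s' w0 w1 w2"
   "c = ac s' (awm w0 blank_tape) (awm w1 (wtape w 0)) (awm w2 tp)" by (auto simp: mach_step)
  show "c : set cs" using s(1)
  proof cases
   case (univ qs' q')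
   thus ?thesis using s(2) `kd q = KU qs` by (auto simp: cs_def awm_stay)
  next
   case ctl
   thus ?thesis by (auto elim: ts.cases)
  qed (use univ(1) in auto)
 qed
 moreover have "distinct cs" using qs by (auto simp: cs_def distinct_map inj_on_def)
 moreover have "cs ~= []" using qs by (simp add: cs_def)
 moreover have "ALL i < length cs. aacc (cs ! i) t (zs ! i)"
  using univ(3,5-7) qs by (auto simp: cs_def aa_def dest: nth_mem)
 moreover have "a_state (ab (AC (Run [] q)) (wtape w 0) tp) : a_univ mach" using univ(1) by (auto simp: mach_def)
 ultimately show ?case using univ(2) unfolding aa_def add_0 by (intro aacc_univ) (auto simp: cs_def)
next
 case (inp q j l v tp)
 have SS: "AI j l : SS" using inp by (auto simp: SS_KS)
 have "aa 0 1 (Suc (length w - 0)) (ac (AI j l) (itape j w 0) (wtape w (Suc 0)) tp)"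
  by (rule AI_run) (use inp SS KI in "auto simp: scan_def")
 hence "aa 0 1 (Suc (Suc (length w - 0))) (ab (AC (Run [] q)) (wtape w 0) tp)"
  by (rule aa_step[OF astp.inp[where kd = kd, OF inp(1)], rotated 7])
   (use inp Run_ctrls(1)[OF nil_C] in "auto simp: SS_KS not_univ awm_stay itape_0 awm_wtape", simp_all add: scan_def)
 thus ?case unfolding aa_def by (rule aacc_mono) (use inp in simp_all)
next
 case (stk q j b p0 tp v)
 have SS: "S1 j b : SS" "S2 j b : SS" using stk by (auto simp: SS_KS)
 have j: "j < K" using KS stk by blast
 have "scan tp : ES" using stk by (simp add: scan_def)
 let ?k = "5 * v j + 2 * zeros j w + L + 2"
 have "aa 0 1 ?k (ab (S2 j b) (wtape w 0) (fst tp, Suc p0))" by (rule S2_run) (use stk SS j in auto)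
 hence "aa 0 1 (Suc (snd tp - p0) + ?k) (ab (S1 j b) (wtape w 0) (fst tp, snd tp))"
  by (intro S1_run) (use stk SS in auto)
 hence "aa 0 1 (Suc (Suc (snd tp - p0) + ?k)) (ab (AC (Run [] q)) (wtape w 0) tp)"
  by (rule aa_step[OF astp.ks[where kd = kd, OF stk(1)], rotated 7])
   (use stk `scan tp : ES` Run_ctrls(1)[OF nil_C] in "auto simp: SS_KS not_univ awm_stay")
 moreover have "zeros j w <= L" using stk length_filter_le[of _ w] by (simp add: zeros_def)
 ultimately show ?case unfolding aa_def by (elim aacc_mono) auto
next
 case (weaken q v tp t z t' z')
 thus ?case unfolding aa_def add_0 using aacc_mono by blast
qed

lemma rep_zeros: "rep K 2 (replicate l (replicate K 0)) (%_. 0)"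
proof -
 have "val 2 (replicate l (replicate K 0)) i = 0" if "i < K" for i using that by (induction l) auto
 thus ?thesis by (auto simp: rep_def vs_def)
qed

lemma mach_init: "atm_init mach = ac G0 blank_tape (wtape [] 0) blank_tape"
 by (simp add: atm_init_def mach_def aconf_def wtape_eq_0 eval_nat_numeral)

lemma G1_run:
 defines "Z \<equiv> %l. replicate l (replicate K 0)"
 assumes "aa t z 0 (ab (AC (Run [] q0)) (wtape (Z L) 0) blank_tape)" "l <= L"
 shows "aa t z (Suc (L - l) + Suc L) (ab G1 (wtape (Z l) (Suc l)) blank_tape)" using assms(3)
proof (induction "L - l" arbitrary: l)
 case 0
 hence l: "l = L" by simp
 have "(tstep 2 K ^^ Suc L) (Bwd [] q0, wtape (Z L) L) (Run [] q0, wtape (Z L) 0)"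
  by (rule tstep_bwd) (use rep_zeros in "auto simp: rep_def Z_def")
 from ctl_chain[OF this _ _ assms(2)]
 have "aa t z (Suc L) (ab (AC (Bwd [] q0)) (wtape (Z L) L) blank_tape)" using Run_ctrls(2)[OF nil_C fin(3)] by (simp add: ES_def)
 hence "aa t z (Suc (Suc L)) (ab G1 (wtape (Z L) (Suc L)) blank_tape)" by (rule aa_step[OF astp.g2, rotated 7])
   (auto simp: SS_KS not_univ awm_stay zero_ES awm_wtape Z_def)
 thus ?case using l by simp
next
 case (Suc d)
 have IH: "aa t z (Suc (L - Suc l) + Suc L) (ab G1 (wtape (Z (Suc l)) (Suc (Suc l))) blank_tape)"
  by (rule Suc(1)) (use Suc in auto)
 have w: "awm (cod (replicate K 0), Rgt) (wtape (Z l) (Suc l)) = wtape (Z (Suc l)) (Suc (Suc l))"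
  by (simp add: awm_def wtape_extend replicate_append_same Z_def)
 have "aa t z (Suc (Suc (L - Suc l) + Suc L)) (ab G1 (wtape (Z l) (Suc l)) blank_tape)"
  by (rule aa_step[OF astp.g1 _ _ _ _ _ _ _ IH _ w[symmetric]])
   (auto simp: SS_KS not_univ awm_stay zero_ES Z_def)
 moreover have "L - l = Suc (L - Suc l)" using Suc(2) by simp
 ultimately show ?case by simp
qed

lemma mach_complete:
 assumes "macc E kd x L q0 (%_. 0) blank_tape t z"
 shows "aacc (atm_init mach) (2 * L + 3 + t) (2 * L + 3 + z)"
proof -
 have "aa t z 0 (ab (AC (Run [] q0)) (wtape (replicate L (replicate K 0)) 0) blank_tape)"
  by (rule macc_complete[OF assms fin(3) rep_zeros]) (auto simp: blank_tape_def ES_def)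
 hence "aa t z (Suc (L - 0) + Suc L) (ab G1 (wtape (replicate 0 (replicate K 0)) (Suc 0)) blank_tape)" by (rule G1_run) simp
 hence "aa t z (Suc (Suc (L - 0) + Suc L)) (ab G0 (wtape [] 0) blank_tape)" by (rule aa_step[OF astp.g0, rotated 7])
   (auto simp: SS_KS not_univ awm_stay zero_ES awm_wtape)
 thus ?thesis unfolding mach_init aa_def by (rule aacc_mono) simp_all
qed

section \<open>From accepting trees back to program derivations\<close>

definition Macc :: "nat => 'q => nat list list => tape => bool" where
 "Macc L q w tp = (ALL v. rep K 2 w v --> (EX t z. macc E kd x L q v tp t z))"

definition below :: "tape => nat => nat => bool" where
 "below tp n b = (EX p0 <= snd tp. fst tp p0 = 0 & (ALL i. p0 < i --> i <= snd tp --> fst tp i ~= 0) & fst tp (p0 + 1 + n) div 2 = b)"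

lemma below_0: "scan t = 0 ==> fst t (Suc (snd t) + n) div 2 = b ==> below t n b"
 unfolding below_def by (intro exI[of _ "snd t"]) (auto simp: scan_def)

lemma below_Lft: "scan t ~= 0 ==> below (fst t, snd t - 1) n b ==> below t n b"
proof -
 assume "scan t ~= 0" "below (fst t, snd t - 1) n b"
 then obtain p0 where p0: "p0 <= snd t - 1" "fst t p0 = 0" "ALL i. p0 < i --> i <= snd t - 1 --> fst t i ~= 0"
  "fst t (p0 + 1 + n) div 2 = b" "fst t (snd t) ~= 0" by (auto simp: below_def scan_def)
 have "fst t i ~= 0" if "p0 < i" "i <= snd t" for i using that p0(3,5) by (cases "i = snd t") auto
 thus ?thesis unfolding below_def using p0 by (intro exI[of _ p0]) auto
qed

text \<open>What acceptance from a machine state yields for the program, provided the tapes have the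
  shape that occurs in that state. In \<open>S3\<close> a decrement of the value \<open>n\<close> is
  under way: the \<open>length xs\<close> zeros passed so far have become ones, which has added
  \<open>2 ^ length xs - 1\<close> to the register.\<close>

fun good :: "('q, 'a) ast => tape => tape => tape => bool" where
 "good (AC s) t0 t1 t2 = (ALL w0 cs0 k. t0 = blank_tape --> vw K 2 w0 --> (ALL c : set cs0. cmd_ok K c) -->
   tinv 2 K w0 cs0 k s t1 --> (EX w'. wseq 2 K cs0 w0 w' & Macc (length w0) k w' t2))"
| "good (AI j l) t0 t1 t2 = (ALL w v p. rep K 2 w v --> j < K --> p <= length w --> t0 = itape j w p -->
   t1 = wtape w (Suc p) --> letter_at x (v j) = l)"
| "good (S1 j b) t0 t1 t2 = (ALL w v. rep K 2 w v --> j < K --> t1 = wtape w 0 -->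
   below t2 (v j) b)"
| "good (S2 j b) t0 t1 t2 = (ALL w v. rep K 2 w v --> j < K --> t1 = wtape w 0 --> fst t2 (snd t2 + v j) div 2 = b)"
| "good (S3 j b) t0 t1 t2 = (ALL xs ys v n. rep K 2 (xs @ ys) v --> j < K --> (ALL y : set xs. y ! j = 1) -->
   t1 = wtape (xs @ ys) (Suc (length xs)) --> Suc (v j) = n + 2 ^ length xs --> fst t2 (snd t2 + n) div 2 = b)"
| "good (S4 j b) t0 t1 t2 = (ALL w v p. rep K 2 w v --> j < K --> p <= length w --> t1 = wtape w p -->
   fst t2 (Suc (snd t2) + v j) div 2 = b)"
| "good G0 t0 t1 t2 = (t0 = blank_tape --> t1 = wtape [] 0 --> t2 = blank_tape -->
   (EX L t z. macc E kd x L q0 (%_. 0) blank_tape t z))"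
| "good G1 t0 t1 t2 = (ALL l. t0 = blank_tape --> t1 = wtape (replicate l (replicate K 0)) (Suc l) --> t2 = blank_tape -->
   (EX L t z. macc E kd x L q0 (%_. 0) blank_tape t z))"
| "good OK t0 t1 t2 = True"

lemma good_S1: "good (S1 j b) t0 t1 t2 ==> rep K 2 w v ==> j < K ==> t1 = wtape w 0 ==> below t2 (v j) b" by simp

lemma good_S2: "good (S2 j b) t0 t1 t2 ==> rep K 2 w v ==> j < K ==> t1 = wtape w 0 ==> fst t2 (snd t2 + v j) div 2 = b"
 by simp

lemma good_AC_D:
 "good (AC s) blank_tape t1 t2 ==> vw K 2 w0 ==> ALL c : set cs0. cmd_ok K c ==>
   tinv 2 K w0 cs0 k s t1 ==> EX w'. wseq 2 K cs0 w0 w' & Macc (length w0) k w' t2" by simp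

lemma good_step:
 assumes "astp E kd K q0 s (scan t1) (scan t2) (addressed x t0) s' w0 w1 w2" "s : SS"
  "ALL q qs. kd q = KU qs --> s ~= AC (Run [] q)"
  "good s' (awm w0 t0) (awm w1 t1) (awm w2 t2)"
 shows "good s t0 t1 t2" using assms(1)
proof cases
 case g0
 show ?thesis unfolding g0 good.simps
 proof (intro impI)
  assume *: "t0 = blank_tape" "t1 = wtape [] 0" "t2 = blank_tape"
  have "awm w1 t1 = wtape (replicate 0 (replicate K 0)) (Suc 0)" "awm w0 t0 = blank_tape" "awm w2 t2 = blank_tape"
   using g0 * by (auto simp: awm_wtape awm_stay)
  moreover have "good G1 (awm w0 t0) (awm w1 t1) (awm w2 t2)" using assms(4) g0 by simp
  ultimately show "EX L t z. macc E kd x L q0 (%_. 0) blank_tape t z" unfolding good.simps by blast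
 qed
next
 case g1
 show ?thesis unfolding g1 good.simps
 proof (intro allI impI, goal_cases)
  case *: (1 l)
  have "awm w1 t1 = wtape (replicate (Suc l) (replicate K 0)) (Suc (Suc l))"
   using g1 * by (simp add: awm_def wtape_extend replicate_append_same)
  thus ?case using assms(4) g1 * by (simp add: awm_stay del: replicate_Suc) blast
 qed
next
 case g2
 show ?thesis unfolding g2 good.simps
 proof (intro allI impI, goal_cases)
  case *: (1 l)
  let ?w = "replicate l (replicate K 0)"
  have "awm w1 t1 = wtape ?w l" using g2 * by (simp add: awm_def wtape_move)
  hence ti: "tinv 2 K ?w [] q0 (Bwd [] q0) (awm w1 t1)" by auto
  have vw: "vw K 2 ?w" using rep_zeros[of l] by (simp add: rep_def)
  have gd: "good (AC (Bwd [] q0)) blank_tape (awm w1 t1) blank_tape"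
   using assms(4) g2 * by (simp add: awm_stay del: good.simps)
  obtain w' where "wseq 2 K [] ?w w'" "Macc (length ?w) q0 w' blank_tape" using good_AC_D[OF gd vw _ ti] by auto
  thus ?case using rep_zeros[of l] unfolding Macc_def wseq.simps by blast
 qed
next
 case (ctl u u' b d)
 show ?thesis unfolding ctl good.simps
 proof (intro allI impI, goal_cases)
  case *: (1 v0 cs0 k)
  have "tinv 2 K v0 cs0 k u' (awm w1 t1)" using tinv_step[OF ctl(6) *(4,2) K] ctl by (simp add: awm_def)
  thus ?case using assms(4) ctl * by (auto simp: awm_stay)
 qed
next
 case (edge q q' cs e' d)
 show ?thesis unfolding edge good.simps
 proof (intro allI impI, goal_cases)
  case *: (1 v0 cs0 k)
  then obtain w where w: "wseq 2 K cs0 v0 w" "t1 = wtape w 0" "k = q" by auto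
  have ed: "((q, scan t2), (q', cs, e', d)) : E" using edge by simp
  have vw: "vw K 2 w" using wseq_vw[OF w(1) *(2)] .
  have "tinv 2 K w cs q' (Run cs q') t1" using w by auto
  moreover have "good (AC (Run cs q')) blank_tape t1 (awm w2 t2)"
   using assms(4) edge * by (simp add: awm_stay del: good.simps)
  ultimately obtain w' where w': "wseq 2 K cs w w'" "Macc (length w) q' w' (awm w2 t2)"
   using good_AC_D[OF _ vw, of _ _ _ cs q'] cmds[OF ed] by blast
  have "Macc (length v0) q w t2" unfolding Macc_def
  proof (intro allI impI, goal_cases)
   case v: (1 v)
   obtain v' where v': "rseq (2 ^ length w) cs v v'" "rep K 2 w' v'" using wseq_rseq[OF w'(1) v] cmds[OF ed] by blast
   obtain t z where "macc E kd x (length w) q' v' (write_move e' d t2) t z"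
    using w'(2) v'(2) edge by (auto simp: Macc_def awm_def)
   hence "macc E kd x (length w) q v t2 (Suc (length cs * (2 * length w + 3)) + t) (Suc (length cs * (2 * length w + 3)) + z)"
    using macc.edge[OF _ ed v'(1)] edge by blast
   thus ?case using wseq_length[OF w(1)] by auto
  qed
  thus ?case using w by blast
 qed
next
 case (univ q qs q')
 thus ?thesis using assms(3) by blast
next
 case (inp q j l)
 show ?thesis unfolding inp good.simps
 proof (intro allI impI, goal_cases)
  case *: (1 v0 cs0 k)
  then obtain w where w: "wseq 2 K cs0 v0 w" "t1 = wtape w 0" "k = q" by auto
  have "q : Q" using inp assms(2) ctrls_Q by (simp add: SS_KS)
  hence j: "j < K" using KI inp by blast
  have "awm w1 t1 = wtape w (Suc 0)" using inp w by (simp add: awm_def wtape_move)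
  moreover have "awm w0 t0 = itape j w 0" using inp * itape_0 by (simp add: awm_stay)
  moreover have "good (AI j l) (awm w0 t0) (awm w1 t1) (awm w2 t2)" using assms(4) inp by simp
  ultimately have "letter_at x (v j) = l" if "rep K 2 w v" for v using that j unfolding good.simps by blast
  hence "Macc (length v0) q w t2" unfolding Macc_def using macc.inp[of kd q j l x] inp by blast
  thus ?case using w by blast
 qed
next
 case (ai1 y j l)
 show ?thesis unfolding ai1 good.simps
 proof (intro allI impI, goal_cases)
  case *: (1 w v p)
  have "y ~= []" using ai1 vs_nonempty K by blast
  hence p: "p < length w" "y = w ! p" using ai1 * by (auto split: if_splits)
  have "awm w1 t1 = wtape w (Suc (Suc p))" using ai1 * p by (simp add: awm_def wtape_move)
  moreover have "awm w0 t0 = itape j w (Suc p)" using ai1 * p itape_write[of w p j] by simp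
  moreover have "good (AI j l) (awm w0 t0) (awm w1 t1) (awm w2 t2)" using assms(4) ai1 by simp
  moreover have "Suc p <= length w" using p by simp
  ultimately show ?case using * unfolding good.simps by blast
 qed
next
 case (ai2 j)
 show ?thesis unfolding ai2 good.simps
 proof (intro allI impI, goal_cases)
  case *: (1 w v p)
  have "p = length w"
  proof (rule ccontr)
   assume "p ~= length w"
   hence "p < length w" using * by simp
   hence "vs K 2 (w ! p)" using * by (simp add: rep_def)
   thus False using ai2 * `p < length w` vs_nonempty[OF _ K] by auto
  qed
  thus ?case using addressed_itape * by simp
 qed
next
 case (ks q j b)
 show ?thesis unfolding ks good.simps
 proof (intro allI impI, goal_cases)
  case *: (1 v0 cs0 k)
  then obtain w where w: "wseq 2 K cs0 v0 w" "t1 = wtape w 0" "k = q" by auto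
  have "q : Q" using ks assms(2) ctrls_Q by (simp add: SS_KS)
  hence j: "j < K" using KS ks by blast
  have g: "good (S1 j b) (awm w0 t0) t1 t2" using assms(4) ks by (simp add: awm_stay)
  have "EX t z. macc E kd x (length w) q v t2 t z" if "rep K 2 w v" for v
  proof -
   obtain p0 where "p0 <= snd t2" "fst t2 p0 = 0" "ALL i. p0 < i --> i <= snd t2 --> fst t2 i ~= 0"
    "fst t2 (p0 + 1 + v j) div 2 = b" using good_S1[OF g `rep K 2 w v` j w(2)] unfolding below_def by blast
   from macc.stk[where kd = kd and q = q and j = j and v = v, OF _ this] show ?thesis using ks by blast
  qed
  hence "Macc (length v0) q w t2" unfolding Macc_def using wseq_length[OF w(1)] by auto
  thus ?case using w by blast
 qed
next
 case (s1a j b)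
 show ?thesis unfolding s1a good.simps
 proof (intro allI impI, goal_cases)
  case *: (1 w v)
  have "good (S1 j b) (awm w0 t0) t1 (fst t2, snd t2 - 1)" using assms(4) s1a by (simp add: awm_stay awm_Lft del: good.simps)
  from good_S1[OF this *] show ?case by (rule below_Lft[rotated]) (use s1a in simp)
 qed
next
 case (s1b j b)
 show ?thesis unfolding s1b good.simps
 proof (intro allI impI, goal_cases)
  case *: (1 w v)
  have "good (S2 j b) (awm w0 t0) t1 (fst t2, Suc (snd t2))" using assms(4) s1b by (simp add: awm_stay awm_Rgt del: good.simps)
  from good_S2[OF this *] show ?case using s1b by (intro below_0) auto
 qed
next
 case (s2 j b)
 show ?thesis unfolding s2 good.simps
 proof (intro allI impI, goal_cases)
  case *: (1 w v)
  have "awm w1 t1 = wtape ([] @ w) (Suc (length ([] :: nat list list)))" using s2 * by (simp add: awm_def wtape_move)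
  moreover have "rep K 2 ([] @ w) v" using * by simp
  moreover have "good (S3 j b) (awm w0 t0) (awm w1 t1) t2" using assms(4) s2 by (simp add: awm_stay)
  ultimately show ?case using *(2) unfolding good.simps by fastforce
 qed
next
 case (s3a y j b)
 show ?thesis unfolding s3a good.simps
 proof (intro allI impI, goal_cases)
  case *: (1 xs ys v n)
  have "y ~= []" using s3a vs_nonempty K by blast
  then obtain ys' where ys: "ys = y # ys'" using s3a * by (cases ys) (auto split: if_splits)
  let ?y = "y[j := 1]"
  have jl: "j < length y" using s3a * by (simp add: vs_def)
  have "awm w1 t1 = wtape ((xs @ [?y]) @ ys') (Suc (length (xs @ [?y])))"
   using s3a *(4) ys by (simp add: awm_def wtape_write)
  moreover have "rep K 2 ((xs @ [?y]) @ ys') (v(j := v j + 2 ^ length xs))"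
   using *(1,2) s3a ys jl vs_update[of y 1 j] by (auto simp: rep_def val_append nth_list_update)
  moreover have "ALL y : set (xs @ [?y]). y ! j = 1" using *(3) jl by simp
  moreover have "good (S3 j b) (awm w0 t0) (awm w1 t1) t2" using assms(4) s3a by (simp add: awm_stay)
  moreover have "Suc ((v(j := v j + 2 ^ length xs)) j) = n + 2 ^ length (xs @ [?y])" using *(5) by simp
  ultimately show ?case using *(2) unfolding good.simps by blast
 qed
next
 case (s3b y j b)
 show ?thesis unfolding s3b good.simps
 proof (intro allI impI, goal_cases)
  case *: (1 xs ys v n)
  have "y ~= []" using s3b vs_nonempty K by blast
  then obtain ys' where ys: "ys = y # ys'" using s3b * by (cases ys) (auto split: if_splits)
  let ?y = "y[j := 0]"
  have jl: "j < length y" using s3b * by (simp add: vs_def)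
  have "awm w1 t1 = wtape (xs @ ?y # ys') (length xs)" using s3b *(4) ys by (simp add: awm_def wtape_write)
  moreover have "rep K 2 (xs @ ?y # ys') (v(j := v j - 2 ^ length xs))"
   using *(1,2) s3b ys jl vs_update[of y 0 j] by (auto simp: rep_def val_append nth_list_update)
  moreover have "good (S4 j b) (awm w0 t0) (awm w1 t1) t2" using assms(4) s3b by (simp add: awm_stay)
  moreover have "length xs <= length (xs @ ?y # ys')" by simp
  ultimately have "fst t2 (Suc (snd t2) + (v(j := v j - 2 ^ length xs)) j) div 2 = b"
   using *(2) unfolding good.simps by blast
  hence "fst t2 (Suc (snd t2) + (v j - 2 ^ length xs)) div 2 = b" by simp
  moreover have "v j = val 2 (xs @ ys) j" using *(1,2) by (simp add: rep_def)
  hence "2 ^ length xs <= v j" using s3b ys by (simp add: val_append)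
  hence "n = Suc (v j - 2 ^ length xs)" using *(5) by simp
  ultimately show ?case by simp
 qed
next
 case (s3c b j)
 show ?thesis unfolding s3c good.simps
 proof (intro allI impI, goal_cases)
  case *: (1 xs ys v n)
  have "ys = []"
  proof (cases ys)
   case (Cons y ys')
   hence "vs K 2 y" using *(1) by (simp add: rep_def)
   thus ?thesis using s3c * Cons vs_nonempty[OF _ K] by auto
  qed simp
  hence "v j = val 2 xs j" using * by (simp add: rep_def)
  moreover have "Suc (val 2 xs j) = 2 ^ length xs" using *(3) by (induction xs) auto
  ultimately have "n = 0" using *(5) by simp
  thus ?case using s3c by (simp add: scan_def)
 qed
next
 case (s4a y j b)
 show ?thesis unfolding s4a good.simps
 proof (intro allI impI, goal_cases)
  case *: (1 w v p)
  have "awm w1 t1 = wtape w (p - 1)" using s4a * by (simp add: awm_def wtape_move)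
  moreover have "good (S4 j b) (awm w0 t0) (awm w1 t1) t2" using assms(4) s4a by (simp add: awm_stay)
  moreover have "p - 1 <= length w" using *(3) by simp
  ultimately show ?case using * unfolding good.simps by blast
 qed
next
 case (s4b j b)
 show ?thesis unfolding s4b good.simps
 proof (intro allI impI, goal_cases)
  case *: (1 w v p)
  have "p = 0"
  proof (cases p)
   case (Suc p')
   hence "vs K 2 (w ! p')" using * by (simp add: rep_def)
   thus ?thesis using s4b * Suc vs_nonempty[OF _ K] by auto
  qed
  have "good (S2 j b) (awm w0 t0) (wtape w 0) (fst t2, Suc (snd t2))" using assms(4) s4b * `p = 0`
   by (simp add: awm_stay awm_Rgt del: good.simps)
  from good_S2[OF this *(1,2) HOL.refl] show ?case by simp
 qed
qed

lemma mach_sound: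
 assumes "accepting_from mach x u" "label u = ac s t0 t1 t2"
 shows "good s t0 t1 t2" using assms
proof (induction arbitrary: s t0 t1 t2 rule: accepting_from.induct)
 case (leaf c)
 then consider "s = OK" | q where "s = AC (Run [] q)" "kd q = KA" by (auto simp: mach_def)
 thus ?case
 proof cases
  case (2 q)
  show ?thesis unfolding 2 good.simps
  proof (intro allI impI, goal_cases)
   case (1 w0 cs0 k)
   then obtain w where "wseq 2 K cs0 w0 w" "k = q" by auto
   moreover have "Macc (length w0) q w t2" unfolding Macc_def using macc.acc[of kd q] 2 by blast
   ultimately show ?case by blast
  qed
 qed simp
next
 case (exist c u)
 have c: "c = ac s t0 t1 t2" using exist by simp
 obtain s' w0 w1 w2 where s: "s : SS" "astp E kd K q0 s (scan t1) (scan t2) (addressed x t0) s' w0 w1 w2"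
  "label u = ac s' (awm w0 t0) (awm w1 t1) (awm w2 t2)" using exist(2) unfolding c mach_step by blast
 have "to_nat s ~: a_univ mach" using exist(1) c by simp
 thus ?case using good_step[OF s(2,1)] exist(4)[OF s(3)] unfolding not_univ by blast
next
 case (univ c us)
 have c: "c = ac s t0 t1 t2" using univ by simp
 obtain q qs where q: "s = AC (Run [] q)" "kd q = KU qs" using univ(1) c by (auto simp: mach_def)
 show ?case unfolding q good.simps
 proof (intro allI impI, goal_cases)
  case *: (1 v0 cs0 k)
  then obtain w where w: "wseq 2 K cs0 v0 w" "t1 = wtape w 0" "k = q" by auto
  have vw: "vw K 2 w" using wseq_vw[OF w(1) *(2)] .
  \<comment> \<open>One child exists, and the side conditions that its step reveals about the
    present configuration hold for all branches. Hence all expected successors are children.\<close>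
  obtain u1 where "u1 : set us" using univ(2) by (cases us) auto
  hence "atm_step mach x c (label u1)" using univ(4) by blast
  hence st: "s : SS" "scan t2 : ES" "scan t0 = 0" unfolding c mach_step by auto
  have M: "ALL v. rep K 2 w v --> (EX t z. macc E kd x (length w) q' v t2 t z)" if "q' : set qs" for q'
  proof -
   have "astp E kd K q0 (AC (Run [] q)) 0 (scan t2) (addressed x t0) (AC (Run [] q')) (0, Stay) (0, Stay) (scan t2, Stay)"
    using q(2) that by (rule astp.univ)
   hence "astp E kd K q0 s (scan t1) (scan t2) (addressed x t0) (AC (Run [] q')) (0, Stay) (0, Stay) (scan t2, Stay)"
    using q w by simp
   hence "atm_step mach x c (ac (AC (Run [] q')) (awm (0, Stay) t0) (awm (0, Stay) t1) (awm (scan t2, Stay) t2))"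
    unfolding c mach_step using st by blast
   hence "atm_step mach x c (ac (AC (Run [] q')) t0 t1 t2)" using st w by (simp add: awm_stay)
   then obtain u' where u': "u' : set us" "label u' = ac (AC (Run [] q')) t0 t1 t2"
    using univ(4) by (metis (mono_tags, lifting) imageE mem_Collect_eq)
   hence "good (AC (Run [] q')) t0 t1 t2" using univ(5) by blast
   moreover have "tinv 2 K w [] q' (Run [] q') t1" using w by simp
   ultimately obtain w' where "wseq 2 K [] w w'" "Macc (length w) q' w' t2"
    using good_AC_D[OF _ vw, of "Run [] q'" t1 t2 "[]" q'] *(1) unfolding list.set by blast
   thus ?thesis by (auto simp: Macc_def)
  qed
  have "Macc (length w) q w t2" unfolding Macc_def
  proof (intro allI impI, goal_cases)
   case v: (1 v)
   have "ALL i. EX t z. i < length qs --> macc E kd x (length w) (qs ! i) v t2 t z" using M v nth_mem by meson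
   then obtain tt zz where tz: "!!i. i < length qs ==> macc E kd x (length w) (qs ! i) v t2 (tt i) (zz i)" by metis
   \<comment> \<open>A common depth bound for all branches; the sum serves in place of the
     maximum.\<close>
   define t where "t = (\<Sum>i < length qs. tt i)"
   have "macc E kd x (length w) (qs ! i) v t2 t (map zz [0..<length qs] ! i)" if "i < length qs" for i
    using tz[OF that]
   proof (rule macc.weaken)
    show "tt i <= t" unfolding t_def using that by (intro member_le_sum) auto
   qed (use that in simp)
   hence "macc E kd x (length w) q v t2 (Suc t) (Suc (sum_list (map zz [0..<length qs])))"
    using q(2) by (intro macc.univ) auto
   thus ?case by blast
  qed
  thus ?case using w wseq_length[OF w(1)] by auto
 qed
qed

end

text \<open>Soundness is demanded for every \<open>L\<close> because the compiled machine guesses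
  the length of the register word; completeness only concerns one suitable guess. The term
  \<open>2 * L n + 3\<close> pays for writing the zero word and returning.\<close>

theorem program_in_ATiSz:
 assumes sound: "!!x L t z. macc E kd x L q0 (%_. 0) blank_tape t z ==> x : A"
  and complete: "!!x. x : A ==> macc E kd x (L (length x)) q0 (%_. 0) blank_tape (T (length x)) (Z (length x))"
  and T: "(%n. real (2 * L n + 3 + T n)) : O(t)" and Z: "(%n. real (2 * L n + 3 + Z n)) : O(z)"
 shows "A : ATiSz t z"
proof -
 have sound': "x : A" if "accepting_tree mach x u" for x u
 proof -
  have "good x G0 blank_tape (wtape [] 0) blank_tape"
   using mach_sound[of x u] that mach_init unfolding accepting_tree_def by metis
  thus ?thesis using sound by auto
 qed
 have complete': "EX u. accepting_tree mach x u & treedepth u <= 2 * L (length x) + 3 + T (length x) &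
   treesize u <= 2 * L (length x) + 3 + Z (length x)" if "x : A" for x
  using mach_complete[OF complete[OF that]] unfolding aacc_def accepting_tree_def by blast
 have "A = {x. EX u. accepting_tree mach x u}" using sound' complete' by blast
 thus ?thesis unfolding ATiSz_def mem_Collect_eq
  by (rule_tac exI[of _ mach], rule_tac exI[of _ "%n. 2 * L n + 3 + T n"], rule_tac exI[of _ "%n. 2 * L n + 3 + Z n"])
   (use wf_mach T Z complete' in blast)
qed

end

section \<open>Balanced decompositions of runs\<close>

text \<open>`seg R st p q n`: a run of `n` steps from `p` to `q` that starts and ends with the stack `st`
 and keeps it as a prefix. `ctx R st w p q p' q' n`: a pair of runs of total length `n`, one from
 `p` to `p'` building up `w` on top of `st` and one from `q'` to `q` removing it.\<close>

inductive seg :: "('s * nat list => 's * nat list => bool) => nat list => 's => 's => nat => bool" for R where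
 nil: "seg R st p p 0"
| keep: "R (p, st) (r, st) ==> seg R st r q n ==> seg R st p q (Suc n)"
| exc: "R (p, st) (p', st @ [a]) ==> seg R (st @ [a]) p' q' m ==> R (q', st @ [a]) (r, st) ==>
  seg R st r q n ==> seg R st p q (m + n + 2)"

inductive ctx :: "('s * nat list => 's * nat list => bool) => nat list => nat list =>
  's => 's => 's => 's => nat => bool" for R where
 nil: "ctx R st [] p q p q 0"
| cons: "seg R st p r n1 ==> R (r, st) (p1, st @ [a]) ==> R (q1, st @ [a]) (r', st) ==> seg R st r' q n2 ==>
  ctx R (st @ [a]) w p1 q1 p' q' n ==> ctx R st (a # w) p q p' q' (n1 + n2 + 2 + n)"

text \<open>Derivations of segments and contexts; the last two arguments bound the depth and the size.\<close>

inductive Dseg :: "('s * nat list => 's * nat list => bool) => nat => ('s => bool) => (nat => bool) =>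
  nat list => 's => 's => nat => nat => bool"
 and Dctx :: "('s * nat list => 's * nat list => bool) => nat => ('s => bool) => (nat => bool) =>
  nat list => nat list => 's => 's => 's => 's => nat => nat => bool"
 for R kk bd sy where
 refl: "Dseg R kk bd sy st p p 1 1"
| step: "R (p, st) (q, st) ==> Dseg R kk bd sy st p q 1 1"
| split: "Dseg R kk bd sy st p r t z ==> Dseg R kk bd sy st r q t z' ==> bd r ==>
  Dseg R kk bd sy st p q (Suc t) (Suc (z + z'))"
| opn: "Dctx R kk bd sy st w p q p' q' t z ==> Dseg R kk bd sy (st @ w) p' q' t z' ==>
  w ~= [] ==> length w <= kk ==> ALL a : set w. sy a ==> bd p' ==> bd q' ==>
  Dseg R kk bd sy st p q (Suc t) (Suc (z + z'))"
| one: "Dseg R kk bd sy st p r t z ==> R (r, st) (p', st @ [a]) ==> R (q', st @ [a]) (r', st) ==>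
  Dseg R kk bd sy st r' q t z' ==> bd r ==> bd r' ==> 1 <= t ==>
  Dctx R kk bd sy st [a] p q p' q' (Suc t) (z + z' + 3)"
| cut: "Dctx R kk bd sy st w1 p q e f t z ==> Dctx R kk bd sy (st @ w1) w2 e f p' q' t z' ==>
  w1 ~= [] ==> w2 ~= [] ==> bd e ==> bd f ==> length (w1 @ w2) <= kk ==>
  Dctx R kk bd sy st (w1 @ w2) p q p' q' (Suc t) (Suc (z + z'))"
| wseg: "Dseg R kk bd sy st p q t z ==> t <= t' ==> Dseg R kk bd sy st p q t' z"
| wctx: "Dctx R kk bd sy st w p q p' q' t z ==> t <= t' ==> Dctx R kk bd sy st w p q p' q' t' z"

text \<open>\<open>kk\<close> limits the number of stack letters written by a single level.
  \<open>bd\<close> and \<open>sy\<close> single out the configurations and letters that may be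
  guessed; they will be those that fit into the registers.\<close>

locale stack_runs =
 fixes R :: "'s * nat list => 's * nat list => bool" and kk Hm :: nat and bd :: "'s => bool" and sy :: "nat => bool"
 assumes R_stack: "R (p, st) (q, st') ==> st' = st \<or> (EX a. st' = st @ [a]) \<or> (EX a. st = st' @ [a])"
  and R_height: "R (p, st) (q, st') ==> length st <= Hm"
  and R_bd: "R (p, st) (q, st') ==> bd p & bd q"
  and R_sy: "R (p, st) (q, st @ [a]) ==> sy a"
  and kk: "0 < kk"
begin

abbreviation "sg \<equiv> seg R"
abbreviation "cx \<equiv> ctx R"
abbreviation "DS \<equiv> Dseg R kk bd sy"
abbreviation "DC \<equiv> Dctx R kk bd sy"

text \<open>The claim for nonempty \<open>w\<close> cuts the run where the last letter of
  \<open>w\<close> is removed for the first time. It is what the induction needs after a push: the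
  part up to that removal is the inner segment of an excursion.\<close>

lemma run_seg_aux:
 assumes "(R ^^ n) (p, w) (q, [])"
 shows "(w = [] --> sg [] p q n) & (ALL w' a. w = w' @ [a] -->
  (EX q' r n1 n2. sg w p q' n1 & R (q', w) (r, w') & (R ^^ n2) (r, w') (q, []) & n = n1 + n2 + 1))" using assms
proof (induction n arbitrary: p w rule: less_induct)
 case (less n)
 show ?case
 proof (cases n)
  case 0
  thus ?thesis using less(2) by (auto intro: seg.nil)
 next
  case (Suc m)
  then obtain p1 w1 where 1: "R (p, w) (p1, w1)" "(R ^^ m) (p1, w1) (q, [])"
   using relpowp_Suc_D2[of m R] less(2) by (metis surj_pair)
  have IH1: "(w1 = [] --> sg [] p1 q m) & (ALL w' a. w1 = w' @ [a] -->
   (EX q' r n1 n2. sg w1 p1 q' n1 & R (q', w1) (r, w') & (R ^^ n2) (r, w') (q, []) & m = n1 + n2 + 1))"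
   by (rule less.IH[OF _ 1(2)]) (simp add: Suc)
  consider "w1 = w" | a where "w1 = w @ [a]" | a where "w = w1 @ [a]" using R_stack[OF 1(1)] by blast
  thus ?thesis
  proof cases
   case 1
   show ?thesis
   proof (intro conjI impI allI)
    assume "w = []"
    thus "sg [] p q n" using IH1 1 `R (p, w) (p1, w1)` seg.keep[of R p "[]" p1 q m] Suc by simp
   next
    fix w' a assume w: "w = w' @ [a]"
    then obtain q' r n1 n2 where *: "sg w p1 q' n1" "R (q', w) (r, w')" "(R ^^ n2) (r, w') (q, [])" "m = n1 + n2 + 1"
     using IH1 1 by blast
    have "sg w p q' (Suc n1)" using *(1) 1 `R (p, w) (p1, w1)` seg.keep[of R p w] by simp
    thus "EX q' r n1 n2. sg w p q' n1 & R (q', w) (r, w') & (R ^^ n2) (r, w') (q, []) & n = n1 + n2 + 1"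
     using * Suc by (rule_tac exI[of _ q'], rule_tac exI[of _ r], rule_tac exI[of _ "Suc n1"], rule_tac exI[of _ n2]) simp
   qed
  next
   case (2 a)
   then obtain q' r n1 n2 where *: "sg w1 p1 q' n1" "R (q', w1) (r, w)" "(R ^^ n2) (r, w) (q, [])" "m = n1 + n2 + 1"
    using IH1 by blast
   have IH2: "(w = [] --> sg [] r q n2) & (ALL w' a. w = w' @ [a] -->
    (EX q' r' n1 n2'. sg w r q' n1 & R (q', w) (r', w') & (R ^^ n2') (r', w') (q, []) & n2 = n1 + n2' + 1))"
    by (rule less.IH[OF _ *(3)]) (use * Suc in simp)
   have ex: "sg w p y (n1 + k + 2)" if "sg w r y k" for y k
    using seg.exc[of R p w p1 a q' n1 r y k] 1(1) * 2 that by simp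
   show ?thesis
   proof (intro conjI impI allI)
    assume "w = []"
    thus "sg [] p q n" using IH2 ex[of q n2] * Suc by (simp add: ac_simps)
   next
    fix w' a' assume w: "w = w' @ [a']"
    then obtain q2 r2 m1 m2 where **: "sg w r q2 m1" "R (q2, w) (r2, w')" "(R ^^ m2) (r2, w') (q, [])" "n2 = m1 + m2 + 1"
     using IH2 by blast
    show "EX q' r n1 n2. sg w p q' n1 & R (q', w) (r, w') & (R ^^ n2) (r, w') (q, []) & n = n1 + n2 + 1"
     using ** ex[OF **(1)] * Suc by (rule_tac exI[of _ q2], rule_tac exI[of _ r2], rule_tac exI[of _ "n1 + m1 + 2"], rule_tac exI[of _ m2]) simp
   qed
  next
   case (3 a)
   thus ?thesis using 1 seg.nil[of R w p] Suc by fastforce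
  qed
 qed
qed

lemma run_seg: "(R ^^ n) (p, []) (q, []) ==> sg [] p q n" using run_seg_aux by blast

text \<open>A segment is a sequence of items, single steps or excursions. It is cut around the item
  that contains step number \<open>k\<close>, so at most \<open>k\<close> steps precede this item
  and at most \<open>n - 1 - k\<close> follow it.\<close>

lemma seg_split:
 assumes "sg st p q n" "k < n"
 shows "EX r r' n1 n2. sg st p r n1 & sg st r' q n2 & n1 <= k & n2 <= n - 1 - k &
  ((R (r, st) (r', st) & n = n1 + 1 + n2) \<or>
   (EX a p' q' m. R (r, st) (p', st @ [a]) & sg (st @ [a]) p' q' m & R (q', st @ [a]) (r', st) & n = n1 + m + 2 + n2))"
 using assms
proof (induction arbitrary: k rule: seg.induct)
 case (keep p st r q n)
 show ?case
 proof (cases k)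
  case 0
  thus ?thesis using keep seg.nil[of R st p] by (intro exI[of _ p] exI[of _ r] exI[of _ 0] exI[of _ n]) auto
 next
  case (Suc k')
  hence "k' < n" using keep(4) by simp
  from keep(3)[OF this] obtain r1 r2 n1 n2 where *: "sg st r r1 n1" "sg st r2 q n2" "n1 <= k'" "n2 <= n - 1 - k'"
   "(R (r1, st) (r2, st) & n = n1 + 1 + n2) \<or>
    (EX a p' q' m. R (r1, st) (p', st @ [a]) & sg (st @ [a]) p' q' m & R (q', st @ [a]) (r2, st) & n = n1 + m + 2 + n2)"
   by blast
  have "sg st p r1 (Suc n1)" using keep(1) *(1) by (rule seg.keep)
  thus ?thesis using * Suc by (intro exI[of _ r1] exI[of _ r2] exI[of _ "Suc n1"] exI[of _ n2]) auto
 qed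
next
 case (exc p st p' a q' m r q n)
 show ?case
 proof (cases "k < m + 2")
  case True
  thus ?thesis using exc seg.nil[of R st p] by (intro exI[of _ p] exI[of _ r] exI[of _ 0] exI[of _ n]) auto
 next
  case False
  hence "k - (m + 2) < n" using exc(7) by simp
  from exc(6)[OF this] obtain r1 r2 n1 n2 where *: "sg st r r1 n1" "sg st r2 q n2" "n1 <= k - (m + 2)" "n2 <= n - 1 - (k - (m + 2))"
   "(R (r1, st) (r2, st) & n = n1 + 1 + n2) \<or>
    (EX a p' q' m. R (r1, st) (p', st @ [a]) & sg (st @ [a]) p' q' m & R (q', st @ [a]) (r2, st) & n = n1 + m + 2 + n2)"
   by blast
  have "sg st p r1 (m + n1 + 2)" using exc(1-3) *(1) by (rule seg.exc)
  thus ?thesis using * False by (intro exI[of _ r1] exI[of _ r2] exI[of _ "m + n1 + 2"] exI[of _ n2]) auto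
 qed
qed simp

text \<open>The analogue for contexts. A level is a letter together with its push, its pop and the
  two segments on the stack below it; here the level containing step number \<open>k\<close> is
  isolated, with levels counted from the bottom.\<close>

lemma ctx_split:
 assumes "cx st w p q p' q' n" "k < n"
 shows "EX u a v e f r r' p1 q1 n1 m1 m2 n2. w = u @ a # v & cx st u p q e f n1 &
  sg (st @ u) e r m1 & R (r, st @ u) (p1, st @ u @ [a]) & R (q1, st @ u @ [a]) (r', st @ u) & sg (st @ u) r' f m2 &
  cx (st @ u @ [a]) v p1 q1 p' q' n2 & n = n1 + (m1 + m2 + 2) + n2 & n1 <= k & n2 <= n - 1 - k" using assms
proof (induction arbitrary: k rule: ctx.induct)
 case (cons st p r n1 p1 a q1 r' q n2 w p' q' n)
 show ?case
 proof (cases "k < n1 + n2 + 2")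
  case True
  have "a # w = [] @ a # w" "cx st [] p q p q 0" by (auto intro: ctx.nil)
  thus ?thesis using cons True
   by (rule_tac exI[of _ "[]"], rule_tac exI[of _ a], rule_tac exI[of _ w], rule_tac exI[of _ p], rule_tac exI[of _ q],
    rule_tac exI[of _ r], rule_tac exI[of _ r'], rule_tac exI[of _ p1], rule_tac exI[of _ q1],
    rule_tac exI[of _ 0], rule_tac exI[of _ n1], rule_tac exI[of _ n2], rule_tac exI[of _ n]) simp
 next
  case False
  hence "k - (n1 + n2 + 2) < n" using cons(7) by simp
  from cons(6)[OF this] obtain u b v e f s s' p2 q2 k1 m1 m2 k2 where *: "w = u @ b # v" "cx (st @ [a]) u p1 q1 e f k1"
   "sg ((st @ [a]) @ u) e s m1" "R (s, (st @ [a]) @ u) (p2, (st @ [a]) @ u @ [b])"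
   "R (q2, (st @ [a]) @ u @ [b]) (s', (st @ [a]) @ u)" "sg ((st @ [a]) @ u) s' f m2"
   "cx ((st @ [a]) @ u @ [b]) v p2 q2 p' q' k2" "n = k1 + (m1 + m2 + 2) + k2" "k1 <= k - (n1 + n2 + 2)"
   "k2 <= n - 1 - (k - (n1 + n2 + 2))" by blast
  have "cx st (a # u) p q e f (n1 + n2 + 2 + k1)" using cons(1-4) *(2) by (rule ctx.cons)
  thus ?thesis using * False
   by (rule_tac exI[of _ "a # u"], rule_tac exI[of _ b], rule_tac exI[of _ v], rule_tac exI[of _ e], rule_tac exI[of _ f],
    rule_tac exI[of _ s], rule_tac exI[of _ s'], rule_tac exI[of _ p2], rule_tac exI[of _ q2],
    rule_tac exI[of _ "n1 + n2 + 2 + k1"], rule_tac exI[of _ m1], rule_tac exI[of _ m2], rule_tac exI[of _ k2], simp, linarith)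
 qed
qed simp

lemma ctx_bd: "cx st w p q p' q' n ==> w ~= [] ==> bd p' & bd q'"
proof (induction rule: ctx.induct)
 case (cons st p r n1 p1 a q1 r' q n2 w p' q' n)
 show ?case
 proof (cases "w = []")
  case True
  hence "p' = p1 & q' = q1" using cons(5) by (auto elim: ctx.cases)
  thus ?thesis using R_bd cons(2,3) by blast
 qed (use cons in simp)
qed simp

lemma ctx_sy: "cx st w p q p' q' n ==> ALL a : set w. sy a" by (induction rule: ctx.induct) (auto dest: R_sy)

lemma ctx_pos: "cx st w p q p' q' n ==> w ~= [] ==> 2 <= n" by (erule ctx.cases) auto

text \<open>Such a segment can be cut around one item so that the part before it, the part after it
  and the interior of an excursion all have at most \<open>h\<close> steps. A constant number of
  levels then reduces it to segments of half the length.\<close>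

definition light :: "nat => nat list => 's => 's => nat => bool" where
 "light h st p q n = (EX r r' n1 n2. sg st p r n1 & sg st r' q n2 & n1 <= h & n2 <= h &
  ((R (r, st) (r', st) & n = n1 + 1 + n2) \<or>
   (EX a p' q' m. R (r, st) (p', st @ [a]) & sg (st @ [a]) p' q' m & R (q', st @ [a]) (r', st) &
    m <= h & n = n1 + m + 2 + n2)))"

text \<open>Descend into the excursion around the middle as long as it is longer than `h`, but at most `k`
 times.\<close>

lemma heavy:
 assumes "sg st p q n" "0 < n" "n <= 2 * h"
 shows "EX w p' q' n' nc. cx st w p q p' q' nc & sg (st @ w) p' q' n' & n = nc + n' & length w <= k &
  (w ~= [] --> h < n') & (length w = k \<or> light h (st @ w) p' q' n')" using assms
proof (induction k arbitrary: st p q n)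
 case 0
 thus ?case using ctx.nil[of R st p q] by (intro exI[of _ "[]"] exI[of _ p] exI[of _ q] exI[of _ n] exI[of _ 0]) auto
next
 case (Suc k)
 \<comment> \<open>A middle step: as \<open>n <= 2 * h\<close>, both \<open>c\<close> and
   \<open>n - 1 - c\<close> are at most \<open>h\<close>. So only the interior of an excursion can
   be longer than \<open>h\<close>.\<close>
 define c where "c = min h (n - 1)"
 have "c < n" using Suc(3) by (simp add: c_def)
 from seg_split[OF Suc(2) this] obtain r r' n1 n2 where *: "sg st p r n1" "sg st r' q n2" "n1 <= c" "n2 <= n - 1 - c"
  "(R (r, st) (r', st) & n = n1 + 1 + n2) \<or>
   (EX a p' q' m. R (r, st) (p', st @ [a]) & sg (st @ [a]) p' q' m & R (q', st @ [a]) (r', st) & n = n1 + m + 2 + n2)"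
  by blast
 have n12: "n1 <= h" "n2 <= h" using *(3,4) Suc(4) by (auto simp: c_def)
 show ?case
 proof (cases "light h st p q n")
  case True
  thus ?thesis using Suc(2) ctx.nil[of R st p q]
   by (intro exI[of _ "[]"] exI[of _ p] exI[of _ q] exI[of _ n] exI[of _ 0]) auto
 next
  case False
  hence "~ (R (r, st) (r', st) & n = n1 + 1 + n2)" using * n12 unfolding light_def by blast
  then obtain a p1 q1 m where m: "R (r, st) (p1, st @ [a])" "sg (st @ [a]) p1 q1 m" "R (q1, st @ [a]) (r', st)"
   "n = n1 + m + 2 + n2" using *(5) by blast
  have "light h st p q n" if "m <= h" unfolding light_def using *(1,2) n12 m that by blast
  hence "h < m" using False by fastforce
  hence "0 < m" "m <= 2 * h" using m(4) Suc(4) by auto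
  from Suc.IH[OF m(2) this] obtain w p' q' n' nc where w: "cx (st @ [a]) w p1 q1 p' q' nc" "sg ((st @ [a]) @ w) p' q' n'"
   "m = nc + n'" "length w <= k" "w ~= [] --> h < n'" "length w = k \<or> light h ((st @ [a]) @ w) p' q' n'" by blast
  have "h < n'"
  proof (cases "w = []")
   case True
   hence "nc = 0" using w(1) by (auto elim: ctx.cases)
   thus ?thesis using w(3) `h < m` by simp
  qed (use w in simp)
  moreover have "cx st (a # w) p q p' q' (n1 + n2 + 2 + nc)" using *(1) m(1,3) *(2) w(1) by (rule ctx.cons)
  ultimately show ?thesis using w m(4)
   by (intro exI[of _ "a # w"] exI[of _ p'] exI[of _ q'] exI[of _ n'] exI[of _ "n1 + n2 + 2 + nc"]) auto
 qed
qed

text \<open>Multiplied out, the depth is \<open>4 * j + 2\<close> plus the remaining height divided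
  by \<open>kk\<close>: four levels for each halving and one level for each full batch of
  \<open>kk\<close> letters. In the size, 10 per step leaves room for the nodes that combine
  parts.\<close>

definition Sbound :: "nat => bool" where
 "Sbound j = (ALL st p q n. sg st p q n --> n <= 2 ^ j -->
  (EX t z. DS st p q t z & 1 <= t & kk * t <= kk * (4 * j + 2) + (Hm - length st) & z <= 10 * n + 1))"

text \<open>The size is sharper than for segments: \<open>z + 1 <= 10 * n\<close> keeps a unit in
  reserve for the node by which a context is joined to something else.\<close>

definition Cbound :: "nat => bool" where
 "Cbound j = (ALL st w p q p' q' n. cx st w p q p' q' n --> w ~= [] --> length w <= kk --> n <= 2 ^ j -->
  (EX t z. DC st w p q p' q' t z & kk * t <= kk * (4 * j + 5) + (Hm - length st) & z + 1 <= 10 * n))"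

lemma le_max_mult: "(kk::nat) * t1 <= b ==> kk * t2 <= b ==> kk * max t1 t2 <= b" by (simp add: max_def)

lemma kap_le: "0 < c ==> kk <= kk * c + (d::nat)" by (cases c) auto

text \<open>The parts have depth \<open>4 * j + 2\<close>; one level opens the excursion and two
  splits put the three parts together, hence \<open>4 * j + 5\<close>.\<close>

lemma light_bound:
 assumes "Sbound j" "light (2 ^ j) st p q n"
 shows "EX t z. DS st p q t z & 1 <= t & kk * t <= kk * (4 * j + 5) + (Hm - length st) & z <= 10 * n + 1"
proof -
 let ?d = "Hm - length st"
 obtain r r' n1 n2 where *: "sg st p r n1" "sg st r' q n2" "n1 <= 2 ^ j" "n2 <= 2 ^ j"
  "(R (r, st) (r', st) & n = n1 + 1 + n2) \<or>
   (EX a p' q' m. R (r, st) (p', st @ [a]) & sg (st @ [a]) p' q' m & R (q', st @ [a]) (r', st) &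
    m <= 2 ^ j & n = n1 + m + 2 + n2)" using assms(2) unfolding light_def by blast
 obtain t1 z1 where 1: "DS st p r t1 z1" "kk * t1 <= kk * (4 * j + 2) + ?d" "z1 <= 10 * n1 + 1"
  using assms(1) *(1,3) unfolding Sbound_def by blast
 obtain t2 z2 where 2: "DS st r' q t2 z2" "kk * t2 <= kk * (4 * j + 2) + ?d" "z2 <= 10 * n2 + 1"
  using assms(1) *(2,4) unfolding Sbound_def by blast
 have "EX t3 z3 l. DS st r r' t3 z3 & bd r & bd r' & kk * t3 <= kk * (4 * j + 3) + ?d & z3 + 3 <= 10 * l & n = n1 + l + n2"
  using *(5)
 proof (elim disjE exE conjE)
  assume "R (r, st) (r', st)" "n = n1 + 1 + n2"
  thus ?thesis using Dseg_Dctx.step[of R r st r'] R_bd[of r st r' st]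
   by (rule_tac exI[of _ 1], rule_tac exI[of _ 1], rule_tac exI[of _ 1]) (auto intro!: kap_le)
 next
  fix a p' q' m
  assume a: "R (r, st) (p', st @ [a])" "sg (st @ [a]) p' q' m" "R (q', st @ [a]) (r', st)" "m <= 2 ^ j" "n = n1 + m + 2 + n2"
  obtain t4 z4 where 4: "DS (st @ [a]) p' q' t4 z4" "kk * t4 <= kk * (4 * j + 2) + (Hm - length (st @ [a]))" "z4 <= 10 * m + 1"
   using assms(1) a(2,4) unfolding Sbound_def by blast
  have bds: "bd r" "bd r'" "bd p'" "bd q'" using R_bd a(1,3) by blast+
  \<comment> \<open>The context of the single letter \<open>a\<close> around the excursion; both
    segments on the lower stack are empty.\<close>
  have "DC st [a] r r' p' q' (Suc 1) (1 + 1 + 3)"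
   by (rule Dseg_Dctx.one[OF Dseg_Dctx.refl a(1,3) Dseg_Dctx.refl bds(1,2)]) simp
  hence "DC st [a] r r' p' q' 2 5" by (simp add: numeral_2_eq_2)
  hence D1: "DC st [a] r r' p' q' (max 2 t4) 5" by (rule Dseg_Dctx.wctx) simp
  have D2: "DS (st @ [a]) p' q' (max 2 t4) z4" using 4(1) by (rule Dseg_Dctx.wseg) simp
  have D: "DS st r r' (Suc (max 2 t4)) (Suc (5 + z4))"
   by (rule Dseg_Dctx.opn[OF D1 D2]) (use bds R_sy[OF a(1)] kk in auto)
  have "kk * max 2 t4 <= kk * (4 * j + 2) + ?d" by (rule le_max_mult) (use 4(2) in "auto simp: add_mult_distrib2")
  hence "kk * Suc (max 2 t4) <= kk * (4 * j + 3) + ?d" by (simp add: add_mult_distrib2)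
  thus ?thesis using D bds 4(3) a(5)
   by (intro exI[of _ "Suc (max 2 t4)"] exI[of _ "Suc (5 + z4)"] exI[of _ "m + 2"]) auto
 qed
 then obtain t3 z3 l where 3: "DS st r r' t3 z3" "bd r" "bd r'" "kk * t3 <= kk * (4 * j + 3) + ?d" "z3 + 3 <= 10 * l"
  "n = n1 + l + n2" by blast
 define t where "t = max t1 (max t2 t3)"
 have t: "kk * t <= kk * (4 * j + 3) + ?d"
  unfolding t_def by (intro le_max_mult) (use 1(2) 2(2) 3(4) in "auto simp: add_mult_distrib2")
 have "DS st r r' t z3" "DS st r' q t z2" "DS st p r (Suc t) z1"
  using Dseg_Dctx.wseg[OF 3(1)] Dseg_Dctx.wseg[OF 2(1)] Dseg_Dctx.wseg[OF 1(1)] by (auto simp: t_def)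
 hence "DS st p q (Suc (Suc t)) (Suc (z1 + Suc (z3 + z2)))" using 3(2,3) by (meson Dseg_Dctx.split)
 moreover have "kk * Suc (Suc t) <= kk * (4 * j + 5) + ?d" using t by (simp add: add_mult_distrib2)
 ultimately show ?thesis using 1(3) 2(3) 3(5,6) by (intro exI[of _ "Suc (Suc t)"] exI[of _ "Suc (z1 + Suc (z3 + z2))"]) auto
qed

text \<open>The descent writes at most \<open>kk\<close> letters. If it ends in a light segment,
  that one is handled by the bounds for \<open>j\<close>. Otherwise it has written exactly
  \<open>kk\<close> letters and the remaining segment is treated by induction on its length with the
  same \<open>j\<close>: the level spent is paid for by the remaining height, which has dropped by
  \<open>kk\<close>.\<close>

lemma S_step:
 assumes "Sbound j" "Cbound j"
 shows "Sbound (Suc j)" unfolding Sbound_def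
proof (intro allI impI, goal_cases)
 case (1 st p q n)
 thus ?case
 proof (induction n arbitrary: st p q rule: less_induct)
  case (less n)
  let ?d = "Hm - length st"
  show ?case
  proof (cases "n = 0")
   case True
   hence "p = q" using less(2) by (auto elim: seg.cases)
   thus ?thesis using Dseg_Dctx.refl by (rule_tac exI[of _ 1], rule_tac exI[of _ 1]) (auto intro!: kap_le)
  next
   case False
   have "n <= 2 * 2 ^ j" using less(3) by simp
   with less(2) False heavy[of st p q n "2 ^ j" kk] obtain w p' q' n' nc where
    w: "cx st w p q p' q' nc" "sg (st @ w) p' q' n'" "n = nc + n'" "length w <= kk"
    "w ~= [] --> 2 ^ j < n'" "length w = kk \<or> light (2 ^ j) (st @ w) p' q' n'" by blast
   show ?thesis
   proof (cases "w = []")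
    case True
    hence "p' = p & q' = q & nc = 0" using w(1) by (auto elim: ctx.cases)
    hence "light (2 ^ j) st p q n" using w(3,6) True kk by auto
    from light_bound[OF assms(1) this] obtain t z where
     "DS st p q t z" "1 <= t" "kk * t <= kk * (4 * j + 5) + ?d" "z <= 10 * n + 1" by blast
    moreover from this(3) have "kk * t <= kk * (4 * Suc j + 2) + ?d" by (simp add: add_mult_distrib2)
    ultimately show ?thesis by blast
   next
    case nonempty: False
    hence n': "2 ^ j < n'" "nc <= 2 ^ j" using w(3,5) less(3) by auto
    have "2 <= nc" using ctx_pos[OF w(1) nonempty] .
    obtain t1 z1 where 1: "DC st w p q p' q' t1 z1" "kk * t1 <= kk * (4 * j + 5) + ?d" "z1 + 1 <= 10 * nc"
     using assms(2) w(1,4) nonempty n'(2) unfolding Cbound_def by blast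
    have "EX t z. DS (st @ w) p' q' t z & kk * t <= kk * (4 * j + 5) + ?d & z <= 10 * n' + 1"
    proof (cases "light (2 ^ j) (st @ w) p' q' n'")
     case True
     from light_bound[OF assms(1) this] obtain t z where
      "DS (st @ w) p' q' t z" "kk * t <= kk * (4 * j + 5) + (Hm - length (st @ w))" "z <= 10 * n' + 1" by blast
     moreover from this(2) have "kk * t <= kk * (4 * j + 5) + ?d" by simp
     ultimately show ?thesis by blast
    next
     case False
     hence k: "length w = kk" using w(6) by simp
     \<comment> \<open>Needed because of truncated subtraction: only within \<open>Hm\<close> does
       \<open>Hm - length st\<close> really drop by \<open>length w\<close>.\<close>
     have "length (st @ w) <= Hm" using w(2) n'(1) by (cases rule: seg.cases) (auto dest: R_height)
     moreover obtain t z where t: "DS (st @ w) p' q' t z" "kk * t <= kk * (4 * Suc j + 2) + (Hm - length (st @ w))" "z <= 10 * n' + 1"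
      using less.IH[of n' "st @ w" p' q'] w(2,3) less(3) `2 <= nc` by auto
     ultimately have "kk * t <= kk * (4 * j + 5) + ?d" using k by (simp add: add_mult_distrib2)
     thus ?thesis using t by blast
    qed
    then obtain t2 z2 where 2: "DS (st @ w) p' q' t2 z2" "kk * t2 <= kk * (4 * j + 5) + ?d" "z2 <= 10 * n' + 1" by blast
    have D1: "DC st w p q p' q' (max t1 t2) z1" using 1(1) by (rule Dseg_Dctx.wctx) simp
    have D2: "DS (st @ w) p' q' (max t1 t2) z2" using 2(1) by (rule Dseg_Dctx.wseg) simp
    have "DS st p q (Suc (max t1 t2)) (Suc (z1 + z2))"
     by (rule Dseg_Dctx.opn[OF D1 D2]) (use nonempty w(4) ctx_sy[OF w(1)] ctx_bd[OF w(1)] in auto)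
    moreover have "kk * max t1 t2 <= kk * (4 * j + 5) + ?d" by (rule le_max_mult) (use 1 2 in auto)
    hence "kk * Suc (max t1 t2) <= kk * (4 * Suc j + 2) + ?d" by (simp add: add_mult_distrib2)
    ultimately show ?thesis using 1(3) 2(3) w(3) by (intro exI[of _ "Suc (max t1 t2)"] exI[of _ "Suc (z1 + z2)"]) auto
   qed
  qed
 qed
qed

lemma level_bound:
 assumes "Sbound j" "sg st p r n1" "R (r, st) (p', st @ [a])" "R (q', st @ [a]) (r', st)" "sg st r' q n2"
  "n1 <= 2 ^ j" "n2 <= 2 ^ j"
 shows "EX t z. DC st [a] p q p' q' t z & kk * t <= kk * (4 * j + 3) + (Hm - length st) & z + 1 <= 10 * (n1 + n2 + 2)"
proof -
 let ?d = "Hm - length st"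
 obtain t1 z1 where 1: "DS st p r t1 z1" "1 <= t1" "kk * t1 <= kk * (4 * j + 2) + ?d" "z1 <= 10 * n1 + 1"
  using assms(1,2,6) unfolding Sbound_def by blast
 obtain t2 z2 where 2: "DS st r' q t2 z2" "kk * t2 <= kk * (4 * j + 2) + ?d" "z2 <= 10 * n2 + 1"
  using assms(1,5,7) unfolding Sbound_def by blast
 have D: "DS st p r (max t1 t2) z1" "DS st r' q (max t1 t2) z2"
  using Dseg_Dctx.wseg[OF 1(1)] Dseg_Dctx.wseg[OF 2(1)] by auto
 have "DC st [a] p q p' q' (Suc (max t1 t2)) (z1 + z2 + 3)"
  by (rule Dseg_Dctx.one[OF D(1) assms(3,4) D(2)]) (use R_bd assms(3,4) 1(2) in auto)
 moreover have "kk * max t1 t2 <= kk * (4 * j + 2) + ?d" by (rule le_max_mult) (use 1 2 in auto)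
 hence "kk * Suc (max t1 t2) <= kk * (4 * j + 3) + ?d" by (simp add: add_mult_distrib2)
 ultimately show ?thesis using 1(4) 2(3) by (intro exI[of _ "Suc (max t1 t2)"] exI[of _ "z1 + z2 + 3"]) auto
qed

text \<open>The context is cut around the level that contains a middle step. The levels below and
  above it form contexts with at most \<open>2 ^ j\<close> steps each. The middle level consists of
  two segments that need not be short, so \<open>Sbound (Suc j)\<close> is used for them. One level
  for the letter and two cuts raise the depth by 3.\<close>

lemma C_step:
 assumes "Sbound (Suc j)" "Cbound j"
 shows "Cbound (Suc j)" unfolding Cbound_def
proof (intro allI impI)
 fix st w p q p' q' n
 assume w: "cx st w p q p' q' n" "w ~= []" "length w <= kk" and n: "n <= 2 ^ Suc j"
 let ?d = "Hm - length st"
 have "2 <= n" using ctx_pos[OF w(1,2)] .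
 define c where "c = min (2 ^ j) (n - 1)"
 have "c < n" using `2 <= n` by (simp add: c_def)
 from ctx_split[OF w(1) this] obtain u a v e f r r' p1 q1 n1 m1 m2 n2 where
  s: "w = u @ a # v" "cx st u p q e f n1" "sg (st @ u) e r m1" "R (r, st @ u) (p1, st @ u @ [a])"
   "R (q1, st @ u @ [a]) (r', st @ u)" "sg (st @ u) r' f m2" "cx (st @ u @ [a]) v p1 q1 p' q' n2"
   "n = n1 + (m1 + m2 + 2) + n2" "n1 <= c" "n2 <= n - 1 - c" by blast
 have n12: "n1 <= 2 ^ j" "n2 <= 2 ^ j" using s(9,10) n by (auto simp: c_def)
 have lw: "length u <= kk" "length v <= kk" using w(3) s(1) by auto
 have bds: "bd p1" "bd q1" using R_bd s(4,5) by blast+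
 have "EX t z. DC (st @ u) [a] e f p1 q1 t z & kk * t <= kk * (4 * Suc j + 3) + (Hm - length (st @ u)) & z + 1 <= 10 * (m1 + m2 + 2)"
  by (rule level_bound[OF assms(1) s(3) _ _ s(6)]) (use s n in auto)
 then obtain t z where l: "DC (st @ u) [a] e f p1 q1 t z" "kk * t <= kk * (4 * Suc j + 3) + ?d" "z + 1 <= 10 * (m1 + m2 + 2)"
  by auto
 have "EX t z. DC (st @ u) (a # v) e f p' q' t z & kk * t <= kk * (4 * Suc j + 4) + ?d & z + 1 <= 10 * (m1 + m2 + 2 + n2)"
 proof (cases "v = []")
  case True
  hence "p' = p1 & q' = q1" using s(7) by (auto elim: ctx.cases)
  thus ?thesis using l True by (intro exI[of _ t] exI[of _ z]) (auto simp: add_mult_distrib2)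
 next
  case False
  obtain t2 z2 where 2: "DC (st @ u @ [a]) v p1 q1 p' q' t2 z2" "kk * t2 <= kk * (4 * j + 5) + (Hm - length (st @ u @ [a]))" "z2 + 1 <= 10 * n2"
   using assms(2) s(7) False lw(2) n12(2) unfolding Cbound_def by blast
  have D1: "DC (st @ u) [a] e f p1 q1 (max t t2) z" using l(1) by (rule Dseg_Dctx.wctx) simp
  have D2: "DC ((st @ u) @ [a]) v p1 q1 p' q' (max t t2) z2" using 2(1) Dseg_Dctx.wctx[of R kk bd sy] by simp
  have "DC (st @ u) ([a] @ v) e f p' q' (Suc (max t t2)) (Suc (z + z2))"
   by (rule Dseg_Dctx.cut[OF D1 D2]) (use False bds w(3) s(1) in auto)
  moreover have "kk * max t t2 <= kk * (4 * Suc j + 3) + ?d"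
   by (rule le_max_mult) (use l 2 in "auto simp: add_mult_distrib2")
  hence "kk * Suc (max t t2) <= kk * (4 * Suc j + 4) + ?d" by (simp add: add_mult_distrib2)
  ultimately show ?thesis using l(3) 2(3) by (intro exI[of _ "Suc (max t t2)"] exI[of _ "Suc (z + z2)"]) auto
 qed
 then obtain t' z' where 3: "DC (st @ u) (a # v) e f p' q' t' z'" "kk * t' <= kk * (4 * Suc j + 4) + ?d"
  "z' + 1 <= 10 * (m1 + m2 + 2 + n2)" by blast
 show "EX t z. DC st w p q p' q' t z & kk * t <= kk * (4 * Suc j + 5) + ?d & z + 1 <= 10 * n"
 proof (cases "u = []")
  case True
  hence "e = p & f = q" using s(2) by (auto elim: ctx.cases)
  thus ?thesis using 3 True s(1,8) by (intro exI[of _ t'] exI[of _ z']) (auto simp: add_mult_distrib2)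
 next
  case False
  obtain t1 z1 where 1: "DC st u p q e f t1 z1" "kk * t1 <= kk * (4 * j + 5) + ?d" "z1 + 1 <= 10 * n1"
   using assms(2) s(2) False lw(1) n12(1) unfolding Cbound_def by blast
  have D1: "DC st u p q e f (max t1 t') z1" using 1(1) by (rule Dseg_Dctx.wctx) simp
  have D2: "DC (st @ u) (a # v) e f p' q' (max t1 t') z'" using 3(1) by (rule Dseg_Dctx.wctx) simp
  have "DC st (u @ a # v) p q p' q' (Suc (max t1 t')) (Suc (z1 + z'))"
   by (rule Dseg_Dctx.cut[OF D1 D2]) (use False ctx_bd[OF s(2)] w(3) s(1) in auto)
  moreover have "kk * max t1 t' <= kk * (4 * Suc j + 4) + ?d"
   by (rule le_max_mult) (use 1 3 in "auto simp: add_mult_distrib2")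
  hence "kk * Suc (max t1 t') <= kk * (4 * Suc j + 5) + ?d" by (simp add: add_mult_distrib2)
  ultimately show ?thesis using 1(3) 3(3) s(1,8) by (intro exI[of _ "Suc (max t1 t')"] exI[of _ "Suc (z1 + z')"]) auto
 qed
qed

lemma S_0: "Sbound 0" unfolding Sbound_def
proof (intro allI impI, goal_cases)
 case *: (1 st p q n)
 from *(1) show ?case
 proof cases
  case nil
  thus ?thesis using Dseg_Dctx.refl by (rule_tac exI[of _ 1], rule_tac exI[of _ 1]) auto
 next
  case (keep r m)
  hence "r = q" using *(2) by (auto elim: seg.cases)
  thus ?thesis using keep Dseg_Dctx.step[of R p st q] by (rule_tac exI[of _ 1], rule_tac exI[of _ 1]) auto
 qed (use *(2) in auto)
qed

text \<open>Vacuous: pushing and popping a letter already takes two steps.\<close>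

lemma C_0: "Cbound 0" unfolding Cbound_def using ctx_pos by fastforce

text \<open>The depth \<open>t\<close> is at most \<open>4 * j + 2 + Hm / kk\<close>, stated without
  division. If a level costs time proportional to \<open>kk\<close>, the total time is proportional
  to \<open>kk * j + Hm\<close>.\<close>

theorem balanced_derivation:
 assumes "(R ^^ n) (p, []) (q, [])" "n <= 2 ^ j"
 shows "EX t z. DS [] p q t z & kk * t <= kk * (4 * j + 2) + Hm & z <= 10 * n + 1"
proof -
 have "Sbound j & Cbound j"
 proof (induction j)
  case (Suc j)
  thus ?case using S_step C_step by blast
 qed (simp add: S_0 C_0)
 thus ?thesis using run_seg[OF assms(1)] assms(2) unfolding Sbound_def by fastforce
qed

end

section \<open>Command idioms\<close>

definition asn :: "nat => nat => nat => nat => rcmd" where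
 "asn i j m a = ([i], Some (True, i), Some (False, j), None, m, a)"

definition cst :: "nat => nat => rcmd" where
 "cst i a = ([i], Some (True, i), None, None, 0, a)"

definition chk :: "nat => nat => nat => nat => rcmd" where
 "chk i j m a = ([], Some (False, i), Some (False, j), None, m, a)"

definition ise :: "nat => nat => rcmd" where
 "ise i a = ([], Some (False, i), None, None, 0, a)"

text \<open>The old value stands on the left of the equation, so the guessed new value is the
  quotient by \<open>m\<close> and the command succeeds only for remainder \<open>a\<close>. With
  \<open>m = 1\<close> it subtracts \<open>a\<close>.\<close>

definition dvr :: "nat => nat => nat => rcmd" where
 "dvr i m a = ([i], Some (False, i), Some (True, i), None, m, a)"

text \<open>The scratch register \<open>t\<close> receives the slack, so the command tests that
  register \<open>i\<close> plus \<open>a\<close> is at most register \<open>j\<close>;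
  \<open>a = 1\<close> makes the comparison strict.\<close>

definition leq :: "nat => nat => nat => nat => rcmd" where
 "leq i j a t = ([t], Some (False, j), Some (False, i), Some (True, t), 1, a)"

definition gsr :: "nat => rcmd" where
 "gsr i = ([i], None, None, None, 0, 0)"

lemma rsem_asn [simp]: "rsem cap (asn i j m a) v v' = (v' = v(i := m * v j + a) & m * v j + a < cap)"
 by (auto simp: asn_def fun_eq_iff)

lemma rsem_cst [simp]: "rsem cap (cst i a) v v' = (v' = v(i := a) & a < cap)" by (auto simp: cst_def fun_eq_iff)

lemma rsem_chk [simp]: "rsem cap (chk i j m a) v v' = (v' = v & v i = m * v j + a)" by (auto simp: chk_def fun_eq_iff)

lemma rsem_ise [simp]: "rsem cap (ise i a) v v' = (v' = v & v i = a)" by (auto simp: ise_def fun_eq_iff)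

lemma rsem_dvr [simp]: "rsem cap (dvr i m a) v v' = (EX y < cap. v' = v(i := y) & v i = m * y + a)"
 by (auto simp: dvr_def fun_eq_iff)

lemma rsem_leq [simp]: "rsem cap (leq i j a t) v v' = (EX y < cap. v' = v(t := y) & v j = v i + y + a)"
 by (auto simp: leq_def fun_eq_iff)

lemma rsem_gsr [simp]: "rsem cap (gsr i) v v' = (EX y < cap. v' = v(i := y))" by (auto simp: gsr_def fun_eq_iff)

lemma cmd_ok_simps [simp]:
 "cmd_ok K (asn i j m a) = (i < K & j < K)" "cmd_ok K (cst i a) = (i < K)"
 "cmd_ok K (chk i j m a) = (i < K & j < K)" "cmd_ok K (ise i a) = (i < K)"
 "cmd_ok K (dvr i m a) = (i < K)" "cmd_ok K (leq i j a t) = (i < K & j < K & t < K)"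
 "cmd_ok K (gsr i) = (i < K)" by (auto simp: asn_def cst_def chk_def ise_def dvr_def leq_def gsr_def)

section \<open>Tapes as pairs of numbers\<close>

text \<open>The cells left of the head as a number in base \<open>Suc b\<close> with digits
  \<open>f i + 1\<close>. As no digit is 0, the number also determines the head position; in
  particular it is 0 exactly in cell 0.\<close>

fun lval :: "nat => (nat => nat) => nat => nat" where
 "lval b f 0 = 0"
| "lval b f (Suc p) = Suc b * lval b f p + f p + 1"

text \<open>The cells from the head on as a number in base \<open>b\<close>, the scanned symbol
  being the lowest digit. The blank is the digit 0, so the infinite blank rest needs no
  care.\<close>

definition rrep :: "nat => (nat => nat) => nat => nat => bool" where
 "rrep b f p r = (ALL j. f (p + j) = (r div b ^ j) mod b)"

definition trep :: "nat => tape => nat => nat => bool" where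
 "trep b tp l r = ((ALL i. fst tp i < b) & l = lval b (fst tp) (snd tp) & rrep b (fst tp) (snd tp) r)"

lemma lval_cong: "ALL i < p. f i = g i ==> lval b f p = lval b g p" by (induction p) auto

lemma rrep_cong: "ALL i >= p. f i = g i ==> rrep b f p r = rrep b g p r" by (auto simp: rrep_def)

lemma rrep_pop: "rrep b f p (b * y + a) ==> a < b ==> f p = a & rrep b f (Suc p) y" unfolding rrep_def
proof (intro conjI allI)
 assume *: "ALL j. f (p + j) = (b * y + a) div b ^ j mod b" "a < b"
 show "f p = a" using *(1)[rule_format, of 0] *(2) by simp
 fix j
 have "(b * y + a) div b ^ Suc j = y div b ^ j" using *(2) by (simp add: div_mult2_eq)
 thus "f (Suc p + j) = y div b ^ j mod b" using *(1)[rule_format, of "Suc j"] by simp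
qed

lemma rrep_push: "rrep b f (Suc p) y ==> a < b ==> rrep b (f(p := a)) p (b * y + a)" unfolding rrep_def
proof
 fix j assume *: "ALL j. f (Suc p + j) = y div b ^ j mod b" "a < b"
 show "(f(p := a)) (p + j) = (b * y + a) div b ^ j mod b"
 proof (cases j)
  case (Suc i)
  have "(b * y + a) div b ^ Suc i = y div b ^ i" using *(2) by (simp add: div_mult2_eq)
  thus ?thesis using *(1)[rule_format, of i] Suc by simp
 qed (use * in simp)
qed

lemma rrep_unique: "rrep b f p r ==> rrep b f p s ==> 1 < b ==> r = s"
proof (induction "r + s" arbitrary: p r s rule: less_induct)
 case less
 show ?case
 proof (cases "r = 0 & s = 0")
  case False
  have r: "r = b * (r div b) + r mod b" and s: "s = b * (s div b) + s mod b" by simp_all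
  have lt: "r mod b < b" "s mod b < b" using less(4) by auto
  have 1: "f p = r mod b & rrep b f (Suc p) (r div b)" using rrep_pop[OF _ lt(1)] less(2) r by metis
  have 2: "f p = s mod b & rrep b f (Suc p) (s div b)" using rrep_pop[OF _ lt(2)] less(3) s by metis
  have "r div b + s div b < r + s"
   using False less(4) by (metis add_less_le_mono add_le_less_mono div_le_dividend div_less_dividend gr0I)
  hence "r div b = s div b" using less.hyps 1 2 less(4) by blast
  thus ?thesis using 1 2 r s by metis
 qed simp
qed

fun rv :: "nat => (nat => nat) => nat => nat => nat" where
 "rv b f p 0 = 0"
| "rv b f p (Suc n) = b * rv b f (Suc p) n + f p"

lemma rrep_rv: "ALL i. f i < b ==> ALL i >= p + n. f i = 0 ==> rrep b f p (rv b f p n)"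
proof (induction n arbitrary: p)
 case 0
 thus ?case by (simp add: rrep_def)
next
 case (Suc n)
 hence "rrep b f (Suc p) (rv b f (Suc p) n)" by simp
 hence "rrep b (f(p := f p)) p (b * rv b f (Suc p) n + f p)" by (rule rrep_push) (use Suc in blast)
 thus ?case by simp
qed

lemma rv_less: "ALL i. f i < b ==> rv b f p n < b ^ n"
proof (induction n arbitrary: p)
 case (Suc n)
 hence "rv b f (Suc p) n < b ^ n" "f p < b" by auto
 hence "b * rv b f (Suc p) n + f p < b * (rv b f (Suc p) n + 1)" by simp
 also have "... <= b * b ^ n" using `rv b f (Suc p) n < b ^ n` by (intro mult_le_mono2) simp
 finally show ?case by simp
qed simp

lemma lval_less: "ALL i. f i < b ==> lval b f p < Suc b ^ p"
proof (induction p)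
 case (Suc p)
 hence "lval b f p < Suc b ^ p" "f p < b" by auto
 hence "Suc b * lval b f p + f p + 1 < Suc b * (lval b f p + 1)" by simp
 also have "... <= Suc b * Suc b ^ p" using `lval b f p < Suc b ^ p` by (intro mult_le_mono2) simp
 finally show ?case by simp
qed simp

lemma trep_exists: "ALL i. fst tp i < b ==> ALL i >= n. fst tp i = 0 ==> EX l r. trep b tp l r"
 unfolding trep_def using rrep_rv[of "fst tp" b "snd tp" n] by auto

lemma trep_unique: "trep b tp l r ==> trep b tp l' r' ==> 1 < b ==> l = l' & r = r'"
 unfolding trep_def using rrep_unique by blast

lemma trep_bound:
 assumes "trep b tp l r" "1 < b" "ALL i >= n. fst tp i = 0" "snd tp <= n"
 shows "l < Suc b ^ n & r < Suc b ^ n"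
proof
 have "l < Suc b ^ snd tp" using assms(1) lval_less unfolding trep_def by blast
 also have "... <= Suc b ^ n" by (rule power_increasing) (use assms(4) in auto)
 finally show "l < Suc b ^ n" .
 have "r = rv b (fst tp) (snd tp) n"
  using assms(1-3) rrep_unique[OF _ rrep_rv[of "fst tp" b "snd tp" n]] unfolding trep_def by auto
 also have "... < b ^ n" using assms(1) rv_less unfolding trep_def by blast
 also have "... <= Suc b ^ n" by (rule power_mono) auto
 finally show "r < Suc b ^ n" .
qed

lemma trep_blank: "0 < b ==> trep b blank_tape 0 0" by (simp add: trep_def blank_tape_def rrep_def)

text \<open>Register sequences for one step of a tape: the registers `l` and `r` hold the two halves,
 `a` is the scanned and `a'` the written symbol.\<close>

fun tcm :: "nat => nat => nat => nat => nat => dir => rcmd list set" where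
 "tcm l r b a a' Stay = {[dvr r b a, asn r r b a']}"
| "tcm l r b a a' Rgt = {[dvr r b a, asn l l (Suc b) (Suc a')]}"
| "tcm l r b a a' Lft = insert [dvr r b a, asn r r b a', ise l 0]
   ((%e. [dvr r b a, asn r r b a', dvr l (Suc b) (Suc e), asn r r b e]) ` {..<b})"

lemma finite_tcm: "finite (tcm l r b a a' d)" by (cases d) auto

lemma tcm_ok: "cs : tcm l r b a a' d ==> l < K ==> r < K ==> c : set cs ==> cmd_ok K c" by (cases d) auto

lemma write_move_parts: "fst (write_move a d tp) = (fst tp)(snd tp := a)" "snd (write_move a d tp) = shift d (snd tp)"
 by (auto simp: write_move_def)

lemma tcm_sound:
 assumes "trep b tp (v l) (v r)" "cs : tcm l r b a a' d" "a < b" "a' < b" "l ~= r" "rseq cap cs v v'"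
 shows "a = scan tp & trep b (write_move a' d tp) (v' l) (v' r) & (ALL i. i ~= l --> i ~= r --> v' i = v i)"
proof -
 obtain f p where tp: "tp = (f, p)" by (cases tp)
 have fb: "ALL i. f i < b" and l: "v l = lval b f p" and r: "rrep b f p (v r)" using assms(1) tp by (auto simp: trep_def)
 have "EX y. v r = b * y + a" using assms(2,6) by (cases d) auto
 then obtain y where y: "v r = b * y + a" by blast
 have fp: "f p = a" and ry: "rrep b f (Suc p) y" using rrep_pop[of b f p y a] r y assms(3) by auto
 have yu: "y' = y" if "v r = b * y' + a" for y' using that y assms(3) by simp
 have fb': "ALL i. (f(p := a')) i < b" using fb assms(4) by simp
 have l': "lval b (f(p := a')) p = lval b f p" by (rule lval_cong) simp
 have rp: "rrep b (f(p := a')) p (b * y + a')" by (rule rrep_push[OF ry assms(4)])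
 have ry': "rrep b (f(p := a')) (Suc p) y" using ry by (subst rrep_cong[of _ _ f]) auto
 have sc: "a = scan tp" using fp tp by (simp add: scan_def)
 show ?thesis
 proof (cases d)
  case Stay
  hence "v' = v(r := b * y + a')" using assms(2,6) yu by auto
  thus ?thesis using sc Stay fb' l l' rp assms(5) tp by (auto simp: trep_def write_move_parts)
 next
  case Rgt
  hence v': "v' = v(r := y, l := Suc b * v l + Suc a')" using assms(2,5,6) yu by auto
  have "lval b (f(p := a')) (Suc p) = Suc b * v l + Suc a'" using l l' by simp
  thus ?thesis using sc Rgt fb' ry' assms(5) tp v' by (auto simp: trep_def write_move_parts simp del: lval.simps)
 next
  case Lft
  then consider "cs = [dvr r b a, asn r r b a', ise l 0]" |
   e where "e < b" "cs = [dvr r b a, asn r r b a', dvr l (Suc b) (Suc e), asn r r b e]" using assms(2) by auto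
  thus ?thesis
  proof cases
   case 1
   hence v': "v' = v(r := b * y + a')" "v l = 0" using assms(5,6) yu by auto
   hence "p = 0" using l by (cases p) auto
   thus ?thesis using v' sc Lft fb' l l' rp assms(5) tp by (auto simp: trep_def write_move_parts)
  next
   case (2 e)
   then obtain y2 where v': "v' = v(r := b * (b * y + a') + e, l := y2)" "v l = Suc b * y2 + Suc e"
    using assms(5,6) yu by (auto simp: fun_upd_twist)
   then obtain p' where p': "p = Suc p'" using l by (cases p) auto
   have eq: "Suc b * y2 + Suc e = Suc b * lval b f p' + Suc (f p')" using v'(2) l p' by simp
   \<comment> \<open>The lowest digit of the left half, shifted by one, is the symbol left of the
     head; reduction modulo \<open>Suc b\<close> identifies it with the guessed
     \<open>e\<close>.\<close>
   have "(Suc b * y2 + Suc e) mod Suc b = Suc e" using 2(1) by (subst mod_mult_self4) simp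
   moreover have "(Suc b * lval b f p' + Suc (f p')) mod Suc b = Suc (f p')" using fb by (subst mod_mult_self4) simp
   ultimately have "e = f p'" using eq by simp
   hence "Suc b * y2 = Suc b * lval b f p'" using eq by (simp only: add_right_cancel)
   hence y2: "y2 = lval b f p'" by (simp only: mult_cancel1) simp
   have "lval b (f(p := a')) p' = lval b f p'" by (rule lval_cong) (simp add: p')
   moreover have "rrep b ((f(p := a'))(p' := e)) p' (b * (b * y + a') + e)"
    using rp 2(1) unfolding p' by (rule rrep_push)
   moreover have "(f(p := a'))(p' := e) = f(p := a')" using `e = f p'` p' by (simp add: fun_upd_idem)
   ultimately show ?thesis using v' y2 sc Lft fb' assms(5) tp p' by (auto simp: trep_def write_move_parts)
  qed
 qed
qed

lemma tcm_complete:
 assumes "trep b tp (v l) (v r)" "scan tp = a" "a' < b" "l ~= r" "v l < cap" "v r < cap"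
  and new: "!!l' r'. trep b (write_move a' d tp) l' r' ==> l' < cap & r' < cap"
 shows "EX cs : tcm l r b a a' d. EX v'. rseq cap cs v v' & trep b (write_move a' d tp) (v' l) (v' r) &
  (ALL i. i ~= l --> i ~= r --> v' i = v i)"
proof -
 obtain f p where tp: "tp = (f, p)" by (cases tp)
 have fb: "ALL i. f i < b" and l: "v l = lval b f p" and r: "rrep b f p (v r)" using assms(1) tp by (auto simp: trep_def)
 have ab: "a < b" using fb assms(2) tp by (auto simp: scan_def)
 define y where "y = v r div b"
 have "f p = v r mod b" using r[unfolded rrep_def, rule_format, of 0] by simp
 hence "a = v r mod b" using assms(2) tp by (simp add: scan_def)
 hence y: "v r = b * y + a" unfolding y_def by (simp only: mult_div_mod_eq)
 have ycap: "y < cap" using assms(6) unfolding y_def by (metis div_le_dividend le_less_trans)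
 define u where "u = v(r := y)"
 have u: "rsem cap (dvr r b a) v u" using y ycap by (auto simp: u_def)
 have ry: "rrep b f (Suc p) y" using rrep_pop[of b f p y a] r y ab by auto
 have rp: "rrep b (f(p := a')) p (b * y + a')" by (rule rrep_push[OF ry assms(3)])
 have l': "lval b (f(p := a')) p = lval b f p" by (rule lval_cong) simp
 have fb': "ALL i. (f(p := a')) i < b" using fb assms(3) by simp
 show ?thesis
 proof (cases d)
  case Stay
  have t: "trep b (write_move a' d tp) (v l) (b * y + a')"
   using Stay fb' l l' rp tp by (auto simp: trep_def write_move_parts)
  have "rseq cap [dvr r b a, asn r r b a'] v (v(r := b * y + a'))"
   using u new[OF t] unfolding rseq.simps by (intro exI[of _ u]) (simp add: u_def)
  thus ?thesis using Stay t assms(4)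
   by (intro bexI[of _ "[dvr r b a, asn r r b a']"] exI[of _ "v(r := b * y + a')"]) auto
 next
  case Rgt
  have ry': "rrep b (f(p := a')) (Suc p) y" using ry by (subst rrep_cong[of _ _ f]) auto
  have t: "trep b (write_move a' d tp) (Suc b * v l + Suc a') y"
   using Rgt fb' l l' ry' tp by (auto simp: trep_def write_move_parts)
  have "rseq cap [dvr r b a, asn l l (Suc b) (Suc a')] v (u(l := Suc b * v l + Suc a'))"
   using u new[OF t] assms(4) unfolding rseq.simps by (intro exI[of _ u]) (simp add: u_def)
  thus ?thesis using Rgt t assms(4)
   by (intro bexI[of _ "[dvr r b a, asn l l (Suc b) (Suc a')]"] exI[of _ "u(l := Suc b * v l + Suc a')"])
    (auto simp: u_def)
 next
  case Lft
  show ?thesis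
  proof (cases p)
   case 0
   have t: "trep b (write_move a' d tp) (v l) (b * y + a')"
    using Lft fb' l l' rp tp 0 by (auto simp: trep_def write_move_parts)
   have "rseq cap [dvr r b a, asn r r b a', ise l 0] v (v(r := b * y + a'))"
    using u new[OF t] l 0 assms(4) unfolding rseq.simps by (intro exI[of _ u]) (simp add: u_def)
   thus ?thesis using Lft t assms(4)
    by (intro bexI[of _ "[dvr r b a, asn r r b a', ise l 0]"] exI[of _ "v(r := b * y + a')"]) auto
  next
   case (Suc p')
   define e where "e = f p'"
   have eb: "e < b" using fb by (simp add: e_def)
   have "rrep b ((f(p := a'))(p' := e)) p' (b * (b * y + a') + e)" using rp eb unfolding Suc by (rule rrep_push)
   moreover have "(f(p := a'))(p' := e) = f(p := a')" using Suc by (simp add: fun_upd_idem e_def)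
   moreover have "lval b (f(p := a')) p' = lval b f p'" by (rule lval_cong) (simp add: Suc)
   ultimately have t: "trep b (write_move a' d tp) (lval b f p') (b * (b * y + a') + e)"
    using Lft fb' tp Suc by (auto simp: trep_def write_move_parts)
   note c = new[OF t]
   \<comment> \<open>Only the final values are assumed to fit. The intermediate value of register
     \<open>r\<close> is no larger than its final one, so it fits as well.\<close>
   have "b * y + a' <= b * (b * y + a') + e" using ab by (cases b) auto
   hence c2: "b * y + a' < cap" using c by simp
   let ?v = "v(r := b * (b * y + a') + e, l := lval b f p')"
   have "rseq cap [dvr r b a, asn r r b a', dvr l (Suc b) (Suc e), asn r r b e] v ?v"
    using u c c2 l Suc assms(4) unfolding rseq.simps
    by (intro exI[of _ u], intro conjI, simp, intro exI[of _ "v(r := b * y + a')"], intro conjI, simp add: u_def)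
     (intro exI[of _ "v(r := b * y + a', l := lval b f p')"], auto simp: e_def fun_upd_twist)
   moreover have "[dvr r b a, asn r r b a', dvr l (Suc b) (Suc e), asn r r b e] : tcm l r b a a' d"
    using Lft eb by auto
   moreover have "trep b (write_move a' d tp) (?v l) (?v r)" using t assms(4) by simp
   ultimately show ?thesis
    by (intro bexI[of _ "[dvr r b a, asn r r b a', dvr l (Suc b) (Suc e), asn r r b e]"] exI[of _ ?v]) auto
  qed
 qed
qed

fun ipc :: "nat => 'a insym => dir => rcmd list" where
 "ipc u i Stay = []"
| "ipc u i Lft = (if i = LeftEnd then [] else [dvr u 1 1])"
| "ipc u i Rgt = (if i = RightEnd then [] else [asn u u 1 1])"

lemma ipc_ok: "u < K ==> c : set (ipc u i d) ==> cmd_ok K c" by (cases d) (auto split: if_splits)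

lemma input_cell_ends:
 "(input_cell x p = LeftEnd) = (p = 0)" "p <= Suc (length x) ==> (input_cell x p = RightEnd) = (p = Suc (length x))"
 by (auto simp: input_cell_def)

lemma ipc_iff:
 assumes "v u <= Suc (length x)" "input_shift x d (v u) < cap"
 shows "rseq cap (ipc u (input_cell x (v u)) d) v v' = (v' = v(u := input_shift x d (v u)))"
 using assms input_cell_ends[where x = x and p = "v u"]
 by (cases d; cases "v u") (auto simp: input_shift_def min_def split: if_splits)

lemma ipc_sound:
 assumes "v u <= Suc (length x)" "rseq cap (ipc u (input_cell x (v u)) d) v v'"
 shows "v' = v(u := input_shift x d (v u))" using assms input_cell_ends[where x = x and p = "v u"]
 by (cases d; cases "v u") (auto simp: input_shift_def min_def split: if_splits)

lemma input_shift_le: "input_shift x d p <= Suc (length x)" by (simp add: input_shift_def)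

fun shc :: "nat => dir => rcmd list set" where
 "shc u Stay = {[]}"
| "shc u Lft = {[ise u 0], [dvr u 1 1]}"
| "shc u Rgt = {[asn u u 1 1]}"

lemma finite_shc: "finite (shc u d)" by (cases d) auto

lemma shc_ok: "u < K ==> cs : shc u d ==> c : set cs ==> cmd_ok K c" by (cases d) auto

lemma shc_sound: "cs : shc u d ==> rseq cap cs v v' ==> v' = v(u := shift d (v u))" by (cases d) auto

lemma shc_complete: "shift d (v u) < cap ==> EX cs : shc u d. rseq cap cs v (v(u := shift d (v u)))"
 by (cases d; cases "v u") auto

section \<open>Alternating programs for stack machines\<close>

instance stack_op :: countable by countable_datatype

type_synonym 'a tr = "(nat * 'a insym * nat * nat) * (nat * nat * dir * dir * dir * stack_op)"

type_synonym surf = "nat * nat * tape * nat"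

inductive sstep :: "'a tr set => 'a list => surf * nat list => surf * nat list => bool" for Tr x where
 "((q, input_cell x ip, scan tp, stack_scan st sp), (q', a, di, dw, ds, p)) : Tr ==>
  sstep Tr x ((q, ip, tp, sp), st)
   ((q', input_shift x di ip, write_move a dw tp, shift ds sp), stack_apply p st)"

text \<open>Surface configurations are held in slots of five registers.\<close>

definition upd :: "(nat => nat) => nat => (nat => nat) => nat => nat" where
 "upd v k g = (%i. if i div 5 = k then g (i mod 5) else v i)"

definition cpy :: "nat => nat => rcmd list" where
 "cpy k j = map (%i. asn (5 * k + i) (5 * j + i) 1 0) [0..<5]"

definition eqs :: "nat => nat => rcmd list" where
 "eqs k j = map (%i. chk (5 * k + i) (5 * j + i) 1 0) [0..<5]"

definition gss :: "nat => rcmd list" where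
 "gss k = map (%i. gsr (5 * k + i)) [0..<5]"

lemma upt_5: "[0..<5] = [0, 1, 2, 3, 4::nat]" by (simp add: upt_rec)

lemma all_less_5: "(ALL i < 5. P i) = (P 0 & P 1 & P 2 & P 3 & P (4::nat))"
proof -
 have "(i < 5) = (i = 0 \<or> i = 1 \<or> i = 2 \<or> i = 3 \<or> i = 4)" for i :: nat by linarith
 hence "P i" if "P 0 & P 1 & P 2 & P 3 & P 4" "i < 5" for i using that by metis
 moreover have "(0::nat) < 5" "(1::nat) < 5" "(2::nat) < 5" "(3::nat) < 5" "(4::nat) < 5" by simp_all
 ultimately show ?thesis by blast
qed

lemma length_cmds [simp]: "length (cpy k j) = 5" "length (eqs k j) = 5" "length (gss k) = 5"
 by (auto simp: cpy_def eqs_def gss_def)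

text \<open>Writing the registers of a slot does not affect the conditions \<open>R\<close> for its
  other registers. The five commands therefore act like one simultaneous update.\<close>

lemma rseq_slot:
 assumes c: "!!i v v'. i < 5 ==> rsem cap (c i) v v' = (EX y. R v i y & v' = v(5 * k + i := y))"
  and R: "!!i l v y. i < 5 ==> l < 5 ==> R (v(5 * k + l := y)) i = R v i"
 shows "rseq cap (map c [0..<5]) v v' = (EX g. (ALL i < 5. R v i (g i)) & v' = upd v k g)"
proof -
 define U where "U m g = (%i. if i div 5 = k & i mod 5 < m then g (i mod 5) else v i)" for m :: nat and g
 have U: "U (Suc m) g = (U m g)(5 * k + m := g m)" if "m < 5" for m g
 proof
  fix i show "U (Suc m) g i = ((U m g)(5 * k + m := g m)) i"
  proof (cases "i = 5 * k + m")
   case False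
   hence "~ (i div 5 = k & i mod 5 = m)" by (metis mult_div_mod_eq)
   thus ?thesis using False by (auto simp: U_def less_Suc_eq)
  qed (use that in "simp add: U_def")
 qed
 have RU: "R (U m g) i = R v i" if "m <= 5" "i < 5" for m g i
  using that by (induction m) (simp_all add: U R, simp add: U_def)
 have "rseq cap (map c [0..<m]) v v' = (EX g. (ALL i < m. R v i (g i)) & v' = U m g)" if "m <= 5" for m v' using that
 proof (induction m arbitrary: v')
  case (Suc m)
  hence m: "m < 5" by simp
  have "rseq cap (map c [0..<Suc m]) v v' =
    (EX g u. (ALL i < m. R v i (g i)) & u = U m g & (EX y. R u m y & v' = u(5 * k + m := y)))"
   using Suc.IH[OF less_imp_le[OF m]] by (simp add: rseq_append c[OF m]) blast
  also have "... = (EX g y. (ALL i < m. R v i (g i)) & R v m y & v' = (U m g)(5 * k + m := y))"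
   using m by (simp add: RU)
  also have "... = (EX g. (ALL i < Suc m. R v i (g i)) & v' = U (Suc m) g)"
  proof
   assume "EX g y. (ALL i < m. R v i (g i)) & R v m y & v' = (U m g)(5 * k + m := y)"
   then obtain g y where g: "ALL i < m. R v i (g i)" "R v m y" "v' = (U m g)(5 * k + m := y)" by blast
   have "U m (g(m := y)) = U m g" by (auto simp: U_def)
   thus "EX g. (ALL i < Suc m. R v i (g i)) & v' = U (Suc m) g" using g
    by (intro exI[of _ "g(m := y)"]) (simp add: U[OF m] less_Suc_eq)
  qed (metis U[OF m] lessI less_SucI)
  finally show ?case .
 qed (simp add: U_def)
 from this[of 5] show ?thesis by (simp add: U_def upd_def)
qed

lemma rseq_cpy:
 assumes "k ~= j"
 shows "rseq cap (cpy k j) v v' = (v' = upd v k (%i. v (5 * j + i)) & (ALL i < 5. v (5 * j + i) < cap))"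
proof -
 have ne: "5 * j + i ~= 5 * k + l" if "i < 5" "l < 5" for i l
 proof -
  have "(5 * j + i) div 5 = j" "(5 * k + l) div 5 = k" using that by auto
  thus ?thesis using assms by metis
 qed
 have "rseq cap (cpy k j) v v' = (EX g. (ALL i < 5. g i = v (5 * j + i) & g i < cap) & v' = upd v k g)"
  unfolding cpy_def by (rule rseq_slot) (use ne in auto)
 moreover have "upd v k g = upd v k (%i. v (5 * j + i))" if "ALL i < 5. g i = v (5 * j + i)" for g
  using that by (auto simp: upd_def)
 ultimately show ?thesis by (metis (no_types, lifting))
qed

lemma rseq_eqs: "rseq cap (eqs k j) v v' = (v' = v & (ALL i < 5. v (5 * k + i) = v (5 * j + i)))"
 unfolding eqs_def upt_5 all_less_5 by auto

lemma rseq_gss: "rseq cap (gss k) v v' = (EX g. (ALL i < 5. g i < cap) & v' = upd v k g)"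
 unfolding gss_def by (rule rseq_slot) auto

lemma slot_cmd_ok:
 "k < 6 ==> j < 6 ==> ALL c : set (cpy k j). cmd_ok 30 c"
 "k < 6 ==> j < 6 ==> ALL c : set (eqs k j). cmd_ok 30 c"
 "k < 6 ==> ALL c : set (gss k). cmd_ok 30 c" by (auto simp: cpy_def eqs_def gss_def)

definition encS :: "nat => nat => (nat => nat) => surf => bool" where
 "encS b n g s = (case s of (q, ip, tp, sp) =>
  g 0 = q & g 1 = ip & g 2 = sp & trep b tp (g 3) (g 4) & ip <= Suc n)"

definition enc :: "nat => nat => (nat => nat) => nat => surf => bool" where
 "enc b n v k s = encS b n (%i. v (5 * k + i)) s"

lemma encS_cong: "ALL i < 5. g i = h i ==> encS b n g s = encS b n h s" unfolding all_less_5 encS_def by auto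

lemma enc_upd [simp]: "enc b n (upd v k g) m s = (if m = k then encS b n g s else enc b n v m s)"
proof (cases "m = k")
 case True
 have "encS b n (%i. upd v k g (5 * k + i)) s = encS b n g s" by (rule encS_cong) (simp add: upd_def)
 thus ?thesis using True by (simp add: enc_def)
next
 case False
 have "encS b n (%i. upd v k g (5 * m + i)) s = encS b n (%i. v (5 * m + i)) s"
  by (rule encS_cong) (use False in "simp add: upd_def")
 thus ?thesis using False by (simp add: enc_def)
qed

lemma enc_upd_cpy: "encS b n (%i. v (5 * j + i)) s = enc b n v j s" by (simp add: enc_def)

lemma encS_unique: "encS b n g s ==> encS b n h s ==> 1 < b ==> ALL i < 5. g i = h i"
proof -
 assume *: "encS b n g s" "encS b n h s" "1 < b"
 obtain q ip tp sp where "s = (q, ip, tp, sp)" by (cases s)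
 thus ?thesis using * trep_unique[of b tp "g 3" "g 4" "h 3" "h 4"] unfolding encS_def all_less_5 by simp
qed

text \<open>On the stack tape, a stack symbol `a` is stored as `2 * a` or, with a flag, as `2 * a + 1`;
 the last flag marks the bottom of the context under consideration.\<close>

definition rep2 :: "(nat => nat) => nat list => bool" where
 "rep2 f st = (f 0 = 0 & (ALL i < length st. f (Suc i) div 2 = st ! i) & (ALL i >= length st. f (Suc i) = 0) &
  (ALL a : set st. a ~= 0))"

text \<open>Letter number \<open>i\<close> lies in cell \<open>Suc i\<close>. The letter directly
  above height \<open>m\<close> is flagged, and no letter above it up to height \<open>k\<close> is;
  flags further down belong to enclosing contexts.\<close>

definition flag :: "(nat => nat) => nat => nat => bool" where
 "flag f m k = (odd (f (Suc m)) & (ALL i. m < i --> i < k --> even (f (Suc i))))"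

lemma rep2_scan: "rep2 f st ==> f (Suc i) div 2 = stack_scan st i" by (auto simp: rep2_def stack_scan_def)

lemma rep2_nonzero: "rep2 f st ==> 0 < i ==> i <= length st ==> f i ~= 0"
proof
 assume *: "rep2 f st" "0 < i" "i <= length st" "f i = 0"
 then obtain j where j: "i = Suc j" "j < length st" by (cases i) auto
 hence "f (Suc j) div 2 = st ! j" "st ! j ~= 0" using *(1) by (auto simp: rep2_def)
 thus False using * j by simp
qed

lemma rep2_top: "rep2 f st ==> (f (length st) = 0) = (st = [])"
 using rep2_nonzero[of f st "length st"] by (cases "st = []") (auto simp: rep2_def)

lemma rep2_push: "rep2 f st ==> a ~= 0 ==> e div 2 = a ==> rep2 (f(Suc (length st) := e)) (st @ [a])"
 by (auto simp: rep2_def nth_append less_Suc_eq)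

lemma rep2_pop: "rep2 f (st @ [a]) ==> rep2 (f(Suc (length st) := 0)) st"
 by (auto simp: rep2_def nth_append split: if_splits)

lemma rep2_update: "rep2 f st ==> 0 < i ==> i <= length st ==> e div 2 = f i div 2 ==> rep2 (f(i := e)) st"
 by (auto simp: rep2_def)

lemma rep2_last: "rep2 f (st @ [a]) ==> f (Suc (length st)) div 2 = a"
 using rep2_scan[of f "st @ [a]" "length st"] by (simp add: stack_scan_def)

text \<open>\<open>PSg\<close> verifies a segment and \<open>PCx\<close> a context.
  \<open>PUS\<close>, \<open>PS1\<close>, \<open>PS2\<close> split a segment; \<open>PW1\<close> to
  \<open>PW3\<close> write a guessed word and \<open>PUO\<close>, \<open>PO\<close> branch into its
  context and the segment above it. \<open>PUE\<close>, \<open>PE1\<close> to \<open>PE4\<close>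
  treat a context of one letter; the states with \<open>K\<close> cut a longer one.
  \<open>PLf\<close> guesses a transition, which \<open>PL1\<close> to \<open>PL3\<close> check in
  separate branches.\<close>

datatype 'a ps =
  PIni | PSg | PAcc | PLf stack_op | PUS | PS1 | PS2 | PW1 | PW2 | PW3 | PUO | PO
 | PCx | PUE | PE1 | PE2 | PE3 | PE4 | PK0 | PK1 | PUK | PK2 | PK3 | PK4
 | PUL "'a tr" | PL1 "'a tr" | PL2 "'a tr" | PL3 "'a tr" | PIn "'a option"

instance ps :: (countable) countable by countable_datatype

fun kdp :: "'a ps => ('a ps, 'a) kind" where
 "kdp PAcc = KA"
| "kdp PUS = KU [PS1, PS2]"
| "kdp PUO = KU [PO, PCx]"
| "kdp PUE = KU [PE1, PE2, PE3, PE4]"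
| "kdp PUK = KU [PK2, PK3]"
| "kdp (PUL tr) = KU [PL1 tr, PL2 tr, PL3 tr]"
| "kdp (PL3 tr) = KS 2 (case tr of ((q, i, a, b), _) => b)"
| "kdp (PIn l) = KI 1 l"
| "kdp _ = KE"

text \<open>Slots 0 and 1 hold the ends of the current segment, or the lower ends of the current context;
 slots 2 and 3 the upper ends of the context; slots 4 and 5 intermediate configurations.\<close>

fun local :: "nat => 'a tr => rcmd list set" where
 "local b ((q, i, a, c), (q', a', di, dw, ds, p)) =
  (%(cs1, cs2). [ise 0 q, cst 0 q'] @ ipc 1 i di @ cs1 @ cs2 @ eqs 0 1) ` (shc 2 ds \<times> tcm 3 4 b a a' dw)"

locale altp =
 fixes Tr :: "'a::finite tr set" and ns nb start fs :: nat
 assumes Tr: "((q, i, a, b), (q', a', di, dw, ds, p)) : Tr ==>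
   q < ns & a < nb & b < nb & q' < ns & a' < nb & (ALL e. p = Push e --> 0 < e & e < nb)"
  and nb: "1 < nb"
begin

text \<open>The numbers are the symbols read from and written to the stack tape, whose head rests on
  the top letter. In \<open>sg3\<close> the blank means an empty stack, where a pop has no effect. A
  context is cut by walking down to an unflagged letter, flagging it and returning to the top
  (\<open>k0\<close> to \<open>k1'\<close>). The new flag is then the bottom of the upper part; for
  the lower part the letters from the new flag on are erased (\<open>k4\<close>,
  \<open>k4'\<close>).\<close>

inductive ed :: "'a ps => nat => 'a ps => rcmd list => nat => dir => bool" where
 ini: "ed PIni 0 PSg (cst 0 start # gss 1 @ [ise 5 fs]) 0 Stay"
| sg1: "ed PSg e PAcc (eqs 0 1) e Stay"
| sg2: "ed PSg e (PLf Keep) [] e Stay"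
| sg3: "ed PSg 0 (PLf Pop) [] 0 Stay"
| sg4: "ed PSg e PUS (gss 4) e Stay"
| sg5: "ed PSg e PW1 (gss 2 @ gss 3) e Rgt"
| s1: "ed PS1 e PSg (cpy 1 4) e Stay"
| s2: "ed PS2 e PSg (cpy 0 4) e Stay"
| w1: "0 < a ==> a < nb ==> ed PW1 0 PW2 [] (2 * a + 1) Stay"
| w2: "ed PW2 e PW3 [] e Rgt"
| w2': "ed PW2 e PUO [] e Stay"
| w3: "0 < a ==> a < nb ==> ed PW3 0 PW2 [] (2 * a) Stay"
| o: "ed PO e PSg (cpy 0 2 @ cpy 1 3) e Stay"
| cx1: "odd e ==> ed PCx e PUE (gss 4 @ gss 5) e Stay"
| cx2: "ed PCx e PK0 (gss 4 @ gss 5) e Stay"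
| e1: "ed PE1 e PSg (cpy 1 4) 0 Lft"
| e2: "ed PE2 e (PLf (Push (e div 2))) (cpy 0 4 @ cpy 1 2) 0 Lft"
| e3: "ed PE3 e (PLf Pop) (cpy 0 3 @ cpy 1 5) e Stay"
| e4: "ed PE4 e PSg (cpy 0 5) 0 Lft"
| k0: "even e ==> e ~= 0 ==> ed PK0 e PK0 [] e Lft"
| k0': "even e ==> e ~= 0 ==> ed PK0 e PK1 [] (e + 1) Rgt"
| k1: "e ~= 0 ==> ed PK1 e PK1 [] e Rgt"
| k1': "ed PK1 0 PUK [] 0 Lft"
| k2: "ed PK2 e PK4 (cpy 2 4 @ cpy 3 5) e Stay"
| k3: "ed PK3 e PCx (cpy 0 4 @ cpy 1 5) e Stay"
| k4: "even e ==> e ~= 0 ==> ed PK4 e PK4 [] 0 Lft"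
| k4': "odd e ==> ed PK4 e PCx [] 0 Lft"
| lf: "((q, i, a, b), (q', a', di, dw, ds, p)) : Tr ==>
  ed (PLf p) e (PUL ((q, i, a, b), (q', a', di, dw, ds, p))) [] e Stay"
| l1: "tr : Tr ==> cs : local nb tr ==> ed (PL1 tr) e PAcc cs e Stay"
| l2: "((q, LeftEnd, a, b), r) : Tr ==> ed (PL2 ((q, LeftEnd, a, b), r)) e PAcc [ise 1 0] e Stay"
| l2': "((q, Letter y, a, b), r) : Tr ==> ed (PL2 ((q, Letter y, a, b), r)) e (PIn (Some y)) [dvr 1 1 1] e Stay"
| l2'': "((q, RightEnd, a, b), r) : Tr ==> ed (PL2 ((q, RightEnd, a, b), r)) e (PIn None) [dvr 1 1 1] e Stay"

definition "SB = {..2 * nb}"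

definition "E = {((q, e), (q', cs, a, d)) | q e q' cs a d. ed q e q' cs a d & e : SB}"

definition "OPS = {Keep, Pop} \<union> Push ` {..<Suc nb}"

definition "QS = {PIni, PSg, PAcc, PUS, PS1, PS2, PW1, PW2, PW3, PUO, PO,
 PCx, PUE, PE1, PE2, PE3, PE4, PK0, PK1, PUK, PK2, PK3, PK4} \<union> PLf ` OPS \<union> PUL ` Tr \<union> PL1 ` Tr \<union> PL2 ` Tr \<union> PL3 ` Tr \<union> range PIn"

definition "CS0 = {[], cst 0 start # gss 1 @ [ise 5 fs], eqs 0 1, gss 4, gss 2 @ gss 3, cpy 1 4, cpy 0 4, cpy 0 2 @ cpy 1 3,
 gss 4 @ gss 5, cpy 0 4 @ cpy 1 2, cpy 0 3 @ cpy 1 5, cpy 0 5, cpy 2 4 @ cpy 3 5, cpy 0 4 @ cpy 1 5, [ise 1 0], [dvr 1 1 1]}"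

definition "CS = CS0 \<union> (UN tr:Tr. local nb tr)"

lemma finite_Tr: "finite Tr"
proof -
 have "Tr <= ({..<ns} \<times> UNIV \<times> {..<nb} \<times> {..<nb}) \<times> ({..<ns} \<times> {..<nb} \<times> UNIV \<times> UNIV \<times> UNIV \<times> OPS)"
 proof
  fix t assume t: "t : Tr"
  obtain q i a b q' a' di dw ds p where "t = ((q, i, a, b), (q', a', di, dw, ds, p))" by (metis surj_pair)
  thus "t : ({..<ns} \<times> UNIV \<times> {..<nb} \<times> {..<nb}) \<times> ({..<ns} \<times> {..<nb} \<times> UNIV \<times> UNIV \<times> UNIV \<times> OPS)"
   using Tr[of q i a b q' a' di dw ds p] t by (cases p) (auto simp: OPS_def)
 qed
 thus ?thesis by (rule finite_subset) (simp add: OPS_def)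
qed

lemma finite_local: "finite (local b tr)" by (cases "(b, tr)" rule: local.cases) (simp add: finite_shc finite_tcm)

lemma finite_QS: "finite QS" and finite_CS: "finite CS"
 by (auto simp: QS_def CS_def CS0_def OPS_def finite_Tr finite_local)

lemma local_ok:
 assumes "cs : local b tr"
 shows "ALL c : set cs. cmd_ok 30 c"
proof -
 obtain q i a d q' a' di dw ds p where tr: "tr = ((q, i, a, d), (q', a', di, dw, ds, p))" by (metis surj_pair)
 obtain cs1 cs2 where cs: "cs1 : shc 2 ds" "cs2 : tcm 3 4 b a a' dw"
  "cs = [ise 0 q, cst 0 q'] @ ipc 1 i di @ cs1 @ cs2 @ eqs 0 1" using assms tr by auto
 have "ALL c : set (ipc 1 i di). cmd_ok 30 c" using ipc_ok[where u = 1 and K = 30 and i = i and d = di] by simp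
 moreover have "ALL c : set cs1. cmd_ok 30 c" using shc_ok[OF _ cs(1), of 30] by simp
 moreover have "ALL c : set cs2. cmd_ok 30 c" using tcm_ok[OF cs(2), of 30] by simp
 ultimately show ?thesis unfolding cs(3) using slot_cmd_ok(2)[of 0 1] by (auto simp del: ipc.simps)
qed

lemma CS0_ok: "cs : CS0 ==> ALL c : set cs. cmd_ok 30 c" unfolding CS0_def insert_iff empty_iff
 by (elim disjE) (auto simp: cpy_def eqs_def gss_def)

lemma CS_ok: "cs : CS ==> ALL c : set cs. cmd_ok 30 c" unfolding CS_def using CS0_ok local_ok by blast

lemma ed_sets: "ed q e q' cs a d ==> e : SB ==> q : QS & q' : QS & cs : CS"
proof (induction rule: ed.induct)
 case (lf q i a b q' a' di dw ds p e)
 hence "p : OPS" using Tr[OF lf(1)] by (cases p) (auto simp: OPS_def)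
 thus ?case using lf by (simp add: QS_def CS_def CS0_def)
next
 case (e2 e)
 hence "Push (e div 2) : OPS" by (auto simp: OPS_def SB_def)
 thus ?case by (simp add: QS_def CS_def CS0_def)
next
 case e3
 have "Pop : OPS" by (simp add: OPS_def)
 thus ?case by (simp add: QS_def CS_def CS0_def)
next
 case sg2
 have "Keep : OPS" by (simp add: OPS_def)
 thus ?case by (simp add: QS_def CS_def CS0_def)
next
 case sg3
 have "Pop : OPS" by (simp add: OPS_def)
 thus ?case by (simp add: QS_def CS_def CS0_def)
next
 case (l1 tr cs e)
 thus ?case by (auto simp add: QS_def CS_def CS0_def)
qed (simp_all add: QS_def CS_def CS0_def)

lemma ed_SB: "ed q e q' cs a d ==> e : SB ==> a : insert (e + 1) SB & (a = e + 1 --> even e \<or> a : SB)"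
 by (induction rule: ed.induct) (auto simp: SB_def)

lemma finite_E: "finite E"
proof -
 have "E <= (QS \<times> SB) \<times> (QS \<times> CS \<times> {..2 * nb + 1} \<times> UNIV)"
 proof
  fix t assume "t : E"
  then obtain q e q' cs a d where t: "t = ((q, e), (q', cs, a, d))" "ed q e q' cs a d" "e : SB"
   unfolding E_def by blast
  thus "t : (QS \<times> SB) \<times> (QS \<times> CS \<times> {..2 * nb + 1} \<times> UNIV)"
   using ed_sets[OF t(2,3)] ed_SB[OF t(2,3)] by (auto simp: SB_def)
 qed
 thus ?thesis by (rule finite_subset) (simp add: finite_QS finite_CS SB_def)
qed

sublocale aprog E kdp 30 PIni QS
proof
 show "finite E" by (rule finite_E)
 show "finite QS" by (rule finite_QS)
 show "PIni : QS" by (simp add: QS_def)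
 show "(ALL c : set cs. cmd_ok 30 c) & q : QS & q' : QS" if "((q, e), (q', cs, a, d)) : E" for q e q' cs a d
  using that ed_sets[of q e q' cs a d] CS_ok unfolding E_def by blast
 show "distinct qs & qs ~= [] & set qs <= QS" if "q : QS" "kdp q = KU qs" for q qs
  using that by (cases q) (auto simp: QS_def)
 show "j < 30" if "q : QS" "kdp q = KI j l" for q j l using that by (cases q) auto
 show "j < 30" if "q : QS" "kdp q = KS j b" for q j b using that by (cases q) auto
qed simp

section \<open>Soundness of the alternating program\<close>

context
 fixes x :: "'a list"
begin

abbreviation "n \<equiv> length x"
abbreviation "S \<equiv> sstep Tr x"
abbreviation "en \<equiv> enc nb n"
abbreviation "encs \<equiv> encS nb n"

text \<open>Guessed slots may contain numbers that encode no configuration. The claim is therefore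
  conditional on slot \<open>i\<close> and asserts in return that slot \<open>j\<close> encodes
  something; this composes along a run.\<close>

definition segc :: "(nat => nat) => nat => nat => nat list => bool" where
 "segc v i j st = (ALL s. en v i s --> (EX s'. en v j s' & S^** (s, st) (s', st)))"

text \<open>The return path is again conditional on slot \<open>l\<close>: that this slot encodes a
  configuration follows only from the segment on top of the context, which another branch
  verifies.\<close>

definition ctxc :: "(nat => nat) => nat => nat => nat => nat => nat list => nat list => bool" where
 "ctxc v i j k l st w = (ALL s. en v i s --> (EX c. en v k c & S^** (s, st) (c, st @ w) &
   (ALL d. en v l d --> (EX s'. en v j s' & S^** (d, st @ w) (s', st)))))"

definition opc :: "stack_op => (nat => nat) => nat => nat => nat list => bool" where
 "opc p v i j st = (ALL s. en v i s --> (EX s'. en v j s' & S (s, st) (s', stack_apply p st)))"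

text \<open>What the register branch \<open>PL1\<close> can guarantee. The input symbol is a
  hypothesis, and the stack symbol does not occur; \<open>PL2\<close> and \<open>PL3\<close> check
  these two.\<close>

fun tr_ok :: "'a tr => (nat => nat) => bool" where
 "tr_ok ((q, i, a, b), (q', a', di, dw, ds, p)) v = (ALL q0 ip tp sp. en v 0 (q0, ip, tp, sp) -->
   input_cell x ip = i --> q0 = q & scan tp = a & en v 1 (q', input_shift x di ip, write_move a' dw tp, shift ds sp))"

abbreviation "on1 f h X \<equiv> ALL st. rep2 f st --> h = length st --> X st"

abbreviation "onp f h X \<equiv> ALL st a. rep2 f (st @ [a]) --> h = Suc (length st) --> X st a"

abbreviation "un2 f X \<equiv> ALL st w. rep2 f (st @ w) --> w ~= [] --> flag f (length st) (length (st @ w)) --> X st w"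

abbreviation "on2 f h X \<equiv> un2 f (%st w. h = length (st @ w) --> X st w)"

abbreviation "un3 f X \<equiv> ALL st w u. rep2 f (st @ w @ u) --> w ~= [] --> u ~= [] -->
 flag f (length st) (length (st @ w)) --> flag f (length (st @ w)) (length (st @ w @ u)) --> X st w u"

text \<open>What acceptance from a state means, by which soundness is proved.\<close>

fun mng :: "'a ps => (nat => nat) => (nat => nat) => nat => bool" where
 "mng PIni v f h = (v = (%_. 0) --> f = (%_. 0) --> h = 0 -->
   (EX ip tp sp. S^** ((start, 0, blank_tape, 0), []) ((fs, ip, tp, sp), [])))"
| "mng PSg v f h = on1 f h (%st. segc v 0 1 st)"
| "mng PAcc v f h = True"
| "mng (PLf p) v f h = on1 f h (%st. opc p v 0 1 st)"
| "mng PUS v f h = on1 f h (%st. segc v 0 1 st)"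
| "mng PS1 v f h = on1 f h (%st. segc v 0 4 st)"
| "mng PS2 v f h = on1 f h (%st. segc v 4 1 st)"
| "mng PW1 v f h = (ALL st. rep2 f st --> h = Suc (length st) --> segc v 0 1 st)"
| "mng PW2 v f h = on2 f h (%st w. segc v 0 1 st)"
| "mng PW3 v f h = un2 f (%st w. h = Suc (length (st @ w)) --> segc v 0 1 st)"
| "mng PUO v f h = on2 f h (%st w. segc v 0 1 st)"
| "mng PO v f h = on1 f h (%st. segc v 2 3 st)"
| "mng PCx v f h = on2 f h (%st w. ctxc v 0 1 2 3 st w)"
| "mng PUE v f h = onp f h (%st a. ctxc v 0 1 2 3 st [a])"
| "mng PE1 v f h = onp f h (%st a. segc v 0 4 st)"
| "mng PE2 v f h = onp f h (%st a. opc (Push a) v 4 2 st)"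
| "mng PE3 v f h = onp f h (%st a. opc Pop v 3 5 (st @ [a]))"
| "mng PE4 v f h = onp f h (%st a. segc v 5 1 st)"
| "mng PK0 v f h = un2 f (%st w. length st < h --> h <= length (st @ w) --> ctxc v 0 1 2 3 st w)"
| "mng PK1 v f h = un3 f (%st w u. 0 < h --> h <= Suc (length (st @ w @ u)) --> ctxc v 0 1 2 3 st (w @ u))"
| "mng PUK v f h = un3 f (%st w u. h = length (st @ w @ u) --> ctxc v 0 1 2 3 st (w @ u))"
| "mng PK2 v f h = un3 f (%st w u. h = length (st @ w @ u) --> ctxc v 0 1 4 5 st w)"
| "mng PK3 v f h = on2 f h (%st w. ctxc v 4 5 2 3 st w)"
| "mng PK4 v f h = un3 f (%st w u. h = length (st @ w @ u) --> ctxc v 0 1 2 3 st w)"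
| "mng (PUL tr) v f h = (tr : Tr --> (ALL st. rep2 f st --> h = length st -->
   opc (snd (snd (snd (snd (snd (snd tr)))))) v 0 1 st))"
| "mng (PL1 tr) v f h = (tr : Tr --> tr_ok tr v)"
| "mng (PL2 tr) v f h = (ALL q ip tp sp. en v 0 (q, ip, tp, sp) --> input_cell x ip = fst (snd (fst tr)))"
| "mng (PL3 tr) v f h = (ALL q ip tp sp st. rep2 f st --> h = length st --> en v 0 (q, ip, tp, sp) -->
   stack_scan st sp = (case tr of ((q, i, a, b), _) => b))"
| "mng (PIn l) v f h = (letter_at x (v 1) = l)"

lemma segc_cpy: "segc (upd v k (%i. v (5 * m + i))) i j st = segc v (if i = k then m else i) (if j = k then m else j) st"
 by (auto simp: segc_def enc_upd_cpy)

lemma opc_cpy: "opc p (upd v k (%i. v (5 * m + i))) i j st = opc p v (if i = k then m else i) (if j = k then m else j) st"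
 by (auto simp: opc_def enc_upd_cpy)

lemma ctxc_cpy: "ctxc (upd v k' (%i. v (5 * m + i))) i j k l st w = ctxc v (if i = k' then m else i) (if j = k' then m else j) (if k = k' then m else k) (if l = k' then m else l) st w"
 by (auto simp: ctxc_def enc_upd_cpy)

lemma segc_gss: "i ~= k ==> j ~= k ==> segc (upd v k g) i j st = segc v i j st" by (auto simp: segc_def)

lemma ctxc_gss: "i ~= k' ==> j ~= k' ==> k ~= k' ==> l ~= k' ==> ctxc (upd v k' g) i j k l st w = ctxc v i j k l st w"
 by (auto simp: ctxc_def)

lemma segc_trans: "segc v i k st ==> segc v k j st ==> segc v i j st" unfolding segc_def by (meson rtranclp_trans)

lemma ctxc_seg:
 assumes "ctxc v i j k l st w" "segc v k l (st @ w)"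
 shows "segc v i j st" unfolding segc_def
proof (intro allI impI, goal_cases)
 case (1 s)
 then obtain c where c: "en v k c" "S^** (s, st) (c, st @ w)"
  "ALL d. en v l d --> (EX s'. en v j s' & S^** (d, st @ w) (s', st))" using assms(1) unfolding ctxc_def by blast
 obtain d where d: "en v l d" "S^** (c, st @ w) (d, st @ w)" using assms(2) c(1) unfolding segc_def by blast
 obtain s' where "en v j s'" "S^** (d, st @ w) (s', st)" using c(3) d(1) by blast
 thus ?case using c(2) d(2) by (meson rtranclp_trans)
qed

lemma ctxc_append:
 assumes "ctxc v i j k l st w" "ctxc v k l k' l' (st @ w) u"
 shows "ctxc v i j k' l' st (w @ u)" unfolding ctxc_def
proof (intro allI impI, goal_cases)
 case (1 s)
 then obtain c where c: "en v k c" "S^** (s, st) (c, st @ w)"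
  "ALL d. en v l d --> (EX s'. en v j s' & S^** (d, st @ w) (s', st))" using assms(1) unfolding ctxc_def by blast
 obtain c' where c': "en v k' c'" "S^** (c, st @ w) (c', (st @ w) @ u)"
  "ALL d. en v l' d --> (EX s'. en v l s' & S^** (d, (st @ w) @ u) (s', st @ w))"
  using assms(2) c(1) unfolding ctxc_def by blast
 have *: "EX s'. en v j s' & S^** (d, (st @ w) @ u) (s', st)" if "en v l' d" for d
  using c'(3) c(3) that by (meson rtranclp_trans)
 show ?case
 proof (rule exI[of _ c'], intro conjI allI impI)
  show "en v k' c'" by (rule c'(1))
  show "S^** (s, st) (c', st @ w @ u)" using rtranclp_trans[OF c(2) c'(2)] by simp
  show "EX s'. en v j s' & S^** (d, st @ w @ u) (s', st)" if "en v l' d" for d using that * by simp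
 qed
qed

lemma ctxc_one:
 assumes "segc v 0 4 st" "opc (Push a) v 4 2 st" "opc Pop v 3 5 (st @ [a])" "segc v 5 1 st"
 shows "ctxc v 0 1 2 3 st [a]" unfolding ctxc_def
proof (intro allI impI, goal_cases)
 case (1 s)
 then obtain r where r: "en v 4 r" "S^** (s, st) (r, st)" using assms(1) unfolding segc_def by blast
 then obtain c where "en v 2 c" "S (r, st) (c, stack_apply (Push a) st)" using assms(2) unfolding opc_def by blast
 hence c: "en v 2 c" "S (r, st) (c, st @ [a])" by simp_all
 have "EX s'. en v 1 s' & S^** (d, st @ [a]) (s', st)" if d: "en v 3 d" for d
 proof -
  obtain r' where "en v 5 r'" "S (d, st @ [a]) (r', stack_apply Pop (st @ [a]))"
   using assms(3) d unfolding opc_def by blast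
  hence r': "en v 5 r'" "S (d, st @ [a]) (r', st)" by simp_all
  then obtain s' where "en v 1 s'" "S^** (r', st) (s', st)" using assms(4) unfolding segc_def by blast
  thus ?thesis using r'(2) by (meson converse_rtranclp_into_rtranclp)
 qed
 thus ?case using r(2) c by (meson rtranclp.rtrancl_into_rtrancl)
qed

lemma local_sound:
 assumes "cs : local nb ((q, i, a, b), (q', a', di, dw, ds, p))" "((q, i, a, b), (q', a', di, dw, ds, p)) : Tr"
  "rseq cap cs v v'"
 shows "tr_ok ((q, i, a, b), (q', a', di, dw, ds, p)) v" unfolding tr_ok.simps
proof (intro allI impI, goal_cases)
 case s: (1 q0 ip tp sp)
 obtain cs1 cs2 where cs: "cs1 : shc 2 ds" "cs2 : tcm 3 4 nb a a' dw"
  "cs = [ise 0 q, cst 0 q'] @ ipc 1 i di @ cs1 @ cs2 @ eqs 0 1" using assms(1) by auto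
 obtain v1 v2 v3 where r: "v 0 = q" "rseq cap (ipc 1 i di) (v(0 := q')) v1" "rseq cap cs1 v1 v2" "rseq cap cs2 v2 v3"
  "rseq cap (eqs 0 1) v3 v'" using assms(3) unfolding cs(3) by (auto simp: rseq_append)
 have e: "v 0 = q0" "v 1 = ip" "v 2 = sp" "trep nb tp (v 3) (v 4)" "ip <= Suc n"
  using s(1) by (auto simp: enc_def encS_def eval_nat_numeral)
 have v1: "v1 = (v(0 := q'))(1 := input_shift x di ip)"
  using ipc_sound[where x = x and u = 1 and v = "v(0 := q')" and cap = cap and d = di and v' = v1] r(2) e(2,5) s(2) by simp
 have v2: "v2 = v1(2 := shift ds sp)" using shc_sound[OF cs(1) r(3)] v1 e(3) by simp
 have t: "a = scan tp & trep nb (write_move a' dw tp) (v3 3) (v3 4) & (ALL i. i ~= 3 --> i ~= 4 --> v3 i = v2 i)"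
  by (rule tcm_sound[OF _ cs(2) _ _ _ r(4)]) (use e(4) v1 v2 Tr[OF assms(2)] in auto)
 have 3: "encs v3 (q', input_shift x di ip, write_move a' dw tp, shift ds sp)"
  unfolding encS_def using t v1 v2 input_shift_le[of x di ip] by auto
 have "ALL i < 5. v3 i = v3 (5 + i)" using r(5) by (simp add: rseq_eqs)
 moreover have "ALL i < 5. v3 (5 + i) = v (5 + i)" using t v1 v2 by auto
 ultimately have "encs (%i. v (5 * 1 + i)) (q', input_shift x di ip, write_move a' dw tp, shift ds sp)"
  using 3 by (subst encS_cong[of _ v3]) auto
 thus ?case using t e r(1) by (auto simp: enc_def)
qed

lemma tr_ok_opc:
 assumes "tr : Tr" "tr_ok tr v" "mng (PL2 tr) v f h" "mng (PL3 tr) v f h" "rep2 f st" "h = length st"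
 shows "opc (snd (snd (snd (snd (snd (snd tr)))))) v 0 1 st" unfolding opc_def
proof (intro allI impI, goal_cases)
 case s: (1 s)
 obtain q0 ip tp sp where s': "s = (q0, ip, tp, sp)" by (metis surj_pair)
 obtain q i a b q' a' di dw ds p where tr: "tr = ((q, i, a, b), (q', a', di, dw, ds, p))" by (metis surj_pair)
 have 1: "input_cell x ip = i" "stack_scan st sp = b" using assms(3)[unfolded mng.simps, rule_format, of q0 ip tp sp]
   assms(4)[unfolded mng.simps, rule_format, of st q0 ip tp sp] assms(5,6) s s' tr by simp_all
 hence 2: "q0 = q" "scan tp = a" "en v 1 (q', input_shift x di ip, write_move a' dw tp, shift ds sp)"
  using assms(2)[unfolded tr tr_ok.simps, rule_format, of q0 ip tp sp] s s' by simp_all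
 hence "S (s, st) ((q', input_shift x di ip, write_move a' dw tp, shift ds sp), stack_apply p st)"
  using assms(1) 1 unfolding tr s' by (intro sstep.intros) simp
 thus ?case using 2(3) tr by (auto simp del: split_paired_Ex)
qed

lemma init_enc: "en (%i. if i = 0 then start else 0) 0 (start, 0, blank_tape, 0)"
 using trep_blank[of nb] nb by (auto simp: enc_def encS_def)

lemma segc_refl:
 assumes "ALL i < 5. v (5 * j + i) = v (5 * k + i)"
 shows "segc v j k st" unfolding segc_def enc_def using encS_cong[OF assms] by blast

lemma cpy_rules:
 assumes "rseq cap (cpy k m) v v'" "k ~= m"
 shows "segc v' i j st = segc v (if i = k then m else i) (if j = k then m else j) st"
  "opc p v' i j st = opc p v (if i = k then m else i) (if j = k then m else j) st"
  "ctxc v' i j k' l st w = ctxc v (if i = k then m else i) (if j = k then m else j) (if k' = k then m else k') (if l = k then m else l) st w"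
 using assms(1) unfolding rseq_cpy[OF assms(2)] by (simp_all only: segc_cpy opc_cpy ctxc_cpy)

lemma gss_rules:
 assumes "rseq cap (gss k) v v'"
 shows "i ~= k ==> j ~= k ==> segc v' i j st = segc v i j st"
  "i ~= k ==> j ~= k ==> k' ~= k ==> l ~= k ==> ctxc v' i j k' l st w = ctxc v i j k' l st w"
 using assms unfolding rseq_gss by (auto simp: segc_gss ctxc_gss)

lemma flag_snoc: "flag f m k ==> even e ==> m < k ==> flag (f(Suc k := e)) m (Suc k)"
 by (auto simp: flag_def less_Suc_eq)

lemma flag_top: "flag f m k ==> m < k ==> odd (f k) ==> k = Suc m"
 unfolding flag_def by (metis Suc_lessE lessI not_less_eq less_antisym)

lemma flag_restrict: "flag f m k ==> k' <= k ==> k' < i ==> m < k' ==> flag (f(i := e)) m k'" by (auto simp: flag_def)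

lemma opc_seg: "opc p v i j st ==> stack_apply p st = st ==> segc v i j st"
 unfolding opc_def segc_def by (metis r_into_rtranclp)

lemma ed_sound:
 assumes "ed q e q' cs a d" "rseq cap cs v v'" "mng q' v' (f(h := a)) (shift d h)" "f h = e"
 shows "mng q v f h" using assms
proof (induction rule: ed.induct)
 case ini
 obtain g where v': "v' = upd (v(0 := start)) 1 g" "v' 5 = fs" using ini(1) by (auto simp: rseq_append rseq_gss)
 show ?case unfolding mng.simps
 proof (intro impI)
  assume *: "v = (%_. 0)" "f = (%_. 0)" "h = 0"
  have "segc v' 0 1 []" using ini(2) * by (simp add: rep2_def)
  moreover have "en v' 0 (start, 0, blank_tape, 0)"
  proof -
   have "v(0 := start) = (%i. if i = 0 then start else 0)" using * by auto
   thus ?thesis using init_enc unfolding v' by simp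
  qed
  ultimately obtain s' where s': "en v' 1 s'" "S^** ((start, 0, blank_tape, 0), []) (s', [])"
   unfolding segc_def by blast
  obtain q ip tp sp where s: "s' = (q, ip, tp, sp)" by (metis surj_pair)
  hence "q = fs" using s'(1) v'(2) by (simp add: enc_def encS_def)
  thus "EX ip tp sp. S^** ((start, 0, blank_tape, 0), []) ((fs, ip, tp, sp), [])" using s s'(2) by blast
 qed
next
 case (sg1 e)
 hence "ALL i < 5. v (5 * 0 + i) = v (5 * 1 + i)" unfolding rseq_eqs by blast
 thus ?case using segc_refl by simp
next
 case (sg2 e)
 hence "mng (PLf Keep) v f h" by (simp add: fun_upd_idem)
 thus ?case unfolding mng.simps using opc_seg[of Keep v 0 1] by simp
next
 case sg3
 hence *: "mng (PLf Pop) v f h" by (simp add: fun_upd_idem)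
 show ?case unfolding mng.simps
 proof (intro allI impI, goal_cases)
  case st: (1 st)
  hence "st = []" using rep2_top sg3(3) by blast
  thus ?case using * st opc_seg[of Pop v 0 1 st] by simp
 qed
next
 case (sg4 e)
 thus ?case using gss_rules(1)[OF sg4(1)] by (simp add: fun_upd_idem)
next
 case (sg5 e)
 then obtain v1 where v1: "rseq cap (gss 2) v v1" "rseq cap (gss 3) v1 v'" unfolding rseq_append by blast
 show ?case using sg5(2,3) gss_rules(1)[OF v1(1)] gss_rules(1)[OF v1(2)] by (simp add: fun_upd_idem)
next
 case (s1 e)
 thus ?case using cpy_rules(1)[OF s1(1)] by (simp add: fun_upd_idem)
next
 case (s2 e)
 thus ?case using cpy_rules(1)[OF s2(1)] by (simp add: fun_upd_idem)
next
 case (w1 a)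
 show ?case unfolding mng.simps
 proof (intro allI impI, goal_cases)
  case st: (1 st)
  have r: "rep2 (f(h := 2 * a + 1)) (st @ [a])" unfolding st(2) by (rule rep2_push) (use st w1 in auto)
  moreover have "flag (f(h := 2 * a + 1)) (length st) (length (st @ [a]))" unfolding st(2) by (auto simp: flag_def)
  ultimately show ?case using w1(4) st(2) w1(3) unfolding mng.simps
   by (metis rseq.simps(1) shift.simps(2) length_append_singleton list.distinct(1))
 qed
next
 case (w2 e)
 thus ?case by (simp add: fun_upd_idem)
next
 case (w2' e)
 thus ?case by (simp add: fun_upd_idem)
next
 case (w3 a)
 show ?case unfolding mng.simps
 proof (intro allI impI, goal_cases)
  case st: (1 st w)
  have r: "rep2 (f(h := 2 * a)) ((st @ w) @ [a])" unfolding st(4) by (rule rep2_push) (use st w3 in auto)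
  moreover have "flag (f(h := 2 * a)) (length st) (Suc (length (st @ w)))"
   unfolding st(4) by (rule flag_snoc) (use st in auto)
  ultimately show ?case using w3(4)[unfolded mng.simps, rule_format, of st "w @ [a]"] st(4) w3(3) by simp
 qed
next
 case (o e)
 then obtain v1 where v1: "rseq cap (cpy 0 2) v v1" "rseq cap (cpy 1 3) v1 v'" unfolding rseq_append by blast
 show ?case using o(2,3) cpy_rules(1)[OF v1(1)] cpy_rules(1)[OF v1(2)] by (simp add: fun_upd_idem)
next
 case (cx1 e)
 then obtain v1 where v1: "rseq cap (gss 4) v v1" "rseq cap (gss 5) v1 v'" unfolding rseq_append by blast
 have f: "f(h := e) = f" using cx1 by (simp add: fun_upd_idem)
 show ?case unfolding mng.simps
 proof (intro allI impI, goal_cases)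
  case st: (1 st w)
  \<comment> \<open>The top letter is flagged and it carries the last flag of the context, so the
    context consists of a single letter.\<close>
  have "length (st @ w) = Suc (length st)" by (rule flag_top[OF st(3)]) (use st cx1 in auto)
  hence "length w = Suc 0" by simp
  then obtain a where a: "w = [a]" by (cases w) auto
  show ?case using cx1(3) st gss_rules(2)[OF v1(1)] gss_rules(2)[OF v1(2)] unfolding a f by simp
 qed
next
 case (cx2 e)
 then obtain v1 where v1: "rseq cap (gss 4) v v1" "rseq cap (gss 5) v1 v'" unfolding rseq_append by blast
 show ?case using cx2(2,3) gss_rules(2)[OF v1(1)] gss_rules(2)[OF v1(2)] by (simp add: fun_upd_idem)
next
 case (e1 e)
 show ?case unfolding mng.simps
 proof (intro allI impI, goal_cases)
  case st: (1 st a)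
  have "segc v' 0 1 st" by (rule e1(2)[unfolded mng.simps, rule_format]) (use rep2_pop[OF st(1)] st(2) in simp_all)
  thus ?case using cpy_rules(1)[OF e1(1)] by simp
 qed
next
 case (e2 e)
 then obtain v1 where v1: "rseq cap (cpy 0 4) v v1" "rseq cap (cpy 1 2) v1 v'" unfolding rseq_append by blast
 show ?case unfolding mng.simps
 proof (intro allI impI, goal_cases)
  case st: (1 st a)
  have "e div 2 = a" using rep2_last[OF st(1)] e2(3) st(2) by simp
  moreover have "opc (Push (e div 2)) v' 0 1 st"
   by (rule e2(2)[unfolded mng.simps, rule_format]) (use rep2_pop[OF st(1)] st(2) in simp_all)
  ultimately show ?case using cpy_rules(2)[OF v1(1)] cpy_rules(2)[OF v1(2)] by simp
 qed
next
 case (e3 e)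
 then obtain v1 where v1: "rseq cap (cpy 0 3) v v1" "rseq cap (cpy 1 5) v1 v'" unfolding rseq_append by blast
 show ?case unfolding mng.simps
 proof (intro allI impI, goal_cases)
  case st: (1 st a)
  have "f(h := e) = f" using e3(3) by (simp add: fun_upd_idem)
  hence "opc Pop v' 0 1 (st @ [a])" using e3(2)[unfolded mng.simps, rule_format, of "st @ [a]"] st by simp
  thus ?case using cpy_rules(2)[OF v1(1)] cpy_rules(2)[OF v1(2)] by simp
 qed
next
 case (e4 e)
 show ?case unfolding mng.simps
 proof (intro allI impI, goal_cases)
  case st: (1 st a)
  have "segc v' 0 1 st" by (rule e4(2)[unfolded mng.simps, rule_format]) (use rep2_pop[OF st(1)] st(2) in simp_all)
  thus ?case using cpy_rules(1)[OF e4(1)] by simp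
 qed
next
 case (k0 e)
 show ?case unfolding mng.simps
 proof (intro allI impI, goal_cases)
  case st: (1 st w)
  \<comment> \<open>The lowest letter of the context is flagged, so walking down over an unflagged
    letter does not leave the context.\<close>
  have "h ~= Suc (length st)" using st(3) k0(1,5) by (auto simp: flag_def)
  hence "length st < h - 1" "h - 1 <= length (st @ w)" using st by auto
  thus ?case using k0(3-5) st unfolding mng.simps by (simp add: fun_upd_idem)
 qed
next
 case (k0' e)
 show ?case unfolding mng.simps
 proof (intro allI impI, goal_cases)
  case st: (1 st w)
  have "h ~= Suc (length st)" using st(3) k0'(1,5) by (auto simp: flag_def)
  hence h: "length st < h - 1" "Suc (h - 1) = h" using st by auto
  \<comment> \<open>The letter in cell \<open>h\<close> becomes the first letter of the upper part,
    so the lower part has \<open>k\<close> letters.\<close>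
  define k where "k = h - 1 - length st"
  have w: "w = take k w @ drop k w" by simp
  have k: "0 < k" "k < length w" "length st + k = h - 1" using h st(5) by (auto simp: k_def)
  have l: "length (st @ take k w) = h - 1" using k by simp
  have "rep2 (f(h := e + 1)) (st @ take k w @ drop k w)"
   unfolding append_take_drop_id using st(1) by (rule rep2_update) (use st k0' h in auto)
  moreover have "flag (f(h := e + 1)) (length st) (length (st @ take k w))"
   unfolding l using st(3) by (rule flag_restrict) (use st(5) h in auto)
  moreover have "flag (f(h := e + 1)) (length (st @ take k w)) (length (st @ take k w @ drop k w))"
   using st(3) h k0'(1) unfolding l by (auto simp: flag_def)
  moreover have "Suc h <= Suc (length (st @ take k w @ drop k w))" using st(5) by simp
  moreover have "v' = v" using k0'(3) by simp
  ultimately have "ctxc v 0 1 2 3 st (take k w @ drop k w)"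
   using k0'(4)[unfolded mng.simps shift.simps, rule_format, of st "take k w" "drop k w"] k
   by (simp only: zero_less_Suc take_eq_Nil drop_eq_Nil) fastforce
  thus ?case by simp
 qed
next
 case (k1 e)
 show ?case unfolding mng.simps
 proof (intro allI impI, goal_cases)
  case st: (1 st w u)
  have "h ~= Suc (length (st @ w @ u))" using st(1) k1(1,4) by (auto simp: rep2_def)
  moreover have "f(h := e) = f" "v' = v" using k1(2,4) by (simp_all add: fun_upd_idem)
  ultimately show ?case using k1(3)[unfolded mng.simps, rule_format, of st w u] st by simp
 qed
next
 case k1'
 show ?case unfolding mng.simps
 proof (intro allI impI, goal_cases)
  case st: (1 st w u)
  have "~ h <= length (st @ w @ u)" using rep2_nonzero[OF st(1,6)] k1'(3) by blast
  hence "h - 1 = length (st @ w @ u)" using st(7) by simp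
  moreover have "f(h := 0) = f" "v' = v" using k1'(1,3) by (simp_all add: fun_upd_idem)
  ultimately show ?case using k1'(2)[unfolded mng.simps, rule_format, of st w u] st by simp
 qed
next
 case (k2 e)
 then obtain v1 where v1: "rseq cap (cpy 2 4) v v1" "rseq cap (cpy 3 5) v1 v'" unfolding rseq_append by blast
 show ?case using k2(2,3) cpy_rules(3)[OF v1(1)] cpy_rules(3)[OF v1(2)] by (simp add: fun_upd_idem)
next
 case (k3 e)
 then obtain v1 where v1: "rseq cap (cpy 0 4) v v1" "rseq cap (cpy 1 5) v1 v'" unfolding rseq_append by blast
 show ?case using k3(2,3) cpy_rules(3)[OF v1(1)] cpy_rules(3)[OF v1(2)] by (simp add: fun_upd_idem)
next
 case (k4 e)
 show ?case unfolding mng.simps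
 proof (intro allI impI, goal_cases)
  case st: (1 st w u)
  obtain u' a where u: "u = u' @ [a]" using st(3) by (cases u rule: rev_cases) auto
  have h: "h = Suc (length (st @ w @ u'))" using st(6) u by simp
  have "u' ~= []"
  proof
   assume "u' = []"
   hence "h = Suc (length (st @ w))" using h by simp
   thus False using st(5) k4(1,5) by (auto simp: flag_def)
  qed
  moreover have "rep2 (f(h := 0)) (st @ w @ u')" unfolding h by (rule rep2_pop[where a = a]) (use st(1) u in simp)
  moreover have "flag (f(h := 0)) (length st) (length (st @ w))"
   using st(4) by (rule flag_restrict) (use st h in auto)
  moreover have "flag (f(h := 0)) (length (st @ w)) (length (st @ w @ u'))"
   using st(5) by (rule flag_restrict) (use u h `u' ~= []` in auto)
  moreover have "v' = v" using k4(3) by simp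
  ultimately show ?case using k4(4)[unfolded mng.simps, rule_format, of st w u'] st h by simp
 qed
next
 case (k4' e)
 show ?case unfolding mng.simps
 proof (intro allI impI, goal_cases)
  case st: (1 st w u)
  have "length (st @ w @ u) = Suc (length (st @ w))" by (rule flag_top[OF st(5)]) (use st k4' in auto)
  hence "length u = Suc 0" by simp
  then obtain a where u: "u = [a]" by (cases u) auto
  have h: "h = Suc (length (st @ w))" using st(6) u by simp
  have "rep2 (f(h := 0)) (st @ w)" unfolding h by (rule rep2_pop[where a = a]) (use st(1) u in simp)
  moreover have "flag (f(h := 0)) (length st) (length (st @ w))"
   using st(4) by (rule flag_restrict) (use st h in auto)
  moreover have "v' = v" using k4'(2) by simp
  ultimately show ?case using k4'(3)[unfolded mng.simps, rule_format, of st w] st h by simp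
 qed
next
 case (lf q i a b q' a' di dw ds p e)
 thus ?case by (simp add: fun_upd_idem)
next
 case (l1 tr cs e)
 obtain q i a b q' a' di dw ds p where tr: "tr = ((q, i, a, b), (q', a', di, dw, ds, p))" by (metis surj_pair)
 have "tr_ok tr v" unfolding tr by (rule local_sound) (use l1 tr in auto)
 thus ?case by simp
next
 case (l2 q a b r e)
 thus ?case by (auto simp: enc_def encS_def input_cell_def)
next
 case (l2' q y a b r e)
 then obtain k where k: "v 1 = Suc k" "v' = v(1 := k)" by auto
 hence "letter_at x k = Some y" using l2'(3) by simp
 thus ?case using k by (auto simp: enc_def encS_def input_cell_def letter_at_def split: if_splits)
next
 case (l2'' q a b r e)
 then obtain k where k: "v 1 = Suc k" "v' = v(1 := k)" by auto
 hence "letter_at x k = None" using l2''(3) by simp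
 thus ?case using k by (auto simp: enc_def encS_def input_cell_def letter_at_def split: if_splits)
qed

lemma macc_mng: "macc E kdp x L q v tp t z ==> mng q v (fst tp) (snd tp)"
proof (induction rule: macc.induct)
 case (acc q v tp)
 thus ?case by (cases q) auto
next
 case (edge q tp q' cs a d v v' t z)
 have "ed q (scan tp) q' cs a d" using edge(2) unfolding E_def by blast
 thus ?case by (rule ed_sound[OF _ edge(3)]) (use edge.IH[unfolded write_move_parts] in "simp_all only: scan_def")
next
 case (univ q qs zs v tp t)
 have *: "mng (qs ! i) v (fst tp) (snd tp)" if "i < length qs" for i using univ(3) that by blast
 show ?case
 proof (cases q)
  case PUS
  hence "mng PS1 v (fst tp) (snd tp)" "mng PS2 v (fst tp) (snd tp)"
   using univ(1) *[of 0] *[of 1] by (auto simp del: mng.simps)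
  thus ?thesis unfolding PUS mng.simps using segc_trans by blast
 next
  case PUO
  hence **: "mng PO v (fst tp) (snd tp)" "mng PCx v (fst tp) (snd tp)"
   using univ(1) *[of 0] *[of 1] by (auto simp del: mng.simps)
  show ?thesis unfolding PUO mng.simps
  proof (intro allI impI, goal_cases)
   case st: (1 st w)
   hence "ctxc v 0 1 2 3 st w" "segc v 2 3 (st @ w)" using ** unfolding mng.simps by blast+
   thus ?case by (rule ctxc_seg)
  qed
 next
  case PUE
  hence **: "mng PE1 v (fst tp) (snd tp)" "mng PE2 v (fst tp) (snd tp)" "mng PE3 v (fst tp) (snd tp)"
   "mng PE4 v (fst tp) (snd tp)" using univ(1) *[of 0] *[of 1] *[of 2] *[of 3] by (auto simp del: mng.simps)
  show ?thesis unfolding PUE mng.simps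
  proof (intro allI impI, goal_cases)
   case st: (1 st a)
   show ?case by (rule ctxc_one; rule **[unfolded mng.simps, rule_format]; rule st)
  qed
 next
  case PUK
  hence **: "mng PK2 v (fst tp) (snd tp)" "mng PK3 v (fst tp) (snd tp)"
   using univ(1) *[of 0] *[of 1] by (auto simp del: mng.simps)
  show ?thesis unfolding PUK mng.simps
  proof (intro allI impI, goal_cases)
   case st: (1 st w u)
   hence "ctxc v 0 1 4 5 st w" using **(1) unfolding mng.simps by blast
   moreover have "ctxc v 4 5 2 3 (st @ w) u" using **(2)[unfolded mng.simps, rule_format, of "st @ w" u] st by simp
   ultimately show ?case by (rule ctxc_append)
  qed
 next
  case (PUL tr)
  hence **: "mng (PL1 tr) v (fst tp) (snd tp)" "mng (PL2 tr) v (fst tp) (snd tp)" "mng (PL3 tr) v (fst tp) (snd tp)"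
   using univ(1) *[of 0] *[of 1] *[of 2] by (auto simp del: mng.simps)
  show ?thesis unfolding PUL mng.simps
  proof (intro allI impI, goal_cases)
   case (1 st)
   thus ?case using ** by (intro tr_ok_opc) simp_all
  qed
 qed (use univ in auto)
next
 case (inp q j l v tp)
 thus ?case by (cases q) auto
next
 case (stk q j b p0 tp v)
 then obtain tr where q: "q = PL3 tr" by (cases q) auto
 obtain q1 i a b1 r where tr: "tr = ((q1, i, a, b1), r)" by (metis surj_pair)
 have jb: "j = 2" "b = b1" using stk(1) q tr by auto
 show ?case unfolding q mng.simps
 proof (intro allI impI, goal_cases)
  case st: (1 q ip tq sp st)
  \<comment> \<open>The stack letters are nonzero, so walking down from the top the first blank is
    the one in cell 0.\<close>
  have "p0 = 0" using rep2_nonzero[OF st(1), of p0] stk(2,3) st(2) by auto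
  moreover have "v 2 = sp" using st(3) by (simp add: enc_def encS_def)
  ultimately show ?case using stk(5) rep2_scan[OF st(1), of sp] jb tr by simp
 qed
qed

lemma alt_sound:
 "macc E kdp x L PIni (%_. 0) blank_tape t z ==>
  EX ip tp sp. S^** ((start, 0, blank_tape, 0), []) ((fs, ip, tp, sp), [])"
 using macc_mng[of L PIni] by (simp add: blank_tape_def)

end

end

section \<open>Completeness of the alternating program\<close>

lemma ipc_length: "length (ipc u i d) <= 1" by (cases d) auto

lemma shc_length: "cs : shc u d ==> length cs <= 1" by (cases d) auto

lemma tcm_length: "cs : tcm l r b a a' d ==> length cs <= 4" by (cases d) auto

lemma butlast_neq: "butlast st ~= st @ [a]"
proof
 assume "butlast st = st @ [a]"
 hence "length (butlast st) = length (st @ [a])" by simp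
 thus False by simp
qed

lemma stack_apply_cases:
 "stack_apply p st = st ==> p = Keep \<or> p = Pop & st = []"
 "stack_apply p st = st @ [a] ==> p = Push a"
 "stack_apply p (st @ [a]) = st ==> p = Pop"
proof -
 show "p = Keep \<or> p = Pop & st = []" if "stack_apply p st = st"
 proof (cases p)
  case Pop
  hence "length (butlast st) = length st" using that by simp
  hence "length st - 1 = length st" by (simp only: length_butlast)
  thus ?thesis using Pop by (cases st) simp_all
 qed (use that in auto)
 show "p = Push a" if "stack_apply p st = st @ [a]" using that butlast_neq[of st a] by (cases p) auto
 show "p = Pop" if "stack_apply p (st @ [a]) = st"
 proof -
  have "length (stack_apply p (st @ [a])) = length st" using that by simp
  thus ?thesis by (cases p) auto
 qed
qed

context altp
begin

context
 fixes x :: "'a list" and L Hb :: nat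
begin

abbreviation "enn \<equiv> enc nb (length x)"

definition "mc q v f h t z = macc E kdp x L q v (f, h) t z"

text \<open>\<open>lam\<close> generously bounds the cost of one level: guessing or copying a
  constant number of slots and walking a constant number of times over at most \<open>L\<close>
  letters. \<open>ell\<close> does so for a leaf, where the stack tape is read at a position of up
  to \<open>Hb\<close>.\<close>

definition "lam = 200 * L + 200"

definition "ell = 60 * L + 60 + 6 * Hb"

context
 fixes kk :: nat and R :: "surf * nat list => surf * nat list => bool"
  and bd :: "surf => bool" and sy :: "nat => bool"
 assumes R_step: "R ((q, ip, tp, sp), st) c ==> sstep Tr x ((q, ip, tp, sp), st) c & sp <= Hb & length st <= Hb"
  and bd: "bd s ==> EX g. encS nb (length x) g s & (ALL i < 5. g i < 2 ^ L)"
  and sy: "sy a ==> 0 < a & a < nb"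
  and kk: "kk <= L"
begin

lemma mc_edge:
 assumes "ed q (f h) q' cs a d" "f h < 2 * nb" "kdp q = KE" "rseq (2 ^ L) cs v v'"
  "mc q' v' (f(h := a)) (shift d h) t z"
  "Suc (length cs * (2 * L + 3)) + t <= t'" "Suc (length cs * (2 * L + 3)) + z <= z'"
 shows "mc q v f h t' z'" unfolding mc_def
proof (rule macc.weaken[OF macc.edge[where kd = kdp and q = q and cs = cs and v' = v', OF assms(3) _ assms(4)] assms(6,7)])
 show "((q, scan (f, h)), (q', cs, a, d)) : E" using assms(1,2) unfolding E_def SB_def by auto
 show "macc E kdp x L q' v' (write_move a d (f, h)) t z" using assms(5) unfolding mc_def write_move_def by simp
qed

lemma mc_weaken: "mc q v f h t z ==> t <= t' ==> z <= z' ==> mc q v f h t' z'" unfolding mc_def by (rule macc.weaken)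

lemma mc_univ2:
 assumes "kdp q = KU [q1, q2]" "mc q1 v f h t z1" "mc q2 v f h t z2" "Suc t <= t'" "Suc (z1 + z2) <= z'"
 shows "mc q v f h t' z'"
proof -
 have "macc E kdp x L q v (f, h) (Suc t) (Suc (sum_list [z1, z2]))"
  by (rule macc.univ[where kd = kdp and q = q, OF assms(1)]) (use assms(2,3) in "auto simp: mc_def less_Suc_eq")
 thus ?thesis unfolding mc_def by (rule macc.weaken) (use assms in simp_all)
qed

lemma mc_univ3:
 assumes "kdp q = KU [q1, q2, q3]" "mc q1 v f h t z1" "mc q2 v f h t z2" "mc q3 v f h t z3"
  "Suc t <= t'" "Suc (z1 + z2 + z3) <= z'"
 shows "mc q v f h t' z'"
proof -
 have "macc E kdp x L q v (f, h) (Suc t) (Suc (sum_list [z1, z2, z3]))"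
  by (rule macc.univ[where kd = kdp and q = q, OF assms(1)]) (use assms(2-4) in "auto simp: mc_def less_Suc_eq")
 thus ?thesis unfolding mc_def by (rule macc.weaken) (use assms in simp_all)
qed

lemma mc_univ4:
 assumes "kdp q = KU [q1, q2, q3, q4]" "mc q1 v f h t z1" "mc q2 v f h t z2" "mc q3 v f h t z3" "mc q4 v f h t z4"
  "Suc t <= t'" "Suc (z1 + z2 + z3 + z4) <= z'"
 shows "mc q v f h t' z'"
proof -
 have "macc E kdp x L q v (f, h) (Suc t) (Suc (sum_list [z1, z2, z3, z4]))"
  by (rule macc.univ[where kd = kdp and q = q, OF assms(1)]) (use assms(2-5) in "auto simp: mc_def less_Suc_eq")
 thus ?thesis unfolding mc_def by (rule macc.weaken) (use assms in simp_all)
qed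

lemma mc_acc: "mc PAcc v f h 0 (Suc 0)"
 unfolding mc_def by (rule macc.acc[where kd = kdp and q = PAcc, unfolded One_nat_def]) simp

definition cpv :: "nat => nat => (nat => nat) => nat => nat" where
 "cpv k j v = upd v k (%i. v (5 * j + i))"

lemma enc_cpv [simp]: "enc b N (cpv k j v) m s = enc b N v (if m = k then j else m) s"
 by (simp add: cpv_def enc_upd_cpy)

lemma cpv_cap [simp]: "ALL i. v i < (cap::nat) ==> ALL i. cpv k j v i < cap" by (simp add: cpv_def upd_def)

lemma rseq_cpv: "k ~= j ==> ALL i. v i < cap ==> rseq cap (cpy k j) v (cpv k j v)" by (simp add: rseq_cpy cpv_def)

lemma rseq_cpv2: "k ~= j ==> k' ~= j' ==> ALL i. v i < cap ==>
  rseq cap (cpy k j @ cpy k' j') v (cpv k' j' (cpv k j v))" unfolding rseq_append using rseq_cpv cpv_cap by blast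

lemma rseq_gss2: "ALL i < 5. g i < cap ==> ALL i < 5. g' i < cap ==>
  rseq cap (gss k @ gss k') v (upd (upd v k g) k' g')" unfolding rseq_append rseq_gss by blast

lemma upd_cap: "ALL i. v i < cap ==> ALL i < 5. g i < (cap::nat) ==> ALL i. upd v k g i < cap" by (auto simp: upd_def)

text \<open>Slot 0 is advanced in place and then compared with slot 1. The comparison succeeds
  because a surface configuration is represented by only one tuple of numbers.\<close>

lemma local_complete:
 assumes tr: "((q, input_cell x ip, scan tp, b), (q', a', di, dw, ds, p)) : Tr"
  and v: "ALL i. v i < 2 ^ L" "enn v 0 (q, ip, tp, sp)"
   "enn v 1 (q', input_shift x di ip, write_move a' dw tp, shift ds sp)"
 shows "EX cs v'. cs : local nb ((q, input_cell x ip, scan tp, b), (q', a', di, dw, ds, p)) & rseq (2 ^ L) cs v v' & length cs <= 13"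
proof -
 let ?cap = "2 ^ L :: nat"
 have 0: "v 0 = q" "v 1 = ip" "v 2 = sp" "trep nb tp (v 3) (v 4)" "ip <= Suc (length x)"
  using v(2) by (auto simp: enc_def encS_def eval_nat_numeral)
 have 1: "v 5 = q'" "v 6 = input_shift x di ip" "v 7 = shift ds sp" "trep nb (write_move a' dw tp) (v 8) (v 9)"
  using v(3) by (simp_all add: enc_def encS_def)
 define v1 where "v1 = v(0 := q')"
 have r1: "rseq ?cap [ise 0 q, cst 0 q'] v v1" using 0(1) 1(1) v(1)[rule_format, of 5] by (simp add: v1_def)
 define v2 where "v2 = v1(1 := input_shift x di ip)"
 have r2: "rseq ?cap (ipc 1 (input_cell x ip) di) v1 v2"
  using ipc_iff[where v = v1 and u = 1 and x = x and d = di and cap = ?cap and v' = v2] 0 1(2) v(1)[rule_format, of 6]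
  by (simp add: v1_def v2_def)
 define v3 where "v3 = v2(2 := shift ds sp)"
 have "EX cs : shc 2 ds. rseq ?cap cs v2 (v2(2 := shift ds (v2 2)))"
  by (rule shc_complete) (use 0 1(3) v(1)[rule_format, of 7] in "simp add: v1_def v2_def")
 then obtain cs1 where cs1: "cs1 : shc 2 ds" "rseq ?cap cs1 v2 v3" using 0 by (auto simp: v3_def v2_def v1_def)
 have "EX cs : tcm 3 4 nb (scan tp) a' dw. EX v'. rseq ?cap cs v3 v' & trep nb (write_move a' dw tp) (v' 3) (v' 4) &
  (ALL i. i ~= 3 --> i ~= 4 --> v' i = v3 i)"
 proof (rule tcm_complete)
  show "trep nb tp (v3 3) (v3 4)" using 0 by (simp add: v3_def v2_def v1_def)
  show "a' < nb" using Tr[OF tr] by simp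
  show "v3 3 < ?cap" "v3 4 < ?cap" using v(1) by (simp_all add: v3_def v2_def v1_def)
  show "l' < ?cap & r' < ?cap" if "trep nb (write_move a' dw tp) l' r'" for l' r'
   using trep_unique[OF that 1(4) nb] v(1) by simp
 qed simp_all
 then obtain cs2 v4 where cs2: "cs2 : tcm 3 4 nb (scan tp) a' dw" "rseq ?cap cs2 v3 v4"
  "trep nb (write_move a' dw tp) (v4 3) (v4 4)" "ALL i. i ~= 3 --> i ~= 4 --> v4 i = v3 i" by blast
 have "encS nb (length x) v4 (q', input_shift x di ip, write_move a' dw tp, shift ds sp)"
  using cs2 input_shift_le[of x di ip] by (simp add: encS_def v3_def v2_def v1_def)
 moreover have "encS nb (length x) (%i. v4 (5 + i)) (q', input_shift x di ip, write_move a' dw tp, shift ds sp)"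
  using cs2 input_shift_le[of x di ip] 1 by (simp add: encS_def v3_def v2_def v1_def)
 ultimately have "ALL i < 5. v4 i = v4 (5 + i)" using encS_unique nb by blast
 hence r5: "rseq ?cap (eqs 0 1) v4 v4" by (simp add: rseq_eqs)
 let ?cs = "[ise 0 q, cst 0 q'] @ ipc 1 (input_cell x ip) di @ cs1 @ cs2 @ eqs 0 1"
 have "rseq ?cap ?cs v v4" using r1 r2 cs1(2) cs2(2) r5 unfolding rseq_append by blast
 moreover have "?cs : local nb ((q, input_cell x ip, scan tp, b), (q', a', di, dw, ds, p))"
  using cs1(1) cs2(1) by (auto intro!: image_eqI[of _ _ "(cs1, cs2)"])
 \<comment> \<open>At most 2 + 1 + 1 + 4 + 5 commands: the state, the input head, the stack head,
   the working tape and the final comparison.\<close>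
 moreover have "length ?cs <= 13"
  using shc_length[OF cs1(1)] tcm_length[OF cs2(1)] ipc_length[of 1 "input_cell x ip" di] by simp
 ultimately show ?thesis by blast
qed

text \<open>Only the stacks before and after the step are known, and \<open>Keep\<close> and
  \<open>Pop\<close> have the same effect on the empty stack. \<open>gd\<close> stands for what can
  be concluded about the operation from these stacks.\<close>

lemma leaf:
 assumes R: "R (p, st) (q, st')" and op: "!!o'. stack_apply o' st = st' ==> gd o'"
  and v: "ALL i. v i < 2 ^ L" "enn v 0 p" "enn v 1 q" "ALL i. f i < 2 * nb" "rep2 f st"
 shows "EX o'. gd o' & mc (PLf o') v f (length st) (30 * L + 50 + 6 * Hb) ell"
proof -
 obtain q0 ip tp sp where p: "p = (q0, ip, tp, sp)" by (metis surj_pair)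
 have s: "sstep Tr x ((q0, ip, tp, sp), st) (q, st')" "sp <= Hb" "length st <= Hb" using R_step R p by blast+
 from s(1) obtain q' a' di dw ds o' where
  tr: "((q0, input_cell x ip, scan tp, stack_scan st sp), (q', a', di, dw, ds, o')) : Tr"
  and q: "q = (q', input_shift x di ip, write_move a' dw tp, shift ds sp)" and st': "st' = stack_apply o' st"
  by (cases rule: sstep.cases) blast
 let ?tr = "((q0, input_cell x ip, scan tp, stack_scan st sp), (q', a', di, dw, ds, o'))"
 have fu: "f(h := f h) = f" for h by simp
 obtain cs v' where cs: "cs : local nb ?tr" "rseq (2 ^ L) cs v v'" "length cs <= 13"
  using local_complete[OF tr v(1)] v(2,3) p q by blast
 have len: "length cs * (2 * L + 3) <= 13 * (2 * L + 3)" using cs(3) by (rule mult_le_mono1)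
 have 1: "mc (PL1 ?tr) v f (length st) (26 * L + 40) (26 * L + 41)"
  by (rule mc_edge[OF ed.l1[OF tr cs(1)] _ _ cs(2), where t = 0 and z = 1]) (use v(4) len in "simp_all add: mc_acc")
 have e: "v 1 = ip" "v 2 = sp" using v(2) p by (auto simp: enc_def encS_def)
 have 2: "mc (PL2 ?tr) v f (length st) (3 * L + 7) (3 * L + 7)"
 proof (cases "input_cell x ip")
  case LeftEnd
  hence "ip = 0" by (simp add: input_cell_ends)
  hence r: "rseq (2 ^ L) [ise 1 0] v v" using e by simp
  have "ed (PL2 ?tr) (f (length st)) PAcc [ise 1 0] (f (length st)) Stay"
   using ed.l2[of q0 "scan tp" "stack_scan st sp"] tr LeftEnd by simp
  thus ?thesis by (rule mc_edge[OF _ _ _ r, where t = 0 and z = 1]) (use v(4) in "simp_all add: mc_acc")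
 next
  case (Letter y)
  hence ip: "0 < ip" "ip <= length x" "x ! (ip - 1) = y" by (auto simp: input_cell_def split: if_splits)
  have "ip - 1 < 2 ^ L" using v(1)[rule_format, of 1] e by simp
  hence r: "rseq (2 ^ L) [dvr 1 1 1] v (v(1 := ip - 1))" using e ip by (auto intro!: exI[of _ "ip - 1"])
  have "ed (PL2 ?tr) (f (length st)) (PIn (Some y)) [dvr 1 1 1] (f (length st)) Stay"
   using ed.l2'[of q0 y "scan tp" "stack_scan st sp"] tr Letter by simp
  moreover have "mc (PIn (Some y)) (v(1 := ip - 1)) f (length st) (L + 2) (L + 3)"
   unfolding mc_def by (rule macc.inp[of _ _ 1]) (use ip in "auto simp: letter_at_def")
  ultimately show ?thesis by (intro mc_edge[OF _ _ _ r, where t = "L + 2" and z = "L + 3"]) ((use v(4) in simp_all), simp_all?)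
 next
  case RightEnd
  hence ip: "0 < ip" "length x <= ip - 1" by (auto simp: input_cell_def split: if_splits)
  have "ip - 1 < 2 ^ L" using v(1)[rule_format, of 1] e by simp
  hence r: "rseq (2 ^ L) [dvr 1 1 1] v (v(1 := ip - 1))" using e ip by (auto intro!: exI[of _ "ip - 1"])
  have "ed (PL2 ?tr) (f (length st)) (PIn None) [dvr 1 1 1] (f (length st)) Stay"
   using ed.l2''[of q0 "scan tp" "stack_scan st sp"] tr RightEnd by simp
  moreover have "mc (PIn None) (v(1 := ip - 1)) f (length st) (L + 2) (L + 3)"
   unfolding mc_def by (rule macc.inp[of _ _ 1]) (use ip in "auto simp: letter_at_def")
  ultimately show ?thesis by (intro mc_edge[OF _ _ _ r, where t = "L + 2" and z = "L + 3"]) ((use v(4) in simp_all), simp_all?)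
 qed
 have "macc E kdp x L (PL3 ?tr) v (f, length st) (snd (f, length st) + 5 * v 2 + 3 * L + 5) (snd (f, length st) + 5 * v 2 + 3 * L + 6)"
 proof (rule macc.stk)
  show "kdp (PL3 ?tr) = KS 2 (stack_scan st sp)" by simp
  show "(0::nat) <= snd (f, length st)" by simp
  show "fst (f, length st) 0 = 0" using v(5) by (simp add: rep2_def)
  show "ALL i. 0 < i --> i <= snd (f, length st) --> fst (f, length st) i ~= 0" using rep2_nonzero[OF v(5)] by simp
  show "fst (f, length st) (0 + 1 + v 2) div 2 = stack_scan st sp" using rep2_scan[OF v(5), of sp] e by simp
 qed
 hence 3: "mc (PL3 ?tr) v f (length st) (6 * Hb + 3 * L + 5) (6 * Hb + 3 * L + 6)"
  unfolding mc_def by (rule macc.weaken) (use s e in simp_all)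
 have "mc (PUL ?tr) v f (length st) (6 * Hb + 30 * L + 48) (26 * L + 41 + (3 * L + 7) + (6 * Hb + 3 * L + 6) + 1)"
  by (rule mc_univ3[where t = "6 * Hb + 30 * L + 47"], simp, rule mc_weaken[OF 1], simp, rule order_refl,
    rule mc_weaken[OF 2], simp, rule order_refl, rule mc_weaken[OF 3], simp, rule order_refl) simp_all
 hence "mc (PLf o') v f (length st) (30 * L + 50 + 6 * Hb) ell"
  by (intro mc_edge[OF ed.lf[OF tr], where v' = v]) ((use v(4) in "simp_all add: ell_def"), simp_all?)
 thus ?thesis using op st' by blast
qed

text \<open>A derivation of depth \<open>t\<close> and size \<open>z\<close> costs
  \<open>lam\<close> for each level plus one leaf in depth, and at most \<open>lam + ell\<close> for
  each unit of size.\<close>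

definition okS :: "surf => surf => nat list => nat => nat => bool" where
 "okS p q st t z = (ALL v f. (ALL i. v i < 2 ^ L) --> (ALL i. f i < 2 * nb) --> rep2 f st -->
  enn v 0 p --> enn v 1 q --> mc PSg v f (length st) (t * lam + ell) (z * (lam + ell)))"

definition okC :: "nat list => nat list => surf => surf => surf => surf => nat => nat => bool" where
 "okC st w p q p' q' t z = (ALL v f. (ALL i. v i < 2 ^ L) --> (ALL i. f i < 2 * nb) --> rep2 f (st @ w) --> w ~= [] -->
  flag f (length st) (length (st @ w)) --> enn v 0 p --> enn v 1 q --> enn v 2 p' --> enn v 3 q' -->
  mc PCx v f (length (st @ w)) (t * lam + ell) (z * (lam + ell)))"

lemma ok_refl: "okS p p st 1 1" unfolding okS_def
proof (intro allI impI, goal_cases)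
 case v: (1 v f)
 have "ALL i < 5. v (5 * 0 + i) = v (5 * 1 + i)"
  by (rule encS_unique[of nb "length x" _ p]) (use v(4,5) nb in "simp_all only: enc_def")
 hence r: "rseq (2 ^ L) (eqs 0 1) v v" unfolding rseq_eqs by blast
 show ?case by (rule mc_edge[OF ed.sg1 _ _ r mc_acc]) (use v(2) in "simp_all add: lam_def")
qed

lemma ok_step:
 assumes "R (p, st) (q, st)"
 shows "okS p q st 1 1" unfolding okS_def
proof (intro allI impI, goal_cases)
 case v: (1 v f)
 obtain o' where o': "o' = Keep \<or> o' = Pop & st = []" "mc (PLf o') v f (length st) (30 * L + 50 + 6 * Hb) ell"
  using leaf[where gd = "%o'. o' = Keep \<or> o' = Pop & st = []", OF assms _ v(1,4,5,2,3)] stack_apply_cases(1) by blast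
 have "ed PSg (f (length st)) (PLf o') [] (f (length st)) Stay"
  using o'(1) ed.sg2[of "f (length st)"] ed.sg3 v(3) by (auto simp: rep2_def)
 thus ?case by (rule mc_edge[where v' = v]) ((use v(2) o'(2) in "simp_all add: lam_def ell_def"), simp_all?)
qed

lemma ok_split:
 assumes "okS p r st t z" "okS r q st t z'" "bd r"
 shows "okS p q st (Suc t) (Suc (z + z'))" unfolding okS_def
proof (intro allI impI, goal_cases)
 case v: (1 v f)
 obtain g where g: "encS nb (length x) g r" "ALL i < 5. g i < 2 ^ L" using bd[OF assms(3)] by blast
 define u where "u = upd v 4 g"
 have r: "rseq (2 ^ L) (gss 4) v u" unfolding rseq_gss u_def using g(2) by blast
 have u: "ALL i. u i < 2 ^ L" "enn u 0 p" "enn u 1 q" "enn u 4 r"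
  unfolding u_def using upd_cap[OF v(1) g(2)] v(4,5) g(1) by simp_all
 have "mc PSg (cpv 1 4 u) f (length st) (t * lam + ell) (z * (lam + ell))"
  using assms(1)[unfolded okS_def, rule_format, of "cpv 1 4 u" f] u v(2,3) by simp
 hence 1: "mc PS1 u f (length st) (Suc (5 * (2 * L + 3)) + (t * lam + ell)) (Suc (5 * (2 * L + 3)) + z * (lam + ell))"
  by (intro mc_edge[OF ed.s1 _ _ rseq_cpv]) ((use u v(2) in simp_all), simp_all?)
 have "mc PSg (cpv 0 4 u) f (length st) (t * lam + ell) (z' * (lam + ell))"
  using assms(2)[unfolded okS_def, rule_format, of "cpv 0 4 u" f] u v(2,3) by simp
 hence 2: "mc PS2 u f (length st) (Suc (5 * (2 * L + 3)) + (t * lam + ell)) (Suc (5 * (2 * L + 3)) + z' * (lam + ell))"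
  by (intro mc_edge[OF ed.s2 _ _ rseq_cpv]) ((use u v(2) in simp_all), simp_all?)
 have "mc PUS u f (length st) (Suc (Suc (5 * (2 * L + 3)) + (t * lam + ell)))
   (Suc ((Suc (5 * (2 * L + 3)) + z * (lam + ell)) + (Suc (5 * (2 * L + 3)) + z' * (lam + ell))))"
  by (rule mc_univ2[OF _ 1 2]) simp_all
 thus ?case by (intro mc_edge[OF ed.sg4 _ _ r])
   (use v(2) in "simp_all add: lam_def[symmetric] add_mult_distrib", simp_all add: lam_def)
qed

text \<open>\<open>w0\<close> has been written and \<open>u\<close> is still to come.
  \<open>w0\<close> is nonempty since the first letter, the only one to be flagged, is written
  separately.\<close>

lemma write_run:
 assumes fin: "!!f. rep2 f (st @ w) ==> flag f (length st) (length (st @ w)) ==> ALL i. f i < 2 * nb ==>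
   mc PUO v f (length (st @ w)) t z"
  and w: "ALL a : set w. sy a"
 shows "w0 @ u = w ==> w0 ~= [] ==> rep2 f (st @ w0) ==> flag f (length st) (length (st @ w0)) ==> ALL i. f i < 2 * nb ==>
   mc PW2 v f (length (st @ w0)) (2 * length u + 1 + t) (2 * length u + 1 + z)"
proof (induction u arbitrary: w0 f)
 case Nil
 hence "mc PUO v f (length (st @ w0)) t z" using fin[of f] by simp
 thus ?case by (intro mc_edge[OF ed.w2', where v' = v]) ((use Nil in simp_all), simp_all?)
next
 case (Cons a u)
 let ?h = "Suc (length (st @ w0))"
 define f' where "f' = f(?h := 2 * a)"
 have a: "0 < a" "a < nb" using sy w Cons.prems(1) by auto
 have r: "rep2 f' ((st @ w0) @ [a])" unfolding f'_def by (rule rep2_push) (use Cons.prems a in auto)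
 have fl: "flag f' (length st) ?h" unfolding f'_def by (rule flag_snoc) (use Cons.prems in auto)
 have b: "ALL i. f' i < 2 * nb" using Cons.prems a by (simp add: f'_def)
 have "mc PW2 v f' (length (st @ w0 @ [a])) (2 * length u + 1 + t) (2 * length u + 1 + z)"
  using Cons.IH[of "w0 @ [a]" f'] r fl b Cons.prems(1) by simp
 hence 3: "mc PW2 v f' ?h (2 * length u + 1 + t) (2 * length u + 1 + z)" by simp
 have "f ?h = 0" using Cons.prems(3) by (auto simp: rep2_def)
 hence "ed PW3 (f ?h) PW2 [] (2 * a) Stay" using ed.w3[OF a] by simp
 hence "mc PW3 v f ?h (2 * length u + 2 + t) (2 * length u + 2 + z)"
  by (rule mc_edge[where v' = v]) ((use 3 Cons.prems(5) in "simp_all add: f'_def"), simp_all?)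
 thus ?case by (intro mc_edge[OF ed.w2, where v' = v]) ((use Cons.prems(5) in simp_all), simp_all?)
qed

lemma ok_opn:
 assumes C: "okC st w p q p' q' t z" and S: "okS p' q' (st @ w) t z'"
  and w: "w ~= []" "length w <= kk" "ALL a : set w. sy a" and b: "bd p'" "bd q'"
 shows "okS p q st (Suc t) (Suc (z + z'))" unfolding okS_def
proof (intro allI impI, goal_cases)
 case v: (1 v f)
 obtain g where g: "encS nb (length x) g p'" "ALL i < 5. g i < 2 ^ L" using bd[OF b(1)] by blast
 obtain g' where g': "encS nb (length x) g' q'" "ALL i < 5. g' i < 2 ^ L" using bd[OF b(2)] by blast
 define u where "u = upd (upd v 2 g) 3 g'"
 have r: "rseq (2 ^ L) (gss 2 @ gss 3) v u" unfolding u_def by (rule rseq_gss2[OF g(2) g'(2)])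
 have u: "ALL i. u i < 2 ^ L" "enn u 0 p" "enn u 1 q" "enn u 2 p'" "enn u 3 q'"
  unfolding u_def using upd_cap[OF upd_cap[OF v(1) g(2)] g'(2)] v(4,5) g(1) g'(1) by simp_all
 let ?T = "20 * L + 32 + (t * lam + ell)" and ?Z = "20 * L + 32 + z * (lam + ell) + z' * (lam + ell)"
 have *: "mc PUO u f (length (st @ w)) ?T ?Z"
  if f: "rep2 f (st @ w)" "flag f (length st) (length (st @ w))" "ALL i. f i < 2 * nb" for f
 proof -
  have 1: "mc PCx u f (length (st @ w)) (t * lam + ell) (z * (lam + ell))"
   using C[unfolded okC_def, rule_format, of u f] u f w(1) by simp
  have "mc PSg (cpv 1 3 (cpv 0 2 u)) f (length (st @ w)) (t * lam + ell) (z' * (lam + ell))"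
   using S[unfolded okS_def, rule_format, of "cpv 1 3 (cpv 0 2 u)" f] u f by simp
  hence 2: "mc PO u f (length (st @ w)) (20 * L + 31 + (t * lam + ell)) (20 * L + 31 + z' * (lam + ell))"
   by (intro mc_edge[OF ed.o _ _ rseq_cpv2]) ((use u f(3) in simp_all), simp_all?)
  show ?thesis by (rule mc_univ2[OF _ 2 mc_weaken[OF 1 _ order_refl]]) simp_all
 qed
 obtain a w' where w': "w = a # w'" using w(1) by (cases w) auto
 have a: "0 < a" "a < nb" using sy w(3) w' by auto
 let ?h = "Suc (length st)"
 let ?f = "f(?h := 2 * a + 1)"
 have "mc PW2 u ?f (length (st @ [a])) (2 * length w' + 1 + ?T) (2 * length w' + 1 + ?Z)"
 proof (rule write_run[OF * w(3)])
  show "[a] @ w' = w" using w' by simp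
  show "rep2 ?f (st @ [a])" by (rule rep2_push) (use v(3) a in auto)
  show "flag ?f (length st) (length (st @ [a]))" by (auto simp: flag_def)
 qed (use v(2) a in auto)
 hence 2: "mc PW2 u ?f ?h (2 * length w' + 1 + ?T) (2 * length w' + 1 + ?Z)" by simp
 have "f ?h = 0" using v(3) by (auto simp: rep2_def)
 hence "ed PW1 (f ?h) PW2 [] (2 * a + 1) Stay" using ed.w1[OF a] by simp
 hence 1: "mc PW1 u f ?h (2 * length w' + 2 + ?T) (2 * length w' + 2 + ?Z)"
  by (rule mc_edge[where v' = u]) ((use 2 v(2) in simp_all), simp_all?)
 have "length w' <= L" using w(2) w' kk by simp
 thus ?case by (intro mc_edge[OF ed.sg5 _ _ r])
   (use v(2) 1 in "simp_all add: lam_def[symmetric] add_mult_distrib", simp_all add: lam_def)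
qed

lemma ok_one:
 assumes S1: "okS p r st t z" and R1: "R (r, st) (p', st @ [a])" and R2: "R (q', st @ [a]) (r', st)"
  and S2: "okS r' q st t z'" and b: "bd r" "bd r'"
 shows "okC st [a] p q p' q' (Suc t) (z + z' + 3)" unfolding okC_def
proof (intro allI impI, goal_cases)
 case v: (1 v f)
 obtain g where g: "encS nb (length x) g r" "ALL i < 5. g i < 2 ^ L" using bd[OF b(1)] by blast
 obtain g' where g': "encS nb (length x) g' r'" "ALL i < 5. g' i < 2 ^ L" using bd[OF b(2)] by blast
 define u where "u = upd (upd v 4 g) 5 g'"
 have ru: "rseq (2 ^ L) (gss 4 @ gss 5) v u" unfolding u_def by (rule rseq_gss2[OF g(2) g'(2)])
 have u: "ALL i. u i < 2 ^ L" "enn u 0 p" "enn u 1 q" "enn u 2 p'" "enn u 3 q'" "enn u 4 r" "enn u 5 r'"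
  unfolding u_def using upd_cap[OF upd_cap[OF v(1) g(2)] g'(2)] v(6-9) g(1) g'(1) by simp_all
 let ?h = "Suc (length st)"
 let ?f = "f(?h := 0)"
 have f: "rep2 ?f st" "ALL i. ?f i < 2 * nb" using rep2_pop[OF v(3)] v(2) nb by auto
 have e: "odd (f ?h)" "f ?h div 2 = a" using v(5) rep2_last[OF v(3)] by (auto simp: flag_def)
 let ?T = "20 * L + 31 + (t * lam + ell)"
 have "mc PSg (cpv 1 4 u) ?f (length st) (t * lam + ell) (z * (lam + ell))"
  using S1[unfolded okS_def, rule_format, of "cpv 1 4 u" ?f] u f by simp
 hence 1: "mc PE1 u f ?h ?T (10 * L + 16 + z * (lam + ell))"
  by (intro mc_edge[OF ed.e1 _ _ rseq_cpv]) ((use u v(2) in simp_all), simp_all?)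
 obtain o1 where "o1 = Push a" "mc (PLf o1) (cpv 1 2 (cpv 0 4 u)) ?f (length st) (30 * L + 50 + 6 * Hb) ell"
  using leaf[where v = "cpv 1 2 (cpv 0 4 u)" and f = ?f and gd = "%o'. o' = Push a", OF R1 stack_apply_cases(2)] u f by auto
 hence "mc (PLf (Push (f ?h div 2))) (cpv 1 2 (cpv 0 4 u)) ?f (length st) (30 * L + 50 + 6 * Hb) ell"
  using e(2) by simp
 hence 2: "mc PE2 u f ?h (20 * L + 31 + (30 * L + 50 + 6 * Hb)) (20 * L + 31 + ell)"
  by (intro mc_edge[OF ed.e2 _ _ rseq_cpv2]) ((use u v(2) in simp_all), simp_all?)
 obtain o2 where "o2 = Pop" "mc (PLf o2) (cpv 1 5 (cpv 0 3 u)) f (length (st @ [a])) (30 * L + 50 + 6 * Hb) ell"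
  using leaf[where v = "cpv 1 5 (cpv 0 3 u)" and f = f and gd = "%o'. o' = Pop", OF R2 stack_apply_cases(3)] u v(2,3) by auto
 hence 3: "mc PE3 u f ?h (20 * L + 31 + (30 * L + 50 + 6 * Hb)) (20 * L + 31 + ell)"
  by (intro mc_edge[OF ed.e3 _ _ rseq_cpv2]) ((use u v(2) in simp_all), simp_all?)
 have "mc PSg (cpv 0 5 u) ?f (length st) (t * lam + ell) (z' * (lam + ell))"
  using S2[unfolded okS_def, rule_format, of "cpv 0 5 u" ?f] u f by simp
 hence 4: "mc PE4 u f ?h ?T (10 * L + 16 + z' * (lam + ell))"
  by (intro mc_edge[OF ed.e4 _ _ rseq_cpv]) ((use u v(2) in simp_all), simp_all?)
 have T: "20 * L + 31 + (30 * L + 50 + 6 * Hb) <= ?T" if "20 * L + 31 + (30 * L + 50 + 6 * Hb) <= 20 * L + 31 + ell"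
  using that by simp
 have l: "30 * L + 50 + 6 * Hb <= ell" by (simp add: ell_def)
 have "mc PUE u f ?h (Suc ?T) (Suc ((10 * L + 16 + z * (lam + ell)) + (20 * L + 31 + ell) + (20 * L + 31 + ell) + (10 * L + 16 + z' * (lam + ell))))"
  by (rule mc_univ4[OF _ 1 mc_weaken[OF 2 _ order_refl] mc_weaken[OF 3 _ order_refl] 4]) (use l in simp_all)
 thus ?case unfolding length_append_singleton by (intro mc_edge[where f = f and h = ?h, OF ed.cx1[OF e(1)] _ _ ru])
   (use v(2) in "simp_all add: lam_def[symmetric] add_mult_distrib fun_upd_idem", simp_all add: lam_def)
qed

lemma down_run:
 assumes "mc PK0 v f h0 t z" "ALL i. f i < 2 * nb"
  and "ALL i. h0 < i --> i <= h0 + k --> even (f i) & f i ~= 0"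
 shows "mc PK0 v f (h0 + k) (k + t) (k + z)" using assms(3)
proof (induction k)
 case 0
 thus ?case using assms(1) by simp
next
 case (Suc k)
 hence "mc PK0 v f (h0 + k) (k + t) (k + z)" by simp
 moreover have "even (f (h0 + Suc k))" "f (h0 + Suc k) ~= 0" using Suc.prems by auto
 moreover have "shift Lft (h0 + Suc k) = h0 + k" by simp
 ultimately show ?case
  using mc_edge[OF ed.k0, of f "h0 + Suc k" v v "k + t" "k + z" "Suc k + t" "Suc k + z"] assms(2) by simp
qed

lemma up_run:
 assumes "mc PK1 v f (h + k) t z" "ALL i. f i < 2 * nb"
  and "ALL i. h <= i --> i < h + k --> f i ~= 0"
 shows "mc PK1 v f h (k + t) (k + z)" using assms(1,3)
proof (induction k arbitrary: h)
 case (Suc k)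
 have "mc PK1 v f (Suc h) (k + t) (k + z)" by (rule Suc.IH) (use Suc.prems in auto)
 moreover have "f h ~= 0" using Suc.prems by auto
 ultimately show ?case using mc_edge[OF ed.k1, of f h v v "k + t" "k + z" "Suc k + t" "Suc k + z"] assms(2) by simp
qed simp

lemma pop_run:
 assumes fin: "!!f. rep2 f (st @ w) ==> flag f (length st) (length (st @ w)) ==> ALL i. f i < 2 * nb ==>
   mc PCx v f (length (st @ w)) t z" and w: "w ~= []"
 shows "u ~= [] ==> rep2 f (st @ w @ u) ==> flag f (length st) (length (st @ w)) ==>
   flag f (length (st @ w)) (length (st @ w @ u)) ==> ALL i. f i < 2 * nb ==>
   mc PK4 v f (length (st @ w @ u)) (length u + t) (length u + z)"
proof (induction u arbitrary: f rule: rev_induct)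
 case (snoc a u)
 let ?h = "Suc (length (st @ w @ u))"
 define f' where "f' = f(?h := 0)"
 have r: "rep2 f' (st @ w @ u)" unfolding f'_def by (rule rep2_pop[where a = a]) (use snoc.prems in simp)
 have f1: "flag f' (length st) (length (st @ w))" unfolding f'_def using snoc.prems(3) by (rule flag_restrict) (use w in auto)
 have b: "ALL i. f' i < 2 * nb" using snoc.prems(5) nb by (auto simp: f'_def)
 have nz: "f ?h ~= 0" using rep2_nonzero[OF snoc.prems(2)] by simp
 show ?case
 proof (cases "u = []")
  case True
  have "odd (f ?h)" using snoc.prems(4) True by (auto simp: flag_def)
  moreover have "mc PCx v f' (length (st @ w)) t z" by (rule fin) (use r f1 b True in simp_all)
  ultimately show ?thesis by (intro mc_edge[OF ed.k4', where v' = v]) ((use snoc.prems(5) True in "simp_all add: f'_def"), simp_all?)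
 next
  case False
  have "flag f' (length (st @ w)) (length (st @ w @ u))" unfolding f'_def using snoc.prems(4) by (rule flag_restrict) (use False in auto)
  hence "mc PK4 v f' (length (st @ w @ u)) (length u + t) (length u + z)" using snoc.IH[of f'] False r f1 b by simp
  moreover have "even (f ?h)" using snoc.prems(4) False by (auto simp: flag_def)
  ultimately show ?thesis
   using mc_edge[OF ed.k4, of f ?h v v "length u + t" "length u + z" "Suc (length u) + t" "Suc (length u) + z"] nz snoc.prems(5)
   by (simp add: f'_def)
 qed
qed simp

lemma ok_cut:
 assumes C1: "okC st w1 p q e e' t z" and C2: "okC (st @ w1) w2 e e' p' q' t z'"
  and w: "w1 ~= []" "w2 ~= []" "length (w1 @ w2) <= kk" and b: "bd e" "bd e'"
 shows "okC st (w1 @ w2) p q p' q' (Suc t) (Suc (z + z'))" unfolding okC_def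
proof (intro allI impI, goal_cases)
 case v: (1 v f)
 obtain g where g: "encS nb (length x) g e" "ALL i < 5. g i < 2 ^ L" using bd[OF b(1)] by blast
 obtain g' where g': "encS nb (length x) g' e'" "ALL i < 5. g' i < 2 ^ L" using bd[OF b(2)] by blast
 define u where "u = upd (upd v 4 g) 5 g'"
 have ru: "rseq (2 ^ L) (gss 4 @ gss 5) v u" unfolding u_def by (rule rseq_gss2[OF g(2) g'(2)])
 have u: "ALL i. u i < 2 ^ L" "enn u 0 p" "enn u 1 q" "enn u 2 p'" "enn u 3 q'" "enn u 4 e" "enn u 5 e'"
  unfolding u_def using upd_cap[OF upd_cap[OF v(1) g(2)] g'(2)] v(6-9) g(1) g'(1) by simp_all
 define m where "m = length (st @ w1)"
 define k where "k = length w2 - 1"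
 have k: "length w2 = Suc k" using w(2) by (cases w2) (auto simp: k_def)
 let ?h = "Suc m"
 have top: "length (st @ w1 @ w2) = ?h + k" using k by (simp add: m_def)
 have ev: "even (f i) & f i ~= 0" if i: "m < i" "i <= ?h + k" for i
 proof -
  obtain j where j: "i = Suc j" using i by (cases i) auto
  have "0 < length w1" using w(1) by simp
  hence "length st < j" "j < length (st @ w1 @ w2)" using i j top unfolding m_def length_append by linarith+
  hence "even (f i)" using v(5) j by (auto simp: flag_def)
  moreover have "f i ~= 0" using rep2_nonzero[OF v(3), of i] i top by simp
  ultimately show ?thesis by blast
 qed
 define f' where "f' = f(?h := f ?h + 1)"
 have r: "rep2 f' (st @ w1 @ w2)" unfolding f'_def using v(3) by (rule rep2_update) (use ev[of ?h] top in auto)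
 have f1: "flag f' (length st) (length (st @ w1))" unfolding f'_def using v(5) by (rule flag_restrict) (use w in "auto simp: m_def")
 have f2: "flag f' (length (st @ w1)) (length (st @ w1 @ w2))"
  unfolding top using ev unfolding flag_def m_def[symmetric] f'_def by auto
 have fb: "ALL i. f' i < 2 * nb"
 proof
  fix i
  have "even (f ?h)" "f ?h < 2 * nb" using ev[of ?h] v(2) by auto
  \<comment> \<open>\<open>f ?h\<close> is even, so adding the flag cannot reach the even
    bound.\<close>
  hence "f ?h + 1 < 2 * nb" by (metis Suc_eq_plus1 Suc_lessI dvd_triv_left even_Suc)
  thus "f' i < 2 * nb" using v(2) by (simp add: f'_def)
 qed
 have lw: "length w1 + length w2 <= L" using w(3) kk by simp
 have "mc PK4 (cpv 3 5 (cpv 2 4 u)) f' (length (st @ w1 @ w2)) (length w2 + (t * lam + ell)) (length w2 + z * (lam + ell))"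
 proof (rule pop_run)
  fix fa assume "rep2 fa (st @ w1)" "flag fa (length st) (length (st @ w1))" "ALL i. fa i < 2 * nb"
  thus "mc PCx (cpv 3 5 (cpv 2 4 u)) fa (length (st @ w1)) (t * lam + ell) (z * (lam + ell))"
   using C1[unfolded okC_def, rule_format, of "cpv 3 5 (cpv 2 4 u)" fa] u w(1) by simp
 qed (use w r f1 f2 fb in simp_all)
 hence 2: "mc PK2 u f' (?h + k) (20 * L + 31 + (length w2 + (t * lam + ell))) (20 * L + 31 + (length w2 + z * (lam + ell)))"
  unfolding top by (intro mc_edge[OF ed.k2 _ _ rseq_cpv2]) ((use u fb in simp_all), simp_all?)
 have "mc PCx (cpv 1 5 (cpv 0 4 u)) f' (length ((st @ w1) @ w2)) (t * lam + ell) (z' * (lam + ell))"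
  using C2[unfolded okC_def, rule_format, of "cpv 1 5 (cpv 0 4 u)" f'] u w(2) r f2 fb by simp
 hence 3: "mc PK3 u f' (?h + k) (20 * L + 31 + (t * lam + ell)) (20 * L + 31 + z' * (lam + ell))"
  unfolding append_assoc top by (intro mc_edge[OF ed.k3 _ _ rseq_cpv2]) ((use u fb in simp_all), simp_all?)
 let ?T = "20 * L + 32 + (length w2 + (t * lam + ell))"
 let ?Z = "40 * L + 63 + length w2 + z * (lam + ell) + z' * (lam + ell)"
 have 1: "mc PUK u f' (?h + k) ?T ?Z" by (rule mc_univ2[OF _ 2 mc_weaken[OF 3 _ order_refl]]) simp_all
 have z0: "f' (Suc ?h + k) = 0" using r top unfolding rep2_def by auto
 hence "ed PK1 (f' (Suc ?h + k)) PUK [] (f' (Suc ?h + k)) Lft" using ed.k1' by simp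
 hence "mc PK1 u f' (Suc ?h + k) (Suc ?T) (Suc ?Z)"
  by (rule mc_edge[where v' = u]) ((use 1 fb in simp_all), simp_all?)
 hence "mc PK1 u f' (Suc ?h) (k + Suc ?T) (k + Suc ?Z)" by (rule up_run[OF _ fb]) (use rep2_nonzero[OF r] top in auto)
 hence "mc PK0 u f ?h (k + Suc (Suc ?T)) (k + Suc (Suc ?Z))"
  by (intro mc_edge[OF ed.k0', where v' = u]) ((use v(2) ev[of ?h] in "simp_all add: f'_def"), simp_all?)
 hence "mc PK0 u f (?h + k) (k + (k + Suc (Suc ?T))) (k + (k + Suc (Suc ?Z)))"
  by (rule down_run[OF _ v(2)]) (use ev in auto)
 thus ?case unfolding top by (intro mc_edge[OF ed.cx2 _ _ ru])
   (use v(2) k lw in "simp_all add: lam_def[symmetric] add_mult_distrib fun_upd_idem", simp_all add: lam_def)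
qed

lemma ok_weaken:
 "okS p q st t z ==> t <= t' ==> okS p q st t' z"
 "okC st w p q p' q' t z ==> t <= t' ==> okC st w p q p' q' t' z"
 unfolding okS_def okC_def by (blast intro: mc_weaken add_mono mult_le_mono1 order_refl)+

lemma derivation_accepted:
 "Dseg R kk bd sy st p q t z ==> okS p q st t z"
 "Dctx R kk bd sy st w p q p' q' t z ==> okC st w p q p' q' t z"
proof (induction rule: Dseg_Dctx.inducts)
 case refl
 show ?case by (rule ok_refl)
next
 case step
 thus ?case by (rule ok_step)
next
 case (split st p r t z q z')
 thus ?case by (intro ok_split)
next
 case (opn st w p q p' q' t z z')
 thus ?case by (intro ok_opn)
next
 case (one st p r t z p' a q' r' q z')
 thus ?case by (intro ok_one)
next
 case (cut st w1 p q e f t z w2 p' q' z')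
 thus ?case by (intro ok_cut)
qed (blast intro: ok_weaken)+

lemma alt_complete:
 assumes D: "Dseg R kk bd sy [] (start, 0, blank_tape, 0) s t z"
  and s: "bd s" "fst s = fs" and start: "start < 2 ^ L"
 shows "macc E kdp x L PIni (%_. 0) blank_tape (20 * L + 30 + t * lam + ell) (20 * L + 30 + z * (lam + ell))"
proof -
 obtain g where g: "encS nb (length x) g s" "ALL i < 5. g i < 2 ^ L" using bd[OF s(1)] by blast
 define v :: "nat => nat" where "v = (%_. 0)(0 := start)"
 let ?v = "upd v 1 g"
 have v: "ALL i. v i < 2 ^ L" "enn v 0 (start, 0, blank_tape, 0)"
  using start trep_blank[of nb] nb by (auto simp: v_def enc_def encS_def)
 have 5: "?v 5 = fs" using g(1) s(2) by (cases s) (auto simp: upd_def encS_def)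
 have "mc PSg ?v (%_. 0) (length []) (t * lam + ell) (z * (lam + ell))"
  using derivation_accepted(1)[OF D, unfolded okS_def, rule_format, of ?v "%_. 0"] v g nb upd_cap[OF v(1) g(2)]
  by (simp add: rep2_def)
 moreover have "rseq (2 ^ L) (cst 0 start # gss 1 @ [ise 5 fs]) (%_. 0) ?v"
  using start g(2) 5 by (auto simp: rseq_append rseq_gss v_def[symmetric])
 ultimately have "mc PIni (%_. 0) (%_. 0) 0 (20 * L + 30 + t * lam + ell) (20 * L + 30 + z * (lam + ell))"
  by (intro mc_edge[where f = "%_. 0" and h = 0 and v' = ?v, OF ed.ini]) ((use nb in "simp_all add: fun_upd_idem"), simp_all?)
 thus ?thesis by (simp add: mc_def blank_tape_def)
qed

end

end

end

section \<open>Stack machines are simulated by alternating machines\<close>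

lemma bl_le: "m < 2 ^ k ==> bl m <= k"
proof (rule ccontr)
 assume *: "m < 2 ^ k" "~ bl m <= k"
 hence "(2::nat) ^ Suc k <= 2 ^ bl m" by (intro power_increasing) auto
 also have "... <= 2 * m + 1" by (rule two_power_bl_le)
 finally show False using *(1) by simp
qed

lemma bl_Suc_pos: "1 <= bl (Suc n)" using bl_pos[of "Suc n"] by simp

lemma pb_bl: assumes "pb f" shows "EX k. ALL n. bl (f n) <= k * bl (Suc n)"
proof -
 obtain c where c: "!!n. f n <= (n + 2) ^ c" using assms unfolding pb_def by blast
 have "bl (f n) <= (2 * c + 1) * bl (Suc n)" for n
 proof -
  let ?b = "bl (Suc n)"
  have "n + 2 <= 2 ^ (?b + 1)" using less_two_power_bl[of "Suc n"] by simp
  hence "(n + 2) ^ c <= (2 ^ (?b + 1)) ^ c" by (rule power_mono) simp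
  also have "... = 2 ^ ((?b + 1) * c)" by (simp only: power_mult)
  also have "... < 2 ^ ((?b + 1) * c + 1)" by simp
  finally have "f n < 2 ^ ((?b + 1) * c + 1)" using c[of n] by linarith
  hence "bl (f n) <= (?b + 1) * c + 1" by (rule bl_le)
  also have "... <= (?b + ?b) * c + ?b" by (intro add_mono mult_le_mono1) (use bl_Suc_pos[of n] in simp_all)
  also have "... = (2 * c + 1) * ?b" by (simp add: algebra_simps)
  finally show ?thesis .
 qed
 thus ?thesis by blast
qed

definition cv :: "nauxsa_conf => surf * nat list" where
 "cv c = ((n_state c, n_ipos c, n_work c, n_spos c), n_stack c)"

lemma sstep_nauxsa: "sstep (n_trans M) x (cv c) s = (EX c'. s = cv c' & nauxsa_step M x c c')"
proof
 assume "sstep (n_trans M) x (cv c) s"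
 thus "EX c'. s = cv c' & nauxsa_step M x c c'"
 proof (cases rule: sstep.cases)
  case (1 q ip tp st sp q' a di dw ds p)
  thus ?thesis unfolding nauxsa_step_def
   by (intro exI[of _ "\<lparr>n_state = q', n_ipos = input_shift x di ip, n_work = write_move a dw tp,
    n_stack = stack_apply p st, n_spos = shift ds sp\<rparr>"]) (auto simp: cv_def, blast)
 qed
next
 assume "EX c'. s = cv c' & nauxsa_step M x c c'"
 then obtain c' q a di dw ds p where s: "s = cv c'" and
  t: "((n_state c, input_cell x (n_ipos c), scan (n_work c), stack_scan (n_stack c) (n_spos c)), (q, a, di, dw, ds, p)) : n_trans M"
  and c': "c' = \<lparr>n_state = q, n_ipos = input_shift x di (n_ipos c), n_work = write_move a dw (n_work c),
   n_stack = stack_apply p (n_stack c), n_spos = shift ds (n_spos c)\<rparr>" unfolding nauxsa_step_def by blast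
 show "sstep (n_trans M) x (cv c) s" unfolding s c' cv_def using sstep.intros[OF t] by simp
qed

lemma sstep_mono: "sstep Tr x c c' ==> Tr <= Tr' ==> sstep Tr' x c c'"
 by (induction rule: sstep.induct) (auto intro: sstep.intros)

lemma cv_eqD: "cv c = ((q, ip, tp, sp), st) ==>
  n_state c = q & n_ipos c = ip & n_work c = tp & n_spos c = sp & n_stack c = st" by (simp add: cv_def)

lemma cv_init: "cv (nauxsa_init M) = ((n_start M, 0, blank_tape, 0), [])" by (simp add: cv_def nauxsa_init_def)

locale accepting_nauxsa =
 fixes M :: "'a::finite nauxsa" and T W H :: "nat => nat"
 assumes wf: "wf_nauxsa M"
  and space: "(nauxsa_step M x)^** (nauxsa_init M) c ==>
   snd (n_work c) < W (length x) & length (n_stack c) <= H (length x) & n_spos c < H (length x)"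
  and time: "nauxsa_accepts M x ==> EX k c. k <= T (length x) &
   (nauxsa_step M x ^^ k) (nauxsa_init M) c & n_state c : n_accept M"
begin

definition "fs = n_states M"
text \<open>The successor guarantees a base greater than 1, on which the uniqueness of the tape
  numbers depends.\<close>

definition "nb = Suc (n_syms M)"

text \<open>The additional state `fs` empties the stack, so that acceptance is a run from the empty stack
 to the empty stack.\<close>

definition "TrF = {((q, i, a, b), (fs, a, Stay, Stay, Stay, Keep)) | q i a b.
  q : n_accept M & q < fs & a < nb & b < nb} \<union>
 {((fs, i, a, b), (fs, a, Stay, Stay, Stay, Pop)) | i a b. a < nb & b < nb}"

definition "Tr = n_trans M \<union> TrF"

lemma wf_step:
 "((q, i, a, b), (q', a', di, dw, ds, p)) : n_trans M ==> q < fs & a < nb & b < nb & q' < fs & a' < nb &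
  (ALL e. p = Push e --> 0 < e & e < nb)" using wf unfolding wf_nauxsa_def fs_def nb_def using less_SucI by blast

sublocale altp Tr "Suc fs" nb "n_start M" fs
proof
 fix q i a b q' a' di dw ds p
 assume "((q, i, a, b), (q', a', di, dw, ds, p)) : Tr"
 thus "q < Suc fs & a < nb & b < nb & q' < Suc fs & a' < nb & (ALL e. p = Push e --> 0 < e & e < nb)"
  unfolding Tr_def using wf_step[of q i a b q' a' di dw ds p] by (auto simp: TrF_def)
next
 show "1 < nb" using wf by (auto simp: wf_nauxsa_def nb_def)
qed

text \<open>As long as no accepting state has been reached, the added transitions cannot have been
  used, so the run is one of \<open>M\<close>.\<close>

lemma sound_run:
 assumes "(sstep Tr x)^** (cv (nauxsa_init M)) s"
 shows "nauxsa_accepts M x \<or> (EX c. s = cv c & n_state c < fs & (nauxsa_step M x)^** (nauxsa_init M) c)"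
 using assms
proof (induction rule: rtranclp_induct)
 case base
 have "n_state (nauxsa_init M) < fs" using wf by (simp add: wf_nauxsa_def fs_def nauxsa_init_def)
 thus ?case by blast
next
 case (step s s')
 show ?case
 proof (cases "nauxsa_accepts M x")
  case False
  then obtain c where c: "s = cv c" "n_state c < fs" "(nauxsa_step M x)^** (nauxsa_init M) c" using step by blast
  from step(2) show ?thesis
  proof (cases rule: sstep.cases)
   case (1 q ip tp st sp q' a di dw ds p)
   have q: "n_state c = q" using cv_eqD[of c q ip tp sp st] 1(1) c(1) by simp
   have "((q, input_cell x ip, scan tp, stack_scan st sp), (q', a, di, dw, ds, p)) : n_trans M"
   proof (rule ccontr)
    assume "~ ?thesis"
    hence "((q, input_cell x ip, scan tp, stack_scan st sp), (q', a, di, dw, ds, p)) : TrF"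
     using 1(3) by (simp add: Tr_def)
    hence "q : n_accept M" using c(2) q by (auto simp: TrF_def)
    thus False using False c(3) q unfolding nauxsa_accepts_def by blast
   qed
   from sstep.intros[OF this] wf_step[OF this] have "sstep (n_trans M) x (cv c) s'" and "q' < fs"
    using 1(1,2) c(1) by simp_all
   then obtain c' where c': "s' = cv c'" "nauxsa_step M x c c'" unfolding sstep_nauxsa by blast
   hence "n_state c' = q'" using 1(2) by (simp add: cv_def)
   moreover have "(nauxsa_step M x)^** (nauxsa_init M) c'" using c(3) c'(2) by (rule rtranclp.rtrancl_into_rtrancl)
   ultimately show ?thesis using c'(1) `q' < fs` by blast
  qed
 qed simp
qed

lemma sound:
 assumes "(sstep Tr x)^** ((n_start M, 0, blank_tape, 0), []) ((fs, ip, tp, sp), [])"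
 shows "nauxsa_accepts M x"
 using sound_run[of x "((fs, ip, tp, sp), [])"] assms cv_eqD unfolding cv_init by (metis less_irrefl)

context
 fixes x :: "'a list"
begin

text \<open>Both bounds are needed: \<open>H\<close> for the time of the alternating machine, and
  \<open>T\<close>, a polynomial, for the size of its tree, since the cost of a leaf grows with the
  height.\<close>

definition "Hb = min (H (length x)) (T (length x))"

definition okc :: "surf * nat list => bool" where
 "okc = (%((q, ip, tp, sp), st). q <= fs & ip <= Suc (length x) & snd tp < W (length x) & (ALL i. fst tp i < nb) &
  (ALL i >= W (length x). fst tp i = 0) & sp <= Hb & length st <= Hb & (ALL a : set st. a < nb))"

text \<open>The run is decomposed with respect to the restricted relation, so that every
  configuration that has to be guessed fits into the registers.\<close>

definition "RR c c' = (sstep Tr x c c' & okc c & okc c')"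

definition "bds s = (EX st. okc (s, st))"

definition "sys a = (0 < a & a < nb)"

text \<open>In i steps at most i letters are pushed and the stack head moves at most i cells, which
  yields the \<open>T\<close> part of \<open>Hb\<close>.\<close>

lemma reach_ok:
 "(nauxsa_step M x ^^ i) (nauxsa_init M) c ==> i <= T (length x) ==>
  okc (cv c) & n_state c < fs & n_spos c <= i & length (n_stack c) <= i & (RR ^^ i) (cv (nauxsa_init M)) (cv c)"
proof (induction i arbitrary: c)
 case 0
 have "0 < W (length x) & 0 < H (length x)" using space[of x "nauxsa_init M"] by (auto simp: nauxsa_init_def)
 hence "okc (cv (nauxsa_init M))" using wf by (auto simp: cv_init okc_def wf_nauxsa_def fs_def nb_def blank_tape_def)
 thus ?case using 0 wf by (auto simp: nauxsa_init_def wf_nauxsa_def fs_def)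
next
 case (Suc i)
 obtain c0 where c0: "(nauxsa_step M x ^^ i) (nauxsa_init M) c0" "nauxsa_step M x c0 c" using Suc.prems(1) by auto
 have IH: "okc (cv c0)" "n_state c0 < fs" "n_spos c0 <= i" "length (n_stack c0) <= i" "(RR ^^ i) (cv (nauxsa_init M)) (cv c0)"
  using Suc.IH[OF c0(1)] Suc.prems(2) by auto
 have reach: "(nauxsa_step M x)^** (nauxsa_init M) c" using Suc.prems(1) by (meson relpowp_imp_rtranclp)
 note sp = space[OF reach]
 have s: "sstep (n_trans M) x (cv c0) (cv c)" using c0(2) sstep_nauxsa by blast
 from s obtain q ip tp st sp q' a di dw ds p where 1: "cv c0 = ((q, ip, tp, sp), st)"
  "cv c = ((q', input_shift x di ip, write_move a dw tp, shift ds sp), stack_apply p st)"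
  "((q, input_cell x ip, scan tp, stack_scan st sp), q', a, di, dw, ds, p) : n_trans M"
  by (cases rule: sstep.cases) metis
 note w = wf_step[OF 1(3)]
 have e0: "n_spos c0 = sp" "n_stack c0 = st" "n_work c0 = tp" using cv_eqD[OF 1(1)] by auto
 have e: "n_state c = q'" "n_spos c = shift ds sp" "n_stack c = stack_apply p st" "n_work c = write_move a dw tp"
  using cv_eqD[OF 1(2)] by auto
 have p1: "n_spos c <= Suc i" using IH(3) e e0 by (cases ds) auto
 have p2: "length (n_stack c) <= Suc i" using IH(4) e e0 by (cases p) auto
 have o0: "snd tp < W (length x)" "ALL i. fst tp i < nb" "ALL i >= W (length x). fst tp i = 0" "ALL a : set st. a < nb"
  using IH(1) unfolding 1(1) okc_def by auto
 have tape: "ALL i. fst (write_move a dw tp) i < nb" "ALL i >= W (length x). fst (write_move a dw tp) i = 0"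
  using o0 w by (auto simp: write_move_parts)
 have stk: "ALL a : set (stack_apply p st). a < nb" using o0(4) w by (cases p) (auto dest: in_set_butlastD)
 have hb: "n_spos c <= Hb" "length (n_stack c) <= Hb" using sp p1 p2 Suc.prems(2) by (auto simp: Hb_def)
 have ok: "okc (cv c)" unfolding 1(2) okc_def using w tape stk sp hb e input_shift_le[of x di ip] by auto
 have "RR (cv c0) (cv c)" unfolding RR_def using IH(1) ok sstep_mono[OF s] by (simp add: Tr_def)
 thus ?case using IH(5) ok e w p1 p2 by auto
qed

lemma pop_runs: "okc ((fs, ip, tp, sp), st) ==> (RR ^^ length st) ((fs, ip, tp, sp), st) ((fs, ip, tp, sp), [])"
proof (induction st rule: rev_induct)
 case (snoc b st)
 have ok: "okc ((fs, ip, tp, sp), st)" using snoc.prems by (auto simp: okc_def)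
 have sc: "stack_scan (st @ [b]) sp < nb" using snoc.prems nb nth_mem[of sp "st @ [b]"]
  unfolding okc_def stack_scan_def by auto
 have ta: "scan tp < nb" using snoc.prems unfolding okc_def scan_def by auto
 have "((fs, input_cell x ip, scan tp, stack_scan (st @ [b]) sp), (fs, scan tp, Stay, Stay, Stay, Pop)) : Tr"
  unfolding Tr_def TrF_def using sc ta by auto
 from sstep.intros[OF this] have "sstep Tr x ((fs, ip, tp, sp), st @ [b]) ((fs, ip, tp, sp), st)"
 proof -
  have "ip <= Suc (length x)" using ok by (simp add: okc_def)
  moreover have "write_move (scan tp) Stay tp = tp" by (simp add: write_move_def scan_def)
  ultimately show ?thesis
   using sstep.intros[OF `((fs, input_cell x ip, scan tp, stack_scan (st @ [b]) sp), (fs, scan tp, Stay, Stay, Stay, Pop)) : Tr`]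
   by (simp add: input_shift_def)
 qed
 hence "RR ((fs, ip, tp, sp), st @ [b]) ((fs, ip, tp, sp), st)" using snoc.prems ok by (simp add: RR_def)
 from relpowp_Suc_I2[OF this snoc.IH[OF ok]] show ?case by (simp only: length_append_singleton)
qed simp

lemma run:
 assumes "nauxsa_accepts M x"
 shows "EX m ip tp sp. m <= 2 * T (length x) + 1 & okc ((fs, ip, tp, sp), []) &
  (RR ^^ m) ((n_start M, 0, blank_tape, 0), []) ((fs, ip, tp, sp), [])"
proof -
 obtain k c where k: "k <= T (length x)" "(nauxsa_step M x ^^ k) (nauxsa_init M) c" "n_state c : n_accept M"
  using time[OF assms] by blast
 note r = reach_ok[OF k(2,1)]
 obtain ip tp sp st where c: "n_ipos c = ip" "n_work c = tp" "n_spos c = sp" "n_stack c = st" by blast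
 have cvc: "cv c = ((n_state c, ip, tp, sp), st)" using c by (simp add: cv_def)
 have ok: "okc ((fs, ip, tp, sp), st)" "okc ((fs, ip, tp, sp), [])" using r unfolding cvc okc_def by auto
 have sc: "stack_scan st sp < nb" "scan tp < nb" using ok(1) nb nth_mem[of sp st]
  unfolding okc_def stack_scan_def scan_def by auto
 have t: "((n_state c, input_cell x ip, scan tp, stack_scan st sp), (fs, scan tp, Stay, Stay, Stay, Keep)) : Tr"
  unfolding Tr_def TrF_def using sc k(3) r by auto
 have "ip <= Suc (length x)" using ok by (simp add: okc_def)
 moreover have "write_move (scan tp) Stay tp = tp" by (simp add: write_move_def scan_def)
 ultimately have "sstep Tr x (cv c) ((fs, ip, tp, sp), st)"
  using sstep.intros[OF t] unfolding cvc by (simp add: input_shift_def)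
 hence "RR (cv c) ((fs, ip, tp, sp), st)" using ok r by (simp add: RR_def)
 hence "(RR ^^ Suc (length st)) (cv c) ((fs, ip, tp, sp), [])" using pop_runs[OF ok(1)] by (rule relpowp_Suc_I2)
 hence "(RR ^^ (k + Suc (length st))) (cv (nauxsa_init M)) ((fs, ip, tp, sp), [])"
  using r unfolding relpowp_add by blast
 moreover have "k + Suc (length st) <= 2 * T (length x) + 1" using k(1) r c by simp
 ultimately show ?thesis using ok(2) unfolding cv_init by blast
qed

lemma runs: "0 < k ==> stack_runs RR k Hb bds sys"
proof
 fix p st q st' assume r: "RR (p, st) (q, st')"
 show "length st <= Hb" using r by (auto simp: RR_def okc_def)
 show "bds p & bds q" using r by (auto simp: RR_def bds_def)
 have s: "sstep Tr x (p, st) (q, st')" using r by (simp add: RR_def)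
 then obtain o' where o': "st' = stack_apply o' st" by (cases rule: sstep.cases) auto
 show "st' = st \<or> (EX a. st' = st @ [a]) \<or> (EX a. st = st' @ [a])"
 proof (cases o')
  case Pop
  thus ?thesis using o' by (cases st rule: rev_cases) auto
 qed (use o' in auto)
next
 fix p st q a assume r: "RR (p, st) (q, st @ [a])"
 hence "sstep Tr x (p, st) (q, st @ [a])" by (simp add: RR_def)
 thus "sys a"
 proof (cases rule: sstep.cases)
  case (1 q ip tp sp q' a' di dw ds o')
  have "o' = Push a" using stack_apply_cases(2)[of o' st a] 1 by simp
  moreover have "((q, input_cell x ip, scan tp, stack_scan st sp), q', a', di, dw, ds, o') : Tr" using 1 by blast
  ultimately show ?thesis using Tr by (simp add: sys_def)
 qed
qed

lemma bds_enc:
 assumes "bds s" "fs < 2 ^ L" "Suc (length x) < 2 ^ L" "T (length x) < 2 ^ L" "Suc nb ^ W (length x) <= 2 ^ L"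
 shows "EX g. encS nb (length x) g s & (ALL i < 5. g i < 2 ^ L)"
proof -
 obtain q ip tp sp where s: "s = (q, ip, tp, sp)" by (metis surj_pair)
 have ok: "q <= fs" "ip <= Suc (length x)" "snd tp < W (length x)" "ALL i. fst tp i < nb"
  "ALL i >= W (length x). fst tp i = 0" "sp <= T (length x)" using assms(1) unfolding bds_def okc_def s Hb_def by auto
 obtain l r where lr: "trep nb tp l r" using trep_exists[OF ok(4,5)] by blast
 have "l < Suc nb ^ W (length x) & r < Suc nb ^ W (length x)" by (rule trep_bound[OF lr nb ok(5)]) (use ok(3) in simp)
 hence "l < 2 ^ L" "r < 2 ^ L" using assms(5) by linarith+
 moreover have "q < 2 ^ L" "ip < 2 ^ L" "sp < 2 ^ L" using ok assms by linarith+
 ultimately show ?thesis using ok(2) lr s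
  by (intro exI[of _ "%i. [q, ip, sp, l, r] ! i"]) (auto simp: encS_def all_less_5)
qed

text \<open>Here \<open>kk\<close> is \<open>L\<close>. Since \<open>lam L <= 400 * L\<close> and
  \<open>L * t <= L * (4 * j + 2) + Hb\<close>, the time of all levels is at most
  \<open>400 * (L * (4 * j + 2) + Hb)\<close>; the batches of \<open>L\<close> letters cancel the
  cost of a level. The leaf contributes another \<open>6 * Hb\<close>. The run has at most
  \<open>2 * T + 1\<close> steps, which gives the factor \<open>20 * T + 11\<close> in the
  size.\<close>

lemma complete:
 assumes acc: "nauxsa_accepts M x" and L: "0 < L" "fs < 2 ^ L" "Suc (length x) < 2 ^ L" "T (length x) < 2 ^ L"
  "Suc nb ^ W (length x) <= 2 ^ L" and j: "2 * T (length x) + 1 <= 2 ^ j"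
 shows "macc E kdp x L PIni (%_. 0) blank_tape (80 * L + 90 + 400 * (L * (4 * j + 2)) + 406 * H (length x))
  (20 * L + 30 + (20 * T (length x) + 11) * (260 * L + 260 + 6 * T (length x)))"
proof -
 obtain m ip tp sp where m: "m <= 2 * T (length x) + 1" "okc ((fs, ip, tp, sp), [])"
  "(RR ^^ m) ((n_start M, 0, blank_tape, 0), []) ((fs, ip, tp, sp), [])" using run[OF acc] by blast
 have "m <= 2 ^ j" using m(1) j by linarith
 from stack_runs.balanced_derivation[OF runs[OF L(1)] m(3) this]
 obtain t z where tz: "Dseg RR L bds sys [] (n_start M, 0, blank_tape, 0) (fs, ip, tp, sp) t z"
  "L * t <= L * (4 * j + 2) + Hb" "z <= 10 * m + 1" by blast
 have 1: "macc E kdp x L PIni (%_. 0) blank_tape (20 * L + 30 + t * lam L + ell L Hb) (20 * L + 30 + z * (lam L + ell L Hb))"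
 proof (rule alt_complete[OF _ _ _ _ tz(1)])
  show "sstep Tr x ((q, ip, tp, sp), st) c & sp <= Hb & length st <= Hb" if "RR ((q, ip, tp, sp), st) c" for q ip tp sp st c
   using that by (auto simp: RR_def okc_def)
  show "EX g. encS nb (length x) g s & (ALL i < 5. g i < 2 ^ L)" if "bds s" for s using bds_enc[OF that L(2-5)] .
  show "0 < a & a < nb" if "sys a" for a using that by (simp add: sys_def)
  show "bds (fs, ip, tp, sp)" using m(2) by (auto simp: bds_def)
  show "n_start M < 2 ^ L" using wf L(2) unfolding wf_nauxsa_def fs_def by linarith
 qed simp_all
 have hb: "Hb <= H (length x)" "Hb <= T (length x)" by (simp_all add: Hb_def)
 have "t * lam L <= t * (400 * L)" unfolding lam_def using L(1) by (intro mult_le_mono2) simp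
 also have "... = 400 * (L * t)" by simp
 also have "... <= 400 * (L * (4 * j + 2) + Hb)" using tz(2) by (rule mult_le_mono2)
 finally have t: "t * lam L <= 400 * (L * (4 * j + 2)) + 400 * Hb" by simp
 have z: "z * (lam L + ell L Hb) <= (20 * T (length x) + 11) * (260 * L + 260 + 6 * T (length x))"
  by (rule mult_le_mono) (use tz(3) m(1) hb in "simp_all add: lam_def ell_def")
 show ?thesis by (rule macc.weaken[OF 1]) (use t z hb in "simp_all add: ell_def")
qed

end

lemma in_ATiSz:
 assumes T: "pb T" and W: "(%n. real (W n)) : O(%n. log 2 (real n))"
  and H: "(%n. real (H n)) : O(h)" and lg: "(%n. real ((bl (Suc n))\<^sup>2)) : O(h)"
 shows "EX c. {x. nauxsa_accepts M x} : ATiSz h (%n. real (n ^ c))"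
proof -
 \<comment> \<open>The summands dominate everything a register has to hold: states, input positions,
   stack positions and the two halves of the working tape. It is polynomial, so its binary length
   \<open>L\<close> is logarithmic.\<close>
 define X where "X n = fs + Suc n + T n + Suc nb ^ W n" for n
 define L where "L n = bl (X n)" for n
 define j where "j n = bl (2 * T n + 1)" for n
 have pX: "pb X" unfolding X_def by (intro pb_intros pb_exp_log T W)
 obtain k1 where k1: "!!n. L n <= k1 * bl (Suc n)" using pb_bl[OF pX] unfolding L_def by blast
 have "pb (%n. 2 * T n + 1)" by (intro pb_intros T)
 then obtain k2 where k2: "!!n. j n <= k2 * bl (Suc n)" using pb_bl unfolding j_def by blast
 define Tt where "Tt n = 80 * L n + 90 + 400 * (L n * (4 * j n + 2)) + 406 * H n" for n
 define Zz where "Zz n = 20 * L n + 30 + (20 * T n + 11) * (260 * L n + 260 + 6 * T n)" for n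
 have Lpos: "0 < L n" for n unfolding L_def X_def using bl_pos[of "fs + Suc n + T n + Suc nb ^ W n"] by simp
 have L2: "L n <= 2 * X n + 1" for n using two_power_bl_le[of "X n"] less_exp[of "L n"] unfolding L_def by linarith
 have pL: "pb L" by (rule pb_mono[of "%n. 2 * X n + 1"]) (intro pb_intros pX, rule L2)
 have "pb (%n. 2 * L n + 3 + Zz n)" unfolding Zz_def by (intro pb_intros pL T)
 then obtain c where c: "(%n. real (2 * L n + 3 + Zz n)) : O(%n. real (n ^ c))" using bigo_of_pb by blast
 define K where "K = 82 * k1 + 93 + 400 * (k1 * (4 * k2 + 2))"
 have le: "2 * L n + 3 + Tt n <= K * (bl (Suc n))\<^sup>2 + 406 * H n" for n
 proof -
  let ?b = "bl (Suc n)"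
  have b: "1 <= ?b" by (rule bl_Suc_pos)
  hence b2: "?b <= ?b\<^sup>2" "1 <= ?b\<^sup>2" by (simp_all add: power2_eq_square)
  have "L n <= k1 * ?b\<^sup>2" using k1[of n] mult_le_mono2[OF b2(1), of k1] by linarith
  moreover have "L n * (4 * j n + 2) <= (k1 * ?b) * (4 * (k2 * ?b) + 2 * ?b)"
   by (intro mult_le_mono add_mono k1 mult_le_mono2 k2) (use b in simp)
  moreover have "(k1 * ?b) * (4 * (k2 * ?b) + 2 * ?b) = k1 * (4 * k2 + 2) * ?b\<^sup>2"
   by (simp add: power2_eq_square algebra_simps)
  moreover have "K * ?b\<^sup>2 = 82 * (k1 * ?b\<^sup>2) + 93 * ?b\<^sup>2 + 400 * (k1 * (4 * k2 + 2) * ?b\<^sup>2)"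
   by (simp add: K_def algebra_simps)
  ultimately show ?thesis unfolding Tt_def using b2(2) by linarith
 qed
 have "(%n. real K * real ((bl (Suc n))\<^sup>2) + 406 * real (H n)) : O(h)"
  by (intro sum_in_bigo) (use H lg in "simp_all add: K_def")
 moreover have "(%n. real (2 * L n + 3 + Tt n)) : O(%n. real K * real ((bl (Suc n))\<^sup>2) + 406 * real (H n))"
 proof (rule bigoI[of _ 1], rule always_eventually, rule allI)
  fix n
  have "real (2 * L n + 3 + Tt n) <= real (K * (bl (Suc n))\<^sup>2 + 406 * H n)" using le[of n] by (simp only: of_nat_le_iff)
  thus "norm (real (2 * L n + 3 + Tt n)) <= 1 * norm (real K * real ((bl (Suc n))\<^sup>2) + 406 * real (H n))"
   by simp
 qed
 ultimately have Tb: "(%n. real (2 * L n + 3 + Tt n)) : O(h)" by (rule landau_o.big_trans[rotated])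
 have "{x. nauxsa_accepts M x} : ATiSz h (%n. real (n ^ c))"
 proof (rule program_in_ATiSz[where L = L and T = Tt and Z = Zz, OF _ _ Tb c])
  fix x L t z assume "macc E kdp x L PIni (%_. 0) blank_tape t z"
  thus "x : {x. nauxsa_accepts M x}" using alt_sound sound by blast
 next
  fix x assume x: "x : {x. nauxsa_accepts M x}"
  have X: "X (length x) < 2 ^ L (length x)" unfolding L_def by (rule less_two_power_bl)
  show "macc E kdp x (L (length x)) PIni (%_. 0) blank_tape (Tt (length x)) (Zz (length x))" unfolding Tt_def Zz_def
  proof (rule complete)
   show "2 * T (length x) + 1 <= 2 ^ j (length x)" unfolding j_def using less_two_power_bl less_imp_le by blast
  qed (use x X Lpos in "auto simp: X_def")
 qed
 thus ?thesis by blast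
qed

end

theorem NAuxSA_subset_ATiSz:
 fixes A :: "'a::finite list set"
 assumes "A : NAuxSA (%n. real (n ^ c)) (%n. log 2 (real n)) h" "(%n. real ((bl (Suc n))\<^sup>2)) : O(h)"
 shows "EX c. A : ATiSz h (%n. real (n ^ c))"
proof -
 obtain M :: "'a nauxsa" and T W H where M: "wf_nauxsa M" "A = {x. nauxsa_accepts M x}"
  "(%n. real (T n)) : O(%n. real (n ^ c))" "(%n. real (W n)) : O(%n. log 2 (real n))" "(%n. real (H n)) : O(h)"
  "ALL x c. (nauxsa_step M x)^** (nauxsa_init M) c --> snd (n_work c) < W (length x) &
   length (n_stack c) <= H (length x) & n_spos c < H (length x)"
  "ALL x : A. EX k c. k <= T (length x) & (nauxsa_step M x ^^ k) (nauxsa_init M) c & n_state c : n_accept M"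
  using assms(1) unfolding NAuxSA_def by blast
 interpret accepting_nauxsa M T W H
 proof
  show "wf_nauxsa M" by (rule M(1))
  show "snd (n_work c) < W (length x) & length (n_stack c) <= H (length x) & n_spos c < H (length x)"
   if "(nauxsa_step M x)^** (nauxsa_init M) c" for x c using M(6) that by blast
  show "EX k c. k <= T (length x) & (nauxsa_step M x ^^ k) (nauxsa_init M) c & n_state c : n_accept M"
   if "nauxsa_accepts M x" for x using M(2,7) that by blast
 qed
 show ?thesis unfolding M(2) by (rule in_ATiSz[OF pb_of_bigo[OF M(3)] M(4,5) assms(2)])
qed

section \<open>Alternating machines are simulated by stack machines\<close>

type_synonym act = "nat * (nat * dir) list"

type_synonym 'a view = "nat * nat list * 'a option * bool list"

definition appl :: "act => atm_conf => atm_conf" where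
 "appl mv c = \<lparr>a_state = fst mv, a_conts = map2 (%(a, d). write_move a d) (snd mv) (a_conts c)\<rparr>"

text \<open>Distinct transitions can have the same effect only because of left moves in cell 0. In a view
 with the flags `z` of the heads in cell 0, such moves are replaced by `Stay`, so that a universal
 configuration has as many successors as normalized transitions.\<close>

definition normact :: "bool list => (nat * dir) list => (nat * dir) list" where
 "normact z acts = map2 (%b (a, d). (a, if b & d = Lft then Stay else d)) z acts"

definition view_of :: "'a list => 'a view => atm_conf => bool" where
 "view_of x w c = (w = (a_state c, map scan (a_conts c), addressed x (hd (a_conts c)), map (%tp. snd tp = 0) (a_conts c)))"

definition succs :: "'a atm => 'a view => act set" where
 "succs N = (%(q, as, io, z). {(q', normact z acts) | q' acts. ((q, as, io), (q', acts)) : a_trans N})"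

definition succl :: "'a atm => 'a view => act list" where
 "succl N w = (SOME l. distinct l & set l = succs N w)"

definition acts :: "'a atm => act set" where
 "acts N = {..<a_states N} \<times> {l. set l <= {..<a_syms N} \<times> UNIV & length l = a_tapes N}"

lemma finite_acts: "finite (acts N)"
 unfolding acts_def by (intro finite_cartesian_product finite_lists_length_eq) simp_all

lemma succs_acts:
 assumes "wf_atm N" "length z = a_tapes N"
 shows "succs N (q, as, io, z) <= acts N"
proof
 fix mv assume "mv : succs N (q, as, io, z)"
 then obtain q' l where mv: "mv = (q', normact z l)" "((q, as, io), (q', l)) : a_trans N" by (auto simp: succs_def)
 have w: "q' < a_states N" "length l = a_tapes N" "ALL (a, d) : set l. a < a_syms N"
  using assms(1) mv(2) unfolding wf_atm_def by blast+
 have "set (normact z l) <= {..<a_syms N} \<times> UNIV"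
  using w(3) by (auto simp: normact_def dest!: set_zip_rightD split: if_splits)
 thus "mv : acts N" using w assms(2) mv(1) by (simp add: acts_def normact_def)
qed

lemma succl:
 assumes "wf_atm N" "length z = a_tapes N"
 shows "distinct (succl N (q, as, io, z)) & set (succl N (q, as, io, z)) = succs N (q, as, io, z)"
proof -
 have "finite (succs N (q, as, io, z))" using finite_subset[OF succs_acts[OF assms] finite_acts] .
 hence "EX l. distinct l & set l = succs N (q, as, io, z)" using finite_distinct_list by blast
 thus ?thesis unfolding succl_def by (rule someI_ex)
qed

lemma appl_normact:
 assumes "length l = length tps"
 shows "map2 (%(a, d). write_move a d) (normact (map (%tp. snd tp = 0) tps) l) tps = map2 (%(a, d). write_move a d) l tps"
 using assms
proof (induction l tps rule: list_induct2)
 case (Cons y l t tps)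
 obtain a d where y: "y = (a, d)" by (cases y)
 have "normact (map (%tp. snd tp = 0) (t # tps)) (y # l) =
   (a, if snd t = 0 & d = Lft then Stay else d) # normact (map (%tp. snd tp = 0) tps) l" by (simp add: normact_def y)
 moreover have "write_move a (if snd t = 0 & d = Lft then Stay else d) t = write_move a d t"
  by (auto simp: write_move_def)
 ultimately show ?case using Cons y by simp
qed (simp add: normact_def)

lemma step_succs:
 assumes "wf_atm N" "length (a_conts c) = a_tapes N" "view_of x w c"
 shows "atm_step N x c c' = (EX mv : succs N w. c' = appl mv c)"
proof -
 have len: "length l = length (a_conts c)" if "((a_state c, as, io), q', l) : a_trans N" for as io q' l
  using assms(1,2) that unfolding wf_atm_def by metis
 have "atm_step N x c c' = (EX q' l. ((a_state c, map scan (a_conts c), addressed x (hd (a_conts c))), q', l) : a_trans N &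
   c' = appl (q', normact (map (%tp. snd tp = 0) (a_conts c)) l) c)"
  unfolding atm_step_def appl_def fst_conv snd_conv using appl_normact len by metis
 thus ?thesis using assms(3) unfolding view_of_def succs_def by auto
qed

lemma write_move_inj:
 assumes "write_move a d tp = write_move a' d' tp" "snd tp = 0 ==> d ~= Lft & d' ~= Lft"
 shows "a = a' & d = d'"
proof
 show "a = a'" using assms(1) by (auto simp: write_move_def dest: fun_cong[where x = "snd tp"])
 have "shift d (snd tp) = shift d' (snd tp)" using assms(1) by (simp add: write_move_def)
 thus "d = d'" using assms(2) by (cases d; cases d'; cases "snd tp") auto
qed

text \<open>After normalization no head in cell 0 is moved to the left, so the symbols and moves can
  be read off from their effect. Distinct transitions then lead to distinct children of a universal
  node.\<close>

lemma appl_inj: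
 assumes "wf_atm N" "length (a_conts c) = a_tapes N" "view_of x w c" "mv : succs N w" "\<beta> : succs N w" "appl mv c = appl \<beta> c"
 shows "mv = \<beta>"
proof -
 let ?ts = "a_conts c" and ?z = "map (%tp. snd tp = 0) (a_conts c)"
 obtain q l where mv: "mv = (q, normact ?z l)" "length l = length ?ts"
  using assms(1-4) unfolding view_of_def succs_def wf_atm_def by fastforce
 obtain q' l' where \<beta>: "\<beta> = (q', normact ?z l')" "length l' = length ?ts"
  using assms(1-3,5) unfolding view_of_def succs_def wf_atm_def by fastforce
 have e: "q = q'" "map2 (%(a, d). write_move a d) (normact ?z l) ?ts = map2 (%(a, d). write_move a d) (normact ?z l') ?ts"
  using assms(6) mv(1) \<beta>(1) by (simp_all add: appl_def)
 have "normact ?z l = normact ?z l'"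
 proof (rule nth_equalityI)
  show "length (normact ?z l) = length (normact ?z l')" using mv \<beta> by (simp add: normact_def)
  fix i assume "i < length (normact ?z l)"
  hence i: "i < length ?ts" using mv by (simp add: normact_def)
  obtain a d where ad: "normact ?z l ! i = (a, d)" by (cases "normact ?z l ! i")
  obtain a' d' where ad': "normact ?z l' ! i = (a', d')" by (cases "normact ?z l' ! i")
  have "write_move a d (?ts ! i) = write_move a' d' (?ts ! i)"
   using arg_cong[OF e(2), of "%l. l ! i"] i ad ad' mv \<beta> by (simp add: normact_def)
  moreover have "d ~= Lft & d' ~= Lft" if "snd (?ts ! i) = 0"
   using ad ad' i that mv \<beta> by (auto simp: normact_def split: prod.splits if_splits)
  ultimately have "a = a' & d = d'" by (rule write_move_inj)
  thus "normact ?z l ! i = normact ?z l' ! i" using ad ad' by simp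
 qed
 thus ?thesis using e(1) mv \<beta> by simp
qed

definition acc_conf :: "'a atm => 'a list => atm_conf => bool" where
 "acc_conf N x c = (EX u. label u = c & accepting_from N x u)"

lemma acc_leaf: "a_state c : a_accept N ==> acc_conf N x c"
 unfolding acc_conf_def using accepting_from.leaf[of c N x] by (intro exI[of _ "Node c []"]) simp

lemma acc_exist:
 assumes "a_state c ~: a_univ N" "atm_step N x c c'" "acc_conf N x c'"
 shows "acc_conf N x c"
proof -
 obtain u where u: "label u = c'" "accepting_from N x u" using assms(3) unfolding acc_conf_def by blast
 hence "accepting_from N x (Node c [u])" using accepting_from.exist[of c N x u] assms by simp
 thus ?thesis unfolding acc_conf_def by (intro exI[of _ "Node c [u]"]) simp
qed

lemma acc_univ:
 assumes "a_state c : a_univ N" "finite {c'. atm_step N x c c'}" "{c'. atm_step N x c c'} ~= {}"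
  "!!c'. atm_step N x c c' ==> acc_conf N x c'"
 shows "acc_conf N x c"
proof -
 obtain cs where cs: "set cs = {c'. atm_step N x c c'}" "distinct cs" using finite_distinct_list[OF assms(2)] by blast
 have "ALL c' : set cs. EX u. label u = c' & accepting_from N x u" using assms(4) cs(1) unfolding acc_conf_def by blast
 then obtain U where U: "ALL c' : set cs. label (U c') = c' & accepting_from N x (U c')" by metis
 have m: "map label (map U cs) = cs" using U by (simp add: map_idI)
 have "accepting_from N x (Node c (map U cs))"
 proof (rule accepting_from.univ[OF assms(1)])
  show "map U cs ~= []" using cs(1) assms(3) by auto
  show "distinct (map label (map U cs))" unfolding m by (rule cs(2))
  show "label ` set (map U cs) = {c'. atm_step N x c c'}" using arg_cong[OF m, of set] cs(1) by (simp add: image_image)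
  show "ALL u : set (map U cs). accepting_from N x u" using U by simp
 qed
 thus ?thesis unfolding acc_conf_def by (intro exI[of _ "Node c (map U cs)"]) simp
qed

text \<open>An entry of the stack is the list of the transitions still to be followed from a configuration,
 the first of which is being followed.\<close>

definition conf :: "'a atm => act list list => atm_conf" where
 "conf N es = foldl (%c al. appl (hd al) c) (atm_init N) es"

lemma conf_simps [simp]: "conf N [] = atm_init N" "conf N (es @ [al]) = appl (hd al) (conf N es)"
 by (simp_all add: conf_def)

text \<open>The possible stack entries. The length bound suffices because pending transitions are
  distinct, and it makes the stack alphabet finite.\<close>

definition entries :: "'a atm => act list set" where
 "entries N = {al. al ~= [] & set al <= acts N & length al <= card (acts N)}"

lemma finite_entries: "finite (entries N)"
 unfolding entries_def using finite_lists_length_le[OF finite_acts] by (rule rev_finite_subset) blast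

lemma hd_entries: "al : entries N ==> hd al : acts N" unfolding entries_def using hd_in_set by blast

lemma entries_tl: "mv # al : entries N ==> al ~= [] ==> al : entries N" by (auto simp: entries_def)

lemma conf_len: "set es <= entries N ==> length (a_conts (conf N es)) = a_tapes N"
proof (induction es rule: rev_induct)
 case (snoc al es)
 thus ?case using hd_entries[of al N] by (auto simp: appl_def acts_def)
qed (simp add: atm_init_def)

lemma conf_tape:
 assumes "set (es @ [al]) <= entries N" "t < a_tapes N"
 shows "a_conts (conf N (es @ [al])) ! t = write_move (fst (snd (hd al) ! t)) (snd (snd (hd al) ! t)) (a_conts (conf N es) ! t)"
proof -
 have "length (a_conts (conf N es)) = a_tapes N" using assms(1) by (intro conf_len) simp
 moreover have "length (snd (hd al)) = a_tapes N" using hd_entries[of al N] assms(1) by (auto simp: acts_def)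
 ultimately show ?thesis using assms(2) by (simp add: appl_def split_beta)
qed

lemma conf_bounds:
 assumes "set es <= entries N" "t < a_tapes N"
 shows "snd (a_conts (conf N es) ! t) <= length es & (ALL j >= length es. fst (a_conts (conf N es) ! t) j = 0)"
 using assms(1)
proof (induction es rule: rev_induct)
 case Nil
 thus ?case using assms(2) by (simp add: atm_init_def blank_tape_def)
next
 case (snoc al es)
 let ?tp = "a_conts (conf N es) ! t"
 obtain a d where ad: "snd (hd al) ! t = (a, d)" by (cases "snd (hd al) ! t")
 have IH: "snd ?tp <= length es" "ALL j >= length es. fst ?tp j = 0" using snoc by auto
 have "a_conts (conf N (es @ [al])) ! t = write_move a d ?tp" using conf_tape[OF snoc.prems assms(2)] ad by simp
 moreover have "shift d (snd ?tp) <= Suc (length es)" using IH(1) by (cases d) auto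
 ultimately show ?case using IH by (simp add: write_move_parts)
qed

lemma conf_syms:
 assumes "wf_atm N" "set es <= entries N" "t < a_tapes N"
 shows "fst (a_conts (conf N es) ! t) j < a_syms N" using assms(2)
proof (induction es rule: rev_induct)
 case Nil
 thus ?case using assms by (simp add: atm_init_def blank_tape_def wf_atm_def)
next
 case (snoc al es)
 have h: "hd al : acts N" using snoc.prems hd_entries[of al N] by simp
 hence l: "set (snd (hd al)) <= {..<a_syms N} \<times> UNIV" "length (snd (hd al)) = a_tapes N" by (auto simp: acts_def)
 hence "snd (hd al) ! t : set (snd (hd al))" using assms(3) by simp
 hence "snd (hd al) ! t : {..<a_syms N} \<times> UNIV" using l(1) by blast
 hence "fst (snd (hd al) ! t) < a_syms N" by auto
 thus ?case using snoc unfolding conf_tape[OF snoc.prems assms(3)] by (simp add: write_move_parts)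
qed

lemma conf_state: "wf_atm N ==> set es <= entries N ==> a_state (conf N es) < a_states N"
proof (induction es rule: rev_induct)
 case (snoc al es)
 thus ?case using hd_entries[of al N] by (auto simp: appl_def acts_def)
qed (simp add: atm_init_def wf_atm_def)

text \<open>The obligations recorded on the stack: a configuration is accepted once the transitions still
 to be followed from it lead to accepted configurations.\<close>

definition oblig :: "'a atm => 'a list => act list list => bool" where
 "oblig N x es = (ALL es1 al es2. es = es1 @ al # es2 -->
  (ALL mv : set al. acc_conf N x (appl mv (conf N es1))) --> acc_conf N x (conf N es1))"

lemma oblig_Nil: "oblig N x []" by (simp add: oblig_def)

lemma oblig_snoc: "oblig N x (es @ [al]) = (oblig N x es &
 ((ALL mv : set al. acc_conf N x (appl mv (conf N es))) --> acc_conf N x (conf N es)))"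
proof
 assume o: "oblig N x (es @ [al])"
 have "oblig N x es" unfolding oblig_def
 proof (intro allI impI, goal_cases)
  case (1 es1 al1 es2)
  thus ?case using o[unfolded oblig_def, rule_format, of es1 al1 "es2 @ [al]"] by simp
 qed
 thus "oblig N x es & ((ALL mv : set al. acc_conf N x (appl mv (conf N es))) --> acc_conf N x (conf N es))"
  using o[unfolded oblig_def, rule_format, of es al "[]"] by blast
next
 assume o: "oblig N x es & ((ALL mv : set al. acc_conf N x (appl mv (conf N es))) --> acc_conf N x (conf N es))"
 show "oblig N x (es @ [al])" unfolding oblig_def
 proof (intro allI impI)
  fix es1 al1 es2 assume e: "es @ [al] = es1 @ al1 # es2" and a: "ALL mv : set al1. acc_conf N x (appl mv (conf N es1))"
  show "acc_conf N x (conf N es1)"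
  proof (cases es2 rule: rev_cases)
   case Nil
   thus ?thesis using e a o by simp
  next
   case (snoc es3 al3)
   hence "es = es1 @ al1 # es3" using e by simp
   thus ?thesis using o a unfolding oblig_def by blast
  qed
 qed
qed

lemma oblig_expand:
 assumes N: "wf_atm N" and es: "set es <= entries N" "oblig N x es" and w: "view_of x w (conf N es)"
  and al: "(fst w : a_univ N & al = succl N w & al ~= []) \<or> (fst w ~: a_univ N & (EX mv : succs N w. al = [mv]))"
 shows "oblig N x (es @ [al])" unfolding oblig_snoc
proof (intro conjI impI)
 show "oblig N x es" by (rule es(2))
 assume a: "ALL mv : set al. acc_conf N x (appl mv (conf N es))"
 note len = conf_len[OF es(1)]
 note step = step_succs[OF N len w]
 obtain q as io z where w': "w = (q, as, io, z)" by (metis surj_pair)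
 have z: "length z = a_tapes N" "a_state (conf N es) = fst w" using w len unfolding view_of_def w' by auto
 show "acc_conf N x (conf N es)"
 proof (cases "fst w : a_univ N")
  case True
  hence al': "al = succl N w" "al ~= []" using al by auto
  have S: "set al = succs N w" "finite (succs N w)" using succl[OF N z(1)] al'(1) w' by (metis, metis List.finite_set)
  have eq: "{c'. atm_step N x (conf N es) c'} = (%mv. appl mv (conf N es)) ` succs N w" using step by blast
  show ?thesis
  proof (rule acc_univ)
   show "a_state (conf N es) : a_univ N" using True z by simp
   show "finite {c'. atm_step N x (conf N es) c'}" unfolding eq using S(2) by simp
   show "{c'. atm_step N x (conf N es) c'} ~= {}" unfolding eq using S(1) al'(2) by auto
   show "acc_conf N x c'" if "atm_step N x (conf N es) c'" for c' using that[unfolded step] a S(1) by auto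
  qed
 next
  case False
  then obtain mv where "mv : succs N w" "al = [mv]" using al by blast
  thus ?thesis using acc_exist[of "conf N es" N x "appl mv (conf N es)"] False a step z(2) by auto
 qed
qed

lemma oblig_pop:
 assumes "oblig N x (es @ [mv # rest])" "acc_conf N x (conf N (es @ [mv # rest]))"
 shows "if rest = [] then oblig N x es & acc_conf N x (conf N es) else oblig N x (es @ [rest])"
 using assms unfolding oblig_snoc by auto

text \<open>What a replay of the stack is for: \<open>Tp t\<close> checks the guessed symbol and
  flag of tape \<open>t\<close>, \<open>Bt\<close> reads one digit of the index tape. A replay
  tracks one tape only, by its head position and the content of a single cell chosen beforehand, so
  logarithmic space is enough. The flag of \<open>Bt\<close> records that the address is already
  known to be too large.\<close>

datatype job = Tp nat | Bt bool

text \<open>\<open>Len\<close> measures the input and \<open>Bud\<close> runs the transducer.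
  \<open>Vis\<close> is entered with the state of a new configuration; its view is guessed, and
  checked by replays that go down (\<open>Dn\<close>) and up (\<open>Up\<close>) the stack.
  \<open>Wl\<close> and \<open>Wr\<close> walk to the addressed letter, \<open>Ex\<close> pushes the
  transitions to follow, \<open>Ret\<close> and \<open>Ret2\<close> find the top again, and
  \<open>Rp\<close> puts back what is left of an entry.\<close>

datatype 'a dst = Len | Bud nat | Vis nat | Dn "'a view" job | Up "'a view" job nat | Wl "'a view" | Wr "'a view"
 | Ex "'a view" | Ret | Ret2 | Rp "act list" | Fin

instance job :: countable by countable_datatype
instance dst :: (countable) countable by countable_datatype

text \<open>Codes are positive because 0 is the blank. \<open>None\<close> is the marker at the
  bottom, by which the stack head finds the start of a replay.\<close>

definition en :: "act list option => nat" where
 "en al = Suc (to_nat al)"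

lemma en_inj [simp]: "(en al = en al') = (al = al')" "en al ~= 0" "0 < en al" by (auto simp: en_def)

definition ST :: "act list list => nat list" where
 "ST es = en None # map (%al. en (Some al)) es"

lemma ST_simps [simp]: "length (ST es) = Suc (length es)" "ST es @ [en (Some al)] = ST (es @ [al])"
 "stack_scan (ST es) 0 = en None" "stack_scan (ST es) (Suc i) = (if i < length es then en (Some (es ! i)) else 0)"
 "butlast (ST (es @ [al])) = ST es" by (auto simp: ST_def stack_scan_def)

text \<open>The address on the index tape without its lowest \<open>J\<close> digits, cell
  \<open>B\<close> being the last one considered. Going down from \<open>J = B\<close> it is
  computed by the Horner scheme.\<close>

definition hsum :: "(nat => nat) => nat => nat => nat" where
 "hsum f J B = (\<Sum>i = J..B. if f i = 1 then 2 ^ (i - J) else 0)"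

lemma hsum_beyond [simp]: "hsum f (Suc B) B = 0" by (simp add: hsum_def)

lemma hsum_step: "J <= B ==> hsum f J B = 2 * hsum f (Suc J) B + (if f J = 1 then 1 else 0)"
proof -
 assume "J <= B"
 hence "hsum f J B = (if f J = 1 then 1 else 0) + (\<Sum>i = Suc J..B. if f i = 1 then 2 ^ (i - J) else (0::nat))"
  unfolding hsum_def by (subst sum.atLeast_Suc_atMost) simp_all
 also have "(\<Sum>i = Suc J..B. if f i = 1 then 2 ^ (i - J) else (0::nat)) = (\<Sum>i = Suc J..B. 2 * (if f i = 1 then 2 ^ (i - Suc J) else 0))"
  by (rule sum.cong) (auto simp: Suc_diff_Suc[symmetric] simp flip: power_Suc)
 also have "... = 2 * hsum f (Suc J) B" by (simp add: hsum_def sum_distrib_left)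
 finally show ?thesis by simp
qed

lemma addressed_hsum:
 assumes "ALL j > B. fst tp j = 0"
 shows "addressed x tp = (if hsum (fst tp) 0 B < length x then Some (x ! hsum (fst tp) 0 B) else None)"
proof -
 have "{j. fst tp j = 1} <= {0..B}"
 proof
  fix j assume "j : {j. fst tp j = 1}"
  thus "j : {0..B}" using assms by (cases "j <= B") auto
 qed
 hence "(\<Sum>j | fst tp j = 1. 2 ^ j) = (\<Sum>j\<in>{0..B}. if fst tp j = 1 then 2 ^ j else (0::nat))"
  by (subst sum.inter_filter[symmetric]) (auto intro!: sum.cong)
 thus ?thesis by (simp add: addressed_def Let_def hsum_def cong: if_cong)
qed

fun tpi :: "job => nat" where
 "tpi (Tp t) = t"
| "tpi (Bt b) = 0"

text \<open>The unary input of the transducer exists only as its length in register 1, so the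
  scanned symbol is determined by comparing the position in register 2 with it.\<close>

fun inp :: "unit insym => rcmd list" where
 "inp LeftEnd = [ise 2 0]"
| "inp (Letter u) = [leq 0 2 1 11, leq 2 1 0 11]"
| "inp RightEnd = [chk 2 1 1 1]"

definition small :: "nat => rcmd => bool" where
 "small c = (%(ch, X, Y, Z, m, a). length ch <= 1 & m <= c & a <= c)"

lemma finite_small: "finite {c. cmd_ok K c & small b c}"
proof -
 let ?S = "{None} \<union> Some ` (UNIV \<times> {..<K})"
 have "{c. cmd_ok K c & small b c} <= {l. set l <= {..<K} & length l <= 1} \<times> ?S \<times> ?S \<times> ?S \<times> {..b} \<times> {..b}"
 proof
  fix c assume c: "c : {c. cmd_ok K c & small b c}"
  obtain ch X Y Z m a where "c = (ch, X, Y, Z, m, a)" by (cases c)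
  thus "c : {l. set l <= {..<K} & length l <= 1} \<times> ?S \<times> ?S \<times> ?S \<times> {..b} \<times> {..b}"
   using c by (cases X; cases Y; cases Z) (auto simp: small_def)
 qed
 thus ?thesis by (rule finite_subset) (intro finite_cartesian_product finite_lists_length_le; simp)
qed

lemma small_simps [simp]:
 "small b (asn i j m a) = (m <= b & a <= b)" "small b (cst i a) = (a <= b)"
 "small b (chk i j m a) = (m <= b & a <= b)" "small b (ise i a) = (a <= b)"
 "small b (dvr i m a) = (m <= b & a <= b)" "small b (leq i j a t) = (1 <= b & a <= b)" "small b (gsr i)"
 by (auto simp: small_def asn_def cst_def chk_def ise_def dvr_def leq_def gsr_def)

text \<open>The registers: 0 holds zero; 1 the argument of the transducer; 2, 3, 4 its input position and its
 tape; 5 the bound on the depth; 6 the length of the input; 7 the depth; 8 a tape position; 9 the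
 position of a head; 10 the address; 11 scratch values.\<close>

locale dfs =
 fixes N :: "'a::finite atm" and D :: transducer and C0 C1 B :: nat
 assumes N: "wf_atm N" and D: "wf_transducer D" and B: "1 < B"
begin

definition "bD = Suc (d_syms D)"

text \<open>One Horner step on register 10, followed by a check of the guess \<open>s'\<close>
  whether the result exceeds every valid address. Once it does, nothing is computed any more, which
  keeps the register small.\<close>

definition cb :: "bool => nat => bool => rcmd list" where
 "cb s f s' = (if s then [] else [asn 10 10 2 (if f = 1 then 1 else 0), if s' then leq 6 10 0 11 else leq 10 6 1 11])"

text \<open>\<open>bud2\<close> may interrupt the transducer at any time, since a partial output
  only lowers the allowed depth. In \<open>vis2\<close> the view is guessed, and in register 8 the
  cell to be tracked; \<open>tp\<close> accepts the replay if this cell is where the head of the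
  tape ended up. After the last tape, register 8 is set to the depth bound, beyond which the index
  tape is blank. \<open>ex\<close> gets stuck when the bound is exhausted.\<close>

inductive pe :: "'a dst => 'a insym => nat => 'a dst => rcmd list => dir => dir => stack_op => bool" where
 len1: "i ~= LeftEnd ==> pe Len i 0 Len [asn 6 6 1 1] Lft Stay Keep"
| len2: "pe Len LeftEnd 0 (Bud (d_start D)) [dvr 6 1 1, gsr 1, cst 5 C0] Stay Stay Keep"
| bud1: "d_trans D q i a = Some (q', a', di, dw, b) ==> a < bD ==> a' < bD ==> cs : tcm 3 4 bD a a' dw ==>
  pe (Bud q) j 0 (Bud q') (inp i @ ipc 2 i di @ cs @ (if b then [asn 5 5 1 C1] else [])) Stay Stay Keep"
| bud2: "pe (Bud q) j 0 (Vis (a_start N)) [] Stay Stay (Push (en None))"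
| vis1: "q : a_accept N ==> pe (Vis q) j e Ret [] Stay Stay Keep"
| vis2: "pe (Vis q) j e (Dn (q, w) (Tp 0)) [gsr 8, cst 9 0] Stay Stay Keep"
| dn1: "e ~= en None ==> pe (Dn w jb) j e (Dn w jb) [] Stay Lft Keep"
| dn2: "pe (Dn w jb) j (en None) (Up w jb 0) [] Stay Rgt Keep"
| up: "snd (hd al) ! tpi jb = (a, d) ==> cs : shc 9 d ==> (c, f') : {(chk 9 8 1 0, a), (leq 9 8 1 11, f), (leq 8 9 1 11, f)} ==>
  pe (Up w jb f) j (en (Some al)) (Up w jb f') (c # cs) Stay Rgt Keep"
| tp: "pe (Up (q, as, io, z) (Tp t) (as ! t)) j 0 (Dn (q, as, io, z) (if Suc t < a_tapes N then Tp (Suc t) else Bt False))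
  ([chk 9 8 1 0, if z ! t then ise 8 0 else leq 0 8 1 11, gsr 8] @ (if Suc t < a_tapes N then [] else [chk 8 5 1 0]) @
   [cst 9 0, cst 10 0]) Stay Stay Keep"
| bt1: "(s --> s') ==> pe (Up w (Bt s) f) j 0 (Dn w (Bt s')) (cb s f s' @ [dvr 8 1 1, cst 9 0]) Stay Stay Keep"
| bt2: "(s --> s') ==> s' = (fst (snd (snd w)) = None) ==>
  pe (Up w (Bt s) f) j 0 (if s' then Ex w else Wl w) (cb s f s' @ [ise 8 0]) Stay Stay Keep"
| wl1: "i ~= LeftEnd ==> pe (Wl w) i e (Wl w) [] Lft Stay Keep"
| wl2: "pe (Wl w) LeftEnd e (Wr w) [asn 8 10 1 0] Rgt Stay Keep"
| wr1: "pe (Wr w) i e (Wr w) [dvr 8 1 1] Rgt Stay Keep"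
| wr2: "pe (Wr (q, as, Some y, z)) (Letter y) e (Ex (q, as, Some y, z)) [ise 8 0] Stay Stay Keep"
| ex: "(fst w : a_univ N & al = succl N w & al ~= []) \<or> (fst w ~: a_univ N & (EX mv : succs N w. al = [mv])) ==>
  pe (Ex w) j e (Vis (fst (hd al))) [leq 7 5 1 11, asn 7 7 1 1] Stay Stay (Push (en (Some al)))"
| ret1: "e ~= 0 ==> pe Ret j e Ret [] Stay Rgt Keep"
| ret2: "pe Ret j 0 Ret2 [] Stay Lft Keep"
| ret3: "pe Ret2 j (en None) Fin [] Stay Stay Keep"
| ret4: "pe Ret2 j (en (Some [mv])) Ret [dvr 7 1 1] Stay Stay Pop"
| ret5: "al ~= [] ==> pe Ret2 j (en (Some (mv # al))) (Rp al) [] Stay Stay Pop"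
| rp: "pe (Rp al) j e (Vis (fst (hd al))) [] Stay Stay (Push (en (Some al)))"

definition "EF = insert 0 (en ` insert None (Some ` entries N))"

definition "OF = insert Keep (insert Pop (Push ` (EF - {0})))"

definition views :: "'a view set" where
 "views = {..<a_states N} \<times> {l. set l <= {..<a_syms N} & length l = a_tapes N} \<times> UNIV \<times>
  {l. set l <= UNIV & length l = a_tapes N}"

definition "jobs = Tp ` {..<a_tapes N} \<union> Bt ` UNIV"

definition "QF = {Len, Ret, Ret2, Fin} \<union> Bud ` {..<d_states D} \<union> Vis ` {..<a_states N} \<union> (%(w, j). Dn w j) ` (views \<times> jobs) \<union>
 (%(w, j, f). Up w j f) ` (views \<times> jobs \<times> {..<a_syms N}) \<union> Wl ` views \<union> Wr ` views \<union> Ex ` views \<union> Rp ` entries N"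

definition "Bc = C0 + C1 + bD + 3"

definition "P = {((q, i, e), (q', cs, di, ds, p)) | q i e q' cs di ds p. pe q i e q' cs di ds p & q : QF & q' : QF &
 e : EF & p : OF & length cs <= 12 & (ALL c : set cs. cmd_ok 12 c & small Bc c)}"

lemma finite_P: "finite P"
proof -
 have 1: "finite EF" by (simp add: EF_def finite_entries)
 have 2: "finite OF" by (simp add: OF_def 1)
 have 3: "finite views" unfolding views_def by (intro finite_cartesian_product finite_lists_length_eq) simp_all
 have 4: "finite QF" by (simp add: QF_def 3 jobs_def finite_entries)
 have "P <= (QF \<times> UNIV \<times> EF) \<times> (QF \<times> {cs. set cs <= {c. cmd_ok 12 c & small Bc c} & length cs <= 12} \<times> UNIV \<times> UNIV \<times> OF)"
  unfolding P_def by auto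
 thus ?thesis
  by (rule finite_subset) (intro finite_cartesian_product finite_lists_length_le 1 2 4 finite_small finite)
qed

sublocale nprog P B 12 Len "{Fin}"
proof
 show "finite P" by (rule finite_P)
 show "cmd_ok 12 c" if "((q, i, e), (q', cs, di, ds, p)) : P" "c : set cs" for q i e q' cs di ds p c
  using that unfolding P_def by blast
 show "0 < a" if "((q, i, e), (q', cs, di, ds, Push a)) : P" for q i e q' cs di ds a
  using that unfolding P_def OF_def by auto
 show "1 < B" by (rule B)
qed simp

section \<open>Soundness of the search\<close>

context
 fixes x :: "'a list" and cap :: nat
begin

abbreviation "n \<equiv> length x"

definition dreach :: "nat => transducer_conf => bool" where
 "dreach m c = (transducer_step D (replicate m ()))^** (transducer_init D) c"

definition budget :: "(nat => nat) => bool" where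
 "budget v = (v 1 < cap & (EX c. dreach (v 1) c & v 5 = C0 + C1 * length (d_out c)))"

text \<open>\<open>k\<close> is the depth held in register 7. It equals \<open>length es\<close>
  except between the removal of an entry and its replacement by the shortened one, when it is one
  larger.\<close>

definition core :: "act list list => (nat => nat) => nat list => nat => nat => bool" where
 "core es v st sp k = (st = ST es & set es <= entries N & sp <= length st & v 7 = k & k <= v 5 & v 0 = 0 & v 6 = n &
  budget v)"

lemma core_cong:
 "core es v st sp k ==> v' 0 = v 0 ==> v' 1 = v 1 ==> v' 5 = v 5 ==> v' 6 = v 6 ==> v' 7 = v 7 ==> sp' <= length st ==>
  core es v' st sp' k" by (simp add: core_def budget_def)

abbreviation "tap es t \<equiv> a_conts (conf N es) ! t"

fun tapes_ok :: "'a view => act list list => nat => bool" where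
 "tapes_ok (q, as, io, z) es k = (a_state (conf N es) = q &
  (ALL t < k. as ! t = scan (tap es t) & z ! t = (snd (tap es t) = 0)))"

text \<open>The part of the guessed view that has been verified so far: the tapes before
  \<open>t\<close>, or all tapes together with the value of the index digits above the cell in
  register 8.\<close>

fun vfy :: "'a view => job => act list list => (nat => nat) => bool" where
 "vfy w (Tp t) es v = (t < a_tapes N & tapes_ok w es t)"
| "vfy w (Bt s) es v = (tapes_ok w es (a_tapes N) & v 8 <= v 5 &
  (if s then n <= hsum (fst (tap es 0)) (Suc (v 8)) (v 5) else v 10 = hsum (fst (tap es 0)) (Suc (v 8)) (v 5)))"

text \<open>In \<open>Up\<close> the first \<open>sp - 1\<close> entries have been replayed, as cell
  0 of the stack holds the bottom marker. Register 9 is then the head position on the tracked tape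
  and \<open>f\<close> the content of its cell number \<open>v 8\<close>. In \<open>Wr\<close>, the
  letter with address i lies in input cell i + 1.\<close>

fun loc :: "'a dst => act list list => nat => (nat => nat) => nat => bool" where
 "loc (Vis q) es ip v sp = (a_state (conf N es) = q)"
| "loc (Dn w jb) es ip v sp = (w : views & v 9 = 0 & vfy w jb es v)"
| "loc (Up w jb f) es ip v sp = (w : views & vfy w jb es v & 0 < sp &
  v 9 = snd (tap (take (sp - 1) es) (tpi jb)) & f = fst (tap (take (sp - 1) es) (tpi jb)) (v 8))"
| "loc (Wl w) es ip v sp = (w : views & tapes_ok w es (a_tapes N) & v 10 = hsum (fst (tap es 0)) 0 (v 5) & v 10 < n)"
| "loc (Wr w) es ip v sp = (w : views & tapes_ok w es (a_tapes N) & v 10 = hsum (fst (tap es 0)) 0 (v 5) & v 10 < n &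
  v 8 + ip = Suc (v 10))"
| "loc (Ex w) es ip v sp = view_of x w (conf N es)"
| "loc Ret es ip v sp = acc_conf N x (conf N es)"
| "loc Ret2 es ip v sp = (acc_conf N x (conf N es) & sp = length es)"
| "loc Fin es ip v sp = acc_conf N x (atm_init N)"
| "loc _ es ip v sp = False"

fun pinv :: "'a dst => nat => (nat => nat) => nat list => nat => bool" where
 "pinv Len ip v st sp = (st = [] & sp = 0 & v 0 = 0 & v 2 = 0 & v 3 = 0 & v 4 = 0 & v 7 = 0 & v 6 + ip = Suc n)"
| "pinv (Bud q) ip v st sp = (st = [] & sp = 0 & v 0 = 0 & v 7 = 0 & v 6 = n & v 1 < cap & v 2 <= Suc (v 1) &
  (EX c. dreach (v 1) c & d_state c = q & d_ipos c = v 2 & trep bD (d_work c) (v 3) (v 4) & v 5 = C0 + C1 * length (d_out c)))"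
| "pinv (Rp al) ip v st sp = (EX es. core es v st sp (Suc (length es)) & oblig N x (es @ [al]) & al : entries N)"
| "pinv q ip v st sp = (EX es. core es v st sp (length es) & oblig N x es & loc q es ip v sp)"

lemma tapes_pos: "0 < a_tapes N" using N by (simp add: wf_atm_def)

lemma view_ok:
 assumes "set es <= entries N" "(q, as, io, z) : views" "tapes_ok (q, as, io, z) es (a_tapes N)" "length es <= b"
  and io: "io = (if hsum (fst (tap es 0)) 0 b < n then Some (x ! hsum (fst (tap es 0)) 0 b) else None)"
 shows "view_of x (q, as, io, z) (conf N es)"
proof -
 note len = conf_len[OF assms(1)]
 have l: "length as = a_tapes N" "length z = a_tapes N" using assms(2) by (auto simp: views_def)
 have "as = map scan (a_conts (conf N es))" by (rule nth_equalityI) (use l len assms(3) in auto)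
 moreover have "z = map (%tp. snd tp = 0) (a_conts (conf N es))" by (rule nth_equalityI) (use l len assms(3) in auto)
 moreover have "io = addressed x (hd (a_conts (conf N es)))"
 proof -
  have "ALL j > b. fst (tap es 0) j = 0" using conf_bounds[OF assms(1) tapes_pos] assms(4) by simp
  moreover have "hd (a_conts (conf N es)) = tap es 0" using len tapes_pos by (intro hd_conv_nth) auto
  ultimately show ?thesis unfolding io using addressed_hsum by metis
 qed
 moreover have "a_state (conf N es) = q" using assms(3) by simp
 ultimately show ?thesis by (simp add: view_of_def)
qed

lemma inp_sound: "rseq cap (inp i) v v' ==> v 0 = 0 ==>
  i = input_cell (replicate (v 1) ()) (v 2) & (ALL j. j ~= 11 --> v' j = v j)"
 by (cases i) (auto simp: input_cell_def)

lemma bud_step: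
 assumes "d_trans D q i a = Some (q', a', di, dw, b)" "a < bD" "a' < bD" "cs : tcm 3 4 bD a a' dw"
  "rseq cap (inp i @ ipc 2 i di @ cs @ (if b then [asn 5 5 1 C1] else [])) v v'" "pinv (Bud q) ip v st sp"
 shows "pinv (Bud q') ip v' st sp"
proof -
 obtain c where c: "dreach (v 1) c" "d_state c = q" "d_ipos c = v 2" "trep bD (d_work c) (v 3) (v 4)"
  "v 5 = C0 + C1 * length (d_out c)" using assms(6) by auto
 have v: "st = []" "sp = 0" "v 0 = 0" "v 7 = 0" "v 6 = n" "v 1 < cap" "v 2 <= Suc (v 1)" using assms(6) by auto
 obtain v1 v2 v3 where r: "rseq cap (inp i) v v1" "rseq cap (ipc 2 i di) v1 v2" "rseq cap cs v2 v3"
  "rseq cap (if b then [asn 5 5 1 C1] else []) v3 v'" using assms(5) unfolding rseq_append by blast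
 let ?x = "replicate (v 1) ()"
 have 1: "i = input_cell ?x (v 2)" "!!j. j ~= 11 ==> v1 j = v j" using inp_sound[OF r(1) v(3)] by auto
 have 2: "v2 = v1(2 := input_shift ?x di (v 2))"
  using ipc_sound[where x = ?x and u = 2 and v = v1 and cap = cap and d = di and v' = v2] r(2) v(7) 1 by simp
 have "a = scan (d_work c) & trep bD (write_move a' dw (d_work c)) (v3 3) (v3 4) & (ALL j. j ~= 3 --> j ~= 4 --> v3 j = v2 j)"
  by (rule tcm_sound[OF _ assms(4,2,3) _ r(3)]) (use c(4) 1 2 in simp_all)
 hence 3: "a = scan (d_work c)" "trep bD (write_move a' dw (d_work c)) (v3 3) (v3 4)" "!!j. j ~= 3 ==> j ~= 4 ==> v3 j = v2 j"
  by auto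
 have 4: "v' = (if b then v3(5 := v3 5 + C1) else v3)" using r(4) by auto
 define c' where "c' = \<lparr>d_state = q', d_ipos = input_shift ?x di (d_ipos c), d_work = write_move a' dw (d_work c),
  d_out = d_out c @ (if b then [()] else [])\<rparr>"
 have "transducer_step D ?x c c'" unfolding transducer_step_def transducer_action_def
  by (intro exI conjI) (use assms(1) c 1 3 in "auto simp: c'_def")
 hence "dreach (v 1) c'" using c(1) unfolding dreach_def by (meson rtranclp.rtrancl_into_rtrancl)
 moreover have "v' 1 = v 1" "v' 0 = v 0" "v' 7 = v 7" "v' 6 = v 6" "v' 2 = input_shift ?x di (v 2)" "v' 3 = v3 3" "v' 4 = v3 4"
  "v' 5 = v 5 + (if b then C1 else 0)" using 1 2 3 4 by auto
 ultimately show ?thesis using v c 3(2) input_shift_le[of ?x di "v 2"] by (auto simp: c'_def intro!: exI[of _ c'])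
qed

lemma cb_sound:
 assumes "rseq cap (cb s f s') v u" "s --> s'" "v 6 = n" "vfy w (Bt s) es v" "f = fst (tap es 0) (v 8)"
 shows "(ALL j. j ~= 10 --> j ~= 11 --> u j = v j) &
  (if s' then n <= hsum (fst (tap es 0)) (v 8) (v 5) else u 10 = hsum (fst (tap es 0)) (v 8) (v 5) & u 10 < n)"
 using assms hsum_step[of "v 8" "v 5" "fst (tap es 0)"] by (auto simp: cb_def split: if_splits)

lemma loc_step:
 assumes c: "core es v st sp (length es)" and o: "oblig N x es"
  and "pe q i e q' cs di ds p" "q : QF" "q' : QF" "p : OF" "rseq cap cs v v'" "i = input_cell x ip" "e = stack_scan st sp"
  "loc q es ip v sp"
 shows "pinv q' (input_shift x di ip) v' (stack_apply p st) (shift ds sp)"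
proof -
 have st: "st = ST es" "set es <= entries N" "sp <= Suc (length es)" "v 7 = length es" "v 7 <= v 5" "v 0 = 0" "v 6 = n" "budget v"
  using c by (auto simp: core_def)
 \<comment> \<open>The common case of edges that leave the stack alone and change no register below
   8: only the local part of the invariant has to be shown again.\<close>
 have K: "pinv r jp u (stack_apply Keep st) sp'" if "ALL j<8. u j = v j" "sp' <= Suc (length es)" "loc r es jp u sp'" for r jp u sp'
 proof -
  have "core es u st sp' (length es)" by (rule core_cong[OF c]) (use that st in auto)
  thus ?thesis using that(3) o by (cases r) auto
 qed
 have top: "stack_scan st sp = 0 ==> sp = Suc (length es)" "stack_scan st sp = en None ==> sp = 0"
  "stack_scan st sp = en (Some al) ==> EX i. sp = Suc i & i < length es & es ! i = al" for al
  using st(3) unfolding st(1) by (cases sp; auto split: if_splits)+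
 from assms(3-10) show ?thesis
 proof (induction rule: pe.induct)
  case (vis1 q j e)
  thus ?case using acc_leaf[of _ N x] st(3) by (intro K) auto
 next
  case (vis2 q j e w)
  then obtain m where v': "v' = v(8 := m, 9 := 0)" by auto
  have "(q, w) : views" using vis2(2) by (auto simp: QF_def)
  thus ?case using vis2 v' st tapes_pos by (cases w) (intro K; auto)
 next
  case (dn1 e w jb j)
  thus ?case using st by (intro K) auto
 next
  case (dn2 w jb j)
  have "tpi jb < a_tapes N" using dn2 tapes_pos by (cases jb) auto
  hence "tap [] (tpi jb) = blank_tape" by (simp add: atm_init_def)
  thus ?case using dn2 top by (intro K) (auto simp: blank_tape_def)
 next
  case (up al jb a d cs c f' f w j)
  obtain w' where w': "rsem cap c v w'" "rseq cap cs w' v'" using up(7) unfolding rseq.simps by blast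
  hence u: "ALL j. j ~= 11 --> w' j = v j" "f' = (if v 9 = v 8 then a else f)" using up(3) by auto
  obtain i where i: "sp = Suc i" "i < length es" "es ! i = al" using top(3)[OF up(9)[symmetric]] by blast
  have t: "tpi jb < a_tapes N" using up tapes_pos by (cases jb) auto
  have tk: "take (Suc i) es = take i es @ [al]" using i by (simp add: take_Suc_conv_app_nth)
  have "set (take i es @ [al]) <= entries N" using st(2) set_take_subset[of "Suc i" es] unfolding tk by blast
  from conf_tape[OF this t] have ct: "tap (take (Suc i) es) (tpi jb) = write_move a d (tap (take i es) (tpi jb))"
   using up(1) unfolding tk by simp
  have v': "v' = w'(9 := shift d (v 9))" using shc_sound[OF up(2) w'(2)] u by simp
  hence vv: "v' 9 = shift d (v 9)" "v' 8 = v 8" "v' 10 = v 10" "ALL j<8. v' j = v j" using u by auto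
  have "vfy w jb es v'" using up vv by (cases jb) auto
  thus ?case using up(10) u(2) vv i ct by (intro K) (auto simp: write_move_parts)
 next
  case (tp q as io z t j)
  have sp: "sp = Suc (length es)" using tp top by simp
  have l: "v 9 = snd (tap es t)" "as ! t = fst (tap es t) (v 8)" using tp(7) sp by auto
  have z: "v 9 = v 8" "z ! t = (v 8 = 0)" using tp st by (auto split: if_splits)
  have "as ! t = scan (tap es t)" "z ! t = (snd (tap es t) = 0)" using l z by (auto simp: scan_def)
  hence "tapes_ok (q, as, io, z) es (Suc t)" using tp(7) by (auto simp: less_Suc_eq)
  moreover have "Suc t = a_tapes N" if "~ Suc t < a_tapes N" using that tp(7) by auto
  ultimately show ?case using tp sp by (intro K) (auto split: if_splits)
 next
  case (bt1 s s' w f j)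
  have sp: "sp = Suc (length es)" using bt1 top by simp
  obtain u y where u: "rseq cap (cb s f s') v u" "u 8 = y + 1" "v' = u(8 := y, 9 := 0)" using bt1(5) unfolding rseq_append by auto
  note b = cb_sound[OF u(1) bt1(1) st(7), of w es]
  show ?case using bt1 b sp u by (intro K) (auto split: if_splits)
 next
  case (bt2 s s' w f j)
  have sp: "sp = Suc (length es)" using bt2 top by simp
  have u: "rseq cap (cb s f s') v v'" "v' 8 = 0" using bt2(6) unfolding rseq_append by auto
  note b = cb_sound[OF u(1) bt2(1) st(7), of w es]
  obtain q as io z where w: "w = (q, as, io, z)" by (metis surj_pair)
  show ?case
  proof (cases s')
   case True
   have "view_of x w (conf N es)" unfolding w
    by (rule view_ok[OF st(2), of _ _ _ _ "v 5"]) (use bt2 b u st True w sp in auto)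
   thus ?thesis using True b u bt2 sp by (intro K) auto
  next
   case False
   thus ?thesis using b u bt2 sp by (intro K) auto
  qed
 next
  case (wl1 i w e)
  thus ?case using st by (intro K) auto
 next
  case (wl2 w e)
  hence ip: "ip = 0" using input_cell_ends[where x = x and p = ip] by simp
  show ?case using wl2 ip st by (intro K) (auto simp: input_shift_def)
 next
  case (wr1 w i e)
  then obtain y where "v 8 = y + 1" "v' = v(8 := y)" by auto
  thus ?case using wr1 st by (intro K) (auto simp: input_shift_def)
 next
  case (wr2 q as y z e)
  have v': "v 8 = 0" "v' = v" using wr2(4) by auto
  have "x ! hsum (fst (tap es 0)) 0 (v 5) = y" using wr2(5,7) v' by (auto simp: input_cell_def split: if_splits)
  hence "view_of x (q, as, Some y, z) (conf N es)" using wr2(7) st by (intro view_ok[of _ _ _ _ _ "v 5"]) auto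
  thus ?case using v' st by (intro K) auto
 next
  case (ex w al j e)
  obtain t where v': "v' = v(11 := t, 7 := Suc (v 7))" "v 5 = v 7 + t + 1" using ex(5) by auto
  have "al : entries N" using ex(4) by (auto simp: OF_def EF_def)
  hence "core (es @ [al]) v' (stack_apply (Push (en (Some al))) st) sp (length (es @ [al]))"
   using c v' by (auto simp: core_def budget_def)
  moreover have "oblig N x (es @ [al])" using N st(2) o ex(1,8) by (intro oblig_expand[of N es x w]) auto
  moreover have "a_state (conf N (es @ [al])) = fst (hd al)" by (simp add: appl_def)
  ultimately show ?case unfolding pinv.simps loc.simps by (intro exI[of _ "es @ [al]"]) simp
 next
  case (ret1 e j)
  have "sp ~= Suc (length es)" using ret1 st by auto
  thus ?case using ret1 st by (intro K) auto
 next
  case (ret2 j)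
  thus ?case using top by (intro K) auto
 next
  case (ret3 j)
  hence "es = []" using top by auto
  thus ?case using ret3 by (intro K) auto
 next
  case (ret4 j mv)
  obtain es' where es': "es = es' @ [[mv]]" using top(3)[of "[mv]"] ret4(6,7) by (cases es rule: rev_cases) auto
  obtain y where v': "v 7 = y + 1" "v' = v(7 := y)" using ret4(4) by auto
  have "oblig N x es'" "acc_conf N x (conf N es')" using oblig_pop[of N x es' mv "[]"] o ret4(7) es' by auto
  moreover have "core es' v' (stack_apply Pop st) sp (length es')"
   using c ret4(7) v' unfolding es' by (auto simp: core_def budget_def)
  ultimately show ?case by (auto intro!: exI[of _ es'])
 next
  case (ret5 al j mv)
  obtain es' where es': "es = es' @ [mv # al]" using top(3)[of "mv # al"] ret5(7,8) by (cases es rule: rev_cases) auto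
  have "oblig N x (es' @ [al])" using oblig_pop[of N x es' mv al] o ret5(1,8) es' by auto
  moreover have "al : entries N" using st(2) ret5(1) entries_tl[of mv al N] unfolding es' by auto
  moreover have "core es' v' (stack_apply Pop st) sp (Suc (length es'))"
   using c ret5(5,8) unfolding es' by (auto simp: core_def budget_def)
  ultimately show ?case by (auto intro!: exI[of _ es'])
 qed auto
qed

lemma pe_sound:
 assumes "pe q i e q' cs di ds p" "q : QF" "q' : QF" "p : OF" "rseq cap cs v v'" "i = input_cell x ip" "e = stack_scan st sp"
  "pinv q ip v st sp"
 shows "pinv q' (input_shift x di ip) v' (stack_apply p st) (shift ds sp)"
proof -
 have "?thesis \<or> (EX es. core es v st sp (length es) & oblig N x es & loc q es ip v sp)" using assms
 proof (induction rule: pe.induct)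
  case (len1 i)
  hence "ip ~= 0" using input_cell_ends(1)[where x = x and p = ip] by metis
  thus ?case using len1 by (auto simp: input_shift_def)
 next
  case len2
  hence ip: "ip = 0" using input_cell_ends[where x = x and p = ip] by simp
  from len2(4) obtain y m where v': "v 6 = y + 1" "v' = v(6 := y, 1 := m, 5 := C0)" "m < cap" by auto
  have "dreach m (transducer_init D)" by (simp add: dreach_def)
  moreover have "trep bD blank_tape 0 0" by (rule trep_blank) (simp add: bD_def)
  ultimately show ?case using len2 v' ip by (auto simp: transducer_init_def intro!: exI[of _ "transducer_init D"])
 next
  case (bud1 q i a q' a' di dw b cs j)
  have "pinv (Bud q') ip v' st sp" by (rule bud_step[OF bud1(1-4)]) (use bud1 in auto)
  thus ?case by simp
 next
  case (bud2 q j)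
  thus ?case by (auto simp: core_def budget_def ST_def oblig_Nil atm_init_def intro!: exI[of _ "[]"])
 next
  case (rp al j e)
  obtain es where es: "core es v st sp (Suc (length es))" "oblig N x (es @ [al])" "al : entries N" using rp(7) by auto
  have "core (es @ [al]) v' (stack_apply (Push (en (Some al))) st) sp (length (es @ [al]))"
   using es(1,3) rp(4) by (auto simp: core_def budget_def)
  moreover have "a_state (conf N (es @ [al])) = fst (hd al)" by (simp add: appl_def)
  ultimately show ?case using es(2) unfolding pinv.simps loc.simps by (intro disjI1 exI[of _ "es @ [al]"]) simp
 qed simp_all
 thus ?thesis using loc_step[OF _ _ assms(1-7)] by blast
qed

lemma reach_pinv:
 assumes "(mstep P cap x)^** (minit Len x) (q, ip, v, st, sp)"
 shows "pinv q ip v st sp"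
proof -
 have "case c of (q, ip, v, st, sp) => pinv q ip v st sp" if "(mstep P cap x)^** (minit Len x) c" for c using that
 proof (induction rule: rtranclp_induct)
  case (step c c')
  from step(2) show ?case
  proof (cases rule: mstep.cases)
   case (1 q ip st sp q' cs di ds p v v')
   hence "pe q (input_cell x ip) (stack_scan st sp) q' cs di ds p" "q : QF" "q' : QF" "p : OF" unfolding P_def by blast+
   from pe_sound[OF this 1(4) HOL.refl HOL.refl] step(3) 1(1,2) show ?thesis by simp
  qed
 qed (simp add: minit_def)
 thus ?thesis using assms by blast
qed

end

end

section \<open>Running time of the search on an accepting tree\<close>

lemma shc_small: "cs : shc u d ==> u < K ==> 1 <= b ==> c : set cs ==> cmd_ok K c & small b c" by (cases d) auto

lemma tcm_small: "cs : tcm l r b a a' d ==> l < K ==> r < K ==> a < b ==> a' < b ==> Suc b <= k ==> c : set cs ==>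
  cmd_ok K c & small k c" by (cases d) auto

lemma ipc_small: "u < K ==> 1 <= b ==> c : set (ipc u i d) ==> cmd_ok K c & small b c"
 by (cases d) (auto split: if_splits)

lemma inp_small: "1 <= b ==> c : set (inp i) ==> cmd_ok 12 c & small b c" by (cases i) auto

lemma inp_length: "length (inp i) <= 2" by (cases i) auto

definition runs_in :: "('c => 'c => bool) => nat => 'c => 'c => bool" where
 "runs_in R k c c' = (EX j <= k. (R ^^ j) c c')"

lemma runs_in_refl: "runs_in R k c c" unfolding runs_in_def by (intro exI[of _ 0]) simp

lemma runs_in_trans: "runs_in R k c c' ==> runs_in R l c' c'' ==> runs_in R (k + l) c c''"
 unfolding runs_in_def using relpowp_trans add_mono by (metis (no_types, lifting))

lemma runs_in_mono: "runs_in R k c c' ==> k <= l ==> runs_in R l c c'" unfolding runs_in_def using le_trans by blast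

lemma runs_in_step: "R c c' ==> runs_in R 1 c c'" unfolding runs_in_def by (metis order_refl relpowp_1)

context dfs
begin

context
 fixes x :: "'a list" and cap :: nat
begin

abbreviation "rn \<equiv> runs_in (mstep P cap x)"
abbreviation "nn \<equiv> length x"
abbreviation "tapp es t \<equiv> a_conts (conf N es) ! t"

abbreviation "vis es \<equiv> Vis (a_state (conf N es))"

lemma rstep:
 assumes "pe q i e q' cs di ds p" "input_cell x ip = i" "stack_scan st sp = e" "q : QF" "q' : QF" "stack_scan st sp : EF" "p : OF"
  "length cs <= 12" "ALL c : set cs. cmd_ok 12 c & small Bc c" "rseq cap cs v v'"
  "input_shift x di ip = ip'" "stack_apply p st = st'" "shift ds sp = sp'"
 shows "rn 1 (q, ip, v, st, sp) (q', ip', v', st', sp')"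
proof -
 have "mstep P cap x (q, ip, v, st, sp) (q', input_shift x di ip, v', stack_apply p st, shift ds sp)"
  by (rule mstep.intros[OF _ assms(10)]) (use assms(1-9) in "auto simp: P_def")
 thus ?thesis using assms(11-13) by (intro runs_in_step) simp
qed

lemma stay [simp]: "ip <= Suc nn ==> input_shift x Stay ip = ip" by (simp add: input_shift_def)

lemma Bc: "1 <= Bc" "2 <= Bc" "C0 <= Bc" "C1 <= Bc" "Suc bD <= Bc" by (simp_all add: Bc_def)

lemma QF_simps [simp]:
 "Len : QF" "Ret : QF" "Ret2 : QF" "Fin : QF" "(Bud q : QF) = (q < d_states D)" "(Vis q : QF) = (q < a_states N)"
 "(Dn w jb : QF) = (w : views & jb : jobs)" "(Up w jb f : QF) = (w : views & jb : jobs & f < a_syms N)"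
 "(Wl w : QF) = (w : views)" "(Wr w : QF) = (w : views)" "(Ex w : QF) = (w : views)" "(Rp al : QF) = (al : entries N)"
 by (auto simp: QF_def image_iff)

lemma OF_simps [simp]: "Keep : OF" "Pop : OF" "Push (en None) : OF" "(Push (en (Some al)) : OF) = (al : entries N)"
 by (auto simp: OF_def EF_def)

lemma EF_simps [simp]: "0 : EF" "en None : EF" "(en (Some al) : EF) = (al : entries N)" by (auto simp: EF_def)

lemma jobs_simps [simp]: "(Tp t : jobs) = (t < a_tapes N)" "Bt s : jobs" by (auto simp: jobs_def)

lemma scan_EF: "set es <= entries N ==> stack_scan (ST es) sp : EF" by (cases sp) auto

lemma leq_complete: "v j = v i + a + y ==> y < cap ==> rsem cap (leq i j a k) v (v(k := y))" by auto

lemma tpi_less: "jb : jobs ==> tpi jb < a_tapes N" using N by (cases jb) (auto simp: wf_atm_def)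

lemma cb_small: "length (cb s f s') <= 2" "c : set (cb s f s') ==> cmd_ok 12 c & small Bc c"
 using Bc by (auto simp: cb_def split: if_splits)

definition vw :: "act list list => 'a view" where
 "vw es = (a_state (conf N es), map scan (a_conts (conf N es)), addressed x (hd (a_conts (conf N es))),
  map (%tp. snd tp = 0) (a_conts (conf N es)))"

lemma vw_view_of: "view_of x (vw es) (conf N es)" by (simp add: view_of_def vw_def)

context
 fixes b :: nat
 assumes cap: "b < cap" "2 * nn + 2 < cap"
begin

definition gc :: "act list list => (nat => nat) => bool" where
 "gc es v = (v 0 = 0 & v 6 = nn & v 7 = length es & v 5 = b)"

text \<open>The cost of establishing a view: one replay for each tape, one for each of the
  \<open>b + 1\<close> digits of the address, and a walk over the input to the addressed
  letter.\<close>

definition "VV = a_tapes N * (2 * b + 3) + Suc b * (2 * b + 3) + 2 * nn + 10"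

context
 fixes es :: "act list list"
 assumes es: "set es <= entries N" "length es <= b"
begin

abbreviation "ll \<equiv> length es"
abbreviation "tt t \<equiv> a_conts (conf N es) ! t"
abbreviation "hs J \<equiv> hsum (fst (tt 0)) J b"

lemma es_facts [simp]: "stack_scan (ST es) sp : EF" "length (a_conts (conf N es)) = a_tapes N" "a_state (conf N es) < a_states N"
 "t < a_tapes N ==> fst (tt t) i < a_syms N" "0 < a_tapes N" "i < ll ==> es ! i : entries N"
 using scan_EF[OF es(1)] conf_len[OF es(1)] conf_state[OF N es(1)] conf_syms[OF N es(1)] tapes_pos nth_mem es(1)
 by (simp_all add: subset_iff)

lemma vw_views [simp]: "vw es : views"
proof -
 have "ALL tp : set (a_conts (conf N es)). scan tp < a_syms N" by (simp add: all_set_conv_all_nth scan_def)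
 thus ?thesis by (simp add: vw_def views_def image_subset_iff)
qed

lemma vw_input: "vw es = (q, as, io, z) ==> io = (if hs 0 < nn then Some (x ! hs 0) else None)"
proof -
 assume w: "vw es = (q, as, io, z)"
 have "hd (a_conts (conf N es)) = tt 0" by (metis hd_conv_nth es_facts(2,5) length_greater_0_conv)
 moreover have "ALL j > b. fst (tt 0) j = 0" using conf_bounds[OF es(1) es_facts(5)] es(2) by simp
 ultimately show ?thesis using addressed_hsum[of b "tt 0" x] w unfolding vw_def by simp
qed

context
 fixes ip :: nat
 assumes ip: "ip <= Suc nn"
begin

abbreviation "cf q v sp \<equiv> (q, ip, v, ST es, sp)"

lemma dn_run:
 assumes jb: "jb : jobs"
 shows "sp <= Suc ll ==> rn (Suc sp) (cf (Dn (vw es) jb) v sp) (cf (Up (vw es) jb 0) v 1)"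
proof (induction sp)
 case 0
 have "rn 1 (cf (Dn (vw es) jb) v 0) (cf (Up (vw es) jb 0) v 1)"
  by (rule rstep[OF pe.dn2 HOL.refl]) (use jb ip N in "auto simp: wf_atm_def")
 thus ?case by simp
next
 case (Suc sp)
 have "stack_scan (ST es) (Suc sp) ~= en None" using en_inj(1)[of None] by auto
 hence "rn 1 (cf (Dn (vw es) jb) v (Suc sp)) (cf (Dn (vw es) jb) v sp)"
  by (rule rstep[OF pe.dn1 HOL.refl HOL.refl]) (use jb ip in auto)
 from runs_in_trans[OF this Suc.IH] Suc.prems show ?case by simp
qed

lemma up_run:
 assumes g: "gc es v" and jb: "jb : jobs" and v9: "v 9 = 0" and v8: "v 8 < cap"
 shows "i <= ll ==> EX v'. rn i (cf (Up (vw es) jb 0) v 1)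
  (cf (Up (vw es) jb (fst (tapp (take i es) (tpi jb)) (v 8))) v' (Suc i)) &
  v' 9 = snd (tapp (take i es) (tpi jb)) & (ALL j. j ~= 9 --> j ~= 11 --> v' j = v j)"
proof (induction i)
 case 0
 have "tapp [] (tpi jb) = blank_tape" using tpi_less[OF jb] by (simp add: atm_init_def)
 thus ?case using v9 by (intro exI[of _ v]) (simp add: runs_in_refl blank_tape_def)
next
 case (Suc i)
 let ?t = "tpi jb"
 have i: "i < ll" using Suc by simp
 define f where "f = fst (tapp (take i es) ?t) (v 8)"
 define f' where "f' = fst (tapp (take (Suc i) es) ?t) (v 8)"
 obtain u where u: "rn i (cf (Up (vw es) jb 0) v 1) (cf (Up (vw es) jb f) u (Suc i))"
  "u 9 = snd (tapp (take i es) ?t)" "ALL j. j ~= 9 --> j ~= 11 --> u j = v j" using Suc by (auto simp: f_def)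
 define al where "al = es ! i"
 have tk: "take (Suc i) es = take i es @ [al]" using i by (simp add: take_Suc_conv_app_nth al_def)
 obtain a d where ad: "snd (hd al) ! ?t = (a, d)" by (cases "snd (hd al) ! ?t")
 have sub: "set (take i es @ [al]) <= entries N" using es(1) set_take_subset[of "Suc i" es] unfolding tk by blast
 hence sub': "set (take i es) <= entries N" by simp
 from conf_tape[OF sub tpi_less[OF jb]] have ct: "tapp (take (Suc i) es) ?t = write_move a d (tapp (take i es) ?t)"
  using ad unfolding tk by simp
 have u9: "u 9 <= i" using conf_bounds[OF sub' tpi_less[OF jb]] u(2) i by simp
 have f': "f' = (if u 9 = v 8 then a else f)" unfolding f'_def ct by (simp add: write_move_parts u(2) f_def)
 have fs: "f < a_syms N" "f' < a_syms N"
  unfolding f_def f'_def using conf_syms[OF N _ tpi_less[OF jb]] sub' sub tk by (metis, metis)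
 have sc: "stack_scan (ST es) (Suc i) = en (Some al)" using i by (simp add: al_def)
 have "EX k y. (k, f') : {(chk 9 8 1 0, a), (leq 9 8 1 11, f), (leq 8 9 1 11, f)} & rsem cap k u (u(11 := y))"
 proof -
  consider "u 9 = u 8" | "u 9 < u 8" | "u 8 < u 9" by linarith
  thus ?thesis
  proof cases
   case 1
   thus ?thesis using f' u(3) by (intro exI[of _ "chk 9 8 1 0"] exI[of _ "u 11"]) simp
  next
   case 2
   thus ?thesis using f' u(3) v8 by (intro exI[of _ "leq 9 8 1 11"] exI[of _ "u 8 - u 9 - 1"] conjI leq_complete) auto
  next
   case 3
   thus ?thesis using f' u(3) u9 i es(2) cap by (intro exI[of _ "leq 8 9 1 11"] exI[of _ "u 9 - u 8 - 1"] conjI leq_complete) auto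
  qed
 qed
 then obtain k y where k: "(k, f') : {(chk 9 8 1 0, a), (leq 9 8 1 11, f), (leq 8 9 1 11, f)}" "rsem cap k u (u(11 := y))"
  by blast
 let ?u = "u(11 := y)" and ?v = "u(11 := y, 9 := shift d (u 9))"
 have "shift d (u 9) < cap" using u9 es(2) i cap by (cases d) auto
 then obtain cs where cs: "cs : shc 9 d" "rseq cap cs ?u ?v" using shc_complete[of d ?u 9 cap] by auto
 have r: "rseq cap (k # cs) u ?v" using k(2) cs(2) unfolding rseq.simps by blast
 have "rn 1 (cf (Up (vw es) jb f) u (Suc i)) (cf (Up (vw es) jb f') ?v (Suc (Suc i)))"
  by (rule rstep[OF pe.up[OF ad cs(1) k(1)] HOL.refl sc _ _ _ _ _ _ r])
   (use jb ip fs k(1) Bc shc_length[OF cs(1)] shc_small[OF cs(1), of 12 Bc] in auto)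
 from runs_in_trans[OF u(1) this]
 have "rn (Suc i) (cf (Up (vw es) jb 0) v 1) (cf (Up (vw es) jb f') ?v (Suc (Suc i)))" by simp
 moreover have "?v 9 = snd (tapp (take (Suc i) es) ?t)" using u(2) ct by (simp add: write_move_parts)
 moreover have "ALL j. j ~= 9 --> j ~= 11 --> ?v j = v j" using u(3) by simp
 ultimately show ?case unfolding f'_def by blast
qed

lemma job_run:
 assumes g: "gc es v" and jb: "jb : jobs" and v9: "v 9 = 0" and v8: "v 8 < cap" and sp: "sp <= Suc ll"
 shows "EX v'. rn (2 * b + 2) (cf (Dn (vw es) jb) v sp) (cf (Up (vw es) jb (fst (tt (tpi jb)) (v 8))) v' (Suc ll)) &
  v' 9 = snd (tt (tpi jb)) & (ALL j. j ~= 9 --> j ~= 11 --> v' j = v j) & gc es v'"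
proof -
 obtain v' where v': "rn ll (cf (Up (vw es) jb 0) v 1) (cf (Up (vw es) jb (fst (tt (tpi jb)) (v 8))) v' (Suc ll))"
  "v' 9 = snd (tt (tpi jb))" "ALL j. j ~= 9 --> j ~= 11 --> v' j = v j" using up_run[OF g jb v9 v8, of ll] by auto
 have "rn (Suc sp + ll) (cf (Dn (vw es) jb) v sp) (cf (Up (vw es) jb (fst (tt (tpi jb)) (v 8))) v' (Suc ll))"
  by (rule runs_in_trans[OF dn_run[OF jb sp] v'(1)])
 thus ?thesis using v'(2,3) sp es(2) g by (intro exI[of _ v']) (auto simp: gc_def elim: runs_in_mono)
qed

lemma tapes_run:
 "t < a_tapes N ==> gc es v ==> v 9 = 0 ==> v 8 = snd (tt t) ==> sp <= Suc ll ==>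
  EX v'. rn ((a_tapes N - t) * (2 * b + 3)) (cf (Dn (vw es) (Tp t)) v sp) (cf (Dn (vw es) (Bt False)) v' (Suc ll)) &
   gc es v' & v' 9 = 0 & v' 8 = b & v' 10 = 0"
proof (induction "a_tapes N - t" arbitrary: t v sp)
 case (Suc m)
 obtain q as io z where w: "vw es = (q, as, io, z)" by (metis surj_pair)
 have as: "as ! t = scan (tt t)" "z ! t = (snd (tt t) = 0)" using w Suc.prems(1) by (auto simp: vw_def)
 have v8: "v 8 < cap" using Suc.prems(1,4) conf_bounds[OF es(1), of t] es(2) cap by simp
 have f: "fst (tt t) (v 8) = as ! t" using as Suc.prems(4) by (simp add: scan_def)
 hence fs: "as ! t < a_syms N" using es_facts(4)[OF Suc.prems(1)] by metis
 obtain u where u: "rn (2 * b + 2) (cf (Dn (vw es) (Tp t)) v sp) (cf (Up (vw es) (Tp t) (as ! t)) u (Suc ll))"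
  "u 9 = v 8" "ALL j. j ~= 9 --> j ~= 11 --> u j = v j" "gc es u" using job_run[of v "Tp t" sp] Suc.prems v8 f by auto
 \<comment> \<open>The right guess for register 8 in the next replay: the head position on the next
   tape, or the highest digit \<open>b\<close> of the index tape.\<close>
 define k where "k = (if Suc t < a_tapes N then snd (tt (Suc t)) else b)"
 define y where "y = (if z ! t then u 11 else u 8 - 1)"
 let ?j = "if Suc t < a_tapes N then Tp (Suc t) else Bt False" and ?v = "u(11 := y, 8 := k, 9 := 0, 10 := 0)"
 have "k < cap" using conf_bounds[OF es(1), of "Suc t"] es(2) cap by (auto simp: k_def)
 hence r3: "rsem cap (gsr 8) (u(11 := y)) (u(11 := y, 8 := k))" by auto
 have r2: "rsem cap (if z ! t then ise 8 0 else leq 0 8 1 11) u (u(11 := y))"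
  using as(2) u(3,4) Suc.prems(4) v8 by (auto simp: y_def gc_def intro!: exI[of _ "u 8 - 1"])
 have r1: "rsem cap (chk 9 8 1 0) u u" using u(2,3) by simp
 have r4: "rseq cap ((if Suc t < a_tapes N then [] else [chk 8 5 1 0]) @ [cst 9 0, cst 10 0]) (u(11 := y, 8 := k)) ?v"
  using u(4) cap by (auto simp: k_def gc_def)
 have "rn 1 (cf (Up (q, as, io, z) (Tp t) (as ! t)) u (Suc ll)) (cf (Dn (q, as, io, z) ?j) ?v (Suc ll))"
 proof (rule rstep[OF pe.tp HOL.refl])
  show "rseq cap ([chk 9 8 1 0, if z ! t then ise 8 0 else leq 0 8 1 11, gsr 8] @
    (if Suc t < a_tapes N then [] else [chk 8 5 1 0]) @ [cst 9 0, cst 10 0]) u ?v"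
   unfolding append.simps rseq.simps using r1 r2 r3 r4 by blast
 qed (use vw_views[unfolded w] ip fs Bc Suc.prems(1) in auto)
 note s = runs_in_trans[OF u(1) this[folded w]]
 have g: "gc es ?v" using u(4) by (simp add: gc_def)
 show ?case
 proof (cases "Suc t < a_tapes N")
  case True
  have m: "m = a_tapes N - Suc t" using Suc.hyps(2) by simp
  obtain v' where v': "rn ((a_tapes N - Suc t) * (2 * b + 3)) (cf (Dn (vw es) (Tp (Suc t))) ?v (Suc ll)) (cf (Dn (vw es) (Bt False)) v' (Suc ll))"
   "gc es v'" "v' 9 = 0" "v' 8 = b" "v' 10 = 0" using Suc.hyps(1)[OF m True g, of "Suc ll"] True by (auto simp: k_def)
  have "a_tapes N - t = Suc (a_tapes N - Suc t)" using Suc.prems(1) by simp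
  thus ?thesis using runs_in_mono[OF runs_in_trans[OF s[unfolded if_P[OF True]] v'(1)], of "(a_tapes N - t) * (2 * b + 3)"] v'(2-5)
   by auto
 next
  case False
  hence "a_tapes N - t = 1" using Suc.prems(1) by simp
  thus ?thesis using False s g by (intro exI[of _ ?v]) (auto simp: k_def elim: runs_in_mono)
 qed
qed simp

text \<open>The address is continued only while it is at most \<open>nn\<close>, so a Horner step
  yields at most \<open>2 * nn + 1\<close>, which is below the capacity. An address that has reached
  \<open>nn\<close> stays too large, as \<open>hs\<close> does not decrease when further digits are
  taken in.\<close>

lemma bit_run:
 assumes J: "v 8 = J" and g: "gc es v" and v: "v 9 = 0" "J <= b" "sp <= Suc ll"
  and s: "if s then nn <= hs (Suc J) else v 10 = hs (Suc J) & v 10 <= nn"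
 shows "EX u v' f. rn (2 * b + 2) (cf (Dn (vw es) (Bt s)) v sp) (cf (Up (vw es) (Bt s) f) u (Suc ll)) & f < a_syms N &
  rseq cap (cb s f (nn <= hs J)) u v' & gc es v' & v' 8 = J & (s --> nn <= hs J) & (hs J < nn --> v' 10 = hs J)"
proof -
 define f where "f = fst (tt 0) (v 8)"
 obtain u where u: "rn (2 * b + 2) (cf (Dn (vw es) (Bt s)) v sp) (cf (Up (vw es) (Bt s) f) u (Suc ll))"
  "ALL j. j ~= 9 --> j ~= 11 --> u j = v j" "gc es u" using job_run[of v "Bt s" sp] J g v cap unfolding f_def by auto
 let ?h = "hs J"
 have A: "?h = 2 * hs (Suc J) + (if f = 1 then 1 else 0)" using hsum_step[of J b "fst (tt 0)"] v(2) J by (simp add: f_def)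
 define d where "d = (if nn <= ?h then ?h - nn else nn - ?h - 1)"
 define v' where "v' = (if s then u else u(10 := ?h, 11 := d))"
 have "rseq cap (cb s f (nn <= ?h)) u v'"
 proof (cases s)
  case False
  have h: "?h = 2 * u 10 + (if f = 1 then 1 else 0)" "?h < cap" using A s False u(2) cap(2) by auto
  have 1: "rsem cap (asn 10 10 2 (if f = 1 then 1 else 0)) u (u(10 := ?h))" using h by simp
  have d: "d < cap" "if nn <= ?h then ?h = nn + d else nn = ?h + d + 1" using h cap(2) by (auto simp: d_def)
  hence 2: "rsem cap (if nn <= ?h then leq 6 10 0 11 else leq 10 6 1 11) (u(10 := ?h)) (u(10 := ?h, 11 := d))"
   using u(3) by (auto simp: gc_def)
  have "cb s f (nn <= ?h) = [asn 10 10 2 (if f = 1 then 1 else 0), if nn <= ?h then leq 6 10 0 11 else leq 10 6 1 11]"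
   using False by (simp add: cb_def)
  thus ?thesis using 1 2 False unfolding v'_def rseq.simps by auto
 qed (simp add: cb_def v'_def)
 moreover have "f < a_syms N" by (simp add: f_def)
 moreover have "gc es v'" "v' 8 = J" "s --> nn <= ?h" "?h < nn --> v' 10 = ?h" using u(2,3) J s A by (auto simp: v'_def gc_def)
 ultimately show ?thesis using u(1) by blast
qed

lemma bits_run:
 "v 8 = J ==> gc es v ==> v 9 = 0 ==> J <= b ==> sp <= Suc ll ==>
  (if s then nn <= hs (Suc J) else v 10 = hs (Suc J) & v 10 <= nn) ==>
  EX v'. rn (Suc J * (2 * b + 3)) (cf (Dn (vw es) (Bt s)) v sp) (cf (if hs 0 < nn then Wl (vw es) else Ex (vw es)) v' (Suc ll)) &
   gc es v' & (hs 0 < nn --> v' 10 = hs 0)"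
proof (induction J arbitrary: v sp s)
 case 0
 obtain u v' f where u: "rn (2 * b + 2) (cf (Dn (vw es) (Bt s)) v sp) (cf (Up (vw es) (Bt s) f) u (Suc ll))" "f < a_syms N"
  "rseq cap (cb s f (nn <= hs 0)) u v'" "gc es v'" "v' 8 = 0" "s --> nn <= hs 0" "hs 0 < nn --> v' 10 = hs 0"
  using bit_run[OF 0] by blast
 have io: "(nn <= hs 0) = (fst (snd (snd (vw es))) = None)" using vw_input by (cases "vw es") auto
 have r: "rseq cap (cb s f (nn <= hs 0) @ [ise 8 0]) u v'" using u(3,5) unfolding rseq_append by auto
 have "rn 1 (cf (Up (vw es) (Bt s) f) u (Suc ll)) (cf (if nn <= hs 0 then Ex (vw es) else Wl (vw es)) v' (Suc ll))"
  by (rule rstep[OF pe.bt2[OF u(6) io] HOL.refl _ _ _ _ _ _ _ r]) (use u(2) ip cb_small(1)[of s f "nn <= hs 0"] cb_small(2)[of _ s f "nn <= hs 0"] Bc in auto)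
 from runs_in_mono[OF runs_in_trans[OF u(1) this], of "Suc 0 * (2 * b + 3)"] show ?case
  using u(4,7) by (intro exI[of _ v']) auto
next
 case (Suc J)
 obtain u v' f where u: "rn (2 * b + 2) (cf (Dn (vw es) (Bt s)) v sp) (cf (Up (vw es) (Bt s) f) u (Suc ll))" "f < a_syms N"
  "rseq cap (cb s f (nn <= hs (Suc J))) u v'" "gc es v'" "v' 8 = Suc J" "s --> nn <= hs (Suc J)" "hs (Suc J) < nn --> v' 10 = hs (Suc J)"
  using bit_run[OF Suc.prems] by blast
 define v2 where "v2 = v'(8 := J, 9 := 0)"
 have "rseq cap [dvr 8 1 1, cst 9 0] v' v2" using u(5) Suc.prems(4) cap by (auto simp: v2_def intro!: exI[of _ J])
 hence r: "rseq cap (cb s f (nn <= hs (Suc J)) @ [dvr 8 1 1, cst 9 0]) u v2" using u(3) unfolding rseq_append by blast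
 have 1: "rn 1 (cf (Up (vw es) (Bt s) f) u (Suc ll)) (cf (Dn (vw es) (Bt (nn <= hs (Suc J)))) v2 (Suc ll))"
  by (rule rstep[OF pe.bt1[OF u(6)] HOL.refl _ _ _ _ _ _ _ r]) (use u(2) ip cb_small(1)[of s f "nn <= hs (Suc J)"] cb_small(2)[of _ s f "nn <= hs (Suc J)"] Bc in auto)
 have v2: "gc es v2" "v2 8 = J" "v2 9 = 0" "v2 10 = v' 10" using u(4) by (simp_all add: gc_def v2_def)
 hence "if nn <= hs (Suc J) then nn <= hs (Suc J) else v2 10 = hs (Suc J) & v2 10 <= nn" using u(7) by auto
 then obtain w where w: "rn (Suc J * (2 * b + 3)) (cf (Dn (vw es) (Bt (nn <= hs (Suc J)))) v2 (Suc ll))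
   (cf (if hs 0 < nn then Wl (vw es) else Ex (vw es)) w (Suc ll))" "gc es w" "hs 0 < nn --> w 10 = hs 0"
  using Suc.IH[of v2 "Suc ll" "nn <= hs (Suc J)"] v2 Suc_leD[OF Suc.prems(4)] order_refl by blast
 from runs_in_mono[OF runs_in_trans[OF u(1) runs_in_trans[OF 1 w(1)]], of "Suc (Suc J) * (2 * b + 3)"]
 show ?case using w(2,3) by (intro exI[of _ w]) auto
qed

end

lemma wl_run: "ip <= Suc nn ==> rn ip (Wl (vw es), ip, v, ST es, sp) (Wl (vw es), 0, v, ST es, sp)"
proof (induction ip)
 case (Suc ip)
 have "rn 1 (Wl (vw es), Suc ip, v, ST es, sp) (Wl (vw es), ip, v, ST es, sp)"
  by (rule rstep[OF pe.wl1 HOL.refl HOL.refl]) (use Suc.prems in "auto simp: input_cell_def input_shift_def")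
 from runs_in_trans[OF this Suc.IH] Suc.prems show ?case by simp
qed (rule runs_in_refl)

lemma wr_run:
 assumes A: "A < nn"
 shows "v 8 = k ==> ip + k = Suc A ==> rn k (Wr (vw es), ip, v, ST es, sp) (Wr (vw es), Suc A, v(8 := 0), ST es, sp)"
proof (induction k arbitrary: v ip)
 case 0
 hence "v(8 := 0) = v" by (simp add: fun_upd_idem)
 thus ?case using 0 by (simp add: runs_in_refl)
next
 case (Suc k)
 define u where "u = v(8 := k)"
 have u: "u 8 = k" "u(8 := 0) = v(8 := 0)" by (simp_all add: u_def)
 have r: "rseq cap [dvr 8 1 1] v u" using Suc.prems A cap by (auto simp: u_def intro!: exI[of _ k])
 have 1: "rn 1 (Wr (vw es), ip, v, ST es, sp) (Wr (vw es), Suc ip, u, ST es, sp)"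
  by (rule rstep[OF pe.wr1 HOL.refl HOL.refl _ _ _ _ _ _ r]) (use Bc Suc.prems(2) A in "auto simp: input_shift_def")
 have "rn k (Wr (vw es), Suc ip, u, ST es, sp) (Wr (vw es), Suc A, v(8 := 0), ST es, sp)"
  using Suc.IH[of u "Suc ip"] Suc.prems(2) u by (metis add_Suc_shift)
 from runs_in_trans[OF 1 this] show ?case unfolding plus_1_eq_Suc .
qed

lemma expand_run:
 assumes g: "gc es v" and ip: "ip <= Suc nn" and sp: "sp <= Suc ll"
 shows "EX v' ip'. rn VV (vis es, ip, v, ST es, sp) (Ex (vw es), ip', v', ST es, Suc ll) & gc es v' & ip' <= Suc nn"
proof -
 define J where "J = snd (tt 0)"
 let ?v = "v(8 := J, 9 := 0)"
 have "J < cap" using conf_bounds[OF es(1) es_facts(5)] es(2) cap by (simp add: J_def)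
 hence r: "rseq cap [gsr 8, cst 9 0] v ?v" using cap by auto
 obtain w where w: "vw es = (a_state (conf N es), w)" by (simp add: vw_def)
 have "rn 1 (vis es, ip, v, ST es, sp) (Dn (a_state (conf N es), w) (Tp 0), ip, ?v, ST es, sp)"
  by (rule rstep[OF pe.vis2 HOL.refl HOL.refl _ _ _ _ _ _ r]) (use vw_views[unfolded w] Bc ip in auto)
 note 1 = this[folded w]
 have g1: "gc es ?v" using g by (simp add: gc_def)
 obtain v2 where v2: "rn (a_tapes N * (2 * b + 3)) (Dn (vw es) (Tp 0), ip, ?v, ST es, sp)
   (Dn (vw es) (Bt False), ip, v2, ST es, Suc ll)" "gc es v2" "v2 9 = 0" "v2 8 = b" "v2 10 = 0"
  using tapes_run[OF ip es_facts(5) g1 _ _ sp] by (auto simp: J_def)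
 obtain v3 where v3: "rn (Suc b * (2 * b + 3)) (Dn (vw es) (Bt False), ip, v2, ST es, Suc ll)
   (if hs 0 < nn then Wl (vw es) else Ex (vw es), ip, v3, ST es, Suc ll)" "gc es v3" "hs 0 < nn --> v3 10 = hs 0"
  using bits_run[OF ip v2(4,2,3), of "Suc ll" False] v2(5) by auto
 note 3 = runs_in_trans[OF 1 runs_in_trans[OF v2(1) v3(1)]]
 show ?thesis
 proof (cases "hs 0 < nn")
  case False
  hence "rn VV (vis es, ip, v, ST es, sp) (Ex (vw es), ip, v3, ST es, Suc ll)"
   using 3 by (auto simp: VV_def elim!: runs_in_mono)
  thus ?thesis using v3(2) ip by blast
 next
  case True
  let ?v4 = "v3(8 := hs 0)" and ?v5 = "v3(8 := hs 0, 8 := 0)"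
  have r4: "rseq cap [asn 8 10 1 0] v3 ?v4" using v3(3) True cap by auto
  have 5: "rn 1 (Wl (vw es), 0, v3, ST es, Suc ll) (Wr (vw es), 1, ?v4, ST es, Suc ll)"
   by (rule rstep[OF pe.wl2 _ HOL.refl _ _ _ _ _ _ r4]) (use Bc in "auto simp: input_cell_def input_shift_def")
  have 6: "rn (hs 0) (Wr (vw es), 1, ?v4, ST es, Suc ll) (Wr (vw es), Suc (hs 0), ?v5, ST es, Suc ll)"
   by (rule wr_run[OF True]) auto
  obtain q as io z where w: "vw es = (q, as, io, z)" by (metis surj_pair)
  hence w5: "vw es = (q, as, Some (x ! hs 0), z)" using vw_input True by simp
  have r5: "rseq cap [ise 8 0] ?v5 ?v5" by simp
  have 7: "rn 1 (Wr (vw es), Suc (hs 0), ?v5, ST es, Suc ll) (Ex (vw es), Suc (hs 0), ?v5, ST es, Suc ll)"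
   unfolding w5 by (rule rstep[OF pe.wr2 _ HOL.refl _ _ _ _ _ _ r5])
    (use vw_views[unfolded w5] Bc True in "auto simp: input_cell_def")
  have "rn VV (vis es, ip, v, ST es, sp) (Ex (vw es), Suc (hs 0), ?v5, ST es, Suc ll)"
   by (rule runs_in_mono[OF runs_in_trans[OF 3[unfolded if_P[OF True]] runs_in_trans[OF wl_run[OF ip] runs_in_trans[OF 5 runs_in_trans[OF 6 7]]]]])
    (use True ip in "simp add: VV_def")
  moreover have "gc es ?v5" using v3(2) by (simp add: gc_def)
  ultimately show ?thesis using True by (intro exI[of _ ?v5] exI[of _ "Suc (hs 0)"]) simp
 qed
qed

lemma back_run:
 assumes ip: "ip <= Suc nn" and sp: "sp <= Suc ll"
 shows "rn (b + 2) (Ret, ip, v, ST es, sp) (Ret2, ip, v, ST es, ll)"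
proof -
 have up: "rn k (Ret, ip, v, ST es, s) (Ret, ip, v, ST es, s + k)" if "s + k <= Suc ll" for k s using that
 proof (induction k arbitrary: s)
  case (Suc k)
  have "stack_scan (ST es) s ~= 0" using Suc.prems by (cases s) auto
  hence "rn 1 (Ret, ip, v, ST es, s) (Ret, ip, v, ST es, Suc s)"
   by (rule rstep[OF pe.ret1 HOL.refl HOL.refl]) (use ip in auto)
  from runs_in_trans[OF this Suc.IH[of "Suc s"]] Suc.prems show ?case by simp
 qed (simp add: runs_in_refl)
 have m: "rn 1 (Ret, ip, v, ST es, Suc ll) (Ret2, ip, v, ST es, ll)"
  by (rule rstep[OF pe.ret2 HOL.refl]) (use ip in auto)
 have "rn (Suc ll - sp) (Ret, ip, v, ST es, sp) (Ret, ip, v, ST es, Suc ll)" using up[of sp "Suc ll - sp"] sp by simp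
 from runs_in_trans[OF this m] show ?thesis by (rule runs_in_mono) (use es(2) in simp)
qed

end

lemma entries_succl:
 assumes "view_of x w (conf N es)" "set es <= entries N"
 shows "succl N w ~= [] ==> succl N w : entries N" "mv : succs N w ==> [mv] : entries N"
  "distinct (succl N w)" "set (succl N w) = succs N w"
proof -
 obtain q as io z where w: "w = (q, as, io, z)" by (metis surj_pair)
 have z: "length z = a_tapes N" using assms conf_len[OF assms(2)] unfolding w view_of_def by auto
 note s = succl[OF N z, of q as io, folded w] and sub = succs_acts[OF N z, of q as io, folded w]
 show "distinct (succl N w)" "set (succl N w) = succs N w" using s by auto
 show "succl N w : entries N" if "succl N w ~= []"
 proof -
  have "length (succl N w) <= card (acts N)" using s sub by (metis distinct_card card_mono finite_acts)
  thus ?thesis using that s sub by (simp add: entries_def)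
 qed
 show "[mv] : entries N" if "mv : succs N w"
 proof -
  have "mv : acts N" using that sub by blast
  hence "0 < card (acts N)" using finite_acts[of N] card_gt_0_iff by blast
  thus ?thesis using \<open>mv : acts N\<close> by (simp add: entries_def)
 qed
qed

text \<open>\<open>RB\<close> covers the way from a finished child to its next sibling or back to
  the parent. \<open>WW\<close> is what one node of the tree is charged: establishing its view and
  the steps around it.\<close>

definition "RB = b + 8"

definition "WW = VV + 2 * b + 30"

definition visit :: "act list list => nat => bool" where
 "visit es K = (ALL v ip sp. gc es v --> ip <= Suc nn --> sp <= Suc (length es) -->
  (EX v' ip' sp'. rn K (vis es, ip, v, ST es, sp) (Ret, ip', v', ST es, sp') & gc es v' &
   ip' <= Suc nn & sp' <= Suc (length es)))"

lemma visit_mono: "visit es K ==> K <= K' ==> visit es K'" unfolding visit_def by (meson runs_in_mono)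

text \<open>As siblings are finished, the entry is shortened to its suffixes. The hypothesis
  therefore speaks of all entries that start with a transition from \<open>al\<close>; the
  configuration depends only on the first element of an entry.\<close>

lemma list_run:
 assumes es: "set es <= entries N" "length es < b"
 shows "al : entries N ==> (!!al'. al' : entries N ==> hd al' : set al ==> visit (es @ [al']) (K (hd al'))) ==>
  gc (es @ [al]) v ==> ip <= Suc nn ==> sp <= Suc (Suc (length es)) ==>
  EX v' ip' sp'. rn (\<Sum>mv\<leftarrow>al. K mv + RB) (Vis (fst (hd al)), ip, v, ST (es @ [al]), sp) (Ret, ip', v', ST es, sp') &
   gc es v' & ip' <= Suc nn & sp' <= Suc (length es)"
proof (induction al arbitrary: v ip sp)
 case Nil
 thus ?case by (simp add: entries_def)
next
 case (Cons mv al)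
 let ?es = "es @ [mv # al]"
 have st: "a_state (conf N ?es) = fst mv" by (simp add: appl_def)
 have "visit ?es (K mv)" using Cons.prems(2)[of "mv # al"] Cons.prems(1) by simp
 then obtain v1 ip1 sp1 where v1: "rn (K mv) (Vis (fst mv), ip, v, ST ?es, sp) (Ret, ip1, v1, ST ?es, sp1)"
  "gc ?es v1" "ip1 <= Suc nn" "sp1 <= Suc (length ?es)"
  using Cons.prems(3-5) unfolding visit_def st by (metis length_append_singleton)
 have es': "set ?es <= entries N" "length ?es <= b" using Cons.prems(1) es by auto
 note 2 = runs_in_trans[OF v1(1) back_run[OF es' v1(3,4)]]
 have sc: "stack_scan (ST ?es) (length ?es) = en (Some (mv # al))" by simp
 show ?case
 proof (cases "al = []")
  case True
  let ?v = "v1(7 := length es)"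
  have r: "rseq cap [dvr 7 1 1] v1 ?v" using v1(2) es(2) cap by (auto simp: gc_def intro!: exI[of _ "length es"])
  have "rn 1 (Ret2, ip1, v1, ST ?es, length ?es) (Ret, ip1, ?v, ST es, length ?es)"
   by (rule rstep[OF pe.ret4 HOL.refl sc[unfolded True] _ _ _ _ _ _ r, folded True]) (use Bc v1(3) Cons.prems(1) True in auto)
  hence "rn (\<Sum>mv\<leftarrow>mv # al. K mv + RB) (Vis (fst mv), ip, v, ST ?es, sp) (Ret, ip1, ?v, ST es, length ?es)"
   by (rule runs_in_mono[OF runs_in_trans[OF 2]]) (simp add: RB_def)
  moreover have "gc es ?v" "length ?es <= Suc (length es)" using v1(2) by (simp_all add: gc_def)
  ultimately show ?thesis using v1(3) unfolding list.sel by blast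
 next
  case False
  have al: "al : entries N" using entries_tl[OF Cons.prems(1) False] .
  have 3: "rn 1 (Ret2, ip1, v1, ST ?es, length ?es) (Rp al, ip1, v1, ST es, length ?es)"
   by (rule rstep[OF pe.ret5[OF False] HOL.refl sc]) (use al v1(3) Cons.prems(1) in auto)
  have "fst (hd al) < a_states N" using hd_entries[OF al] by (auto simp: acts_def)
  hence 4: "rn 1 (Rp al, ip1, v1, ST es, length ?es) (Vis (fst (hd al)), ip1, v1, ST (es @ [al]), length ?es)"
   by (intro rstep[OF pe.rp HOL.refl HOL.refl]) (use al v1(3) scan_EF[OF es(1)] in auto)
  have g: "gc (es @ [al]) v1" using v1(2) by (simp add: gc_def)
  obtain v5 ip5 sp5 where 5: "rn (\<Sum>mv\<leftarrow>al. K mv + RB) (Vis (fst (hd al)), ip1, v1, ST (es @ [al]), length ?es) (Ret, ip5, v5, ST es, sp5)"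
   "gc es v5" "ip5 <= Suc nn" "sp5 <= Suc (length es)"
   using Cons.IH[OF al Cons.prems(2) g v1(3), of "length ?es"] by auto
  from runs_in_mono[OF runs_in_trans[OF 2 runs_in_trans[OF 3 runs_in_trans[OF 4 5(1)]]], of "\<Sum>mv\<leftarrow>mv # al. K mv + RB"]
  show ?thesis using 5(2-4) by (auto simp: RB_def)
 qed
qed

lemma node_run:
 assumes es: "set es <= entries N" "length es < b" and al: "al : entries N"
  and ch: "(fst (vw es) : a_univ N & al = succl N (vw es) & al ~= []) \<or> (fst (vw es) ~: a_univ N & (EX mv : succs N (vw es). al = [mv]))"
  and K: "!!al'. al' : entries N ==> hd al' : set al ==> visit (es @ [al']) (K (hd al'))"
  and le: "VV + 1 + (\<Sum>mv\<leftarrow>al. K mv + RB) <= M"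
 shows "visit es M" unfolding visit_def
proof (intro allI impI, goal_cases)
 case v: (1 v ip sp)
 obtain v1 ip1 where 1: "rn VV (vis es, ip, v, ST es, sp) (Ex (vw es), ip1, v1, ST es, Suc (length es))"
  "gc es v1" "ip1 <= Suc nn" using expand_run[OF es(1) _ v] es(2) by auto
 let ?v = "v1(11 := b - length es - 1, 7 := Suc (length es))"
 have r: "rseq cap [leq 7 5 1 11, asn 7 7 1 1] v1 ?v"
  using 1(2) es(2) cap by (auto simp: gc_def intro!: exI[of _ "b - length es - 1"])
 have hs: "fst (hd al) < a_states N" using hd_entries[OF al] by (auto simp: acts_def)
 have 2: "rn 1 (Ex (vw es), ip1, v1, ST es, Suc (length es)) (Vis (fst (hd al)), ip1, ?v, ST (es @ [al]), Suc (length es))"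
  by (rule rstep[OF pe.ex[OF ch] HOL.refl HOL.refl _ _ _ _ _ _ r])
   (use vw_views[OF es(1)] scan_EF[OF es(1)] hs al Bc es(2) 1(3) in auto)
 have g: "gc (es @ [al]) ?v" using 1(2) by (simp add: gc_def)
 obtain v' ip' sp' where 3: "rn (\<Sum>mv\<leftarrow>al. K mv + RB) (Vis (fst (hd al)), ip1, ?v, ST (es @ [al]), Suc (length es)) (Ret, ip', v', ST es, sp')"
  "gc es v'" "ip' <= Suc nn" "sp' <= Suc (length es)" using list_run[OF es al K g 1(3), of "Suc (length es)"] by auto
 have "rn M (vis es, ip, v, ST es, sp) (Ret, ip', v', ST es, sp')"
  by (rule runs_in_mono[OF runs_in_trans[OF 1(1) runs_in_trans[OF 2 3(1)]]]) (use le in simp)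
 thus ?case using 3 by blast
qed

text \<open>Every node is charged \<open>WW\<close>. The way back \<open>RB\<close> is included in
  the bound for a subtree, so that the sum over the children also pays for the steps between
  them.\<close>

lemma tree_run:
 "accepting_from N x u ==> label u = conf N es ==> set es <= entries N ==> treedepth u + length es <= b ==>
  EX K. visit es K & K + RB <= treesize u * WW"
proof (induction arbitrary: es rule: accepting_from.induct)
 case (leaf c)
 have c: "a_state (conf N es) : a_accept N" using leaf by simp
 have "visit es 1" unfolding visit_def
 proof (intro allI impI, goal_cases)
  case v: (1 v ip sp)
  have "rn 1 (vis es, ip, v, ST es, sp) (Ret, ip, v, ST es, sp)"
   by (rule rstep[OF pe.vis1[OF c] HOL.refl HOL.refl]) (use conf_state[OF N leaf(3)] scan_EF[OF leaf(3)] v(2) in auto)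
  thus ?case using v by blast
 qed
 moreover have "1 + RB <= treesize (Node c []) * WW" by (simp add: RB_def WW_def)
 ultimately show ?case by blast
next
 case (exist c u)
 have c: "c = conf N es" using exist.prems(1) by simp
 note len = conf_len[OF exist.prems(2)]
 obtain mv where mv: "mv : succs N (vw es)" "label u = appl mv (conf N es)"
  using exist(2) step_succs[OF N len vw_view_of] c by blast
 note ent = entries_succl(2)[OF vw_view_of exist.prems(2) mv(1)]
 have d: "Suc (treedepth u) + length es <= b" using exist.prems(3) by simp
 have ex: "EX K. visit (es @ [al']) K & K + RB <= treesize u * WW" if "al' : entries N" "hd al' = mv" for al'
  by (rule exist.IH) (use that mv exist.prems(2) d in auto)
 hence K: "visit (es @ [al']) (treesize u * WW - RB)" if "al' : entries N" "hd al' = mv" for al'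
 proof -
  obtain K where "visit (es @ [al']) K" "K + RB <= treesize u * WW" using ex[OF `al' : entries N` \<open>hd al' = mv\<close>] by blast
  thus ?thesis using visit_mono by (metis add_le_imp_le_diff)
 qed
 obtain K0 where "K0 + RB <= treesize u * WW" using ex[OF ent] by auto
 hence RB: "RB <= treesize u * WW" by simp
 let ?M = "VV + 1 + treesize u * WW"
 have "visit es ?M" by (rule node_run[OF exist.prems(2) _ ent, where K = "%_. treesize u * WW - RB"])
   (use d exist(1) c mv(1) K RB in "auto simp: vw_def")
 moreover have "?M + RB <= treesize (Node c [u]) * WW" by (simp add: RB_def WW_def)
 ultimately show ?case by blast
next
 case (univ c us)
 have c: "c = conf N es" using univ.prems(1) by simp
 note len = conf_len[OF univ.prems(2)]
 note es = entries_succl[OF vw_view_of univ.prems(2)]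
 let ?al = "succl N (vw es)"
 have step: "{c'. atm_step N x c c'} = (%mv. appl mv (conf N es)) ` succs N (vw es)"
  using step_succs[OF N len vw_view_of] c by blast
 have ne: "?al ~= []" using univ(2,4) step es(4) by auto
 have "ALL mv : succs N (vw es). EX u : set us. label u = appl mv (conf N es)"
 proof
  fix mv assume "mv : succs N (vw es)"
  hence "appl mv (conf N es) : label ` set us" unfolding univ(4) step by blast
  thus "EX u : set us. label u = appl mv (conf N es)" by auto
 qed
 then obtain U where U: "!!mv. mv : succs N (vw es) ==> U mv : set us & label (U mv) = appl mv (conf N es)" by metis
 \<comment> \<open>Distinct normalized transitions lead to children with distinct labels, so each
   subtree of the accepting tree is charged only once.\<close>
 have inj: "inj_on U (succs N (vw es))" by (rule inj_onI) (metis U appl_inj[OF N len vw_view_of])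
 have d: "Suc (treedepth u) + length es <= b" if "u : set us" for u
 proof -
  have "treedepth u <= Max (set (map treedepth us))" using that by (intro Max_ge) auto
  thus ?thesis using univ.prems(3) univ(2) by simp
 qed
 have ex: "EX K. visit (es @ [al']) K & K + RB <= treesize (U (hd al')) * WW"
  if "al' : entries N" "hd al' : set ?al" for al'
 proof -
  have u: "U (hd al') : set us" "label (U (hd al')) = appl (hd al') (conf N es)" using U that(2) es(4) by auto
  thus ?thesis using univ(5) that(1) univ.prems(2) d[OF u(1)] by auto
 qed
 have K: "visit (es @ [al']) (treesize (U (hd al')) * WW - RB)" if "al' : entries N" "hd al' : set ?al" for al'
 proof -
  obtain K where "visit (es @ [al']) K" "K + RB <= treesize (U (hd al')) * WW"
   using ex[OF `al' : entries N` `hd al' : set ?al`] by blast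
  thus ?thesis using visit_mono by (metis add_le_imp_le_diff)
 qed
 have one: "1 <= treesize u" for u by (cases u) simp
 have RW: "RB <= WW" by (simp add: RB_def WW_def)
 have RB: "treesize u * WW - RB + RB = treesize u * WW" for u
  using one[of u] RW by (metis le_add_diff_inverse2 le_trans mult_le_mono1 mult_1)
 have "(\<Sum>mv\<leftarrow>?al. treesize (U mv) * WW - RB + RB) = (\<Sum>mv\<leftarrow>?al. treesize (U mv)) * WW"
  unfolding RB by (simp add: sum_list_mult_const)
 also have "(\<Sum>mv\<leftarrow>?al. treesize (U mv)) = (\<Sum>mv\<in>succs N (vw es). treesize (U mv))"
  using sum_list_distinct_conv_sum_set[OF es(3), of "%mv. treesize (U mv)"] es(4) by simp
 also have "... = sum treesize (U ` succs N (vw es))" using inj by (simp add: sum.reindex)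
 also have "... <= sum treesize (set us)" by (rule sum_mono2) (use U in auto)
 also have "... = sum_list (map treesize us)"
  using sum_list_distinct_conv_sum_set[of us treesize] univ(3) distinct_map by metis
 finally have S: "(\<Sum>mv\<leftarrow>?al. treesize (U mv) * WW - RB + RB) <= sum_list (map treesize us) * WW"
  by (simp add: mult_le_mono1)
 obtain u0 where "u0 : set us" using univ(2) by (cases us) auto
 from d[OF this] have lt: "length es < b" by simp
 let ?M = "VV + 1 + sum_list (map treesize us) * WW"
 have "visit es ?M" by (rule node_run[OF univ.prems(2) lt es(1)[OF ne], where K = "%mv. treesize (U mv) * WW - RB"])
   (use univ(1) c K S ne in "auto simp: vw_def")
 moreover have "?M + RB <= treesize (Node c us) * WW" by (simp add: RB_def WW_def)
 ultimately show ?case by blast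
qed

end

end

end

section \<open>Halting times of deterministic transducers\<close>

abbreviation "treach D y \<equiv> (transducer_step D y)^** (transducer_init D)"

lemma transducer_step_det: "transducer_step D y c c1 ==> transducer_step D y c c2 ==> c1 = c2"
 unfolding transducer_step_def by force

definition halted :: "transducer => unit list => transducer_conf => bool" where
 "halted D y c = (transducer_action D y c = None)"

lemma halted_step: "halted D y c ==> ~ transducer_step D y c c'" by (simp add: halted_def transducer_step_def)

lemma transducer_out_mono: "(transducer_step D y)^** c c' ==> length (d_out c) <= length (d_out c')"
 by (induction rule: rtranclp_induct) (auto simp: transducer_step_def)

text \<open>By determinism every reachable configuration lies on the way to the halting one. As the
  output only grows, each partial output is bounded by the final one.\<close>

lemma transducer_reach_halted:
 assumes "(transducer_step D y)^** c0 c" "(transducer_step D y)^** c0 cf" "halted D y cf"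
 shows "(transducer_step D y)^** c cf" using assms(1)
proof (induction rule: rtranclp_induct)
 case (step c c')
 from step(3,2) show ?case
 proof (cases rule: converse_rtranclpE)
  case base
  thus ?thesis using step(2) halted_step assms(3) by blast
 next
  case (step c'')
  thus ?thesis using transducer_step_det `transducer_step D y c c'` by metis
 qed
qed (rule assms(2))

text \<open>The number of steps until a transducer halts depends only on its configuration without the
 output, so no such configuration occurs twice in a halting run.\<close>

definition dcore :: "transducer_conf => nat * nat * tape" where
 "dcore c = (d_state c, d_ipos c, d_work c)"

lemma halting_time_core:
 "(transducer_step D y ^^ i) c cf ==> halted D y cf ==> (transducer_step D y ^^ j) c' cf' ==> halted D y cf' ==>
  dcore c = dcore c' ==> i = j"
proof (induction i arbitrary: c c' j)
 case 0
 hence "halted D y c'" by (simp add: halted_def transducer_action_def dcore_def)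
 show ?case
 proof (cases j)
  case (Suc k)
  then obtain d where "transducer_step D y c' d" using relpowp_Suc_D2 0(3) by metis
  thus ?thesis using halted_step `halted D y c'` by blast
 qed simp
next
 case (Suc i)
 obtain d where d: "transducer_step D y c d" "(transducer_step D y ^^ i) d cf" using relpowp_Suc_D2[OF Suc.prems(1)] by blast
 have "~ halted D y c'"
 proof
  assume "halted D y c'"
  hence "halted D y c" using Suc.prems(5) by (simp add: halted_def transducer_action_def dcore_def)
  thus False using d(1) halted_step by blast
 qed
 then obtain j' where j: "j = Suc j'" using Suc.prems(3,4) by (cases j) auto
 obtain d' where d': "transducer_step D y c' d'" "(transducer_step D y ^^ j') d' cf'"
  using relpowp_Suc_D2 Suc.prems(3) unfolding j by metis
 have "dcore d = dcore d'" using d(1) d'(1) Suc.prems(5)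
  unfolding transducer_step_def transducer_action_def dcore_def by force
 thus ?case using Suc.IH[OF d(2) Suc.prems(2) d'(2) Suc.prems(4)] j by simp
qed

definition tapes :: "nat => nat => tape set" where
 "tapes b w = {f. (ALL i < w. f i < b) & (ALL i >= w. f i = 0)} \<times> {..<w}"

lemma card_tapes: "finite (tapes b w) & card (tapes b w) <= b ^ w * w"
proof -
 let ?F = "{f. (ALL i < w. f i < b) & (ALL i >= w. f i = (0::nat))}"
 have inj: "inj_on (%f. map f [0..<w]) ?F"
 proof (rule inj_onI)
  fix f g assume fg: "f : ?F" "g : ?F" "map f [0..<w] = map g [0..<w]"
  show "f = g"
  proof
   fix i show "f i = g i" using fg by (cases "i < w") (auto simp: map_eq_conv)
  qed
 qed
 have sub: "(%f. map f [0..<w]) ` ?F <= {l. set l <= {..<b} & length l = w}" by auto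
 have fin: "finite {l. set l <= {..<b} & length l = w}" by (rule finite_lists_length_eq) simp
 have "finite ?F" using finite_subset[OF sub fin] inj by (rule finite_imageD)
 moreover have "card ?F <= b ^ w" using card_inj_on_le[OF inj sub fin] card_lists_length_eq[of "{..<b}" w] by simp
 ultimately show ?thesis by (simp add: tapes_def card_cartesian_product mult_le_mono1)
qed

lemma transducer_reach_bounds:
 assumes "wf_transducer D" "!!c. treach D y c ==> snd (d_work c) < w"
  "treach D y c"
 shows "d_state c < d_states D & d_ipos c <= Suc (length y) & (ALL i. fst (d_work c) i < d_syms D) &
  (ALL i >= w. fst (d_work c) i = 0) & snd (d_work c) < w" using assms(3)
proof (induction rule: rtranclp_induct)
 case base
 thus ?case using assms(1) assms(2)[of "transducer_init D"]
  by (simp add: transducer_init_def wf_transducer_def blank_tape_def)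
next
 case (step c c')
 obtain q a di dw b where s: "transducer_action D y c = Some (q, a, di, dw, b)"
  "c' = \<lparr>d_state = q, d_ipos = input_shift y di (d_ipos c), d_work = write_move a dw (d_work c),
   d_out = d_out c @ (if b then [()] else [])\<rparr>" using step(2) unfolding transducer_step_def by blast
 have "scan (d_work c) < d_syms D" using step(3) by (simp add: scan_def)
 hence "q < d_states D" "a < d_syms D"
  using s(1) assms(1) step(3) unfolding transducer_action_def wf_transducer_def by blast+
 moreover have "snd (d_work c') < w" using assms(2) step(1,2) by (meson rtranclp.rtrancl_into_rtrancl)
 ultimately show ?case using s(2) step(3) input_shift_le[of y di "d_ipos c"] by (auto simp: write_move_parts)
qed

lemma halting_time_bound:
 assumes "wf_transducer D" "!!c. treach D y c ==> snd (d_work c) < w"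
  "(transducer_step D y ^^ j) (transducer_init D) cf" "halted D y cf"
 shows "j < d_states D * ((length y + 2) * (d_syms D ^ w * w))"
proof -
 obtain f where f: "f 0 = transducer_init D" "f j = cf" "!!i. i < j ==> transducer_step D y (f i) (f (Suc i))"
  using assms(3) unfolding relpowp_fun_conv by blast
 have reach: "(transducer_step D y ^^ i) (f 0) (f i)" if "i <= j" for i
  using that f(3) unfolding relpowp_fun_conv by (intro exI[of _ f]) auto
 have rest: "(transducer_step D y ^^ (j - i)) (f i) cf" if "i <= j" for i
  using that f(2,3) unfolding relpowp_fun_conv by (intro exI[of _ "%k. f (i + k)"]) auto
 let ?S = "{..<d_states D} \<times> {..Suc (length y)} \<times> tapes (d_syms D) w"
 have inj: "inj_on (dcore \<circ> f) {..j}"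
 proof (rule inj_onI)
  fix i k assume ik: "i : {..j}" "k : {..j}" "(dcore \<circ> f) i = (dcore \<circ> f) k"
  have "j - i = j - k" by (rule halting_time_core[OF rest assms(4) rest assms(4)]) (use ik in auto)
  thus "i = k" using ik by auto
 qed
 have sub: "(dcore \<circ> f) ` {..j} <= ?S"
 proof
  fix t assume "t : (dcore \<circ> f) ` {..j}"
  then obtain i where i: "i <= j" "t = dcore (f i)" by auto
  have "treach D y (f i)" using reach[OF i(1)] f(1) by (metis relpowp_imp_rtranclp)
  from transducer_reach_bounds[OF assms(1,2) this] show "t : ?S"
   unfolding i(2) dcore_def tapes_def by (cases "d_work (f i)") auto
 qed
 have fin: "finite ?S" using card_tapes by blast
 have "Suc j <= card ?S" using card_inj_on_le[OF inj sub fin] by simp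
 also have "... = d_states D * ((length y + 2) * card (tapes (d_syms D) w))" by (simp add: card_cartesian_product)
 also have "... <= d_states D * ((length y + 2) * (d_syms D ^ w * w))" using card_tapes by (intro mult_le_mono2) blast
 finally show ?thesis by simp
qed

section \<open>The search together with the computation of its depth bound\<close>

context dfs
begin

context
 fixes x :: "'a list" and cap :: nat
begin

abbreviation "rm \<equiv> runs_in (mstep P cap x)"

lemma len_run:
 assumes "ip <= Suc (length x)" "v 6 + ip < cap"
 shows "rm ip (Len, ip, v, [], 0) (Len, 0, v(6 := v 6 + ip), [], 0)" using assms
proof (induction ip arbitrary: v)
 case 0
 thus ?case by (simp add: runs_in_refl)
next
 case (Suc ip)
 define v1 where "v1 = v(6 := Suc (v 6))"
 have r: "rseq cap [asn 6 6 1 1] v v1" using Suc.prems by (simp add: v1_def)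
 have m: "rm 1 (Len, Suc ip, v, [], 0) (Len, ip, v1, [], 0)"
  by (rule rstep[OF pe.len1 HOL.refl _ _ _ _ _ _ _ r]) (use Bc Suc.prems in "auto simp: stack_scan_def input_cell_def input_shift_def")
 have "rm ip (Len, ip, v1, [], 0) (Len, 0, v1(6 := v1 6 + ip), [], 0)"
  by (rule Suc.IH) (use Suc.prems in "auto simp: v1_def")
 moreover have "v1(6 := v1 6 + ip) = v(6 := v 6 + Suc ip)" by (auto simp: v1_def)
 ultimately show ?case using runs_in_trans[OF m] unfolding plus_1_eq_Suc by metis
qed

lemma inp_complete:
 assumes "v 0 = 0" "v 2 <= Suc (v 1)" "ALL j. v j < cap"
 shows "EX v'. rseq cap (inp (input_cell (replicate (v 1) ()) (v 2))) v v' & (ALL j. j ~= 11 --> v' j = v j) & v' 11 < cap"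
proof -
 consider "v 2 = 0" | "1 <= v 2" "v 2 <= v 1" | "v 2 = Suc (v 1)" using assms(2) by linarith
 thus ?thesis
 proof cases
  case 1
  thus ?thesis using assms by (intro exI[of _ v]) (simp add: input_cell_def)
 next
  case 2
  let ?u = "v(11 := v 2 - 1)" and ?w = "v(11 := v 1 - v 2)"
  have b: "v 2 - 1 < cap" "v 1 - v 2 < cap" using assms(3) by (meson diff_le_self le_less_trans)+
  have "rsem cap (leq 0 2 1 11) v ?u" using 2 assms(1) b(1) by (auto intro!: exI[of _ "v 2 - 1"])
  moreover have "rsem cap (leq 2 1 0 11) ?u ?w" using 2 b(2) by (auto intro!: exI[of _ "v 1 - v 2"])
  ultimately have "rseq cap [leq 0 2 1 11, leq 2 1 0 11] v ?w" unfolding rseq.simps by blast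
  moreover have "input_cell (replicate (v 1) ()) (v 2) = Letter ()" using 2 by (auto simp: input_cell_def)
  ultimately show ?thesis using b by (intro exI[of _ ?w]) auto
 next
  case 3
  thus ?thesis using assms by (intro exI[of _ v]) (simp add: input_cell_def)
 qed
qed

lemma bud_run:
 assumes w: "!!c. treach D (replicate m ()) c ==> snd (d_work c) < w"
  and cap: "Suc m < cap" "Suc bD ^ w <= cap" "C0 + C1 * J < cap" and ip: "ip <= Suc (length x)"
  and v0: "ALL j. v j < cap" "v 0 = 0" "v 1 = m" "v 2 = 0" "v 3 = 0" "v 4 = 0" "v 5 = C0"
 shows "j <= J ==> (transducer_step D (replicate m ()) ^^ j) (transducer_init D) c ==>
  EX v'. rm j (Bud (d_start D), ip, v, [], 0) (Bud (d_state c), ip, v', [], 0) &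
   (ALL i. v' i < cap) & v' 0 = 0 & v' 1 = m & v' 6 = v 6 & v' 7 = v 7 & v' 2 = d_ipos c & trep bD (d_work c) (v' 3) (v' 4) &
   v' 5 = C0 + C1 * length (d_out c) & length (d_out c) <= j"
proof (induction j arbitrary: c)
 case 0
 have "trep bD blank_tape 0 0" by (rule trep_blank) (simp add: bD_def)
 thus ?case using 0 v0 by (intro exI[of _ v]) (auto simp: transducer_init_def runs_in_refl)
next
 case (Suc j)
 let ?y = "replicate m ()"
 obtain c0 where c0: "(transducer_step D ?y ^^ j) (transducer_init D) c0" "transducer_step D ?y c0 c" using Suc.prems(2) by auto
 obtain u where u: "rm j (Bud (d_start D), ip, v, [], 0) (Bud (d_state c0), ip, u, [], 0)"
  "ALL i. u i < cap" "u 0 = 0" "u 1 = m" "u 6 = v 6" "u 7 = v 7" "u 2 = d_ipos c0" "trep bD (d_work c0) (u 3) (u 4)"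
  "u 5 = C0 + C1 * length (d_out c0)" "length (d_out c0) <= j" using Suc.IH[OF _ c0(1)] Suc.prems(1) by auto
 have reach0: "(transducer_step D ?y)^** (transducer_init D) c0" using c0(1) by (rule relpowp_imp_rtranclp)
 have reach: "(transducer_step D ?y)^** (transducer_init D) c" using Suc.prems(2) by (rule relpowp_imp_rtranclp)
 note b0 = transducer_reach_bounds[OF D w reach0] and b1 = transducer_reach_bounds[OF D w reach]
 obtain q a di dw b where s: "transducer_action D ?y c0 = Some (q, a, di, dw, b)"
  "c = \<lparr>d_state = q, d_ipos = input_shift ?y di (d_ipos c0), d_work = write_move a dw (d_work c0),
   d_out = d_out c0 @ (if b then [()] else [])\<rparr>" using c0(2) unfolding transducer_step_def by blast
 have sc: "scan (d_work c0) < d_syms D" using b0 by (simp add: scan_def)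
 hence a: "a < bD" using s(1) D b0 unfolding transducer_action_def wf_transducer_def bD_def using less_SucI by blast
 let ?i = "input_cell ?y (d_ipos c0)"
 obtain u1 where u1: "rseq cap (inp ?i) u u1" "ALL j. j ~= 11 --> u1 j = u j" "u1 11 < cap"
  using inp_complete[of u] u b0 by auto
 define u2 where "u2 = u1(2 := input_shift ?y di (d_ipos c0))"
 have shc: "input_shift ?y di (d_ipos c0) < cap" using input_shift_le[of ?y di "d_ipos c0"] cap(1) by simp
 have r2: "rseq cap (ipc 2 ?i di) u1 u2"
  using ipc_iff[where v = u1 and u = 2 and x = ?y and d = di and cap = cap and v' = u2] u1(2) u(7) b0 shc by (simp add: u2_def)
 have "EX cs : tcm 3 4 bD (scan (d_work c0)) a dw. EX v'. rseq cap cs u2 v' & trep bD (write_move a dw (d_work c0)) (v' 3) (v' 4) &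
  (ALL i. i ~= 3 --> i ~= 4 --> v' i = u2 i)"
 proof (rule tcm_complete)
  show "trep bD (d_work c0) (u2 3) (u2 4)" using u(8) u1(2) by (simp add: u2_def)
  show "a < bD" by (rule a)
  show "u2 3 < cap" "u2 4 < cap" using u(2) u1(2) by (simp_all add: u2_def)
  show "l' < cap & r' < cap" if "trep bD (write_move a dw (d_work c0)) l' r'" for l' r'
  proof -
   have "l' < Suc bD ^ w & r' < Suc bD ^ w"
    by (rule trep_bound[OF that]) (use b1 s(2) D in "auto simp: bD_def wf_transducer_def")
   thus ?thesis using cap(2) by linarith
  qed
 qed simp_all
 then obtain cs u3 where cs: "cs : tcm 3 4 bD (scan (d_work c0)) a dw" "rseq cap cs u2 u3"
  "trep bD (write_move a dw (d_work c0)) (u3 3) (u3 4)" "ALL i. i ~= 3 --> i ~= 4 --> u3 i = u2 i" by blast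
 have u3c: "u3 3 < cap" "u3 4 < cap"
 proof -
  have "u3 3 < Suc bD ^ w & u3 4 < Suc bD ^ w"
   by (rule trep_bound[OF cs(3)]) (use b1 s(2) D in "auto simp: bD_def wf_transducer_def")
  thus "u3 3 < cap" "u3 4 < cap" using cap(2) by linarith+
 qed
 define u4 where "u4 = (if b then u3(5 := u3 5 + C1) else u3)"
 have u35: "u3 5 = C0 + C1 * length (d_out c0)" using cs(4) u1(2) u(9) by (simp add: u2_def)
 have oc: "C0 + C1 * length (d_out c) < cap"
 proof -
  have "length (d_out c) <= J" using u(10) Suc.prems(1) s(2) by auto
  hence "C1 * length (d_out c) <= C1 * J" by (rule mult_le_mono2)
  thus ?thesis using cap(3) by linarith
 qed
 have r4: "rseq cap (if b then [asn 5 5 1 C1] else []) u3 u4" using oc u35 s(2) by (auto simp: u4_def)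
 let ?cs = "inp ?i @ ipc 2 ?i di @ cs @ (if b then [asn 5 5 1 C1] else [])"
 have r: "rseq cap ?cs u u4" using u1(1) r2 cs(2) r4 unfolding rseq_append by blast
 have s2: "d_state c = q" using s(2) by simp
 have dt: "d_trans D (d_state c0) ?i (scan (d_work c0)) = Some (q, a, di, dw, b)" using s(1) by (simp add: transducer_action_def)
 have scb: "scan (d_work c0) < bD" using sc by (simp add: bD_def)
 have m: "rm 1 (Bud (d_state c0), ip, u, [], 0) (Bud (d_state c), ip, u4, [], 0)"
 proof (rule rstep[OF pe.bud1[OF dt scb a cs(1), folded s2] HOL.refl _ _ _ _ _ _ _ r])
  show "length ?cs <= 12" using inp_length[of ?i] ipc_length[of 2 ?i di] tcm_length[OF cs(1)] by simp
  show "ALL c : set ?cs. cmd_ok 12 c & small Bc c"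
   using inp_small[OF Bc(1), of _ ?i] ipc_small[of 2 12 Bc _ ?i di] tcm_small[OF cs(1) _ _ scb a Bc(5), of 12] Bc
   by (auto split: if_splits)
 qed (use b0 b1 ip in "auto simp: stack_scan_def")
 have "rm (Suc j) (Bud (d_start D), ip, v, [], 0) (Bud (d_state c), ip, u4, [], 0)"
  using runs_in_trans[OF u(1) m] by simp
 moreover have u4: "u4 0 = 0" "u4 1 = m" "u4 6 = v 6" "u4 7 = v 7" "u4 2 = d_ipos c" "u4 3 = u3 3" "u4 4 = u3 4"
  "u4 5 = C0 + C1 * length (d_out c)" using cs(4) u1(2) u u35 s(2) by (auto simp: u4_def u2_def)
 moreover have "ALL i. u4 i < cap"
 proof
  fix i
  have "u4 i = u1 i" if "i ~= 2" "i ~= 3" "i ~= 4" "i ~= 5" using that cs(4) by (simp add: u4_def u2_def)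
  moreover have "u1 i < cap" using u1(2,3) u(2) by (cases "i = 11") auto
  ultimately show "u4 i < cap" using u4 u3c oc shc s(2) by (cases "i = 2 \<or> i = 3 \<or> i = 4 \<or> i = 5") auto
 qed
 moreover have "length (d_out c) <= Suc j" using u(10) s(2) by auto
 ultimately show ?case using cs(3) s(2) by (intro exI[of _ u4]) auto
qed

lemma complete_run:
 assumes u: "accepting_tree N x u" and c: "(transducer_step D (replicate m ()) ^^ j) (transducer_init D) c"
  and w: "!!c. treach D (replicate m ()) c ==> snd (d_work c) < w"
  and b: "treedepth u <= C0 + C1 * length (d_out c)"
  and cap: "2 * length x + 2 < cap" "Suc m < cap" "Suc bD ^ w <= cap" "C0 + C1 * j < cap"
 shows "EX k cf. k <= length x + j + treesize u * WW x (C0 + C1 * j) + C0 + C1 * j + 10 &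
  (mstep P cap x ^^ k) (minit Len x) cf & fst cf : {Fin}"
proof -
 define v1 :: "nat => nat" where "v1 = (%_. 0)(6 := Suc (length x))"
 have "rm (Suc (length x)) (Len, Suc (length x), (%_. 0), [], 0) (Len, 0, (%_. 0)(6 := 0 + Suc (length x)), [], 0)"
  by (rule len_run) (use cap in auto)
 hence 1: "rm (Suc (length x)) (minit Len x) (Len, 0, v1, [], 0)" by (simp add: minit_def v1_def)
 define v2 where "v2 = v1(6 := length x, 1 := m, 5 := C0)"
 have C0c: "C0 < cap" using cap(4) by simp
 have s1: "rsem cap (dvr 6 1 1) v1 (v1(6 := length x))" using cap by (auto simp: v1_def intro!: exI[of _ "length x"])
 have s2: "rsem cap (gsr 1) (v1(6 := length x)) (v1(6 := length x, 1 := m))" using cap by (auto intro!: exI[of _ m])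
 have s3: "rsem cap (cst 5 C0) (v1(6 := length x, 1 := m)) v2" using C0c by (simp add: v2_def)
 have r2: "rseq cap [dvr 6 1 1, gsr 1, cst 5 C0] v1 v2" unfolding rseq.simps using s1 s2 s3 by blast
 have 2: "rm 1 (Len, 0, v1, [], 0) (Bud (d_start D), 0, v2, [], 0)"
  by (rule rstep[OF pe.len2 _ _ _ _ _ _ _ _ r2]) (use Bc D in "auto simp: input_cell_def stack_scan_def wf_transducer_def")
 have v2: "ALL j. v2 j < cap" "v2 0 = 0" "v2 1 = m" "v2 2 = 0" "v2 3 = 0" "v2 4 = 0" "v2 5 = C0" "v2 6 = length x" "v2 7 = 0"
  using cap C0c by (auto simp: v2_def v1_def)
 obtain v3 where v3: "rm j (Bud (d_start D), 0, v2, [], 0) (Bud (d_state c), 0, v3, [], 0)"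
  "ALL i. v3 i < cap" "v3 0 = 0" "v3 6 = length x" "v3 7 = 0" "v3 5 = C0 + C1 * length (d_out c)" "length (d_out c) <= j"
  using bud_run[OF w cap(2,3,4) _ v2(1-7) order_refl c, where ip = 0] v2(8,9) by auto
 let ?b = "C0 + C1 * length (d_out c)"
 have bb: "?b < cap" using v3(2,6) by metis
 have vs: "a_state (conf N []) = a_start N" by (simp add: atm_init_def)
 have ds: "d_state c < d_states D" using transducer_reach_bounds[OF D w relpowp_imp_rtranclp[OF c]] by blast
 have 4: "rm 1 (Bud (d_state c), 0, v3, [], 0) (Vis (a_state (conf N [])), 0, v3, ST [], 0)"
  by (rule rstep[OF pe.bud2[where j = "input_cell x 0", folded vs] HOL.refl]) (use ds N in "auto simp: vs atm_init_def stack_scan_def wf_atm_def ST_def")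
 have acc: "accepting_from N x u" "label u = conf N []" using u by (simp_all add: accepting_tree_def)
 obtain K where K: "visit x cap ?b [] K" "K + RB ?b <= treesize u * WW x ?b"
  using tree_run[OF bb cap(1) acc] b by auto
 have g: "gc x ?b [] v3" unfolding gc_def[OF bb cap(1)] using v3 by simp
 obtain v5 ip sp where 5: "rm K (Vis (a_state (conf N [])), 0, v3, ST [], 0) (Ret, ip, v5, ST [], sp)" "ip <= Suc (length x)" "sp <= Suc 0"
  using K(1)[unfolded visit_def[OF bb cap(1)], rule_format, OF g, of 0 0] by auto
 have 6: "rm (?b + 2) (Ret, ip, v5, ST [], sp) (Ret2, ip, v5, ST [], 0)"
  using back_run[OF bb cap(1), of "[]" ip sp v5] 5 by simp
 have 7: "rm 1 (Ret2, ip, v5, ST [], 0) (Fin, ip, v5, ST [], 0)"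
  by (rule rstep[OF pe.ret3 HOL.refl]) (use 5(2) in auto)
 have "rm (Suc (length x) + (1 + (j + (1 + (K + (?b + 2 + 1)))))) (minit Len x) (Fin, ip, v5, ST [], 0)"
  by (rule runs_in_trans[OF 1 runs_in_trans[OF 2 runs_in_trans[OF v3(1) runs_in_trans[OF 4 runs_in_trans[OF 5(1) runs_in_trans[OF 6 7]]]]]])
 then obtain k where k: "k <= Suc (length x) + (1 + (j + (1 + (K + (?b + 2 + 1)))))" "(mstep P cap x ^^ k) (minit Len x) (Fin, ip, v5, ST [], 0)"
  unfolding runs_in_def by blast
 have bj: "?b <= C0 + C1 * j" using v3(7) by (simp add: mult_le_mono2)
 have "WW x ?b <= WW x (C0 + C1 * j)"
  unfolding WW_def[OF bb cap(1)] VV_def[OF bb cap(1)] WW_def[OF cap(4,1)] VV_def[OF cap(4,1)]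
  by (intro add_mono mult_le_mono bj order_refl mult_le_mono2 iffD2[OF Suc_le_mono])
 hence "treesize u * WW x ?b <= treesize u * WW x (C0 + C1 * j)" by (rule mult_le_mono2)
 hence "k <= length x + j + treesize u * WW x (C0 + C1 * j) + C0 + C1 * j + 10" using k(1) K(2) bj by linarith
 thus ?thesis using k(2) by (intro exI[of _ k] exI[of _ "(Fin, ip, v5, ST [], 0)"]) simp
qed

end

text \<open>\<open>WW\<close> was introduced under assumptions on the capacity that its value does
  not involve; some capacity satisfies them, so the equation holds unconditionally.\<close>

lemma WW_eq: "WW x b = a_tapes N * (2 * b + 3) + Suc b * (2 * b + 3) + 2 * length x + 10 + 2 * b + 30"
proof -
 have c: "b < Suc (b + 2 * length x + 2)" "2 * length x + 2 < Suc (b + 2 * length x + 2)" by simp_all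
 show ?thesis unfolding WW_def[OF c] VV_def[OF c] ..
qed

context
 fixes x :: "'a list" and cap :: nat
begin

lemma sound_run:
 assumes "(mstep P cap x)^** (minit Len x) c" "fst c : {Fin}"
 shows "EX u. accepting_tree N x u"
proof -
 obtain ip v st sp where c: "c = (Fin, ip, v, st, sp)" using assms(2) by (metis prod.collapse singletonD)
 from reach_pinv[OF assms(1)[unfolded c]] show ?thesis by (auto simp: acc_conf_def accepting_tree_def)
qed

text \<open>The depth never exceeds register 5, which is computed from some output of the
  transducer, possibly a partial one, on some \<open>m\<close> below the capacity. One more cell is
  taken by the bottom marker.\<close>

lemma height_run:
 assumes "(mstep P cap x)^** (minit Len x) (q, ip, v, st, sp)"
  and out: "!!m c. dreach m c ==> m < cap ==> C0 + C1 * length (d_out c) <= H"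
 shows "length st <= Suc H & sp <= Suc H"
proof -
 have c: "length st <= Suc H & sp <= Suc H" if "core x cap es v st sp k" "length es <= k" for es k
 proof -
  have "budget cap v" using that(1) by (simp add: core_def)
  then obtain c where c: "v 1 < cap" "dreach (v 1) c" "v 5 = C0 + C1 * length (d_out c)" unfolding budget_def by blast
  have "v 5 <= H" using out[OF c(2,1)] c(3) by simp
  moreover have "length st = Suc (length es)" "k <= v 5" "sp <= length st" using that(1) by (auto simp: core_def)
  ultimately show ?thesis using that(2) by linarith
 qed
 have "pinv x cap q ip v st sp" using reach_pinv[OF assms(1)] .
 thus ?thesis
 proof (cases q)
  case (Rp al)
  then obtain es where "core x cap es v st sp (Suc (length es))" using `pinv x cap q ip v st sp` by auto
  thus ?thesis using c[of es "Suc (length es)"] by simp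
 qed (use c in auto)
qed

end

end

text \<open>A computation may guess any m below the capacity \<open>2 ^ (d * bl (Suc n))\<close>,
  hence the maximum in the height. That this maximum is of order s(n^c) is left as a condition on
  \<open>h\<close>, to be discharged by the growth properties of \<open>s\<close>.\<close>

theorem ATiSz_subset_NAuxSA:
 fixes A :: "'a::finite list set"
 assumes "constructible s" and "A : ATiSz (%n. real (s (n ^ c1))) (%n. real (n ^ c2))"
 shows "EX d C0 C1. ALL h. (ALL H. (ALL n. H n = Suc (Max ((%m. C0 + C1 * s m) ` {..<2 ^ (d * bl (Suc n))}))) -->
   (%n. real (H n + 2)) : O(h)) --> (EX c. A : NAuxSA (%n. real (n ^ c)) (%n. log 2 (real n)) h)"
proof -
 obtain D W where D: "wf_transducer D" and W: "(%n. real (W n)) : O(%n. log 2 (real n))"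
  and space: "!!m c. treach D (replicate m ()) c ==> snd (d_work c) < W m"
  and out: "!!m. EX c. treach D (replicate m ()) c & halted D (replicate m ()) c &
   d_out c = replicate (s m) ()" using assms(1) unfolding constructible_def halted_def by blast
 obtain N :: "'a atm" and T Z where wfN: "wf_atm N" and AN: "A = {x. EX u. accepting_tree N x u}"
  and T: "(%n. real (T n)) : O(%n. real (s (n ^ c1)))" and Z: "(%n. real (Z n)) : O(%n. real (n ^ c2))"
  and tree: "!!x. x : A ==> EX u. accepting_tree N x u & treedepth u <= T (length x) & treesize u <= Z (length x)"
  using assms(2) unfolding ATiSz_def by blast
 obtain C1 C0 where TC: "!!n. T n <= C0 + C1 * s (n ^ c1)"
 proof -
  obtain k where k: "!!n. T n <= k * (s (n ^ c1) + 1)" using bound_extend[OF T, of "%n. s (n ^ c1) + 1"] by auto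
  show ?thesis by (rule that[of k k]) (use k in "simp add: algebra_simps")
 qed
 define JJ where "JJ n = d_states D * ((n ^ c1 + 2) * (d_syms D ^ W (n ^ c1) * W (n ^ c1)))" for n
 \<comment> \<open>Each summand dominates one kind of number held in a register; \<open>JJ\<close>
   bounds the halting time of the transducer on \<open>n ^ c1\<close> and thereby the length of its
   output.\<close>
 define X where "X n = 2 * n + 3 + n ^ c1 + Suc (Suc (d_syms D)) ^ W (n ^ c1) + C0 + C1 * JJ n" for n
 have pW: "pb (%n. b ^ W (n ^ c1))" for b by (rule pb_comp[of "%n. b ^ W n"]) (intro pb_exp_log W, intro pb_intros)
 have pW1: "pb (%n. W (n ^ c1))" by (rule pb_mono[OF pW[of 2]]) (simp add: less_imp_le)
 have pJ: "pb JJ" unfolding JJ_def by (intro pb_intros pW pW1)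
 have pX: "pb X" unfolding X_def by (intro pb_intros pW pJ)
 obtain d0 where d0: "!!n. bl (X n) <= d0 * bl (Suc n)" using pb_bl[OF pX] by blast
 define d where "d = Suc d0"
 \<comment> \<open>The word has only \<open>bl (Suc n)\<close> digits, so the degree of the
   polynomial capacity is put into the base: \<open>B ^ bl (Suc n)\<close> is
   \<open>2 ^ (d * bl (Suc n))\<close>.\<close>
 define B :: nat where "B = 2 ^ d"
 have capX: "X n < B ^ bl (Suc n)" for n
 proof -
  have "X n < 2 ^ bl (X n)" by (rule less_two_power_bl)
  also have "... <= 2 ^ (d * bl (Suc n))" using d0[of n] by (intro power_increasing) (auto simp: d_def)
  finally show ?thesis by (simp add: B_def power_mult)
 qed
 have B1: "1 < B" unfolding B_def d_def by (rule one_less_power) simp_all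
 interpret dfs N D C0 C1 B by (rule dfs.intro[OF wfN D B1])
 have outs: "length (d_out c) <= s m" if "dreach m c" for m c
 proof -
  obtain cf where cf: "treach D (replicate m ()) cf" "halted D (replicate m ()) cf"
   "d_out cf = replicate (s m) ()" using out by blast
  have "(transducer_step D (replicate m ()))^** c cf"
   by (rule transducer_reach_halted[OF _ cf(1,2)]) (use that in "simp add: dreach_def")
  thus ?thesis using transducer_out_mono cf(3) by fastforce
 qed
 define H where "H n = Suc (Max ((%m. C0 + C1 * s m) ` {..<2 ^ (d * bl (Suc n))}))" for n
 define TT where "TT n = n + JJ n + Z n * (a_tapes N * (2 * (C0 + C1 * JJ n) + 3) + Suc (C0 + C1 * JJ n) * (2 * (C0 + C1 * JJ n) + 3) +
   2 * n + 10 + 2 * (C0 + C1 * JJ n) + 30) + C0 + C1 * JJ n + 10" for n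
 have pT: "pb TT" unfolding TT_def by (intro pb_intros pJ pb_of_bigo[OF Z])
 have "EX c. A : NAuxSA (%n. real (n ^ c)) (%n. log 2 (real n)) h" if h: "(%n. real (H n + 2)) : O(h)" for h
 proof (rule program_in_NAuxSA[where T = TT and H = H, OF _ _ _ pT h])
  fix x c assume "(mstep P (B ^ bl (Suc (length x))) x)^** (minit Len x) c" "fst c : {Fin}"
  thus "x : A" using sound_run AN by blast
 next
  fix x q ip v st sp
  assume r: "(mstep P (B ^ bl (Suc (length x))) x)^** (minit Len x) (q, ip, v, st, sp)"
  define M where "M = Max ((%m. C0 + C1 * s m) ` {..<2 ^ (d * bl (Suc (length x)))})"
  have "C0 + C1 * length (d_out c) <= M" if "dreach m c" "m < B ^ bl (Suc (length x))" for m c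
  proof -
   have "C0 + C1 * length (d_out c) <= C0 + C1 * s m" using outs[OF that(1)] by (simp add: mult_le_mono2)
   also have "... <= M" unfolding M_def by (rule Max_ge) (use that(2) in "auto simp: B_def power_mult")
   finally show ?thesis .
  qed
  from height_run[OF r this] show "length st <= H (length x) & sp <= H (length x)" by (simp add: H_def M_def)
 next
  fix x assume "x : A"
  then obtain u where u: "accepting_tree N x u" "treedepth u <= T (length x)" "treesize u <= Z (length x)" using tree by blast
  let ?n = "length x"
  \<comment> \<open>The accepting computation guesses \<open>n ^ c1\<close> and runs the transducer
    to its end, so the allowed depth \<open>C0 + C1 * s (n ^ c1)\<close> is at least
    \<open>T n\<close>.\<close>
  let ?m = "?n ^ c1"
  obtain cf where cf: "(transducer_step D (replicate ?m ()))^** (transducer_init D) cf" "halted D (replicate ?m ()) cf"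
   "d_out cf = replicate (s ?m) ()" using out by blast
  obtain j where j: "(transducer_step D (replicate ?m ()) ^^ j) (transducer_init D) cf" using cf(1) rtranclp_imp_relpowp by metis
  have jJ: "j <= JJ ?n" using halting_time_bound[OF D space j cf(2)] by (simp add: JJ_def less_imp_le)
  hence CJ: "C1 * j <= C1 * JJ ?n" by (rule mult_le_mono2)
  have "EX k cf. k <= ?n + j + treesize u * WW x (C0 + C1 * j) + C0 + C1 * j + 10 &
    (mstep P (B ^ bl (Suc ?n)) x ^^ k) (minit Len x) cf & fst cf : {Fin}"
  proof (rule complete_run[OF u(1) j])
   show "snd (d_work c) < W ?m" if "(transducer_step D (replicate ?m ()))^** (transducer_init D) c" for c
    using space that by blast
   show "treedepth u <= C0 + C1 * length (d_out cf)" using u(2) TC[of ?n] cf(3) by simp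
   show "2 * ?n + 2 < B ^ bl (Suc ?n)" "Suc ?m < B ^ bl (Suc ?n)" "C0 + C1 * j < B ^ bl (Suc ?n)"
    using capX[of ?n] CJ unfolding X_def by linarith+
   show "Suc bD ^ W ?m <= B ^ bl (Suc ?n)" using capX[of ?n] by (simp add: X_def bD_def)
  qed
  then obtain k cg where k: "k <= ?n + j + treesize u * WW x (C0 + C1 * j) + C0 + C1 * j + 10"
   "(mstep P (B ^ bl (Suc ?n)) x ^^ k) (minit Len x) cg" "fst cg : {Fin}" by blast
  have "treesize u * WW x (C0 + C1 * j) <= Z ?n * WW x (C0 + C1 * JJ ?n)"
   unfolding WW_eq by (intro mult_le_mono add_mono) (use u(3) jJ in "simp_all add: mult_le_mono2")
  hence "k <= TT ?n" using k(1) jJ CJ unfolding TT_def WW_eq by linarith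
  thus "EX k c. k <= TT ?n & (mstep P (B ^ bl (Suc ?n)) x ^^ k) (minit Len x) c & fst c : {Fin}" using k by blast
 qed
 thus ?thesis by (intro exI[of _ d] exI[of _ C0] exI[of _ C1]) (auto simp: H_def)
qed

section \<open>The two inclusions for nice bounds\<close>

lemma NAuxSA_mono:
 assumes "h : O(h')"
 shows "NAuxSA t w h <= NAuxSA t w h'"
proof
 fix A :: "'a list set" assume "A : NAuxSA t w h"
 then obtain M :: "'a nauxsa" and T W H where M: "wf_nauxsa M" "A = {x. nauxsa_accepts M x}"
  "(%n. real (T n)) : O(t)" "(%n. real (W n)) : O(w)" "(%n. real (H n)) : O(h)"
  "ALL x c. (nauxsa_step M x)^** (nauxsa_init M) c --> snd (n_work c) < W (length x) &
   length (n_stack c) <= H (length x) & n_spos c < H (length x)"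
  "ALL x : A. EX k c. k <= T (length x) & (nauxsa_step M x ^^ k) (nauxsa_init M) c & n_state c : n_accept M"
  unfolding NAuxSA_def by blast
 have "(%n. real (H n)) : O(h')" using M(5) assms by (rule landau_o.big_trans)
 thus "A : NAuxSA t w h'" unfolding NAuxSA_def mem_Collect_eq
  by (rule_tac exI[of _ M], rule_tac exI[of _ T], rule_tac exI[of _ W], rule_tac exI[of _ H]) (use M in blast)
qed

context
 fixes s :: "nat => nat"
 assumes log_sq: "ALL n >= 1. real (s n) >= (log 2 (real n))\<^sup>2"
begin

lemma log_sq_le_power:
 assumes "1 <= c" "2 <= n"
 shows "(log 2 (real n))\<^sup>2 <= real (s (n ^ c))"
proof -
 have "1 <= n ^ c" using assms by simp
 have "0 <= log 2 (real n)" using assms by simp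
 moreover have "log 2 (real n) <= log 2 (real (n ^ c))" using assms `1 <= n ^ c` self_le_power[of n c] by simp
 ultimately have "(log 2 (real n))\<^sup>2 <= (log 2 (real (n ^ c)))\<^sup>2" by (intro power_mono)
 also have "... <= real (s (n ^ c))" using log_sq `1 <= n ^ c` by blast
 finally show ?thesis .
qed

lemma s_power_pos: "1 <= c ==> 2 <= n ==> 1 <= s (n ^ c)"
proof -
 assume c: "1 <= c" "2 <= n"
 have "1 <= log 2 (real n)" using c by simp
 hence "1 <= (log 2 (real n))\<^sup>2" by simp
 also have "... <= real (s (n ^ c))" by (rule log_sq_le_power[OF c])
 finally show ?thesis by simp
qed

lemma bl_sq_bigo:
 assumes "1 <= c"
 shows "(%n. real ((bl (Suc n))\<^sup>2)) : O(%n. real (s (n ^ c)))"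
proof -
 have "(%n. (real (bl (Suc n)))\<^sup>2) : O(%n. (log 2 (real n))\<^sup>2)" using landau_o.big_power[OF bl_Suc_bigo] .
 moreover have "(%n. (log 2 (real n))\<^sup>2) : O(%n. real (s (n ^ c)))"
 proof (rule bigoI[of _ 1], unfold eventually_at_top_linorder, intro exI[of _ 2] allI impI)
  fix n :: nat assume "2 <= n"
  thus "norm ((log 2 (real n))\<^sup>2) <= 1 * norm (real (s (n ^ c)))" using log_sq_le_power[OF assms] by simp
 qed
 ultimately have "(%n. (real (bl (Suc n)))\<^sup>2) : O(%n. real (s (n ^ c)))" by (rule landau_o.big_trans)
 thus ?thesis by simp
qed

lemma NAuxSA_family_subset:
 "(NAuxSA_family poly_bounds log_bounds (of_poly_bounds s) :: 'a::finite list set set) <=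
  ATiSz_family (of_poly_bounds s) poly_bounds"
proof
 fix A :: "'a list set" assume "A : NAuxSA_family poly_bounds log_bounds (of_poly_bounds s)"
 then obtain c1 c2 where A: "A : NAuxSA (%n. real (n ^ c1)) (%n. log 2 (real n)) (%n. real (s (n ^ c2)))"
  unfolding NAuxSA_family_def poly_bounds_def log_bounds_def of_poly_bounds_def by blast
 obtain c where c: "1 <= c" "A : NAuxSA (%n. real (n ^ c1)) (%n. log 2 (real n)) (%n. real (s (n ^ c)))"
 \<comment> \<open>For exponent 0 the height bound is the constant \<open>s 1\<close>, which does
   not dominate the squared logarithm; the exponent is then raised to 1.\<close>
 proof (cases "c2 = 0")
  case True
  have "(%n. real (s (n ^ c2))) : O(%n. real (s (n ^ 1)))"
  proof (rule bigoI[of _ "real (s 1)"], unfold eventually_at_top_linorder, intro exI[of _ 2] allI impI)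
   fix n :: nat assume "2 <= n"
   hence "real 1 <= real (s (n ^ 1))" using s_power_pos[of 1 n] by (simp only: of_nat_le_iff)
   thus "norm (real (s (n ^ c2))) <= real (s 1) * norm (real (s (n ^ 1)))"
    using mult_left_mono[of 1 "real (s (n ^ 1))" "real (s 1)"] True by simp
  qed
  thus ?thesis using that[of 1] A NAuxSA_mono by blast
 next
  case False
  thus ?thesis using that[of c2] A by simp
 qed
 obtain c' where "A : ATiSz (%n. real (s (n ^ c))) (%n. real (n ^ c'))"
  using NAuxSA_subset_ATiSz[OF c(2) bl_sq_bigo[OF c(1)]] by blast
 thus "A : ATiSz_family (of_poly_bounds s) poly_bounds"
  unfolding ATiSz_family_def poly_bounds_def of_poly_bounds_def by blast
qed

context
 assumes nice: "nice s"
begin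

text \<open>From 2 on, both factors of s(n) = (s(n) / lg n) * lg n are nonnegative and
  nondecreasing.\<close>

lemma s_mono:
 assumes "2 <= m" "m <= n"
 shows "s m <= s n"
proof -
 let ?q = "%n. real (s n) / log 2 (real n)"
 have l: "0 < log 2 (real m)" "log 2 (real m) <= log 2 (real n)" "0 < log 2 (real n)" using assms by simp_all
 have "?q m <= ?q n" using nice assms unfolding nice_def mono_on_def by auto
 hence "?q m * log 2 (real m) <= ?q n * log 2 (real n)" using l by (intro mult_mono) simp_all
 thus ?thesis using l by simp
qed

text \<open>The cube comes from \<open>2 ^ bl (Suc n) <= 2 * n + 3 <= n ^ 3\<close>, valid for n >=
  2. The added 1 keeps the exponent positive also for \<open>d = 0\<close>.\<close>

lemma two_power_bl_le_power:
 assumes "2 <= n"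
 shows "2 ^ (d * bl (Suc n)) <= n ^ (3 * d + 1)"
proof -
 have "(2::nat) ^ (d * bl (Suc n)) = (2 ^ bl (Suc n)) ^ d" by (simp add: mult.commute flip: power_mult)
 also have "... <= (2 * Suc n + 1) ^ d" by (rule power_mono[OF two_power_bl_le]) simp
 also have "... <= (n ^ 3) ^ d"
 proof (rule power_mono)
  have "2 * 2 * n <= n * n * n" using assms by (intro mult_le_mono) simp_all
  moreover have "8 <= n * n * n" using mult_le_mono[OF mult_le_mono[OF assms assms] assms] by simp
  ultimately have "2 * n + 3 <= n * n * n" using assms by linarith
  thus "2 * Suc n + 1 <= n ^ 3" by (simp add: power3_eq_cube)
 qed simp
 also have "... <= n ^ (3 * d + 1)" unfolding power_mult[symmetric] using assms by (intro power_increasing) simp_all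
 finally show ?thesis .
qed

lemma ATiSz_family_subset:
 "ATiSz_family (of_poly_bounds s) poly_bounds <=
  (NAuxSA_family poly_bounds log_bounds (of_poly_bounds s) :: 'a::finite list set set)"
proof
 fix A :: "'a list set" assume "A : ATiSz_family (of_poly_bounds s) poly_bounds"
 then obtain c1 c2 where A: "A : ATiSz (%n. real (s (n ^ c1))) (%n. real (n ^ c2))"
  unfolding ATiSz_family_def poly_bounds_def of_poly_bounds_def by blast
 have "constructible s" using nice by (simp add: nice_def)
 from ATiSz_subset_NAuxSA[OF this A] obtain d C0 C1 where
  sub: "!!h H. (ALL H. (ALL n. H n = Suc (Max ((%m. C0 + C1 * s m) ` {..<2 ^ (d * bl (Suc n))}))) -->
   (%n. real (H n + 2)) : O(h)) ==> EX c. A : NAuxSA (%n. real (n ^ c)) (%n. log 2 (real n)) h" by blast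
 define c where "c = 3 * d + 1"
 \<comment> \<open>The values \<open>s 0\<close> and \<open>s 1\<close> enter separately because
   monotonicity starts at 2. The 3 covers the successor in \<open>H\<close> and the additional
   2.\<close>
 define K where "K = C0 + C1 * (s 0 + s 1 + 1) + 3"
 have "EX c'. A : NAuxSA (%n. real (n ^ c')) (%n. log 2 (real n)) (%n. real (s (n ^ c)))"
 proof (rule sub, intro allI impI)
  fix H assume H: "ALL n. H n = Suc (Max ((%m. C0 + C1 * s m) ` {..<2 ^ (d * bl (Suc n))}))"
  show "(%n. real (H n + 2)) : O(%n. real (s (n ^ c)))"
  proof (rule bigoI[of _ "real K"], unfold eventually_at_top_linorder, intro exI[of _ 2] allI impI)
   fix n :: nat assume n: "2 <= n"
   let ?S = "s (n ^ c)"
   have S: "1 <= ?S" using s_power_pos[of c n] n by (simp add: c_def)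
   have "s m <= (s 0 + s 1 + 1) * ?S" if "m < 2 ^ (d * bl (Suc n))" for m
   proof -
    consider "m = 0" | "m = 1" | "2 <= m" by linarith
    thus ?thesis
    proof cases
     case 3
     have "m <= n ^ c" using that two_power_bl_le_power[OF n, of d] unfolding c_def by linarith
     hence "s m <= ?S" by (rule s_mono[OF 3])
     thus ?thesis by (simp add: algebra_simps)
    qed (use mult_le_mono2[OF S, of "s 0 + s 1 + 1"] in simp_all)
   qed
   hence "C0 + C1 * s m <= C0 * ?S + C1 * ((s 0 + s 1 + 1) * ?S)" if "m < 2 ^ (d * bl (Suc n))" for m
    using that mult_le_mono2[OF S, of C0] by (intro add_mono mult_le_mono2) simp_all
   hence "Max ((%m. C0 + C1 * s m) ` {..<2 ^ (d * bl (Suc n))}) <= C0 * ?S + C1 * ((s 0 + s 1 + 1) * ?S)"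
    by (subst Max_le_iff) (auto simp: lessThan_empty_iff)
   hence "H n + 2 <= C0 * ?S + C1 * ((s 0 + s 1 + 1) * ?S) + 3 * ?S" using H S by simp
   also have "... = K * ?S" by (simp add: K_def algebra_simps)
   finally have "real (H n + 2) <= real (K * ?S)" by (simp only: of_nat_le_iff)
   thus "norm (real (H n + 2)) <= real K * norm (real ?S)" by simp
  qed
 qed
 then obtain c' where "A : NAuxSA (%n. real (n ^ c')) (%n. log 2 (real n)) (%n. real (s (n ^ c)))" by blast
 thus "A : NAuxSA_family poly_bounds log_bounds (of_poly_bounds s)"
  unfolding NAuxSA_family_def poly_bounds_def log_bounds_def of_poly_bounds_def by blast
qed

end

end

theorem theorem28:
  fixes s :: "nat \<Rightarrow> nat"
  assumes "nice s"
    and "\<forall>n\<ge>1. real (s n) \<ge> (log 2 (real n))\<^sup>2"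
  shows "(NAuxSA_family poly_bounds log_bounds (of_poly_bounds s) :: 'a::finite list set set)
       = ATiSz_family (of_poly_bounds s) poly_bounds"
  using NAuxSA_family_subset[OF assms(2)] ATiSz_family_subset[OF assms(2,1)] by (rule subset_antisym)

end
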